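(* Let $F:\mathcal C\to\mathcal D$ be a dominant tensor functor of Frobenius-Perron index $2$ between fusion categories over a field $\Bbbk$. Then $F$ is normal, and we have an exact sequence of fusion categories $$\operatorname{rep}\mathbb Z_2\to\mathcal C\xrightarrow{\ F\ }\mathcal D.$$
   Context: A tensor category over $\Bbbk$ is a $\Bbbk$-linear abelian rigid monoidal category with finite-dimensional Hom spaces, all objects of finite length, monoidal product $\Bbbk$-linear in each variable, and $\operatorname{End}(\mathbf 1)=\Bbbk$. A fusion category is a split semisimple tensor category with finitely many isomorphism classes of simple objects. A tensor functor is a $\Bbbk$-linear exact strong monoidal functor between tensor categories. An object is trivial if isomorphic to $\mathbf 1^n$ for some $n$. For a tensor functor $F:\mathcal C\to\mathcal D$: $\mathfrak{Ker}_F\subset\mathcal C$ is the full subcategory of objects $X$ with $F(X)$ trivial; $F$ is dominant if every object of $\mathcal D$ is a subobject of $F(X)$ for some $X$; $F$ is normal if every $X$ in $\mathcal C$ has a subobject $X_0$ such that $F(X_0)$ is the largest trivial subobject of $F(X)$. A sequence of tensor functors $\mathcal C'\xrightarrow{f}\mathcal C\xrightarrow{F}\mathcal C''$ is exact if $F$ is dominant and normal, $f$ is a full embedding and the essential image of $f$ is $\mathfrak{Ker}_F$. For a simple object $X$ of a fusion category $\mathcal C$, $\operatorname{FPdim}X$ is the largest positive eigenvalue of left multiplication by $[X]$ in the Grothendieck ring with respect to the basis $\Lambda_{\mathcal C}$ of classes of simple objects, and $\operatorname{FPdim}\mathcal C=\sum_{X\in\Lambda_{\mathcal C}}(\operatorname{FPdim}X)^2$.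 The Frobenius-Perron index of a dominant tensor functor $F:\mathcal C\to\mathcal D$ between fusion categories is $\operatorname{FPdim}\mathcal C/\operatorname{FPdim}\mathcal D$. $\operatorname{rep}\mathbb Z_2$ is the category of finite-dimensional representations of $\mathbb Z_2$ over $\Bbbk$.
   Formalization: The exact sequence is asserted only when the characteristic of the field is not 2, since in characteristic 2 rep Z_2 is not semisimple and the claim fails (e.g. Z_2-graded vector spaces to Vec); normality is proved over every field. *)

theory Defs
  imports "Jordan_Normal_Form.VS_Connect" "HOL-Algebra.Elementary_Groups"
begin

section \<open>Categories\<close>

text \<open>A category is given by carrier sets of objects and arrows.  The operations are total HOL
  functions, constrained only on the carriers; \<open>g \<cdot> f\<close> is \<open>g\<close> after \<open>f\<close>.\<close>

record ('o, 'a) category_data =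
  Obj :: "'o set"
  Arr :: "'a set"
  Dom :: "'a \<Rightarrow> 'o"
  Cod :: "'a \<Rightarrow> 'o"
  Ident :: "'o \<Rightarrow> 'a"
  Comp :: "'a \<Rightarrow> 'a \<Rightarrow> 'a" (infixl \<open>\<cdot>\<index>\<close> 70)

definition hom_set :: "('o, 'a, 'z) category_data_scheme \<Rightarrow> 'o \<Rightarrow> 'o \<Rightarrow> 'a set" where
  "hom_set C X Y = {f \<in> Arr C. Dom C f = X \<and> Cod C f = Y}"

locale category =
  fixes C :: "('o, 'a, 'z) category_data_scheme" (structure)
  assumes Dom_closed: "f \<in> Arr C \<Longrightarrow> Dom C f \<in> Obj C"
    and Cod_closed: "f \<in> Arr C \<Longrightarrow> Cod C f \<in> Obj C"
    and Ident_hom: "X \<in> Obj C \<Longrightarrow> Ident C X \<in> hom_set C X X"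
    and Comp_hom: "f \<in> hom_set C X Y \<Longrightarrow> g \<in> hom_set C Y Z \<Longrightarrow> g \<cdot> f \<in> hom_set C X Z"
    and Comp_assoc: "f \<in> hom_set C W X \<Longrightarrow> g \<in> hom_set C X Y \<Longrightarrow> h \<in> hom_set C Y Z
      \<Longrightarrow> (h \<cdot> g) \<cdot> f = h \<cdot> (g \<cdot> f)"
    and Comp_Ident_right: "f \<in> hom_set C X Y \<Longrightarrow> f \<cdot> Ident C X = f"
    and Comp_Ident_left: "f \<in> hom_set C X Y \<Longrightarrow> Ident C Y \<cdot> f = f"

definition inverse_arrows :: "('o, 'a, 'z) category_data_scheme \<Rightarrow> 'a \<Rightarrow> 'a \<Rightarrow> bool" where
  "inverse_arrows C f g \<longleftrightarrow>
     f \<in> Arr C \<and> g \<in> hom_set C (Cod C f) (Dom C f) \<and>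
     g \<cdot>\<^bsub>C\<^esub> f = Ident C (Dom C f) \<and> f \<cdot>\<^bsub>C\<^esub> g = Ident C (Cod C f)"

definition is_iso :: "('o, 'a, 'z) category_data_scheme \<Rightarrow> 'a \<Rightarrow> bool" where
  "is_iso C f \<longleftrightarrow> (\<exists>g. inverse_arrows C f g)"

definition inverse_of :: "('o, 'a, 'z) category_data_scheme \<Rightarrow> 'a \<Rightarrow> 'a" where
  "inverse_of C f = (THE g. inverse_arrows C f g)"

definition isomorphic :: "('o, 'a, 'z) category_data_scheme \<Rightarrow> 'o \<Rightarrow> 'o \<Rightarrow> bool" where
  "isomorphic C X Y \<longleftrightarrow> (\<exists>f \<in> hom_set C X Y. is_iso C f)"

definition is_mono :: "('o, 'a, 'z) category_data_scheme \<Rightarrow> 'a \<Rightarrow> bool" where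
  "is_mono C f \<longleftrightarrow> f \<in> Arr C \<and>
     (\<forall>W. \<forall>g \<in> hom_set C W (Dom C f). \<forall>h \<in> hom_set C W (Dom C f).
        f \<cdot>\<^bsub>C\<^esub> g = f \<cdot>\<^bsub>C\<^esub> h \<longrightarrow> g = h)"

definition is_epi :: "('o, 'a, 'z) category_data_scheme \<Rightarrow> 'a \<Rightarrow> bool" where
  "is_epi C f \<longleftrightarrow> f \<in> Arr C \<and>
     (\<forall>W. \<forall>g \<in> hom_set C (Cod C f) W. \<forall>h \<in> hom_set C (Cod C f) W.
        g \<cdot>\<^bsub>C\<^esub> f = h \<cdot>\<^bsub>C\<^esub> f \<longrightarrow> g = h)"

definition is_zero_obj :: "('o, 'a, 'z) category_data_scheme \<Rightarrow> 'o \<Rightarrow> bool" where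
  "is_zero_obj C X \<longleftrightarrow> X \<in> Obj C \<and>
     (\<forall>Y \<in> Obj C. (\<exists>!f. f \<in> hom_set C X Y) \<and> (\<exists>!f. f \<in> hom_set C Y X))"

definition is_simple :: "('o, 'a, 'z) category_data_scheme \<Rightarrow> 'o \<Rightarrow> bool" where
  "is_simple C X \<longleftrightarrow> X \<in> Obj C \<and> \<not> is_zero_obj C X \<and>
     (\<forall>i. is_mono C i \<and> Cod C i = X \<longrightarrow> is_zero_obj C (Dom C i) \<or> is_iso C i)"


section \<open>Linear and abelian categories\<close>

text \<open>The ground field is the type \<open>'k\<close> of class \<^class>\<open>field\<close>; as a ring record it is
  \<^term>\<open>class_ring\<close>.\<close>

record ('o, 'a, 'k) linear_data = "('o, 'a) category_data" +
  Add :: "'a \<Rightarrow> 'a \<Rightarrow> 'a"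
  Zero :: "'o \<Rightarrow> 'o \<Rightarrow> 'a"
  Scale :: "'k \<Rightarrow> 'a \<Rightarrow> 'a"

text \<open>The multiplication and unit fields of a module record play no role in the theory of modules.\<close>

definition hom_space ::
    "('o, 'a, 'k, 'z) linear_data_scheme \<Rightarrow> 'o \<Rightarrow> 'o \<Rightarrow> ('k, 'a) module" where
  "hom_space C X Y = \<lparr>carrier = hom_set C X Y, mult = undefined, one = undefined,
     zero = Zero C X Y, add = Add C, smult = Scale C\<rparr>"

locale linear_category = category C
  for C :: "('o, 'a, 'k::field, 'z) linear_data_scheme" (structure) +
  assumes hom_vectorspace:
      "X \<in> Obj C \<Longrightarrow> Y \<in> Obj C \<Longrightarrow> vectorspace class_ring (hom_space C X Y)"
    and Comp_Add_left: "f \<in> hom_set C X Y \<Longrightarrow> g \<in> hom_set C Y Z \<Longrightarrow> h \<in> hom_set C Y Z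
      \<Longrightarrow> Add C g h \<cdot> f = Add C (g \<cdot> f) (h \<cdot> f)"
    and Comp_Add_right: "f \<in> hom_set C X Y \<Longrightarrow> g \<in> hom_set C X Y \<Longrightarrow> h \<in> hom_set C Y Z
      \<Longrightarrow> h \<cdot> Add C f g = Add C (h \<cdot> f) (h \<cdot> g)"
    and Comp_Scale_left: "f \<in> hom_set C X Y \<Longrightarrow> g \<in> hom_set C Y Z
      \<Longrightarrow> Scale C c g \<cdot> f = Scale C c (g \<cdot> f)"
    and Comp_Scale_right: "f \<in> hom_set C X Y \<Longrightarrow> g \<in> hom_set C Y Z
      \<Longrightarrow> g \<cdot> Scale C c f = Scale C c (g \<cdot> f)"

text \<open>\<open>S\<close> is the direct sum of \<open>X 0, \<dots>, X (n - 1)\<close> with injections \<open>i\<close> and projections \<open>p\<close>.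
  For \<open>n = 0\<close> the last equation says that the identity of \<open>S\<close> vanishes, i.e. \<open>S\<close> is a zero object.\<close>

definition is_direct_sum ::
    "('o, 'a, 'k, 'z) linear_data_scheme \<Rightarrow> nat \<Rightarrow> (nat \<Rightarrow> 'o) \<Rightarrow> 'o \<Rightarrow> (nat \<Rightarrow> 'a) \<Rightarrow> (nat \<Rightarrow> 'a)
      \<Rightarrow> bool" where
  "is_direct_sum C n X S i p \<longleftrightarrow> S \<in> Obj C \<and>
     (\<forall>k<n. X k \<in> Obj C \<and> i k \<in> hom_set C (X k) S \<and> p k \<in> hom_set C S (X k)) \<and>
     (\<forall>j<n. \<forall>k<n. p j \<cdot>\<^bsub>C\<^esub> i k = (if j = k then Ident C (X k) else Zero C (X k) (X j))) \<and>
     finsum (hom_space C S S) (\<lambda>k. i k \<cdot>\<^bsub>C\<^esub> p k) {..<n} = Ident C S"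

definition is_kernel :: "('o, 'a, 'k, 'z) linear_data_scheme \<Rightarrow> 'a \<Rightarrow> 'a \<Rightarrow> bool" where
  "is_kernel C k f \<longleftrightarrow> f \<in> Arr C \<and> k \<in> Arr C \<and> Cod C k = Dom C f \<and>
     f \<cdot>\<^bsub>C\<^esub> k = Zero C (Dom C k) (Cod C f) \<and>
     (\<forall>W. \<forall>h \<in> hom_set C W (Dom C f). f \<cdot>\<^bsub>C\<^esub> h = Zero C W (Cod C f) \<longrightarrow>
        (\<exists>!u. u \<in> hom_set C W (Dom C k) \<and> k \<cdot>\<^bsub>C\<^esub> u = h))"

definition is_cokernel :: "('o, 'a, 'k, 'z) linear_data_scheme \<Rightarrow> 'a \<Rightarrow> 'a \<Rightarrow> bool" where
  "is_cokernel C q f \<longleftrightarrow> f \<in> Arr C \<and> q \<in> Arr C \<and> Dom C q = Cod C f \<and>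
     q \<cdot>\<^bsub>C\<^esub> f = Zero C (Dom C f) (Cod C q) \<and>
     (\<forall>W. \<forall>h \<in> hom_set C (Cod C f) W. h \<cdot>\<^bsub>C\<^esub> f = Zero C (Dom C f) W \<longrightarrow>
        (\<exists>!u. u \<in> hom_set C (Cod C q) W \<and> u \<cdot>\<^bsub>C\<^esub> q = h))"

definition short_exact :: "('o, 'a, 'k, 'z) linear_data_scheme \<Rightarrow> 'a \<Rightarrow> 'a \<Rightarrow> bool" where
  "short_exact C f g \<longleftrightarrow> is_kernel C f g \<and> is_cokernel C g f"

locale abelian_category = linear_category C
  for C :: "('o, 'a, 'k::field, 'z) linear_data_scheme" (structure) +
  assumes direct_sums: "(\<And>k. k < (n::nat) \<Longrightarrow> X k \<in> Obj C) \<Longrightarrow> \<exists>S i p. is_direct_sum C n X S i p"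
    and kernels: "f \<in> Arr C \<Longrightarrow> \<exists>k. is_kernel C k f"
    and cokernels: "f \<in> Arr C \<Longrightarrow> \<exists>q. is_cokernel C q f"
    and mono_is_kernel: "is_mono C f \<Longrightarrow> \<exists>g. is_kernel C f g"
    and epi_is_cokernel: "is_epi C f \<Longrightarrow> \<exists>g. is_cokernel C f g"

text \<open>A filtration \<open>0 = Y 0 \<subseteq> \<dots> \<subseteq> Y n = X\<close> with simple quotients \<open>Q k = Y (k + 1) / Y k\<close>.\<close>

definition composition_series ::
    "('o, 'a, 'k, 'z) linear_data_scheme \<Rightarrow> nat \<Rightarrow> (nat \<Rightarrow> 'o) \<Rightarrow> (nat \<Rightarrow> 'o) \<Rightarrow> 'o \<Rightarrow> bool" where
  "composition_series C n Y Q X \<longleftrightarrow> is_zero_obj C (Y 0) \<and> Y n = X \<and>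
     (\<forall>k<n. is_simple C (Q k) \<and>
        (\<exists>i \<in> hom_set C (Y k) (Y (Suc k)). \<exists>q \<in> hom_set C (Y (Suc k)) (Q k). short_exact C i q))"

definition finite_length :: "('o, 'a, 'k, 'z) linear_data_scheme \<Rightarrow> 'o \<Rightarrow> bool" where
  "finite_length C X \<longleftrightarrow> (\<exists>n Y Q. composition_series C n Y Q X)"

definition iso_class :: "('o, 'a, 'z) category_data_scheme \<Rightarrow> 'o \<Rightarrow> 'o set" where
  "iso_class C X = {Y \<in> Obj C. isomorphic C X Y}"

definition simple_classes :: "('o, 'a, 'z) category_data_scheme \<Rightarrow> 'o set set" where
  "simple_classes C = iso_class C ` {X. is_simple C X}"

definition class_rep :: "'o set \<Rightarrow> 'o" where
  "class_rep S = (SOME X. X \<in> S)"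

text \<open>The Jordan-Hoelder multiplicity in \<open>X\<close> of the simple objects of the isomorphism class \<open>S\<close>.\<close>

definition multiplicity_in :: "('o, 'a, 'k, 'z) linear_data_scheme \<Rightarrow> 'o set \<Rightarrow> 'o \<Rightarrow> nat" where
  "multiplicity_in C S X =
     (THE m. \<exists>n Y Q. composition_series C n Y Q X \<and> m = card {k. k < n \<and> Q k \<in> S})"


section \<open>Tensor and fusion categories\<close>

record ('o, 'a, 'k) monoidal_data = "('o, 'a, 'k) linear_data" +
  TensO :: "'o \<Rightarrow> 'o \<Rightarrow> 'o" (infixr \<open>\<otimes>\<^sub>o\<index>\<close> 75)
  TensA :: "'a \<Rightarrow> 'a \<Rightarrow> 'a" (infixr \<open>\<otimes>\<^sub>a\<index>\<close> 75)
  Unit :: "'o"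
  Assoc :: "'o \<Rightarrow> 'o \<Rightarrow> 'o \<Rightarrow> 'a"
  Lunit :: "'o \<Rightarrow> 'a"
  Runit :: "'o \<Rightarrow> 'a"

locale monoidal_category = category C
  for C :: "('o, 'a, 'k, 'z) monoidal_data_scheme" (structure) +
  assumes Unit_closed: "Unit C \<in> Obj C"
    and TensO_closed: "X \<in> Obj C \<Longrightarrow> Y \<in> Obj C \<Longrightarrow> X \<otimes>\<^sub>o Y \<in> Obj C"
    and TensA_hom: "f \<in> hom_set C X X' \<Longrightarrow> g \<in> hom_set C Y Y'
      \<Longrightarrow> f \<otimes>\<^sub>a g \<in> hom_set C (X \<otimes>\<^sub>o Y) (X' \<otimes>\<^sub>o Y')"
    and TensA_Ident: "X \<in> Obj C \<Longrightarrow> Y \<in> Obj C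
      \<Longrightarrow> Ident C X \<otimes>\<^sub>a Ident C Y = Ident C (X \<otimes>\<^sub>o Y)"
    and TensA_Comp: "f \<in> hom_set C X X' \<Longrightarrow> f' \<in> hom_set C X' X''
      \<Longrightarrow> g \<in> hom_set C Y Y' \<Longrightarrow> g' \<in> hom_set C Y' Y''
      \<Longrightarrow> (f' \<cdot> f) \<otimes>\<^sub>a (g' \<cdot> g) = (f' \<otimes>\<^sub>a g') \<cdot> (f \<otimes>\<^sub>a g)"
    and Assoc_hom: "X \<in> Obj C \<Longrightarrow> Y \<in> Obj C \<Longrightarrow> Z \<in> Obj C
      \<Longrightarrow> Assoc C X Y Z \<in> hom_set C ((X \<otimes>\<^sub>o Y) \<otimes>\<^sub>o Z) (X \<otimes>\<^sub>o (Y \<otimes>\<^sub>o Z))"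
    and Assoc_iso: "X \<in> Obj C \<Longrightarrow> Y \<in> Obj C \<Longrightarrow> Z \<in> Obj C \<Longrightarrow> is_iso C (Assoc C X Y Z)"
    and Assoc_natural: "f \<in> hom_set C X X' \<Longrightarrow> g \<in> hom_set C Y Y' \<Longrightarrow> h \<in> hom_set C Z Z'
      \<Longrightarrow> Assoc C X' Y' Z' \<cdot> ((f \<otimes>\<^sub>a g) \<otimes>\<^sub>a h) = (f \<otimes>\<^sub>a (g \<otimes>\<^sub>a h)) \<cdot> Assoc C X Y Z"
    and Lunit_hom: "X \<in> Obj C \<Longrightarrow> Lunit C X \<in> hom_set C (Unit C \<otimes>\<^sub>o X) X"
    and Lunit_iso: "X \<in> Obj C \<Longrightarrow> is_iso C (Lunit C X)"
    and Lunit_natural: "f \<in> hom_set C X Y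
      \<Longrightarrow> Lunit C Y \<cdot> (Ident C (Unit C) \<otimes>\<^sub>a f) = f \<cdot> Lunit C X"
    and Runit_hom: "X \<in> Obj C \<Longrightarrow> Runit C X \<in> hom_set C (X \<otimes>\<^sub>o Unit C) X"
    and Runit_iso: "X \<in> Obj C \<Longrightarrow> is_iso C (Runit C X)"
    and Runit_natural: "f \<in> hom_set C X Y
      \<Longrightarrow> Runit C Y \<cdot> (f \<otimes>\<^sub>a Ident C (Unit C)) = f \<cdot> Runit C X"
    and pentagon: "W \<in> Obj C \<Longrightarrow> X \<in> Obj C \<Longrightarrow> Y \<in> Obj C \<Longrightarrow> Z \<in> Obj C
      \<Longrightarrow> (Ident C W \<otimes>\<^sub>a Assoc C X Y Z) \<cdot> Assoc C W (X \<otimes>\<^sub>o Y) Z \<cdot> (Assoc C W X Y \<otimes>\<^sub>a Ident C Z)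
        = Assoc C W X (Y \<otimes>\<^sub>o Z) \<cdot> Assoc C (W \<otimes>\<^sub>o X) Y Z"
    and triangle: "X \<in> Obj C \<Longrightarrow> Y \<in> Obj C
      \<Longrightarrow> (Ident C X \<otimes>\<^sub>a Lunit C Y) \<cdot> Assoc C X (Unit C) Y = Runit C X \<otimes>\<^sub>a Ident C Y"

text \<open>\<open>Y\<close> is a left dual of \<open>X\<close>, equivalently \<open>X\<close> is a right dual of \<open>Y\<close>, with evaluation
  \<open>ev : Y \<otimes> X \<rightarrow> 1\<close> and coevaluation \<open>coev : 1 \<rightarrow> X \<otimes> Y\<close>.\<close>

definition is_dual :: "('o, 'a, 'k, 'z) monoidal_data_scheme \<Rightarrow> 'o \<Rightarrow> 'o \<Rightarrow> 'a \<Rightarrow> 'a \<Rightarrow> bool" where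
  "is_dual C Y X ev coev \<longleftrightarrow> X \<in> Obj C \<and> Y \<in> Obj C \<and>
     ev \<in> hom_set C (Y \<otimes>\<^sub>o\<^bsub>C\<^esub> X) (Unit C) \<and> coev \<in> hom_set C (Unit C) (X \<otimes>\<^sub>o\<^bsub>C\<^esub> Y) \<and>
     Runit C X \<cdot>\<^bsub>C\<^esub> (Ident C X \<otimes>\<^sub>a\<^bsub>C\<^esub> ev) \<cdot>\<^bsub>C\<^esub> Assoc C X Y X \<cdot>\<^bsub>C\<^esub> (coev \<otimes>\<^sub>a\<^bsub>C\<^esub> Ident C X)
       \<cdot>\<^bsub>C\<^esub> inverse_of C (Lunit C X) = Ident C X \<and>
     Lunit C Y \<cdot>\<^bsub>C\<^esub> (ev \<otimes>\<^sub>a\<^bsub>C\<^esub> Ident C Y) \<cdot>\<^bsub>C\<^esub> inverse_of C (Assoc C Y X Y)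
       \<cdot>\<^bsub>C\<^esub> (Ident C Y \<otimes>\<^sub>a\<^bsub>C\<^esub> coev) \<cdot>\<^bsub>C\<^esub> inverse_of C (Runit C Y) = Ident C Y"

locale tensor_category = abelian_category C + monoidal_category C
  for C :: "('o, 'a, 'k::field, 'z) monoidal_data_scheme" (structure) +
  assumes hom_fin_dim:
      "X \<in> Obj C \<Longrightarrow> Y \<in> Obj C \<Longrightarrow> vectorspace.fin_dim class_ring (hom_space C X Y)"
    and obj_finite_length: "X \<in> Obj C \<Longrightarrow> finite_length C X"
    and left_duals: "X \<in> Obj C \<Longrightarrow> \<exists>Y ev coev. is_dual C Y X ev coev"
    and right_duals: "X \<in> Obj C \<Longrightarrow> \<exists>Y ev coev. is_dual C X Y ev coev"
    and TensA_Add_left: "f \<in> hom_set C X X' \<Longrightarrow> f' \<in> hom_set C X X' \<Longrightarrow> g \<in> hom_set C Y Y'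
      \<Longrightarrow> Add C f f' \<otimes>\<^sub>a g = Add C (f \<otimes>\<^sub>a g) (f' \<otimes>\<^sub>a g)"
    and TensA_Add_right: "f \<in> hom_set C X X' \<Longrightarrow> g \<in> hom_set C Y Y' \<Longrightarrow> g' \<in> hom_set C Y Y'
      \<Longrightarrow> f \<otimes>\<^sub>a Add C g g' = Add C (f \<otimes>\<^sub>a g) (f \<otimes>\<^sub>a g')"
    and TensA_Scale_left: "f \<in> hom_set C X X' \<Longrightarrow> g \<in> hom_set C Y Y'
      \<Longrightarrow> Scale C c f \<otimes>\<^sub>a g = Scale C c (f \<otimes>\<^sub>a g)"
    and TensA_Scale_right: "f \<in> hom_set C X X' \<Longrightarrow> g \<in> hom_set C Y Y'
      \<Longrightarrow> f \<otimes>\<^sub>a Scale C c g = Scale C c (f \<otimes>\<^sub>a g)"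
    and End_Unit: "bij_betw (\<lambda>c. Scale C c (Ident C (Unit C))) UNIV (hom_set C (Unit C) (Unit C))"

locale fusion_category = tensor_category C
  for C :: "('o, 'a, 'k::field, 'z) monoidal_data_scheme" (structure) +
  assumes semisimple: "X \<in> Obj C
      \<Longrightarrow> \<exists>n S i p. (\<forall>k<n. is_simple C (S k)) \<and> is_direct_sum C n S X i p"
    and split: "is_simple C X \<Longrightarrow> bij_betw (\<lambda>c. Scale C c (Ident C X)) UNIV (hom_set C X X)"
    and finite_simple_classes: "finite (simple_classes C)"

definition is_trivial :: "('o, 'a, 'k, 'z) monoidal_data_scheme \<Rightarrow> 'o \<Rightarrow> bool" where
  "is_trivial C X \<longleftrightarrow>
     (\<exists>n S i p. is_direct_sum C n (\<lambda>_. Unit C) S i p \<and> isomorphic C X S)"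


section \<open>Tensor functors\<close>

text \<open>\<open>FTens X Y : F X \<otimes> F Y \<rightarrow> F (X \<otimes> Y)\<close> and \<open>FUnit : 1 \<rightarrow> F 1\<close> are the monoidal structure
  of \<open>F\<close>.\<close>

record ('o, 'a, 'p, 'b) functor_data =
  FObj :: "'o \<Rightarrow> 'p"
  FArr :: "'a \<Rightarrow> 'b"
  FTens :: "'o \<Rightarrow> 'o \<Rightarrow> 'b"
  FUnit :: "'b"

locale tensor_functor = C: tensor_category C + D: tensor_category D
  for C :: "('o, 'a, 'k::field, 'z) monoidal_data_scheme"
    and D :: "('p, 'b, 'k, 'y) monoidal_data_scheme"
    and F :: "('o, 'a, 'p, 'b) functor_data" +
  assumes FObj_closed: "X \<in> Obj C \<Longrightarrow> FObj F X \<in> Obj D"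
    and FArr_hom: "f \<in> hom_set C X Y \<Longrightarrow> FArr F f \<in> hom_set D (FObj F X) (FObj F Y)"
    and FArr_Ident: "X \<in> Obj C \<Longrightarrow> FArr F (Ident C X) = Ident D (FObj F X)"
    and FArr_Comp: "f \<in> hom_set C X Y \<Longrightarrow> g \<in> hom_set C Y Z
      \<Longrightarrow> FArr F (g \<cdot>\<^bsub>C\<^esub> f) = FArr F g \<cdot>\<^bsub>D\<^esub> FArr F f"
    and FArr_Add: "f \<in> hom_set C X Y \<Longrightarrow> g \<in> hom_set C X Y
      \<Longrightarrow> FArr F (Add C f g) = Add D (FArr F f) (FArr F g)"
    and FArr_Scale: "f \<in> hom_set C X Y \<Longrightarrow> FArr F (Scale C c f) = Scale D c (FArr F f)"
    and FArr_exact: "short_exact C f g \<Longrightarrow> short_exact D (FArr F f) (FArr F g)"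
    and FTens_hom: "X \<in> Obj C \<Longrightarrow> Y \<in> Obj C
      \<Longrightarrow> FTens F X Y \<in> hom_set D (FObj F X \<otimes>\<^sub>o\<^bsub>D\<^esub> FObj F Y) (FObj F (X \<otimes>\<^sub>o\<^bsub>C\<^esub> Y))"
    and FTens_iso: "X \<in> Obj C \<Longrightarrow> Y \<in> Obj C \<Longrightarrow> is_iso D (FTens F X Y)"
    and FTens_natural: "f \<in> hom_set C X X' \<Longrightarrow> g \<in> hom_set C Y Y'
      \<Longrightarrow> FArr F (f \<otimes>\<^sub>a\<^bsub>C\<^esub> g) \<cdot>\<^bsub>D\<^esub> FTens F X Y = FTens F X' Y' \<cdot>\<^bsub>D\<^esub> (FArr F f \<otimes>\<^sub>a\<^bsub>D\<^esub> FArr F g)"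
    and FUnit_hom: "FUnit F \<in> hom_set D (Unit D) (FObj F (Unit C))"
    and FUnit_iso: "is_iso D (FUnit F)"
    and FTens_Assoc: "X \<in> Obj C \<Longrightarrow> Y \<in> Obj C \<Longrightarrow> Z \<in> Obj C
      \<Longrightarrow> FArr F (Assoc C X Y Z) \<cdot>\<^bsub>D\<^esub> FTens F (X \<otimes>\<^sub>o\<^bsub>C\<^esub> Y) Z
            \<cdot>\<^bsub>D\<^esub> (FTens F X Y \<otimes>\<^sub>a\<^bsub>D\<^esub> Ident D (FObj F Z))
        = FTens F X (Y \<otimes>\<^sub>o\<^bsub>C\<^esub> Z) \<cdot>\<^bsub>D\<^esub> (Ident D (FObj F X) \<otimes>\<^sub>a\<^bsub>D\<^esub> FTens F Y Z)
            \<cdot>\<^bsub>D\<^esub> Assoc D (FObj F X) (FObj F Y) (FObj F Z)"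
    and FTens_Lunit: "X \<in> Obj C
      \<Longrightarrow> FArr F (Lunit C X) \<cdot>\<^bsub>D\<^esub> FTens F (Unit C) X \<cdot>\<^bsub>D\<^esub> (FUnit F \<otimes>\<^sub>a\<^bsub>D\<^esub> Ident D (FObj F X))
        = Lunit D (FObj F X)"
    and FTens_Runit: "X \<in> Obj C
      \<Longrightarrow> FArr F (Runit C X) \<cdot>\<^bsub>D\<^esub> FTens F X (Unit C) \<cdot>\<^bsub>D\<^esub> (Ident D (FObj F X) \<otimes>\<^sub>a\<^bsub>D\<^esub> FUnit F)
        = Runit D (FObj F X)"

definition Ker_objects ::
    "('o, 'a, 'k, 'z) monoidal_data_scheme \<Rightarrow> ('p, 'b, 'k, 'y) monoidal_data_scheme
      \<Rightarrow> ('o, 'a, 'p, 'b) functor_data \<Rightarrow> 'o set" where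
  "Ker_objects C D F = {X \<in> Obj C. is_trivial D (FObj F X)}"

definition dominant ::
    "('o, 'a, 'k, 'z) monoidal_data_scheme \<Rightarrow> ('p, 'b, 'k, 'y) monoidal_data_scheme
      \<Rightarrow> ('o, 'a, 'p, 'b) functor_data \<Rightarrow> bool" where
  "dominant C D F \<longleftrightarrow>
     (\<forall>Y \<in> Obj D. \<exists>X \<in> Obj C. \<exists>i \<in> hom_set D Y (FObj F X). is_mono D i)"

definition normal_functor ::
    "('o, 'a, 'k, 'z) monoidal_data_scheme \<Rightarrow> ('p, 'b, 'k, 'y) monoidal_data_scheme
      \<Rightarrow> ('o, 'a, 'p, 'b) functor_data \<Rightarrow> bool" where
  "normal_functor C D F \<longleftrightarrow>
     (\<forall>X \<in> Obj C. \<exists>X0 \<in> Obj C. \<exists>i \<in> hom_set C X0 X. is_mono C i \<and>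
        is_mono D (FArr F i) \<and> is_trivial D (FObj F X0) \<and>
        (\<forall>T \<in> Obj D. \<forall>j \<in> hom_set D T (FObj F X). is_trivial D T \<and> is_mono D j \<longrightarrow>
           (\<exists>u \<in> hom_set D T (FObj F X0). FArr F i \<cdot>\<^bsub>D\<^esub> u = j)))"

text \<open>Full embedding means fully faithful; injectivity on objects would not be invariant under
  equivalence.\<close>

definition full_embedding ::
    "('o, 'a, 'k, 'z) monoidal_data_scheme \<Rightarrow> ('p, 'b, 'k, 'y) monoidal_data_scheme
      \<Rightarrow> ('o, 'a, 'p, 'b) functor_data \<Rightarrow> bool" where
  "full_embedding C D F \<longleftrightarrow>
     (\<forall>X \<in> Obj C. \<forall>Y \<in> Obj C.
        bij_betw (FArr F) (hom_set C X Y) (hom_set D (FObj F X) (FObj F Y)))"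

definition ess_image_objects ::
    "('o, 'a, 'k, 'z) monoidal_data_scheme \<Rightarrow> ('p, 'b, 'k, 'y) monoidal_data_scheme
      \<Rightarrow> ('o, 'a, 'p, 'b) functor_data \<Rightarrow> 'p set" where
  "ess_image_objects C D F = {Y \<in> Obj D. \<exists>X \<in> Obj C. isomorphic D (FObj F X) Y}"

text \<open>The sequence \<open>A \<rightarrow> C \<rightarrow> D\<close> given by \<open>f\<close> and \<open>F\<close>.  The kernel of \<open>F\<close> is a full subcategory,
  and so is the essential image of the full embedding \<open>f\<close>; hence they agree iff they have the same
  objects.\<close>

definition exact_sequence ::
    "('q, 'c, 'k::field, 'x) monoidal_data_scheme \<Rightarrow> ('o, 'a, 'k, 'z) monoidal_data_scheme
      \<Rightarrow> ('p, 'b, 'k, 'y) monoidal_data_scheme \<Rightarrow> ('q, 'c, 'o, 'a) functor_data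
      \<Rightarrow> ('o, 'a, 'p, 'b) functor_data \<Rightarrow> bool" where
  "exact_sequence A C D f F \<longleftrightarrow>
     tensor_functor A C f \<and> tensor_functor C D F \<and>
     dominant C D F \<and> normal_functor C D F \<and>
     full_embedding A C f \<and> ess_image_objects A C f = Ker_objects C D F"


section \<open>Frobenius-Perron dimension\<close>

text \<open>The class of \<open>X\<close> in the Grothendieck group, which is the free abelian group on the classes
  of simple objects; its elements are represented by their coefficient functions.\<close>

definition gr_class :: "('o, 'a, 'k, 'z) linear_data_scheme \<Rightarrow> 'o \<Rightarrow> 'o set \<Rightarrow> int" where
  "gr_class C X = (\<lambda>S. if S \<in> simple_classes C then int (multiplicity_in C S X) else 0)"

definition grothendieck_ring ::
    "('o, 'a, 'k, 'z) monoidal_data_scheme \<Rightarrow> ('o set \<Rightarrow> int) ring" where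
  "grothendieck_ring C =
     \<lparr>carrier = {a. \<forall>S. S \<notin> simple_classes C \<longrightarrow> a S = 0},
      mult = (\<lambda>a b U. \<Sum>S\<in>simple_classes C. \<Sum>T\<in>simple_classes C.
                a S * b T * gr_class C (class_rep S \<otimes>\<^sub>o\<^bsub>C\<^esub> class_rep T) U),
      one = gr_class C (Unit C),
      zero = (\<lambda>_. 0),
      add = (\<lambda>a b U. a U + b U)\<rparr>"

text \<open>Entry at row \<open>U\<close>, column \<open>T\<close> of the matrix of left multiplication by \<open>[X]\<close> with respect to
  the basis of classes of simple objects.\<close>

definition left_mult_matrix ::
    "('o, 'a, 'k, 'z) monoidal_data_scheme \<Rightarrow> 'o \<Rightarrow> 'o set \<Rightarrow> 'o set \<Rightarrow> int" where
  "left_mult_matrix C X U T =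
     (gr_class C X \<otimes>\<^bsub>grothendieck_ring C\<^esub> gr_class C (class_rep T)) U"

definition left_mult_eigenvalue ::
    "('o, 'a, 'k, 'z) monoidal_data_scheme \<Rightarrow> 'o \<Rightarrow> real \<Rightarrow> bool" where
  "left_mult_eigenvalue C X r \<longleftrightarrow>
     (\<exists>v :: 'o set \<Rightarrow> real. (\<exists>T\<in>simple_classes C. v T \<noteq> 0) \<and>
        (\<forall>U\<in>simple_classes C.
           (\<Sum>T\<in>simple_classes C. of_int (left_mult_matrix C X U T) * v T) = r * v U))"

definition FPdim :: "('o, 'a, 'k, 'z) monoidal_data_scheme \<Rightarrow> 'o \<Rightarrow> real" where
  "FPdim C X = (GREATEST r. r > 0 \<and> left_mult_eigenvalue C X r)"

definition FPdim_category :: "('o, 'a, 'k, 'z) monoidal_data_scheme \<Rightarrow> real" where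
  "FPdim_category C = (\<Sum>S\<in>simple_classes C. (FPdim C (class_rep S))\<^sup>2)"

text \<open>The Frobenius-Perron index of a dominant tensor functor from \<open>C\<close> to \<open>D\<close>; it depends on
  the two categories only.\<close>

definition FP_index ::
    "('o, 'a, 'k, 'z) monoidal_data_scheme \<Rightarrow> ('p, 'b, 'k, 'y) monoidal_data_scheme \<Rightarrow> real" where
  "FP_index C D = FPdim_category C / FPdim_category D"


section \<open>Representations of a group\<close>

text \<open>Finite-dimensional representations in matrix form: an object is a dimension \<open>n\<close> together with
  a homomorphism from \<open>G\<close> to the invertible \<open>n \<times> n\<close> matrices, an arrow is a triple
  (source, target, intertwining matrix).  The monoidal product is the Kronecker product with respect
  to the lexicographic order on pairs of indices, which makes associativity and unit constraints
  identity matrices.  The category is not semisimple, hence not a fusion category, when the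
  characteristic of \<open>'k\<close> divides the order of \<open>G\<close>.\<close>

definition kronecker :: "'k::field mat \<Rightarrow> 'k mat \<Rightarrow> 'k mat" where
  "kronecker A B = mat (dim_row A * dim_row B) (dim_col A * dim_col B)
     (\<lambda>(i, j). A $$ (i div dim_row B, j div dim_col B) * B $$ (i mod dim_row B, j mod dim_col B))"

type_synonym ('g, 'k) rep = "nat \<times> ('g \<Rightarrow> 'k mat)"

type_synonym ('g, 'k) rep_arrow = "('g, 'k) rep \<times> ('g, 'k) rep \<times> 'k mat"

definition rep_objects :: "('g, 'z) monoid_scheme \<Rightarrow> ('g, 'k::field) rep set" where
  "rep_objects G = {(n, \<rho>). \<rho> \<in> carrier G \<rightarrow>\<^sub>E carrier_mat n n \<and> \<rho> \<one>\<^bsub>G\<^esub> = 1\<^sub>m n \<and>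
     (\<forall>g\<in>carrier G. \<forall>h\<in>carrier G. \<rho> (g \<otimes>\<^bsub>G\<^esub> h) = \<rho> g * \<rho> h)}"

definition rep_arrows :: "('g, 'z) monoid_scheme \<Rightarrow> ('g, 'k::field) rep_arrow set" where
  "rep_arrows G = {((n, \<rho>), (m, \<sigma>), A). (n, \<rho>) \<in> rep_objects G \<and> (m, \<sigma>) \<in> rep_objects G \<and>
     A \<in> carrier_mat m n \<and> (\<forall>g\<in>carrier G. A * \<rho> g = \<sigma> g * A)}"

definition rep_tensor ::
    "('g, 'z) monoid_scheme \<Rightarrow> ('g, 'k::field) rep \<Rightarrow> ('g, 'k) rep \<Rightarrow> ('g, 'k) rep" where
  "rep_tensor G X Y = (fst X * fst Y, \<lambda>g\<in>carrier G. kronecker (snd X g) (snd Y g))"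

definition rep_unit :: "('g, 'z) monoid_scheme \<Rightarrow> ('g, 'k::field) rep" where
  "rep_unit G = (1, \<lambda>g\<in>carrier G. 1\<^sub>m 1)"

definition rep_category ::
    "('g, 'z) monoid_scheme \<Rightarrow> (('g, 'k::field) rep, ('g, 'k) rep_arrow, 'k) monoidal_data" where
  "rep_category G =
     \<lparr>Obj = rep_objects G,
      Arr = rep_arrows G,
      Dom = (\<lambda>(X, Y, A). X),
      Cod = (\<lambda>(X, Y, A). Y),
      Ident = (\<lambda>X. (X, X, 1\<^sub>m (fst X))),
      Comp = (\<lambda>(Y', Z, B) (X, Y, A). (X, Z, B * A)),
      Add = (\<lambda>(X, Y, A) (X', Y', B). (X, Y, A + B)),
      Zero = (\<lambda>X Y. (X, Y, 0\<^sub>m (fst Y) (fst X))),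
      Scale = (\<lambda>c (X, Y, A). (X, Y, c \<cdot>\<^sub>m A)),
      TensO = rep_tensor G,
      TensA = (\<lambda>(X, Y, A) (X', Y', B). (rep_tensor G X X', rep_tensor G Y Y', kronecker A B)),
      Unit = rep_unit G,
      Assoc = (\<lambda>X Y Z. (rep_tensor G (rep_tensor G X Y) Z, rep_tensor G X (rep_tensor G Y Z),
                 1\<^sub>m (fst X * fst Y * fst Z))),
      Lunit = (\<lambda>X. (rep_tensor G (rep_unit G) X, X, 1\<^sub>m (fst X))),
      Runit = (\<lambda>X. (rep_tensor G X (rep_unit G), X, 1\<^sub>m (fst X)))\<rparr>"

end

theory Submission
 imports Defs
begin

text \<open>
  Write \<open>R\<close> for the regular element \<open>\<Sum> FPdim X \<cdot> [X]\<close> of a Grothendieck ring.  By Perron-Frobenius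
  theory it is, up to a factor, the only positive common eigenvector of the left multiplications.
  Since \<open>F\<close> is dominant, the image of the regular element of \<open>C\<close> is such a vector for \<open>D\<close>, so it is
  a multiple of the regular element of \<open>D\<close>; as \<open>F\<close> preserves dimensions, the factor is the index
  (\<open>based_ring_hom_dimension\<close>).  The coefficient of the unit therefore gives
  \<open>2 = \<Sum> FPdim X \<cdot> dim Hom(1, F X)\<close>, the sum over the simple objects of \<open>C\<close>.  The unit contributes \<open>1\<close>,
  and all dimensions are at least \<open>1\<close>.  So there is exactly one further simple object \<open>G\<close> whose
  image contains the unit; it has dimension \<open>1\<close>, which forces \<open>F G \<cong> 1\<close> and then \<open>G \<otimes> G \<cong> 1\<close>
  (\<open>index_two_kernel\<close>).  For an arbitrary \<open>X\<close> the sum \<open>X0\<close> of the simple summands of \<open>X\<close> that are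
  isomorphic to \<open>1\<close> or \<open>G\<close> has trivial image, and the image of the complement receives no arrow from
  the unit.  Hence \<open>F X0\<close> is the largest trivial subobject of \<open>F X\<close>, and \<open>F\<close> is normal.

  Knowing the simple objects of the kernel is not enough for the exact sequence, because a tensor
  functor needs coherent isomorphisms.  They are obtained from \<open>F\<close> as follows.  On every object \<open>X\<close> of
  the kernel let \<open>parity X\<close> act by \<open>1\<close> on the copies of \<open>1\<close> and by \<open>- 1\<close> on the copies of \<open>G\<close>.  This is
  natural in \<open>X\<close>, and compatible with tensor products because \<open>G \<otimes> G \<cong> 1\<close>.  The functor \<open>F\<close> is
  faithful on the kernel, and if \<open>2 \<noteq> 0\<close>, the arrows between images that come from the kernel are
  those that commute with the images of the parities (\<open>kernel_functor\<close>).  So the kernel consists of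
  trivial objects of \<open>D\<close>, that is vector spaces, with an involution.  The same holds for the
  representations of the group of order two and the functor that sends a representation to a sum of
  copies of \<open>1\<close>, the involution being the action of the generator (\<open>trivial_functor_Z2\<close>).  Two tensor
  categories with the same such description over \<open>D\<close> are equivalent: objects are matched, arrows and
  the monoidal structure are lifted along \<open>F\<close>, and every coherence condition may be verified in \<open>D\<close>
  since \<open>F\<close> is faithful (\<open>lift_tensor_functor\<close>, \<open>comparison_functor\<close>).

  Throughout, semisimplicity is used in the form that objects are finite direct sums of objects with
  scalar endomorphisms, so that arrows are matrices and Gaussian elimination applies.
\<close>

text \<open>Short forms of composition and of tensor products of arrows and objects.\<close>

notation Comp (infixl \<open>**\<index>\<close> 70) and TensA (infixr \<open>\<star>\<index>\<close> 75) and TensO (infixr \<open>\<boxtimes>\<index>\<close> 75)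

abbreviation (input) comp_in (\<open>(_ **[_]/ _)\<close> [70, 0, 71] 70) where "g **[C] f \<equiv> Comp C g f"
abbreviation (input) tens_in (\<open>(_ \<star>[_]/ _)\<close> [76, 0, 75] 75) where "f \<star>[C] g \<equiv> TensA C f g"
abbreviation (input) tensor_in (\<open>(_ \<boxtimes>[_]/ _)\<close> [76, 0, 75] 75) where "X \<boxtimes>[C] Y \<equiv> TensO C X Y"

abbreviation "Hom \<equiv> hom_set"

type_synonym ('g, 'k) rep_cat = "(('g, 'k) rep, ('g, 'k) rep_arrow, 'k) monoidal_data"

section \<open>Nonnegative matrices\<close>

text \<open>Bolzano-Weierstrass in one coordinate after the other.\<close>

lemma pointwise_convergent_subsequence:
 fixes v :: "nat => 'x => real"
 assumes "finite L" and "\<And>n x. x : L ==> 0 \<le> v n x \<and> v n x \<le> 1"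
 shows "\<exists>f w. strict_mono f \<and> (\<forall>x\<in>L. (\<lambda>n. v (f n) x) \<longlonglongrightarrow> w x)"
 using assms
proof (induction L rule: finite_induct)
 case empty
 have "strict_mono (id :: nat => nat)" by (simp add: strict_mono_def)
 then show ?case by auto
next
 case (insert a L)
 then obtain f w where f: "strict_mono f" and w: "\<forall>x\<in>L. (\<lambda>n. v (f n) x) \<longlonglongrightarrow> w x"
  by (metis insert_iff)
 obtain g where g: "strict_mono (g :: nat => nat)" "monoseq (\<lambda>n. v (f (g n)) a)"
  using seq_monosub[of "\<lambda>n. v (f n) a"] by auto
 have "Bseq (\<lambda>n. v (f (g n)) a)"
  by (rule BseqI[of 1]) (use insert.prems[of a] in "auto simp: abs_le_iff intro: order_trans[of _ 0]")
 then obtain c where c: "(\<lambda>n. v (f (g n)) a) \<longlonglongrightarrow> c"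
  using Bseq_monoseq_convergent[OF _ g(2)] by (auto simp: convergent_def)
 have "strict_mono (f \<circ> g)" using f g(1) by (rule strict_mono_o)
 moreover have "\<forall>x\<in>insert a L. (\<lambda>n. v ((f \<circ> g) n) x) \<longlonglongrightarrow> (w(a := c)) x"
  using c w insert.hyps(2) LIMSEQ_subseq_LIMSEQ[OF _ g(1)] by (fastforce simp: o_def)
 ultimately show ?case by blast
qed

text \<open>The Collatz-Wielandt argument: the largest \<open>r\<close> for which some stochastic \<open>v\<close> satisfies
  \<open>r v \<le> Q v\<close> exists by compactness, and maximality forces equality, because applying the positive
  matrix \<open>Q\<close> to a nonzero slack makes every inequality strict.\<close>

lemma perron_vector:
 fixes Q :: "'x => 'x => real"
 assumes fin: "finite L" and ne: "L \<noteq> {}"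
  and pos: "\<And>x y. x : L ==> y : L ==> Q x y > 0"
 shows "\<exists>v q. (\<forall>x\<in>L. v x > 0) \<and> (\<forall>x\<in>L. (\<Sum>y\<in>L. Q x y * v y) = q * v x)"
proof -
 define good where "good r v \<longleftrightarrow> (\<forall>x\<in>L. 0 \<le> v x) \<and> (\<Sum>x\<in>L. v x) = 1 \<and>
   (\<forall>x\<in>L. r * v x \<le> (\<Sum>y\<in>L. Q x y * v y))" for r :: real and v
 define R where "R = {r. \<exists>v. good r v}"
 have le1: "v x \<le> 1" if "good r v" "x : L" for r v x
  using that fin member_le_sum[of x L v] by (auto simp: good_def)
 have R_le: "r \<le> (\<Sum>x\<in>L. \<Sum>y\<in>L. Q x y)" if r: "r : R" for r
 proof -
  obtain v where v: "good r v" using r unfolding R_def by blast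
  have "r = (\<Sum>x\<in>L. r * v x)" using v by (simp add: good_def sum_distrib_left[symmetric])
  also have "... \<le> (\<Sum>x\<in>L. \<Sum>y\<in>L. Q x y * v y)" using v by (intro sum_mono) (auto simp: good_def)
  also have "... \<le> (\<Sum>x\<in>L. \<Sum>y\<in>L. Q x y)"
   using le1[OF v] v pos by (intro sum_mono) (auto simp: good_def intro!: mult_left_le less_imp_le)
  finally show ?thesis .
 qed
 have bdd: "bdd_above R" using R_le by (rule bdd_aboveI)
 have "good 0 (\<lambda>_. 1 / card L)"
  using fin ne pos by (auto simp: good_def less_imp_le intro!: sum_nonneg divide_nonneg_nonneg)
 then have R0: "0 : R" by (auto simp: R_def)
 define q where "q = Sup R"
 have q0: "0 \<le> q" unfolding q_def using R0 bdd by (rule cSup_upper)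
 have "\<exists>r\<in>R. q - 1 / real (Suc n) < r" for n
 proof -
  have "q - 1 / real (Suc n) < Sup R" unfolding q_def by simp
  then show ?thesis using less_cSup_iff[of R] R0 bdd by blast
 qed
 then obtain r where r: "\<And>n. r n : R" "\<And>n. q - 1 / real (Suc n) < r n" by metis
 then have "\<forall>n. \<exists>v. good (r n) v" unfolding R_def by blast
 then obtain v where v: "\<And>n. good (r n) (v n)" by (rule choice[THEN exE]) blast
 have rq: "r n \<le> q" for n unfolding q_def using r(1) bdd by (rule cSup_upper)
 have r_lim: "r \<longlonglongrightarrow> q"
 proof (rule tendsto_sandwich[where f = "\<lambda>n. q - 1 / real (Suc n)" and h = "\<lambda>_. q"])
  show "(\<lambda>n. q - 1 / real (Suc n)) \<longlonglongrightarrow> q"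
   using LIMSEQ_inverse_real_of_nat_add_minus[of q] by (simp add: inverse_eq_divide)
 qed (use r(2) rq in "auto intro!: always_eventually less_imp_le")
 obtain f w where f: "strict_mono f" and w: "\<And>x. x : L ==> (\<lambda>n. v (f n) x) \<longlonglongrightarrow> w x"
  using pointwise_convergent_subsequence[OF fin, of v] v le1 unfolding good_def by blast
 have rf: "(\<lambda>n. r (f n)) \<longlonglongrightarrow> q" using LIMSEQ_subseq_LIMSEQ[OF r_lim f] by (simp add: o_def)
 have w0: "0 \<le> w x" if "x : L" for x
  using w[OF that] by (rule LIMSEQ_le_const) (use v that in "auto simp: good_def")
 have "(\<lambda>n. \<Sum>x\<in>L. v (f n) x) \<longlonglongrightarrow> (\<Sum>x\<in>L. w x)" by (intro tendsto_sum w)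
 moreover have "(\<lambda>n. \<Sum>x\<in>L. v (f n) x) = (\<lambda>_. 1)" using v by (auto simp: good_def)
 ultimately have w1: "(\<Sum>x\<in>L. w x) = 1" by (simp add: LIMSEQ_const_iff)
 have wQ: "q * w x \<le> (\<Sum>y\<in>L. Q x y * w y)" if "x : L" for x
 proof (rule LIMSEQ_le)
  show "(\<lambda>n. r (f n) * v (f n) x) \<longlonglongrightarrow> q * w x" by (intro tendsto_mult rf w that)
  show "(\<lambda>n. \<Sum>y\<in>L. Q x y * v (f n) y) \<longlonglongrightarrow> (\<Sum>y\<in>L. Q x y * w y)"
   by (intro tendsto_sum tendsto_mult tendsto_const w)
  show "\<exists>N. \<forall>n\<ge>N. r (f n) * v (f n) x \<le> (\<Sum>y\<in>L. Q x y * v (f n) y)"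
   using v that by (auto simp: good_def)
 qed
 have strict: "(\<Sum>y\<in>L. Q x y * u y) > 0"
  if "x : L" and u: "\<And>y. y : L ==> 0 \<le> u y" and "y : L" "u y > 0" for x y u
 proof (rule sum_pos2[OF fin \<open>y : L\<close>])
  show "0 < Q x y * u y" using that pos by simp
  show "0 \<le> Q x z * u z" if "z : L" for z
   using pos[OF \<open>x : L\<close> that] u[OF that] by simp
 qed
 obtain y0 where y0: "y0 : L" "w y0 > 0"
  using w0 w1 by (metis less_eq_real_def sum.neutral zero_neq_one)
 define u where "u x = (\<Sum>y\<in>L. Q x y * w y)" for x
 have u_pos: "u x > 0" if "x : L" for x
  unfolding u_def using that w0 y0 by (rule strict)
 have eq: "u x = q * w x" if "x : L" for x
 proof (rule ccontr)
  assume "u x \<noteq> q * w x"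
  then have slack: "u x - q * w x > 0" using wQ[OF that] by (simp add: u_def)
  have st: "(\<Sum>y\<in>L. Q z y * (u y - q * w y)) > 0" if "z : L" for z
   using that wQ slack \<open>x : L\<close> by (intro strict) (auto simp: u_def)
  have st': "(\<Sum>y\<in>L. Q z y * u y) > q * u z" if "z : L" for z
  proof -
   have "(\<Sum>y\<in>L. Q z y * (u y - q * w y)) = (\<Sum>y\<in>L. Q z y * u y) - q * u z"
    by (simp add: u_def right_diff_distrib sum_subtractf sum_distrib_left mult.left_commute)
   then show ?thesis using st[OF that] by simp
  qed
  \<comment> \<open>all inequalities for \<open>u\<close> are strict, so a larger factor than \<open>q\<close> is possible\<close>
  define p where "p = Min ((\<lambda>z. (\<Sum>y\<in>L. Q z y * u y) / u z) ` L)"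
  have "p > q" unfolding p_def using fin ne st' u_pos by (auto simp: less_divide_eq)
  have p_le: "p * u z \<le> (\<Sum>y\<in>L. Q z y * u y)" if "z : L" for z
  proof -
   have "p \<le> (\<Sum>y\<in>L. Q z y * u y) / u z" unfolding p_def using fin that by (intro Min_le) auto
   then show ?thesis using u_pos[OF that] by (simp add: le_divide_eq)
  qed
  define s where "s = (\<Sum>x\<in>L. u x)"
  have s: "s > 0" unfolding s_def using fin ne u_pos by (intro sum_pos) auto
  have "good p (\<lambda>z. u z / s)"
   using p_le u_pos s
   by (auto simp: good_def s_def[symmetric] sum_divide_distrib[symmetric] divide_le_cancel less_imp_le)
  then have "p : R" by (auto simp: R_def)
  then have "p \<le> q" unfolding q_def using bdd by (rule cSup_upper)
  then show False using \<open>p > q\<close> by simp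
 qed
 have "w x > 0" if "x : L" for x
  using u_pos[OF that] eq[OF that] w0[OF that] q0 by (metis less_eq_real_def mult_zero_right less_irrefl)
 then show ?thesis using eq unfolding u_def by blast
qed

text \<open>For the largest ratio \<open>t\<close> of entries of \<open>w\<close> and \<open>v\<close> the vector \<open>t v - w\<close> is nonnegative with
  a vanishing entry.  Being an eigenvector of a positive matrix, it is zero.\<close>

lemma positive_matrix_eigenvector_unique:
 fixes Q :: "'x => 'x => real"
 assumes fin: "finite L"
  and pos: "\<And>x y. x : L ==> y : L ==> Q x y > 0"
  and v: "\<And>x. x : L ==> v x > 0" "\<And>x. x : L ==> (\<Sum>y\<in>L. Q x y * v y) = q * v x"
  and w: "\<And>x. x : L ==> (\<Sum>y\<in>L. Q x y * w y) = q * w x"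
 shows "\<exists>t. \<forall>x\<in>L. w x = t * v x"
proof (cases "L = {}")
 case False
 define t where "t = Max ((\<lambda>x. w x / v x) ` L)"
 have "t : (\<lambda>x. w x / v x) ` L" unfolding t_def using fin False by (intro Max_in) auto
 then obtain x0 where x0: "x0 : L" "t = w x0 / v x0" by auto
 have nn: "0 \<le> t * v x - w x" if "x : L" for x
 proof -
  have "w x / v x \<le> t" unfolding t_def using fin that by (intro Max_ge) auto
  then show ?thesis using v(1)[OF that] by (simp add: divide_le_eq)
 qed
 have "(\<Sum>y\<in>L. Q x0 y * (t * v y - w y)) = t * (\<Sum>y\<in>L. Q x0 y * v y) - (\<Sum>y\<in>L. Q x0 y * w y)"
  by (simp add: right_diff_distrib sum_subtractf sum_distrib_left mult.left_commute)
 also have "... = 0" using v(1)[OF x0(1)] v(2)[OF x0(1)] x0(2) w[OF x0(1)] by simp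
 finally have z: "(\<Sum>y\<in>L. Q x0 y * (t * v y - w y)) = 0" .
 have "Q x0 y * (t * v y - w y) = 0" if "y : L" for y
  using z nn pos x0(1) that fin by (subst (asm) sum_nonneg_eq_0_iff) (auto intro!: mult_nonneg_nonneg intro: less_imp_le)
 then have "w y = t * v y" if "y : L" for y
  using pos[OF x0(1) that] that by (metis eq_iff_diff_eq_0 less_irrefl mult_eq_0_iff)
 then show ?thesis by blast
qed auto

text \<open>In the supremum norm weighted by a positive eigenvector \<open>v\<close> of eigenvalue \<open>c\<close>, a nonnegative
  matrix has operator norm \<open>c\<close>, so no eigenvalue exceeds \<open>c\<close>.\<close>

lemma greatest_eigenvalue_eqI:
 fixes A :: "'x => 'x => real"
 assumes fin: "finite L" and ne: "L \<noteq> {}"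
  and nonneg: "\<And>x y. x : L ==> y : L ==> A x y \<ge> 0"
  and v: "\<And>x. x : L ==> v x > 0" "\<And>x. x : L ==> (\<Sum>y\<in>L. A x y * v y) = c * v x"
  and c: "c > 0"
 shows "(GREATEST r. r > 0 \<and> (\<exists>w. (\<exists>x\<in>L. w x \<noteq> 0) \<and> (\<forall>x\<in>L. (\<Sum>y\<in>L. A x y * w y) = r * w x))) = c"
proof (rule Greatest_equality)
 show "c > 0 \<and> (\<exists>w. (\<exists>x\<in>L. w x \<noteq> 0) \<and> (\<forall>x\<in>L. (\<Sum>y\<in>L. A x y * w y) = c * w x))"
  using c v ne by (metis equals0I less_irrefl)
next
 fix r :: real
 assume "r > 0 \<and> (\<exists>w. (\<exists>x\<in>L. w x \<noteq> 0) \<and> (\<forall>x\<in>L. (\<Sum>y\<in>L. A x y * w y) = r * w x))"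
 then obtain w where r: "r > 0" and w0: "\<exists>x\<in>L. w x \<noteq> 0"
  and w: "\<And>x. x : L ==> (\<Sum>y\<in>L. A x y * w y) = r * w x" by auto
 define t where "t = Max ((\<lambda>x. \<bar>w x\<bar> / v x) ` L)"
 have "t : (\<lambda>x. \<bar>w x\<bar> / v x) ` L" unfolding t_def using fin ne by (intro Max_in) auto
 then obtain x0 where x0: "x0 : L" "t = \<bar>w x0\<bar> / v x0" by auto
 have ub: "\<bar>w x\<bar> / v x \<le> t" if "x : L" for x
  unfolding t_def using fin that by (intro Max_ge) auto
 have ub': "\<bar>w x\<bar> \<le> t * v x" if "x : L" for x
  using ub[OF that] v(1)[OF that] by (simp add: divide_le_eq)
 have t: "t > 0"
  using w0 ub v(1) by (metis zero_less_abs_iff divide_pos_pos less_le_trans)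
 have wx0: "\<bar>w x0\<bar> = t * v x0" using x0 v(1)[OF x0(1)] by simp
 have "r * (t * v x0) = \<bar>\<Sum>y\<in>L. A x0 y * w y\<bar>" using w[OF x0(1)] r wx0 by (simp add: abs_mult)
 also have "... \<le> (\<Sum>y\<in>L. \<bar>A x0 y * w y\<bar>)" by (rule sum_abs)
 also have "... \<le> (\<Sum>y\<in>L. A x0 y * (t * v y))"
  using ub' nonneg x0(1) by (intro sum_mono) (auto simp: abs_mult intro!: mult_left_mono)
 also have "... = t * (\<Sum>y\<in>L. A x0 y * v y)" by (simp add: sum_distrib_left mult.left_commute)
 also have "... = c * (t * v x0)" using v(2)[OF x0(1)] by simp
 finally show "r \<le> c" using t v(1)[OF x0(1)] by simp
qed

section \<open>Based rings\<close>

lemma sum_rotate: "(\<Sum>a\<in>A. \<Sum>b\<in>B. \<Sum>c\<in>C. g a b c) = (\<Sum>c\<in>C. \<Sum>a\<in>A. \<Sum>b\<in>B. g a b c)"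
proof -
 have "(\<Sum>a\<in>A. \<Sum>b\<in>B. \<Sum>c\<in>C. g a b c) = (\<Sum>a\<in>A. \<Sum>c\<in>C. \<Sum>b\<in>B. g a b c)"
  by (rule sum.cong[OF refl], rule sum.swap)
 also have "... = (\<Sum>c\<in>C. \<Sum>a\<in>A. \<Sum>b\<in>B. g a b c)" by (rule sum.swap)
 finally show ?thesis .
qed

text \<open>The structure constant \<open>N X T U\<close> is the multiplicity of \<open>U\<close> in \<open>X T\<close>.  The last axiom says that left
  multiplication by \<open>T\<close> is adjoint to left multiplication by a nonnegative element, the dual.\<close>

locale based_ring =
 fixes L :: "'x set" and e :: 'x and N :: "'x => 'x => 'x => real"
 assumes fin: "finite L" and e: "e : L"
  and nonneg: "N X T U \<ge> 0"
  and unit_left: "T : L ==> U : L ==> N e T U = (if T = U then 1 else 0)"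
  and unit_right: "T : L ==> U : L ==> N T e U = (if T = U then 1 else 0)"
  and assoc: "X : L ==> T : L ==> Y : L ==> U : L ==>
   (\<Sum>W\<in>L. N X T W * N W Y U) = (\<Sum>W\<in>L. N T Y W * N X W U)"
  and trans_right: "T : L ==> U : L ==> \<exists>X\<in>L. N T X U > 0"
  and trans_left: "T : L ==> U : L ==> \<exists>X\<in>L. N X T U > 0"
  and adjoint: "T : L ==> \<exists>x. (\<forall>S\<in>L. x S \<ge> 0) \<and>
   (\<forall>A\<in>L. \<forall>B\<in>L. N T A B = (\<Sum>S\<in>L. x S * N S B A))"

text \<open>The sum \<open>Q\<close> of all right multiplications is a positive matrix that commutes with all left
  multiplications.  Hence its Perron vector is a common eigenvector of the left multiplications, and
  adjointness identifies the eigenvalues with the entries of that vector.\<close>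

lemma (in based_ring) dimension_exists:
 "\<exists>d. (\<forall>X\<in>L. d X \<ge> 1) \<and> d e = 1 \<and>
   (\<forall>X\<in>L. \<forall>U\<in>L. (\<Sum>T\<in>L. N X T U * d T) = d X * d U)"
proof -
 define Q where "Q U T = (\<Sum>X\<in>L. N T X U)" for U T
 have Q: "Q U T > 0" if UT: "U : L" "T : L" for U T
 proof -
  obtain X where "X : L" "N T X U > 0" using trans_right UT by blast
  then show ?thesis unfolding Q_def using fin nonneg by (intro sum_pos2[of _ X]) auto
 qed
 obtain v q where v: "\<And>x. x : L ==> v x > 0" "\<And>x. x : L ==> (\<Sum>y\<in>L. Q x y * v y) = q * v x"
  using perron_vector[of L Q] fin e Q by blast
 define d where "d X = (\<Sum>T\<in>L. N X T e * v T) / v e" for X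
 have ev: "(\<Sum>T\<in>L. N X T U * v T) = d X * v U" if X: "X : L" and U: "U : L" for X U
 proof -
  define w where "w U = (\<Sum>T\<in>L. N X T U * v T)" for U
  have "(\<Sum>y\<in>L. Q x y * w y) = q * w x" if x: "x : L" for x
  proof -
   have "(\<Sum>y\<in>L. Q x y * w y) = (\<Sum>y\<in>L. \<Sum>T\<in>L. \<Sum>Y\<in>L. N X T y * N y Y x * v T)"
    unfolding Q_def w_def by (simp add: sum_distrib_left sum_distrib_right mult_ac)
   also have "... = (\<Sum>T\<in>L. \<Sum>Y\<in>L. (\<Sum>y\<in>L. N X T y * N y Y x) * v T)"
    by (subst sum_rotate[symmetric]) (simp add: sum_distrib_right)
   also have "... = (\<Sum>T\<in>L. \<Sum>Y\<in>L. (\<Sum>y\<in>L. N T Y y * N X y x) * v T)"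
    using assoc[OF X _ _ x] by simp
   also have "... = (\<Sum>y\<in>L. \<Sum>T\<in>L. \<Sum>Y\<in>L. N T Y y * N X y x * v T)"
    by (subst sum_rotate[symmetric]) (simp add: sum_distrib_right)
   also have "... = (\<Sum>y\<in>L. N X y x * (\<Sum>T\<in>L. Q y T * v T))"
    unfolding Q_def by (simp add: sum_distrib_left sum_distrib_right mult_ac)
   also have "... = q * w x" using v(2) by (simp add: w_def sum_distrib_left mult_ac)
   finally show ?thesis .
  qed
  then obtain t where t: "\<forall>x\<in>L. w x = t * v x"
   using positive_matrix_eigenvector_unique[of L Q v q w] fin Q v by blast
  have "d X = t" using t e v(1)[OF e] by (simp add: d_def w_def[symmetric])
  then show ?thesis using t U by (simp add: w_def)
 qed
 have d_e: "d e = 1"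
 proof -
  have "(\<Sum>T\<in>L. N e T e * v T) = (\<Sum>T\<in>L. if T = e then v T else 0)"
   using e by (intro sum.cong) (auto simp: unit_left)
  then show ?thesis using v(1)[OF e] fin e by (simp add: d_def)
 qed
 have dv: "v T = d T * v e" if T: "T : L" for T
 proof -
  obtain x where x: "\<And>S. S : L ==> x S \<ge> 0"
   and adj: "\<And>A B. A : L ==> B : L ==> N T A B = (\<Sum>S\<in>L. x S * N S B A)"
   using adjoint[OF T] by blast
  define dx where "dx = (\<Sum>S\<in>L. x S * d S)"
  have evx: "(\<Sum>B\<in>L. N T A B * v B) = dx * v A" if A: "A : L" for A
  proof -
   have "(\<Sum>B\<in>L. N T A B * v B) = (\<Sum>B\<in>L. \<Sum>S\<in>L. x S * (N S B A * v B))"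
    using adj[OF A] by (simp add: sum_distrib_left sum_distrib_right mult_ac)
   also have "... = (\<Sum>S\<in>L. x S * (\<Sum>B\<in>L. N S B A * v B))"
    by (subst sum.swap) (simp add: sum_distrib_left)
   also have "... = dx * v A" using ev[OF _ A] by (simp add: dx_def sum_distrib_left sum_distrib_right mult_ac)
   finally show ?thesis .
  qed
  have "dx * (\<Sum>A\<in>L. v A * v A) = (\<Sum>A\<in>L. v A * (\<Sum>B\<in>L. N T A B * v B))"
   using evx by (simp add: sum_distrib_left mult_ac)
  also have "... = (\<Sum>B\<in>L. v B * (\<Sum>A\<in>L. N T A B * v A))"
   by (simp add: sum_distrib_left, subst sum.swap) (simp add: mult_ac)
  also have "... = d T * (\<Sum>A\<in>L. v A * v A)" using ev[OF T] by (simp add: sum_distrib_left mult_ac)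
  finally have "dx = d T"
   using sum_pos[OF fin, of "\<lambda>A. v A * v A"] e v(1) by fastforce
  moreover have "(\<Sum>B\<in>L. N T e B * v B) = (\<Sum>B\<in>L. if B = T then v B else 0)"
   using T by (intro sum.cong) (auto simp: unit_right)
  ultimately show ?thesis using evx[OF e] T fin by simp
 qed
 have ed: "(\<Sum>T\<in>L. N X T U * d T) = d X * d U" if "X : L" "U : L" for X U
 proof -
  have "v e * (\<Sum>T\<in>L. N X T U * d T) = (\<Sum>T\<in>L. N X T U * v T)"
   using dv by (simp add: sum_distrib_left mult_ac)
  also have "... = v e * (d X * d U)" using ev[OF that] dv[OF that(2)] by simp
  finally show ?thesis using v(1)[OF e] by simp
 qed
 have dpos: "d X > 0" if "X : L" for X
  using dv[OF that] v(1)[OF that] v(1)[OF e] by (metis zero_less_mult_pos2)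
 have "d X \<ge> 1" if X: "X : L" for X
 proof -
  have "1 = N X e X * d e" using unit_right X d_e by simp
  also have "... \<le> (\<Sum>T\<in>L. N X T X * d T)"
   using dpos nonneg fin e by (intro member_le_sum) (auto simp: less_imp_le)
  also have "... = d X * d X" using ed X by simp
  finally show ?thesis using dpos[OF X] by (metis less_le_not_le linorder_not_less mult_less_cancel_left2 order_less_trans)
 qed
 then show ?thesis using d_e ed by blast
qed

definition (in based_ring) dim :: "'x => real" where
 "dim = (SOME d. (\<forall>X\<in>L. d X \<ge> 1) \<and> d e = 1 \<and>
   (\<forall>X\<in>L. \<forall>U\<in>L. (\<Sum>T\<in>L. N X T U * d T) = d X * d U))"

lemma (in based_ring)
 shows dim_ge_1: "X : L ==> dim X \<ge> 1"
  and dim_unit: "dim e = 1"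
  and dim_eigen: "X : L ==> U : L ==> (\<Sum>T\<in>L. N X T U * dim T) = dim X * dim U"
 using someI_ex[OF dimension_exists] unfolding dim_def[symmetric] by auto

text \<open>The vector \<open>dim\<close> is a positive eigenvector of left multiplication by \<open>\<Sum> x S \<cdot> S\<close>.\<close>

lemma (in based_ring) greatest_eigenvalue_left_mult:
 assumes x: "\<And>S. S : L ==> x S \<ge> 0" and pos: "\<exists>S\<in>L. x S > 0"
 shows "(GREATEST r. r > 0 \<and> (\<exists>w. (\<exists>T\<in>L. w T \<noteq> 0) \<and>
   (\<forall>U\<in>L. (\<Sum>T\<in>L. (\<Sum>S\<in>L. x S * N S T U) * w T) = r * w U))) = (\<Sum>S\<in>L. x S * dim S)"
proof (rule greatest_eigenvalue_eqI[where v = dim])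
 show "finite L" "L \<noteq> {}" using fin e by auto
 show "\<And>U T. U : L ==> T : L ==> (\<Sum>S\<in>L. x S * N S T U) \<ge> 0"
  using x nonneg by (intro sum_nonneg mult_nonneg_nonneg) auto
 show d0: "dim X > 0" if "X : L" for X using dim_ge_1[OF that] by simp
 show "(\<Sum>T\<in>L. (\<Sum>S\<in>L. x S * N S T U) * dim T) = (\<Sum>S\<in>L. x S * dim S) * dim U" if U: "U : L" for U
 proof -
  have "(\<Sum>T\<in>L. (\<Sum>S\<in>L. x S * N S T U) * dim T) = (\<Sum>T\<in>L. \<Sum>S\<in>L. x S * (N S T U * dim T))"
   by (simp add: sum_distrib_left sum_distrib_right mult_ac)
  also have "... = (\<Sum>S\<in>L. x S * (\<Sum>T\<in>L. N S T U * dim T))"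
   by (subst sum.swap) (simp add: sum_distrib_left)
  also have "... = (\<Sum>S\<in>L. x S * dim S) * dim U" using dim_eigen U by (simp add: sum_distrib_left sum_distrib_right mult_ac)
  finally show ?thesis .
 qed
 show "(\<Sum>S\<in>L. x S * dim S) > 0"
 proof -
  obtain S where "S : L" "x S > 0" using pos by blast
  then show ?thesis using x d0 fin
   by (intro sum_pos2[of L S]) (auto intro!: mult_nonneg_nonneg intro: less_imp_le)
 qed
qed

text \<open>A ring homomorphism with nonnegative matrix \<open>m\<close> whose image meets every basis element.  The
  pushforward \<open>z\<close> of the regular element \<open>\<Sum> dim X \<cdot> X\<close> is a positive simultaneous eigenvector for
  the left multiplications by elements of the image, and so is the regular element of the target.
  Comparing the eigenvalues where the ratio of the two vectors is extremal shows that the dimension is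
  preserved.  The left multiplication by the image of \<open>\<Sum> X\<close> has a strictly positive matrix, whose
  positive eigenvector is unique up to a factor.  So \<open>z\<close> is a multiple of the regular element, and
  pairing with \<open>dim\<close> gives the factor.\<close>

lemma based_ring_hom_dimension:
 fixes L :: "'x set" and L' :: "'y set" and m :: "'x => 'y => real"
 assumes A: "based_ring L e N" and B: "based_ring L' e' N'"
  and m0: "\<And>X Y. m X Y \<ge> 0"
  and hom: "\<And>X T V. X : L ==> T : L ==> V : L' ==>
   (\<Sum>U\<in>L. N X T U * m U V) = (\<Sum>P\<in>L'. \<Sum>R\<in>L'. m X P * m T R * N' P R V)"
  and dom: "\<And>Y. Y : L' ==> \<exists>X\<in>L. m X Y > 0"
 shows "X : L ==> (\<Sum>Y\<in>L'. m X Y * based_ring.dim L' e' N' Y) = based_ring.dim L e N X"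
  and "(\<Sum>X\<in>L. based_ring.dim L e N X * m X e') =
   (\<Sum>X\<in>L. (based_ring.dim L e N X)\<^sup>2) / (\<Sum>Y\<in>L'. (based_ring.dim L' e' N' Y)\<^sup>2)"
proof -
 interpret A: based_ring L e N by fact
 interpret B: based_ring L' e' N' by fact
 let ?d = A.dim and ?d' = B.dim
 define z where "z Y = (\<Sum>X\<in>L. ?d X * m X Y)" for Y
 define dF where "dF X = (\<Sum>Y\<in>L'. m X Y * ?d' Y)" for X
 have dpos: "?d X > 0" if "X : L" for X using A.dim_ge_1[OF that] by simp
 have dpos': "?d' X > 0" if "X : L'" for X using B.dim_ge_1[OF that] by simp
 have zpos: "z Y > 0" if Y: "Y : L'" for Y
 proof -
  obtain X where "X : L" "m X Y > 0" using dom Y by blast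
  then show ?thesis unfolding z_def using A.fin dpos m0
   by (intro sum_pos2[of L X]) (auto intro!: mult_nonneg_nonneg intro: less_imp_le)
 qed
 have z_eigen: "(\<Sum>R\<in>L'. (\<Sum>P\<in>L'. m X P * N' P R V) * z R) = ?d X * z V"
  if X: "X : L" and V: "V : L'" for X V
 proof -
  have "(\<Sum>R\<in>L'. (\<Sum>P\<in>L'. m X P * N' P R V) * z R)
    = (\<Sum>R\<in>L'. \<Sum>T\<in>L. \<Sum>P\<in>L'. ?d T * (m X P * m T R * N' P R V))"
   unfolding z_def sum_product by (rule sum.cong[OF refl], subst sum.swap) (simp add: mult_ac)
  also have "... = (\<Sum>T\<in>L. \<Sum>P\<in>L'. \<Sum>R\<in>L'. ?d T * (m X P * m T R * N' P R V))"
   by (rule sum_rotate[symmetric])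
  also have "... = (\<Sum>T\<in>L. ?d T * (\<Sum>P\<in>L'. \<Sum>R\<in>L'. m X P * m T R * N' P R V))"
   by (simp add: sum_distrib_left)
  also have "... = (\<Sum>T\<in>L. ?d T * (\<Sum>U\<in>L. N X T U * m U V))" using hom X V by simp
  also have "... = (\<Sum>U\<in>L. (\<Sum>T\<in>L. N X T U * ?d T) * m U V)"
   by (simp add: sum_distrib_left sum_distrib_right, subst sum.swap) (simp add: mult_ac)
  also have "... = ?d X * z V" using A.dim_eigen X by (simp add: z_def sum_distrib_left mult_ac)
  finally show ?thesis .
 qed
 have d'_eigen: "(\<Sum>R\<in>L'. (\<Sum>P\<in>L'. m X P * N' P R V) * ?d' R) = dF X * ?d' V"
  if X: "X : L" and V: "V : L'" for X V
 proof -
  have "(\<Sum>R\<in>L'. (\<Sum>P\<in>L'. m X P * N' P R V) * ?d' R)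
    = (\<Sum>P\<in>L'. m X P * (\<Sum>R\<in>L'. N' P R V * ?d' R))"
   by (simp add: sum_distrib_left sum_distrib_right, subst sum.swap) (simp add: mult_ac)
  also have "... = dF X * ?d' V" using B.dim_eigen V by (simp add: dF_def sum_distrib_left sum_distrib_right mult_ac)
  finally show ?thesis .
 qed
 have ne': "L' \<noteq> {}" using B.e by auto
 have dF: "dF X = ?d X" if X: "X : L" for X
 proof -
  let ?M = "\<lambda>V R. \<Sum>P\<in>L'. m X P * N' P R V"
  have M0: "?M V R \<ge> 0" for V R using m0 B.nonneg by (intro sum_nonneg mult_nonneg_nonneg)
  define t where "t = Min ((\<lambda>Y. z Y / ?d' Y) ` L')"
  define s where "s = Max ((\<lambda>Y. z Y / ?d' Y) ` L')"
  have fin': "finite ((\<lambda>Y. z Y / ?d' Y) ` L')" "(\<lambda>Y. z Y / ?d' Y) ` L' \<noteq> {}" using B.fin ne' by auto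
  obtain Y0 where Y0: "Y0 : L'" "t = z Y0 / ?d' Y0" using Min_in[OF fin'] by (auto simp: t_def)
  obtain Y1 where Y1: "Y1 : L'" "s = z Y1 / ?d' Y1" using Max_in[OF fin'] by (auto simp: s_def)
  have t_le: "t * ?d' Y \<le> z Y" if "Y : L'" for Y
   using Min_le[OF fin'(1), of "z Y / ?d' Y"] that dpos'[OF that] by (simp add: t_def le_divide_eq)
  have s_ge: "z Y \<le> s * ?d' Y" if "Y : L'" for Y
   using Max_ge[OF fin'(1), of "z Y / ?d' Y"] that dpos'[OF that] by (simp add: s_def divide_le_eq)
  have "dF X * z Y0 = t * (dF X * ?d' Y0)" using Y0 dpos'[OF Y0(1)] by simp
  also have "... = (\<Sum>R\<in>L'. ?M Y0 R * (t * ?d' R))"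
   unfolding d'_eigen[OF X Y0(1), symmetric] by (simp add: sum_distrib_left mult_ac)
  also have "... \<le> (\<Sum>R\<in>L'. ?M Y0 R * z R)" using t_le M0 by (intro sum_mono mult_left_mono)
  also have "... = ?d X * z Y0" using z_eigen[OF X Y0(1)] .
  finally have le1: "dF X \<le> ?d X" using zpos[OF Y0(1)] by simp
  have "?d X * z Y1 = (\<Sum>R\<in>L'. ?M Y1 R * z R)" using z_eigen[OF X Y1(1)] by simp
  also have "... \<le> (\<Sum>R\<in>L'. ?M Y1 R * (s * ?d' R))" using s_ge M0 by (intro sum_mono mult_left_mono)
  also have "... = s * (dF X * ?d' Y1)"
   unfolding d'_eigen[OF X Y1(1), symmetric] by (simp add: sum_distrib_left mult_ac)
  also have "... = dF X * z Y1" using Y1 dpos'[OF Y1(1)] by simp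
  finally have "?d X \<le> dF X" using zpos[OF Y1(1)] by simp
  then show ?thesis using le1 by simp
 qed
 show "X : L ==> (\<Sum>Y\<in>L'. m X Y * ?d' Y) = ?d X" using dF by (simp add: dF_def)
 define Q where "Q V R = (\<Sum>X\<in>L. \<Sum>P\<in>L'. m X P * N' P R V)" for V R
 have Qpos: "Q V R > 0" if VR: "V : L'" "R : L'" for V R
 proof -
  obtain P where P: "P : L'" "N' P R V > 0" using B.trans_left VR by blast
  obtain X where X: "X : L" "m X P > 0" using dom P by blast
  have "(\<Sum>P\<in>L'. m X P * N' P R V) > 0"
   using P X m0 B.nonneg B.fin by (intro sum_pos2[of L' P]) auto
  then show ?thesis unfolding Q_def using X m0 B.nonneg A.fin
   by (intro sum_pos2[of L X]) (auto intro!: sum_nonneg)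
 qed
 have Qsum: "(\<Sum>R\<in>L'. Q V R * u R) = (\<Sum>X\<in>L. \<Sum>R\<in>L'. (\<Sum>P\<in>L'. m X P * N' P R V) * u R)" for V u
  unfolding Q_def by (simp add: sum_distrib_right, subst sum.swap) simp
 have "\<exists>t. \<forall>Y\<in>L'. z Y = t * ?d' Y"
 proof (rule positive_matrix_eigenvector_unique[where Q = Q and q = "\<Sum>X\<in>L. ?d X"])
  show "(\<Sum>R\<in>L'. Q V R * ?d' R) = (\<Sum>X\<in>L. ?d X) * ?d' V" if "V : L'" for V
   using d'_eigen[OF _ that] dF by (simp add: Qsum sum_distrib_right)
  show "(\<Sum>R\<in>L'. Q V R * z R) = (\<Sum>X\<in>L. ?d X) * z V" if "V : L'" for V
   using z_eigen[OF _ that] by (simp add: Qsum sum_distrib_right)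
 qed (use Qpos dpos' B.fin in auto)
 then obtain t where t: "\<And>Y. Y : L' ==> z Y = t * ?d' Y" by blast
 have "t * (\<Sum>Y\<in>L'. (?d' Y)\<^sup>2) = (\<Sum>Y\<in>L'. z Y * ?d' Y)"
  using t by (simp add: sum_distrib_left power2_eq_square mult_ac)
 also have "... = (\<Sum>X\<in>L. ?d X * dF X)"
  unfolding z_def dF_def by (simp add: sum_distrib_left sum_distrib_right, subst sum.swap) (simp add: mult_ac)
 also have "... = (\<Sum>X\<in>L. (?d X)\<^sup>2)" using dF by (simp add: power2_eq_square)
 finally have "t * (\<Sum>Y\<in>L'. (?d' Y)\<^sup>2) = (\<Sum>X\<in>L. (?d X)\<^sup>2)" .
 moreover have "(\<Sum>Y\<in>L'. (?d' Y)\<^sup>2) > 0"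
  using B.fin ne' dpos' by (intro sum_pos zero_less_power)
 moreover have "z e' = t" using t[OF B.e] B.dim_unit by simp
 ultimately show "(\<Sum>X\<in>L. ?d X * m X e') = (\<Sum>X\<in>L. (?d X)\<^sup>2) / (\<Sum>Y\<in>L'. (?d' Y)\<^sup>2)"
  by (simp add: z_def field_simps)
qed

section \<open>Linear categories\<close>

context category
begin

lemma hom_iff: "f : Hom C X Y \<longleftrightarrow> f : Arr C \<and> Dom C f = X \<and> Cod C f = Y"
 by (simp add: hom_set_def)

lemma hom_obj: "f : Hom C X Y ==> X : Obj C" "f : Hom C X Y ==> Y : Obj C"
 using Dom_closed Cod_closed by (auto simp: hom_iff)

lemma Ident_arrow [simp]: "X : Obj C ==> Ident C X : Arr C" "X : Obj C ==> Dom C (Ident C X) = X"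
 "X : Obj C ==> Cod C (Ident C X) = X"
 using Ident_hom by (auto simp: hom_iff)

lemma Comp_arrow [simp]:
 assumes "f : Arr C" "g : Arr C" "Dom C g = Cod C f"
 shows "g ** f : Arr C" "Dom C (g ** f) = Dom C f" "Cod C (g ** f) = Cod C g"
 using Comp_hom[of f "Dom C f" "Cod C f" g "Cod C g"] assms by (auto simp: hom_iff)

lemma Comp_Ident_simps [simp]:
 "f : Arr C ==> X = Dom C f ==> f ** Ident C X = f"
 "f : Arr C ==> X = Cod C f ==> Ident C X ** f = f"
 using Comp_Ident_left Comp_Ident_right by (auto simp: hom_iff)

lemma comp_assoc:
 assumes "f : Arr C" "g : Arr C" "h : Arr C" "Dom C g = Cod C f" "Dom C h = Cod C g"
 shows "(h ** g) ** f = h ** (g ** f)"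
 using Comp_assoc[of f "Dom C f" "Cod C f" g "Cod C g" h "Cod C h"] assms by (auto simp: hom_iff)

text \<open>Compositions are normalised to the right, so an equation \<open>g f = k\<close> is needed in this form to
  rewrite inside a longer composition.\<close>

lemma comp_cong_left:
 assumes "g ** f = k" and "f : Arr C" "g : Arr C" "x : Arr C" "Dom C g = Cod C f" "Dom C f = Cod C x"
 shows "g ** (f ** x) = k ** x"
 using assms comp_assoc[of x f g] by simp

lemma inverse_arrows_unique:
 assumes "inverse_arrows C f g" "inverse_arrows C f h" shows "g = h"
proof -
 have "g = g ** (f ** h)" using assms by (simp add: inverse_arrows_def hom_iff)
 also have "... = (g ** f) ** h" using assms by (intro comp_assoc[symmetric]) (auto simp: inverse_arrows_def hom_iff)
 also have "... = h" using assms by (simp add: inverse_arrows_def hom_iff)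
 finally show ?thesis .
qed

lemma inverse_of_inverse_arrows: "is_iso C f ==> inverse_arrows C f (inverse_of C f)"
 unfolding is_iso_def inverse_of_def using inverse_arrows_unique by (metis theI')

lemma inverse_ofI: "inverse_arrows C f g ==> inverse_of C f = g"
 by (metis inverse_arrows_unique inverse_of_inverse_arrows is_iso_def)

lemma iso_arrow [simp]: "is_iso C f ==> f : Arr C"
 by (auto simp: is_iso_def inverse_arrows_def)

lemma inverse_of_arrow [simp]:
 assumes "is_iso C f"
 shows "inverse_of C f : Arr C" "Dom C (inverse_of C f) = Cod C f" "Cod C (inverse_of C f) = Dom C f"
  "inverse_of C f ** f = Ident C (Dom C f)" "f ** inverse_of C f = Ident C (Cod C f)"
 using inverse_of_inverse_arrows[OF assms] by (auto simp: inverse_arrows_def hom_iff)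

lemma inverse_of_cancel [simp]:
 assumes "is_iso C f" "x : Arr C"
 shows "Dom C f = Cod C x ==> inverse_of C f ** (f ** x) = x"
  "Cod C f = Cod C x ==> f ** (inverse_of C f ** x) = x"
 using assms by (simp_all add: comp_assoc[symmetric])

lemma iso_inverse_of [simp]: "is_iso C f ==> is_iso C (inverse_of C f)"
 unfolding is_iso_def[of C "inverse_of C f"] inverse_arrows_def
 by (rule exI[of _ f]) (simp add: hom_iff)

lemma iso_Ident [simp]: "X : Obj C ==> is_iso C (Ident C X)"
 unfolding is_iso_def inverse_arrows_def by (rule exI[of _ "Ident C X"]) (simp add: hom_iff)

lemma isoI:
 assumes "f : Hom C X Y" "g : Hom C Y X" "g ** f = Ident C X" "f ** g = Ident C Y"
 shows "is_iso C f"
 unfolding is_iso_def inverse_arrows_def using assms by (auto simp: hom_iff)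

lemma iso_Comp [simp]:
 assumes "is_iso C f" "is_iso C g" "Dom C g = Cod C f"
 shows "is_iso C (g ** f)"
proof (rule isoI[where g = "inverse_of C f ** inverse_of C g"])
 show "g ** f : Hom C (Dom C f) (Cod C g)"
  "inverse_of C f ** inverse_of C g : Hom C (Cod C g) (Dom C f)"
  using assms by (auto simp: hom_iff)
 show "inverse_of C f ** inverse_of C g ** (g ** f) = Ident C (Dom C f)"
  "g ** f ** (inverse_of C f ** inverse_of C g) = Ident C (Cod C g)"
  using assms by (simp_all add: comp_assoc)
qed

lemma isomorphic_refl [simp]: "X : Obj C ==> isomorphic C X X"
 unfolding isomorphic_def by (rule bexI[of _ "Ident C X"]) (auto simp: hom_iff)

lemma isomorphic_sym: "isomorphic C X Y ==> isomorphic C Y X"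
proof -
 assume "isomorphic C X Y"
 then obtain f where "f : Hom C X Y" "is_iso C f" unfolding isomorphic_def by blast
 then have "inverse_of C f : Hom C Y X" "is_iso C (inverse_of C f)" by (auto simp: hom_iff)
 then show ?thesis unfolding isomorphic_def by blast
qed

lemma isomorphic_trans: "isomorphic C X Y ==> isomorphic C Y Z ==> isomorphic C X Z"
proof -
 assume "isomorphic C X Y" "isomorphic C Y Z"
 then obtain f g where "f : Hom C X Y" "is_iso C f" "g : Hom C Y Z" "is_iso C g"
  unfolding isomorphic_def by blast
 then have "g ** f : Hom C X Z" "is_iso C (g ** f)" by (auto simp: hom_iff)
 then show ?thesis unfolding isomorphic_def by blast
qed

lemma isomorphic_obj: "isomorphic C X Y ==> X : Obj C" "isomorphic C X Y ==> Y : Obj C"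
 unfolding isomorphic_def using hom_obj by auto

lemma iso_cancel_left:
 assumes "is_iso C f" "g : Arr C" "h : Arr C" "Dom C f = Cod C g" "Dom C f = Cod C h" "f ** g = f ** h"
 shows "g = h"
proof -
 have "inverse_of C f ** (f ** g) = inverse_of C f ** (f ** h)" using assms(6) by simp
 then show ?thesis
  unfolding inverse_of_cancel(1)[OF assms(1,2,4)] inverse_of_cancel(1)[OF assms(1,3,5)] .
qed

lemma iso_cancel_right:
 assumes "is_iso C f" "g : Arr C" "h : Arr C" "Dom C g = Cod C f" "Dom C h = Cod C f" "g ** f = h ** f"
 shows "g = h"
proof -
 have "(g ** f) ** inverse_of C f = (h ** f) ** inverse_of C f" using assms(6) by simp
 then show ?thesis using assms(1-5) by (simp add: comp_assoc)
qed

lemma iso_class_eq_iff: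
 assumes "X : Obj C" "Y : Obj C" shows "iso_class C X = iso_class C Y \<longleftrightarrow> isomorphic C X Y"
proof
 assume "iso_class C X = iso_class C Y"
 moreover have "Y : iso_class C Y" using assms by (simp add: iso_class_def)
 ultimately show "isomorphic C X Y" by (auto simp: iso_class_def)
next
 assume "isomorphic C X Y"
 then have "isomorphic C X Z \<longleftrightarrow> isomorphic C Y Z" for Z
  using isomorphic_trans[of X Y Z] isomorphic_trans[of Y X Z] isomorphic_sym[of X Y] by blast
 then show "iso_class C X = iso_class C Y" by (simp add: iso_class_def)
qed

lemma split_monoI:
 assumes "f : Hom C X Y" "h : Hom C Y X" "h ** f = Ident C X" shows "is_mono C f"
 unfolding is_mono_def
proof (intro conjI allI ballI impI)
 fix W g k assume a: "g : Hom C W (Dom C f)" "k : Hom C W (Dom C f)" "f ** g = f ** k"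
 then have "(h ** f) ** g = (h ** f) ** k" using assms(1,2) by (simp add: comp_assoc hom_iff)
 then show "g = k" using a assms by (simp add: hom_iff)
qed (use assms in "auto simp: hom_iff")

lemma split_mono_iso:
 assumes "is_mono C i" "s : Hom C (Cod C i) (Dom C i)" "i ** s = Ident C (Cod C i)"
 shows "is_iso C i"
proof (rule isoI[where g = s])
 have i: "i : Arr C" using assms(1) by (simp add: is_mono_def)
 then show "i : Hom C (Dom C i) (Cod C i)" by (simp add: hom_iff)
 have "i ** (s ** i) = i ** Ident C (Dom C i)"
  using assms(2,3) i Dom_closed[OF i] comp_assoc[of i s i, symmetric] by (simp add: hom_iff)
 then show "s ** i = Ident C (Dom C i)"
  using assms(1,2) i Dom_closed[OF i] unfolding is_mono_def by (auto simp: hom_iff)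
qed (use assms in auto)

end

text \<open>Sums of arrows over an arbitrary finite index set, and direct sums indexed by such a set; the
  given notion of direct sum is the case of an initial segment of the naturals.\<close>

definition arrow_sum ::
  "('o, 'a, 'k, 'z) linear_data_scheme => 'o => 'o => ('i => 'a) => 'i set => 'a" where
 "arrow_sum C X Y f I = finsum (hom_space C X Y) f I"

definition sub :: "('o, 'a, 'k::field, 'z) linear_data_scheme => 'a => 'a => 'a" where
 "sub C f g = Add C f (Scale C (- 1) g)"

definition direct_sum_over ::
  "('o, 'a, 'k, 'z) linear_data_scheme => 'i set => ('i => 'o) => 'o => ('i => 'a) => ('i => 'a)
   => bool" where
 "direct_sum_over C I X S i p \<longleftrightarrow> S : Obj C \<and> finite I \<and>
   (\<forall>k\<in>I. X k : Obj C \<and> i k : Hom C (X k) S \<and> p k : Hom C S (X k)) \<and>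
   (\<forall>j\<in>I. \<forall>k\<in>I. p j **[C] i k = (if j = k then Ident C (X k) else Zero C (X k) (X j))) \<and>
   arrow_sum C S S (\<lambda>k. i k **[C] p k) I = Ident C S"

lemma is_direct_sum_iff: "is_direct_sum C n X S i p \<longleftrightarrow> direct_sum_over C {..<n} X S i p"
 by (auto simp: is_direct_sum_def direct_sum_over_def arrow_sum_def)

context linear_category
begin

lemma hom_module:
 assumes "X : Obj C" "Y : Obj C"
 shows "module class_ring (hom_space C X Y)" "abelian_group (hom_space C X Y)"
proof -
 interpret V: vectorspace class_ring "hom_space C X Y" by (rule hom_vectorspace[OF assms])
 show "module class_ring (hom_space C X Y)" "abelian_group (hom_space C X Y)" by unfold_locales
qed

lemma Zero_arrow [simp]:
 assumes "X : Obj C" "Y : Obj C"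
 shows "Zero C X Y : Arr C" "Dom C (Zero C X Y) = X" "Cod C (Zero C X Y) = Y"
 using abelian_group.axioms(1)[OF hom_module(2)[OF assms]] abelian_monoid.zero_closed
 by (fastforce simp: hom_space_def hom_iff)+

lemma Zero_hom: "X : Obj C ==> Y : Obj C ==> Zero C X Y : Hom C X Y"
 by (simp add: hom_iff)

lemma hom_abelian_monoid:
 assumes "f : Hom C X Y" shows "abelian_monoid (hom_space C X Y)" "module class_ring (hom_space C X Y)"
 using hom_module hom_obj[OF assms] abelian_group.axioms(1) by blast+

lemma Add_hom: "f : Hom C X Y ==> g : Hom C X Y ==> Add C f g : Hom C X Y"
 using abelian_monoid.a_closed[OF hom_abelian_monoid(1), of f X Y f g] by (simp add: hom_space_def)

lemma Scale_hom: "f : Hom C X Y ==> Scale C c f : Hom C X Y"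
 using module.smult_closed[OF hom_abelian_monoid(2), of f X Y c f] by (simp add: hom_space_def)

lemma Scale_arrow [simp]:
 assumes "f : Arr C"
 shows "Scale C c f : Arr C" "Dom C (Scale C c f) = Dom C f" "Cod C (Scale C c f) = Cod C f"
 using Scale_hom[of f "Dom C f" "Cod C f" c] assms by (auto simp: hom_iff)

lemma Add_arrow [simp]:
 assumes "f : Arr C" "g : Arr C" "Dom C f = Dom C g" "Cod C f = Cod C g"
 shows "Add C f g : Arr C" "Dom C (Add C f g) = Dom C g" "Cod C (Add C f g) = Cod C g"
 using Add_hom[of f "Dom C f" "Cod C f" g] assms by (auto simp: hom_iff)

lemma Add_assoc:
 "f : Hom C X Y ==> g : Hom C X Y ==> h : Hom C X Y ==>
  Add C (Add C f g) h = Add C f (Add C g h)"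
 using abelian_monoid.a_assoc[OF hom_abelian_monoid(1), of f X Y f g h] by (simp add: hom_space_def)

lemma Add_comm: "f : Hom C X Y ==> g : Hom C X Y ==> Add C f g = Add C g f"
 using abelian_monoid.a_comm[OF hom_abelian_monoid(1), of f X Y f g] by (simp add: hom_space_def)

lemma Add_Zero [simp]:
 assumes "f : Arr C" "Dom C f = X" "Cod C f = Y"
 shows "Add C (Zero C X Y) f = f" "Add C f (Zero C X Y) = f"
proof -
 have f: "f : Hom C X Y" using assms by (simp add: hom_iff)
 show "Add C (Zero C X Y) f = f"
  using abelian_monoid.l_zero[OF abelian_group.axioms(1)[OF hom_module(2)], of X Y f] hom_obj[OF f] f
  by (simp add: hom_space_def)
 then show "Add C f (Zero C X Y) = f" using Add_comm[OF f] hom_obj[OF f] Zero_hom by metis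
qed

lemma Scale_Scale: "f : Arr C ==> Scale C a (Scale C b f) = Scale C (a * b) f"
 using module.smult_assoc1[OF hom_module(1), of "Dom C f" "Cod C f" a b f] Dom_closed Cod_closed
 by (simp add: hom_space_def hom_iff)

lemma Scale_1 [simp]: "f : Arr C ==> Scale C 1 f = f"
 using module.smult_one[OF hom_module(1), of "Dom C f" "Cod C f" f] Dom_closed Cod_closed
 by (simp add: hom_space_def hom_iff)

lemma Scale_add_left: "f : Arr C ==> Scale C (a + b) f = Add C (Scale C a f) (Scale C b f)"
 using module.smult_l_distr[OF hom_module(1), of "Dom C f" "Cod C f" a b f] Dom_closed Cod_closed
 by (simp add: hom_space_def hom_iff)

lemma Scale_0 [simp]: "f : Arr C ==> Scale C 0 f = Zero C (Dom C f) (Cod C f)"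
 using module.lmult_0[OF hom_module(1), of "Dom C f" "Cod C f" f] Dom_closed Cod_closed
 by (simp add: hom_space_def hom_iff)

lemma Scale_Zero [simp]: "X : Obj C ==> Y : Obj C ==> Scale C c (Zero C X Y) = Zero C X Y"
 using module.rmult_0[OF hom_module(1), of X Y c] by (simp add: hom_space_def)

lemma Comp_Scale [simp]:
 assumes "f : Arr C" "g : Arr C" "Dom C g = Cod C f"
 shows "Scale C c g ** f = Scale C c (g ** f)" "g ** Scale C c f = Scale C c (g ** f)"
 using Comp_Scale_left[of f "Dom C f" "Cod C f" g "Cod C g" c]
  Comp_Scale_right[of f "Dom C f" "Cod C f" g "Cod C g" c] assms by (auto simp: hom_iff)

lemma Comp_Zero [simp]:
 assumes "f : Arr C"
 shows "Dom C f = Y ==> X : Obj C ==> f ** Zero C X Y = Zero C X (Cod C f)"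
  and "Cod C f = X ==> Y : Obj C ==> Zero C X Y ** f = Zero C (Dom C f) Y"
proof -
 assume a: "Dom C f = Y" "X : Obj C"
 have Y: "Y : Obj C" using a assms Dom_closed by auto
 have "f ** Zero C X Y = f ** Scale C 0 (Zero C X Y)" using a Y by simp
 also have "... = Scale C 0 (f ** Zero C X Y)" using a Y assms by (subst Comp_Scale(2)) auto
 finally show "f ** Zero C X Y = Zero C X (Cod C f)" using a Y assms by simp
next
 assume a: "Cod C f = X" "Y : Obj C"
 have X: "X : Obj C" using a assms Cod_closed by auto
 have "Zero C X Y ** f = Scale C 0 (Zero C X Y) ** f" using a X by simp
 also have "... = Scale C 0 (Zero C X Y ** f)" using a X assms by (subst Comp_Scale(1)) auto
 finally show "Zero C X Y ** f = Zero C (Dom C f) Y" using a X assms by simp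
qed

lemma Add_Scale_minus: "f : Arr C ==> Add C f (Scale C (- 1) f) = Zero C (Dom C f) (Cod C f)"
 using Scale_add_left[of f 1 "- 1"] by simp

lemma sub_arrow [simp]:
 assumes "f : Arr C" "g : Arr C" "Dom C f = Dom C g" "Cod C f = Cod C g"
 shows "sub C f g : Arr C" "Dom C (sub C f g) = Dom C g" "Cod C (sub C f g) = Cod C g"
 using assms by (auto simp: sub_def)

lemma sub_hom: "f : Hom C X Y ==> g : Hom C X Y ==> sub C f g : Hom C X Y"
 by (simp add: hom_iff)

lemma sub_self [simp]: "f : Arr C ==> sub C f f = Zero C (Dom C f) (Cod C f)"
 by (simp add: sub_def Add_Scale_minus)

lemma sub_Zero [simp]: "f : Arr C ==> Dom C f = X ==> Cod C f = Y ==> sub C f (Zero C X Y) = f"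
 using Dom_closed Cod_closed by (auto simp: sub_def)

lemma sub_Add_cancel:
 assumes "f : Hom C X Y" "g : Hom C X Y" shows "Add C (sub C f g) g = f"
proof -
 have "Add C (sub C f g) g = Add C f (Add C (Scale C (- 1) g) g)"
  unfolding sub_def using assms by (intro Add_assoc[of _ X Y]) (auto simp: hom_iff)
 also have "Add C (Scale C (- 1) g) g = Zero C X Y"
  using assms Add_comm[of "Scale C (- 1) g" X Y g] Add_Scale_minus by (simp add: hom_iff)
 finally show ?thesis using assms by (simp add: hom_iff)
qed

lemma sub_eq_Zero_iff:
 assumes "f : Hom C X Y" "g : Hom C X Y" shows "sub C f g = Zero C X Y \<longleftrightarrow> f = g"
proof
 assume "sub C f g = Zero C X Y"
 then have "Add C (Zero C X Y) g = f" using sub_Add_cancel[OF assms] by simp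
 then show "f = g" using assms by (simp add: hom_iff)
qed (use assms in "auto simp: hom_iff")

lemma Comp_Add:
 assumes "f : Arr C" "g : Arr C" "h : Arr C" "Dom C f = Dom C g" "Cod C f = Cod C g"
 shows "Dom C h = Cod C g ==> h ** Add C f g = Add C (h ** f) (h ** g)"
  and "Cod C h = Dom C g ==> Add C f g ** h = Add C (f ** h) (g ** h)"
 using Comp_Add_right[of f "Dom C g" "Cod C g" g h "Cod C h"]
  Comp_Add_left[of h "Dom C h" "Dom C g" f "Cod C g" g] assms by (auto simp: hom_iff)

lemma Comp_sub:
 assumes "f : Arr C" "g : Arr C" "h : Arr C" "Dom C f = Dom C g" "Cod C f = Cod C g"
 shows "Dom C h = Cod C g ==> h ** sub C f g = sub C (h ** f) (h ** g)"
  and "Cod C h = Dom C g ==> sub C f g ** h = sub C (f ** h) (g ** h)"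
 using assms by (auto simp: sub_def Comp_Add)

lemma Scale_eq_Zero:
 assumes "f : Arr C" "Scale C c f = Zero C (Dom C f) (Cod C f)" "c \<noteq> 0"
 shows "f = Zero C (Dom C f) (Cod C f)"
proof -
 have "f = Scale C (inverse c) (Scale C c f)" using assms(1,3) by (simp add: Scale_Scale)
 also have "... = Zero C (Dom C f) (Cod C f)"
  unfolding assms(2) using assms(1) Dom_closed Cod_closed by simp
 finally show ?thesis .
qed

lemma arrow_sum_empty [simp]: "X : Obj C ==> Y : Obj C ==> arrow_sum C X Y f {} = Zero C X Y"
 using abelian_monoid.finsum_empty[OF abelian_group.axioms(1)[OF hom_module(2)]]
 by (simp add: arrow_sum_def hom_space_def)

lemma arrow_sum_insert:
 assumes "X : Obj C" "Y : Obj C" "finite I" "k \<notin> I" "\<And>j. j : insert k I ==> f j : Hom C X Y"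
 shows "arrow_sum C X Y f (insert k I) = Add C (f k) (arrow_sum C X Y f I)"
 using abelian_monoid.finsum_insert[OF abelian_group.axioms(1)[OF hom_module(2)[OF assms(1,2)]] assms(3,4), of f]
  assms(5) by (simp add: arrow_sum_def hom_space_def Pi_def)

lemma arrow_sum_hom:
 assumes "X : Obj C" "Y : Obj C" "\<And>k. k : I ==> f k : Hom C X Y"
 shows "arrow_sum C X Y f I : Hom C X Y"
 using abelian_monoid.finsum_closed[OF abelian_group.axioms(1)[OF hom_module(2)[OF assms(1,2)]], of f I]
  assms(3) by (simp add: arrow_sum_def hom_space_def Pi_def)

lemma arrow_sum_cong:
 assumes "X : Obj C" "Y : Obj C" "\<And>k. k : I ==> f k = g k" "\<And>k. k : I ==> g k : Hom C X Y"
 shows "arrow_sum C X Y f I = arrow_sum C X Y g I"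
 using abelian_monoid.finsum_cong'[OF abelian_group.axioms(1)[OF hom_module(2)[OF assms(1,2)]], of I I g f]
  assms(3,4) by (simp add: arrow_sum_def hom_space_def Pi_def)

lemma Comp_arrow_sum:
 assumes "finite I" "X : Obj C" "Y : Obj C" "\<And>k. k : I ==> f k : Hom C X Y" "g : Hom C Y Z"
 shows "g ** arrow_sum C X Y f I = arrow_sum C X Z (\<lambda>k. g ** f k) I"
 using assms(1,4)
proof (induction I rule: finite_induct)
 case empty
 then show ?case using assms hom_obj[OF assms(5)] by (simp add: hom_iff)
next
 case (insert k I)
 have Z: "Z : Obj C" using hom_obj[OF assms(5)] by simp
 have s: "arrow_sum C X Y f I : Hom C X Y" using assms insert by (intro arrow_sum_hom) auto
 have e: "arrow_sum C X Y f (insert k I) = Add C (f k) (arrow_sum C X Y f I)"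
  using insert assms by (intro arrow_sum_insert) auto
 have e': "arrow_sum C X Z (\<lambda>k. g ** f k) (insert k I) = Add C (g ** f k) (arrow_sum C X Z (\<lambda>k. g ** f k) I)"
  using insert assms Z by (intro arrow_sum_insert) (auto simp: hom_iff)
 have "f k : Hom C X Y" using insert by simp
 then show ?case unfolding e e' using insert.IH insert.prems s assms(5)
  by (subst Comp_Add) (auto simp: hom_iff)
qed

lemma arrow_sum_Comp:
 assumes "finite I" "X : Obj C" "Y : Obj C" "\<And>k. k : I ==> f k : Hom C X Y" "g : Hom C W X"
 shows "arrow_sum C X Y f I ** g = arrow_sum C W Y (\<lambda>k. f k ** g) I"
 using assms(1,4)
proof (induction I rule: finite_induct)
 case empty
 then show ?case using assms hom_obj[OF assms(5)] by (simp add: hom_iff)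
next
 case (insert k I)
 have Z: "W : Obj C" using hom_obj[OF assms(5)] by simp
 have s: "arrow_sum C X Y f I : Hom C X Y" using assms insert by (intro arrow_sum_hom) auto
 have e: "arrow_sum C X Y f (insert k I) = Add C (f k) (arrow_sum C X Y f I)"
  using insert assms by (intro arrow_sum_insert) auto
 have e': "arrow_sum C W Y (\<lambda>k. f k ** g) (insert k I) = Add C (f k ** g) (arrow_sum C W Y (\<lambda>k. f k ** g) I)"
  using insert assms Z by (intro arrow_sum_insert) (auto simp: hom_iff)
 have "f k : Hom C X Y" using insert by simp
 then show ?case unfolding e e' using insert.IH insert.prems s assms(5)
  by (subst Comp_Add) (auto simp: hom_iff)
qed

lemma arrow_sum_Zero:
 assumes "finite I" "X : Obj C" "Y : Obj C" "\<And>k. k : I ==> f k = Zero C X Y"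
 shows "arrow_sum C X Y f I = Zero C X Y"
 using assms(1,4)
proof (induction I rule: finite_induct)
 case (insert k I)
 have "arrow_sum C X Y f (insert k I) = Add C (f k) (arrow_sum C X Y f I)"
  using insert.hyps insert.prems assms(2,3) by (intro arrow_sum_insert) (auto simp: hom_iff)
 then show ?case using insert assms(2,3) by simp
qed (use assms in auto)

lemma arrow_sum_single:
 assumes "finite I" "X : Obj C" "Y : Obj C" "k : I" "f k : Hom C X Y"
  "\<And>j. j : I ==> j \<noteq> k ==> f j = Zero C X Y"
 shows "arrow_sum C X Y f I = f k"
proof -
 have "arrow_sum C X Y f (insert k (I - {k})) = Add C (f k) (arrow_sum C X Y f (I - {k}))"
 proof (rule arrow_sum_insert)
  fix j assume "j : insert k (I - {k})"
  then show "f j : Hom C X Y" using assms(5,6) Zero_hom[OF assms(2,3)] by (cases "j = k") auto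
 qed (use assms in auto)
 also have "arrow_sum C X Y f (I - {k}) = Zero C X Y" using assms by (intro arrow_sum_Zero) auto
 finally show ?thesis using assms by (simp add: insert_absorb hom_iff)
qed

lemma direct_sum_overD:
 assumes "direct_sum_over C I X S i p"
 shows "S : Obj C" "finite I" "k : I ==> X k : Obj C" "k : I ==> i k : Hom C (X k) S"
  "k : I ==> p k : Hom C S (X k)" "k : I ==> p k ** i k = Ident C (X k)"
  "j : I ==> k : I ==> j \<noteq> k ==> p j ** i k = Zero C (X k) (X j)"
  "arrow_sum C S S (\<lambda>k. i k ** p k) I = Ident C S"
 using assms by (auto simp: direct_sum_over_def)

lemma direct_sum_arrow [simp]:
 assumes "direct_sum_over C I X S i p" "k : I"
 shows "i k : Arr C" "Dom C (i k) = X k" "Cod C (i k) = S"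
  "p k : Arr C" "Dom C (p k) = S" "Cod C (p k) = X k"
 using direct_sum_overD[OF assms(1)] assms(2) by (auto simp: hom_iff)

lemma direct_sum_arrow_into:
 assumes "direct_sum_over C I X S i p" "f : Hom C W S"
 shows "f = arrow_sum C W S (\<lambda>k. i k ** (p k ** f)) I"
proof -
 note d = direct_sum_overD[OF assms(1)]
 have W: "W : Obj C" using hom_obj[OF assms(2)] by simp
 have "f = Ident C S ** f" using assms(2) by (simp add: hom_iff)
 also have "... = arrow_sum C W S (\<lambda>k. i k ** p k ** f) I"
  unfolding d(8)[symmetric] by (rule arrow_sum_Comp) (use d assms in "auto simp: hom_iff")
 also have "... = arrow_sum C W S (\<lambda>k. i k ** (p k ** f)) I"
  by (rule arrow_sum_cong) (use d assms W in "auto simp: hom_iff comp_assoc")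
 finally show ?thesis .
qed

lemma direct_sum_arrow_from:
 assumes "direct_sum_over C I X S i p" "f : Hom C S W"
 shows "f = arrow_sum C S W (\<lambda>k. (f ** i k) ** p k) I"
proof -
 note d = direct_sum_overD[OF assms(1)]
 have W: "W : Obj C" using hom_obj[OF assms(2)] by simp
 have "f = f ** Ident C S" using assms(2) by (simp add: hom_iff)
 also have "... = arrow_sum C S W (\<lambda>k. f ** (i k ** p k)) I"
  unfolding d(8)[symmetric] by (rule Comp_arrow_sum) (use d assms in "auto simp: hom_iff")
 also have "... = arrow_sum C S W (\<lambda>k. (f ** i k) ** p k) I"
  by (rule arrow_sum_cong) (use d assms W in "auto simp: hom_iff comp_assoc")
 finally show ?thesis .
qed

lemma direct_sum_eqI_into:
 assumes "direct_sum_over C I X S i p" "f : Hom C W S" "g : Hom C W S"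
  "\<And>k. k : I ==> p k ** f = p k ** g"
 shows "f = g"
proof -
 have "arrow_sum C W S (\<lambda>k. i k ** (p k ** f)) I = arrow_sum C W S (\<lambda>k. i k ** (p k ** g)) I"
  by (rule arrow_sum_cong)
   (use direct_sum_overD[OF assms(1)] assms hom_obj[OF assms(2)] in "auto simp: hom_iff")
 then show ?thesis using direct_sum_arrow_into[OF assms(1)] assms(2,3) by metis
qed

lemma direct_sum_eqI_from:
 assumes "direct_sum_over C I X S i p" "f : Hom C S W" "g : Hom C S W"
  "\<And>k. k : I ==> f ** i k = g ** i k"
 shows "f = g"
proof -
 have "arrow_sum C S W (\<lambda>k. (f ** i k) ** p k) I = arrow_sum C S W (\<lambda>k. (g ** i k) ** p k) I"
  by (rule arrow_sum_cong)
   (use direct_sum_overD[OF assms(1)] assms hom_obj[OF assms(2)] in "auto simp: hom_iff")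
 then show ?thesis using direct_sum_arrow_from[OF assms(1)] assms(2,3) by metis
qed

lemma direct_sum_tuple:
 assumes d: "direct_sum_over C I X S i p" and W: "W : Obj C" and f: "\<And>k. k : I ==> f k : Hom C W (X k)"
 shows "\<exists>h\<in>Hom C W S. \<forall>k\<in>I. p k ** h = f k"
proof (intro bexI ballI)
 note D = direct_sum_overD[OF d]
 let ?h = "arrow_sum C W S (\<lambda>k. i k ** f k) I"
 show "?h : Hom C W S" by (rule arrow_sum_hom) (use D W f in "auto simp: hom_iff")
 fix k assume k: "k : I"
 have "p k ** ?h = arrow_sum C W (X k) (\<lambda>j. p k ** (i j ** f j)) I"
  by (rule Comp_arrow_sum) (use D W f k in "auto simp: hom_iff")
 also have "... = p k ** (i k ** f k)"
 proof (rule arrow_sum_single)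
  fix j assume j: "j : I" "j \<noteq> k"
  have "p k ** (i j ** f j) = Zero C (X j) (X k) ** f j"
   by (rule comp_cong_left) (use D(3-7) f[OF j(1)] k j in "auto simp: hom_iff")
  then show "p k ** (i j ** f j) = Zero C W (X k)" using D(3)[OF k] f[OF j(1)] by (simp add: hom_iff)
 qed (use D W f k in "auto simp: hom_iff")
 also have "... = Ident C (X k) ** f k"
  by (rule comp_cong_left) (use D(3-6)[OF k] f[OF k] in "auto simp: hom_iff")
 also have "... = f k" using f[OF k] by (simp add: hom_iff)
 finally show "p k ** ?h = f k" .
qed

lemma direct_sum_cotuple:
 assumes d: "direct_sum_over C I X S i p" and W: "W : Obj C" and f: "\<And>k. k : I ==> f k : Hom C (X k) W"
 shows "\<exists>h\<in>Hom C S W. \<forall>k\<in>I. h ** i k = f k"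
proof (intro bexI ballI)
 note D = direct_sum_overD[OF d]
 let ?h = "arrow_sum C S W (\<lambda>k. f k ** p k) I"
 show "?h : Hom C S W" by (rule arrow_sum_hom) (use D W f in "auto simp: hom_iff")
 fix k assume k: "k : I"
 have "?h ** i k = arrow_sum C (X k) W (\<lambda>j. f j ** p j ** i k) I"
  by (rule arrow_sum_Comp) (use D W f k in "auto simp: hom_iff")
 also have "... = f k ** p k ** i k"
 proof (rule arrow_sum_single)
  fix j assume j: "j : I" "j \<noteq> k"
  have "f j ** p j ** i k = f j ** Zero C (X k) (X j)"
   using D(3-5) D(7)[OF j(1) k j(2)] f[OF j(1)] k j by (simp add: hom_iff comp_assoc)
  then show "f j ** p j ** i k = Zero C (X k) W" using D(3)[OF k] f[OF j(1)] by (simp add: hom_iff)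
 qed (use D W f k in "auto simp: hom_iff")
 also have "... = f k" using D(3-6)[OF k] f[OF k] by (simp add: hom_iff comp_assoc)
 finally show "?h ** i k = f k" .
qed

text \<open>Orthogonality together with joint monicity of the projections characterises direct sums; this
  makes most constructions of direct sums free of explicit sums.\<close>

lemma direct_sum_overI:
 assumes S: "S : Obj C" and fin: "finite I"
  and hom: "\<And>k. k : I ==> i k : Hom C (X k) S" "\<And>k. k : I ==> p k : Hom C S (X k)"
  and orth: "\<And>k. k : I ==> p k ** i k = Ident C (X k)"
   "\<And>j k. j : I ==> k : I ==> j \<noteq> k ==> p j ** i k = Zero C (X k) (X j)"
  and monic: "\<And>f. f : Hom C S S ==> (\<And>k. k : I ==> p k ** f = Zero C S (X k)) ==> f = Zero C S S"
 shows "direct_sum_over C I X S i p"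
proof -
 have X: "X k : Obj C" if "k : I" for k using hom_obj[OF hom(1)[OF that]] by simp
 let ?h = "arrow_sum C S S (\<lambda>k. i k ** p k) I"
 have ip: "i k ** p k : Hom C S S" if "k : I" for k using hom[OF that] by (simp add: hom_iff)
 have h: "?h : Hom C S S" by (rule arrow_sum_hom) (use S ip in auto)
 have "p k ** ?h = p k" if k: "k : I" for k
 proof -
  have "p k ** ?h = arrow_sum C S (X k) (\<lambda>j. p k ** (i j ** p j)) I"
   by (rule Comp_arrow_sum) (use S ip hom k fin in auto)
  also have "... = p k ** (i k ** p k)"
  proof (rule arrow_sum_single)
   fix j assume j: "j : I" "j \<noteq> k"
   have "p k ** (i j ** p j) = Zero C (X j) (X k) ** p j"
    by (rule comp_cong_left) (use hom orth k j X in "auto simp: hom_iff")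
   then show "p k ** (i j ** p j) = Zero C S (X k)" using hom(2)[OF j(1)] X[OF k] by (simp add: hom_iff)
  qed (use S hom[OF k] k fin X in "auto simp: hom_iff")
  also have "... = Ident C (X k) ** p k"
   by (rule comp_cong_left) (use hom[OF k] orth(1)[OF k] in "auto simp: hom_iff")
  also have "... = p k" using hom(2)[OF k] by (simp add: hom_iff)
  finally show ?thesis .
 qed
 then have "p k ** sub C ?h (Ident C S) = Zero C S (X k)" if "k : I" for k
  using that hom(2)[OF that] h S by (simp add: Comp_sub hom_iff)
 then have "sub C ?h (Ident C S) = Zero C S S"
  by (intro monic) (use h S in "auto simp: hom_iff")
 then have "?h = Ident C S" using sub_eq_Zero_iff[OF h Ident_hom[OF S]] by simp
 then show ?thesis unfolding direct_sum_over_def using S fin hom orth X by auto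
qed

lemma direct_sum_reindex:
 assumes d: "direct_sum_over C I X S i p" and b: "bij_betw e J I"
 shows "direct_sum_over C J (\<lambda>j. X (e j)) S (\<lambda>j. i (e j)) (\<lambda>j. p (e j))"
proof (rule direct_sum_overI)
 note D = direct_sum_overD[OF d]
 have e: "e j : I" if "j : J" for j using b that by (auto simp: bij_betw_def)
 show "finite J" using D(2) b bij_betw_finite by blast
 fix f assume f: "f : Hom C S S" "\<And>k. k : J ==> p (e k) ** f = Zero C S (X (e k))"
 show "f = Zero C S S"
 proof (rule direct_sum_eqI_into[OF d f(1) Zero_hom])
  fix k assume k: "k : I"
  then obtain j where "j : J" "k = e j" using b by (auto simp: bij_betw_def)
  then show "p k ** f = p k ** Zero C S S" using f(2) D(1,5) k by (simp add: hom_iff)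
 qed (use D in auto)
next
 fix j k assume "j : J" "k : J" "j \<noteq> k"
 then show "p (e j) ** i (e k) = Zero C (X (e k)) (X (e j))"
  using direct_sum_overD(7)[OF d, of "e j" "e k"] b by (auto simp: bij_betw_def inj_on_def)
qed (use direct_sum_overD[OF d] b in "auto simp: bij_betw_def")

lemma direct_sum_over_nat:
 assumes "direct_sum_over C I X S i p"
 obtains e where "bij_betw e {..<card I} I"
  "is_direct_sum C (card I) (\<lambda>k. X (e k)) S (\<lambda>k. i (e k)) (\<lambda>k. p (e k))"
proof -
 obtain e where "bij_betw e {..<card I} I"
  using ex_bij_betw_nat_finite[OF direct_sum_overD(2)[OF assms]] by (auto simp: atLeast0LessThan)
 then show thesis using direct_sum_reindex[OF assms] that by (auto simp: is_direct_sum_iff)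
qed

lemma direct_sum_flatten:
 assumes d: "direct_sum_over C I X S i p"
  and dk: "\<And>k. k : I ==> direct_sum_over C (J k) (Y k) (X k) (i' k) (p' k)"
 shows "direct_sum_over C (Sigma I J) (\<lambda>(k, l). Y k l) S (\<lambda>(k, l). i k ** i' k l) (\<lambda>(k, l). p' k l ** p k)"
proof (rule direct_sum_overI)
 note D = direct_sum_overD[OF d]
 show "S : Obj C" by (rule D(1))
 show "finite (Sigma I J)" using D(2) direct_sum_overD(2)[OF dk] by auto
 fix a assume "a : Sigma I J"
 then obtain k l where a: "a = (k, l)" "k : I" "l : J k" by auto
 note E = direct_sum_overD[OF dk[OF a(2)]]
 show "(case a of (k, l) => i k ** i' k l) : Hom C (case a of (k, l) => Y k l) S"
  "(case a of (k, l) => p' k l ** p k) : Hom C S (case a of (k, l) => Y k l)"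
  using D(4,5)[OF a(2)] E(4,5)[OF a(3)] a by (auto simp: hom_iff)
 have "p' k l ** (p k ** (i k ** i' k l)) = p' k l ** (Ident C (X k) ** i' k l)"
  by (subst comp_cong_left[OF D(6)]) (use D(4,5)[OF a(2)] E(4,5)[OF a(3)] a in "auto simp: hom_iff")
 then have "p' k l ** p k ** (i k ** i' k l) = Ident C (Y k l)"
  using D(4,5)[OF a(2)] E(4-6)[OF a(3)] a by (simp add: hom_iff comp_assoc)
 then show "(case a of (k, l) => p' k l ** p k) ** (case a of (k, l) => i k ** i' k l) =
   Ident C (case a of (k, l) => Y k l)" using a by simp
 fix b assume "b : Sigma I J" and ab: "a \<noteq> b"
 then obtain k' l' where b: "b = (k', l')" "k' : I" "l' : J k'" by auto
 note E' = direct_sum_overD[OF dk[OF b(2)]]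
 have "p' k l ** (p k ** (i k' ** i' k' l')) = Zero C (Y k' l') (Y k l)"
 proof (cases "k = k'")
  case True
  then have "l \<noteq> l'" using ab a b by auto
  have "p' k l ** (p k ** (i k ** i' k l')) = p' k l ** (Ident C (X k) ** i' k l')"
   by (subst comp_cong_left[OF D(6)])
    (use D(4,5)[OF a(2)] E(4,5)[OF a(3)] E'(4,5)[OF b(3)] a True in "auto simp: hom_iff")
  then show ?thesis using True E'(4)[OF b(3)] E(7)[OF a(3) _ \<open>l \<noteq> l'\<close>] b by (simp add: hom_iff)
 next
  case False
  have "p k ** (i k' ** i' k' l') = Zero C (X k') (X k) ** i' k' l'"
   by (rule comp_cong_left[OF D(7)])
    (use D(4,5)[OF a(2)] D(4)[OF b(2)] E'(4)[OF b(3)] a b False in "auto simp: hom_iff")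
  also have "... = Zero C (Y k' l') (X k)" using E'(4)[OF b(3)] D(3)[OF a(2)] by (simp add: hom_iff)
  finally show ?thesis using E(5)[OF a(3)] E'(3)[OF b(3)] by (simp add: hom_iff)
 qed
 then have "p' k l ** p k ** (i k' ** i' k' l') = Zero C (Y k' l') (Y k l)"
  using D(4,5)[OF a(2)] D(4)[OF b(2)] E'(4)[OF b(3)] E(5)[OF a(3)] by (simp add: hom_iff comp_assoc)
 then show "(case a of (k, l) => p' k l ** p k) ** (case b of (k, l) => i k ** i' k l) =
   Zero C (case b of (k, l) => Y k l) (case a of (k, l) => Y k l)" using a b by simp
next
 note D = direct_sum_overD[OF d]
 fix f assume f: "f : Hom C S S"
  "\<And>a. a : Sigma I J ==> (case a of (k, l) => p' k l ** p k) ** f = Zero C S (case a of (k, l) => Y k l)"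
 show "f = Zero C S S"
 proof (rule direct_sum_eqI_into[OF d f(1) Zero_hom[OF D(1) D(1)]])
  fix k assume k: "k : I"
  note E = direct_sum_overD[OF dk[OF k]]
  show "p k ** f = p k ** Zero C S S"
  proof (rule direct_sum_eqI_into[OF dk[OF k]])
   fix l assume l: "l : J k"
   have "p' k l ** (p k ** f) = Zero C S (Y k l)"
    using f(2)[of "(k, l)"] k l D(5)[OF k] E(5)[OF l] f(1) by (simp add: comp_assoc hom_iff)
   then show "p' k l ** (p k ** f) = p' k l ** (p k ** Zero C S S)"
    using D(1) D(5)[OF k] E(5)[OF l] by (simp add: hom_iff)
  qed (use D(1) D(3)[OF k] D(5)[OF k] f(1) in "auto simp: hom_iff")
 qed
qed

lemma direct_sum_of_isos:
 assumes d: "direct_sum_over C I X S i p"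
  and a: "\<And>k. k : I ==> a k : Hom C (Y k) (X k)" "\<And>k. k : I ==> is_iso C (a k)"
 shows "direct_sum_over C I Y S (\<lambda>k. i k ** a k) (\<lambda>k. inverse_of C (a k) ** p k)"
proof (rule direct_sum_overI)
 note D = direct_sum_overD[OF d]
 fix k assume k: "k : I"
 show "i k ** a k : Hom C (Y k) S" "inverse_of C (a k) ** p k : Hom C S (Y k)"
  using D(4,5)[OF k] a[OF k] by (auto simp: hom_iff)
 have "p k ** (i k ** a k) = a k"
  by (subst comp_cong_left[OF D(6)]) (use D(4,5)[OF k] a[OF k] k in "auto simp: hom_iff")
 then show "inverse_of C (a k) ** p k ** (i k ** a k) = Ident C (Y k)"
  using D(4,5)[OF k] a[OF k] by (simp add: hom_iff comp_assoc)
next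
 note D = direct_sum_overD[OF d]
 fix j k assume jk: "j : I" "k : I" "j \<noteq> k"
 have "p j ** (i k ** a k) = Zero C (X k) (X j) ** a k"
  by (rule comp_cong_left[OF D(7)]) (use D(4,5) a jk in "auto simp: hom_iff")
 then have "inverse_of C (a j) ** p j ** (i k ** a k) = inverse_of C (a j) ** (Zero C (X k) (X j) ** a k)"
  using D(4,5) a[OF jk(1)] a[OF jk(2)] jk by (simp add: hom_iff comp_assoc)
 then show "inverse_of C (a j) ** p j ** (i k ** a k) = Zero C (Y k) (Y j)"
  using a[OF jk(1)] a[OF jk(2)] D(3) jk hom_obj[OF a(1)[OF jk(2)]] by (simp add: hom_iff)
next
 note D = direct_sum_overD[OF d]
 fix f assume f: "f : Hom C S S" "\<And>k. k : I ==> inverse_of C (a k) ** p k ** f = Zero C S (Y k)"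
 show "f = Zero C S S"
 proof (rule direct_sum_eqI_into[OF d f(1) Zero_hom[OF D(1) D(1)]])
  fix k assume k: "k : I"
  show "p k ** f = p k ** Zero C S S"
  proof (rule iso_cancel_left[of "inverse_of C (a k)"])
   show "inverse_of C (a k) ** (p k ** f) = inverse_of C (a k) ** (p k ** Zero C S S)"
    using f(2)[OF k] f(1) D(1) D(5)[OF k] a[OF k] by (simp add: hom_iff comp_assoc)
  qed (use f(1) D(1) D(3)[OF k] D(5)[OF k] a[OF k] in "auto simp: hom_iff")
 qed
qed (use direct_sum_overD[OF d] in auto)

lemma direct_sum_transport:
 assumes d: "direct_sum_over C I X S i p" and a: "a : Hom C S T" "is_iso C a"
 shows "direct_sum_over C I X T (\<lambda>k. a ** i k) (\<lambda>k. p k ** inverse_of C a)"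
proof (rule direct_sum_overI)
 note D = direct_sum_overD[OF d]
 show "T : Obj C" using hom_obj[OF a(1)] by simp
 fix k assume k: "k : I"
 show "a ** i k : Hom C (X k) T" "p k ** inverse_of C a : Hom C T (X k)"
  using D(4,5)[OF k] a by (auto simp: hom_iff)
next
 note D = direct_sum_overD[OF d]
 have c: "p j ** inverse_of C a ** (a ** i k) = p j ** i k" if "j : I" "k : I" for j k
  using D(4,5) that a by (simp add: hom_iff comp_assoc)
 show "p k ** inverse_of C a ** (a ** i k) = Ident C (X k)" if "k : I" for k
  using c that D(6) by simp
 show "p j ** inverse_of C a ** (a ** i k) = Zero C (X k) (X j)" if "j : I" "k : I" "j \<noteq> k" for j k
  using c that D(7) by simp
 fix f assume f: "f : Hom C T T" "\<And>k. k : I ==> p k ** inverse_of C a ** f = Zero C T (X k)"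
 have T: "T : Obj C" using hom_obj[OF a(1)] by simp
 have "inverse_of C a ** f = Zero C T S"
  by (rule direct_sum_eqI_into[OF d, of _ T])
   (use f a D(1,5) T in "auto simp: hom_iff comp_assoc")
 then have "a ** (inverse_of C a ** f) = Zero C T T" using a T by (simp add: hom_iff)
 then show "f = Zero C T T" using a f(1) by (simp add: hom_iff)
qed (use direct_sum_overD[OF d] in auto)

lemma split_short_exactI:
 assumes i: "i : Hom C X Y" and q: "q : Hom C Y Z" and r: "r : Hom C Y X" and s: "s : Hom C Z Y"
  and ri: "r ** i = Ident C X" and qs: "q ** s = Ident C Z" and qi: "q ** i = Zero C X Z"
  and sum: "Add C (i ** r) (s ** q) = Ident C Y"
 shows "short_exact C i q"
proof -
 have ob: "X : Obj C" "Y : Obj C" "Z : Obj C" using hom_obj[OF i] hom_obj[OF q] by auto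
 have dec_left: "h = Add C (i ** (r ** h)) (s ** (q ** h))" if h: "h : Hom C W Y" for h W
 proof -
  have "h = Add C (i ** r) (s ** q) ** h" using h sum by (simp add: hom_iff)
  also have "... = Add C (i ** r ** h) (s ** q ** h)" using h i r s q by (intro Comp_Add) (auto simp: hom_iff)
  finally show ?thesis using h i r s q by (simp add: hom_iff comp_assoc)
 qed
 have dec_right: "h = Add C (h ** i ** r) (h ** s ** q)" if h: "h : Hom C Y W" for h W
 proof -
  have "h = h ** Add C (i ** r) (s ** q)" using h sum by (simp add: hom_iff)
  also have "... = Add C (h ** (i ** r)) (h ** (s ** q))" using h i r s q by (intro Comp_Add) (auto simp: hom_iff)
  finally show ?thesis using h i r s q by (simp add: hom_iff comp_assoc)
 qed
 have "is_kernel C i q" unfolding is_kernel_def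
 proof (intro conjI allI ballI impI)
  fix W h assume h: "h : Hom C W (Dom C q)" "q ** h = Zero C W (Cod C q)"
  then have h': "h : Hom C W Y" "W : Obj C" using q hom_obj[OF h(1)] by (auto simp: hom_iff)
  show "\<exists>!u. u : Hom C W (Dom C i) \<and> i ** u = h"
  proof (rule ex1I[of _ "r ** h"])
   show "r ** h : Hom C W (Dom C i) \<and> i ** (r ** h) = h"
    using dec_left[OF h'(1)] h h' i r s q by (simp add: hom_iff)
   fix u assume u: "u : Hom C W (Dom C i) \<and> i ** u = h"
   then have "r ** h = (r ** i) ** u" using i r by (auto simp: hom_iff comp_assoc)
   then show "u = r ** h" using u ri i by (simp add: hom_iff)
  qed
 qed (use i q qi in "auto simp: hom_iff")
 moreover have "is_cokernel C q i" unfolding is_cokernel_def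
 proof (intro conjI allI ballI impI)
  fix W h assume h: "h : Hom C (Cod C i) W" "h ** i = Zero C (Dom C i) W"
  then have h': "h : Hom C Y W" "W : Obj C" using i hom_obj[OF h(1)] by (auto simp: hom_iff)
  show "\<exists>!u. u : Hom C (Cod C q) W \<and> u ** q = h"
  proof (rule ex1I[of _ "h ** s"])
   show "h ** s : Hom C (Cod C q) W \<and> h ** s ** q = h"
    using dec_right[OF h'(1)] h h' i r s q by (simp add: hom_iff)
   fix u assume u: "u : Hom C (Cod C q) W \<and> u ** q = h"
   then have "h ** s = u ** (q ** s)" using q s by (auto simp: hom_iff comp_assoc)
   then show "u = h ** s" using u qs q by (simp add: hom_iff)
  qed
 qed (use i q qi in "auto simp: hom_iff")
 ultimately show ?thesis by (simp add: short_exact_def)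
qed

lemma zero_obj_iff: "is_zero_obj C X \<longleftrightarrow> X : Obj C \<and> Ident C X = Zero C X X"
proof
 assume "is_zero_obj C X"
 then show "X : Obj C \<and> Ident C X = Zero C X X"
  unfolding is_zero_obj_def by (metis Ident_hom Zero_hom)
next
 assume X: "X : Obj C \<and> Ident C X = Zero C X X"
 have "f = Zero C X Y" if "f : Hom C X Y" for f Y
  using that X Comp_Ident_right[OF that] Comp_Zero(1)[of f X X] by (auto simp: hom_iff)
 moreover have "f = Zero C Y X" if "f : Hom C Y X" for f Y
  using that X Comp_Ident_left[OF that] Comp_Zero(2)[of f X X] by (auto simp: hom_iff)
 ultimately show "is_zero_obj C X" unfolding is_zero_obj_def using X Zero_hom by metis
qed

lemma arrow_zero_obj:
 assumes "is_zero_obj C X"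
 shows "f : Hom C X Y ==> f = Zero C X Y" "f : Hom C Y X ==> f = Zero C Y X"
 using assms Zero_hom hom_obj unfolding is_zero_obj_def by metis+

end

locale linear_functor = C: linear_category C + D: linear_category D
 for C :: "('o, 'a, 'k::field, 'z) linear_data_scheme"
  and D :: "('p, 'b, 'k, 'y) linear_data_scheme" +
 fixes Fo :: "'o => 'p" and Fa :: "'a => 'b"
 assumes Fo_obj: "X : Obj C ==> Fo X : Obj D"
  and Fa_hom: "f : Hom C X Y ==> Fa f : Hom D (Fo X) (Fo Y)"
  and Fa_Ident: "X : Obj C ==> Fa (Ident C X) = Ident D (Fo X)"
  and Fa_Comp: "f : Hom C X Y ==> g : Hom C Y Z ==> Fa (g **[C] f) = Fa g **[D] Fa f"
  and Fa_Add: "f : Hom C X Y ==> g : Hom C X Y ==> Fa (Add C f g) = Add D (Fa f) (Fa g)"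
  and Fa_Scale: "f : Hom C X Y ==> Fa (Scale C c f) = Scale D c (Fa f)"
begin

lemma Fa_arrow [simp]:
 assumes "f : Arr C"
 shows "Fa f : Arr D" "Dom D (Fa f) = Fo (Dom C f)" "Cod D (Fa f) = Fo (Cod C f)"
 using Fa_hom[of f "Dom C f" "Cod C f"] assms by (auto simp: C.hom_iff D.hom_iff)

lemma Fa_Comp': "f : Arr C ==> g : Arr C ==> Dom C g = Cod C f ==> Fa (g **[C] f) = Fa g **[D] Fa f"
 using Fa_Comp[of f "Dom C f" "Cod C f" g "Cod C g"] by (simp add: C.hom_iff)

lemma Fa_Zero: "X : Obj C ==> Y : Obj C ==> Fa (Zero C X Y) = Zero D (Fo X) (Fo Y)"
 using Fa_Scale[OF C.Zero_hom, of X Y 0] by simp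

lemma Fa_sub: "f : Hom C X Y ==> g : Hom C X Y ==> Fa (sub C f g) = sub D (Fa f) (Fa g)"
 by (simp add: sub_def Fa_Add[of _ X Y] Fa_Scale C.Scale_hom)

lemma Fa_iso:
 assumes "is_iso C f"
 shows "is_iso D (Fa f)" and "inverse_of D (Fa f) = Fa (inverse_of C f)"
proof -
 have "inverse_arrows D (Fa f) (Fa (inverse_of C f))"
  unfolding inverse_arrows_def using assms C.Dom_closed C.Cod_closed
  by (auto simp: D.hom_iff Fa_Comp'[symmetric] Fa_Ident)
 then show "is_iso D (Fa f)" "inverse_of D (Fa f) = Fa (inverse_of C f)"
  by (auto simp: is_iso_def intro: D.inverse_ofI)
qed

lemma Fo_isomorphic: "isomorphic C X Y ==> isomorphic D (Fo X) (Fo Y)"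
 unfolding isomorphic_def using Fa_hom Fa_iso by blast

lemma Fa_arrow_sum:
 assumes "finite I" "X : Obj C" "Y : Obj C" "\<And>k. k : I ==> f k : Hom C X Y"
 shows "Fa (arrow_sum C X Y f I) = arrow_sum D (Fo X) (Fo Y) (\<lambda>k. Fa (f k)) I"
 using assms(1,4)
proof (induction I rule: finite_induct)
 case (insert k I)
 have s: "arrow_sum C X Y f I : Hom C X Y" using assms insert by (intro C.arrow_sum_hom) auto
 have e: "arrow_sum C X Y f (insert k I) = Add C (f k) (arrow_sum C X Y f I)"
  using insert assms by (intro C.arrow_sum_insert) auto
 have e': "arrow_sum D (Fo X) (Fo Y) (\<lambda>k. Fa (f k)) (insert k I)
   = Add D (Fa (f k)) (arrow_sum D (Fo X) (Fo Y) (\<lambda>k. Fa (f k)) I)"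
  using insert assms Fa_hom Fo_obj by (intro D.arrow_sum_insert) auto
 show ?case unfolding e e' using insert s Fa_Add[of "f k" X Y] by simp
qed (use assms Fo_obj Fa_Zero in auto)

lemma Fa_direct_sum:
 assumes "direct_sum_over C I X S i p"
 shows "direct_sum_over D I (\<lambda>k. Fo (X k)) (Fo S) (\<lambda>k. Fa (i k)) (\<lambda>k. Fa (p k))"
proof -
 note d = C.direct_sum_overD[OF assms]
 have "arrow_sum D (Fo S) (Fo S) (\<lambda>k. Fa (i k) **[D] Fa (p k)) I
   = arrow_sum D (Fo S) (Fo S) (\<lambda>k. Fa (i k **[C] p k)) I"
  by (rule D.arrow_sum_cong) (use d Fo_obj in "auto simp: C.hom_iff D.hom_iff Fa_Comp'")
 also have "... = Fa (arrow_sum C S S (\<lambda>k. i k **[C] p k) I)"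
  by (rule Fa_arrow_sum[symmetric]) (use d in "auto simp: C.hom_iff")
 finally have "arrow_sum D (Fo S) (Fo S) (\<lambda>k. Fa (i k) **[D] Fa (p k)) I = Ident D (Fo S)"
  using d(1,8) Fa_Ident by simp
 moreover have "Fa (p j) **[D] Fa (i k) = Fa (p j **[C] i k)" if "j : I" "k : I" for j k
  using Fa_Comp[OF d(4) d(5)] that by simp
 ultimately show ?thesis unfolding direct_sum_over_def
  using d Fo_obj Fa_hom Fa_Ident Fa_Zero by auto
qed

end

section \<open>Split semisimple categories\<close>

text \<open>A split semisimple linear category with a chosen class \<open>B\<close> of simple objects.  Simplicity is
  replaced by the Schur property, so that abelianness can be derived instead of assumed.\<close>

locale split_semisimple_category = linear_category C
 for C :: "('o, 'a, 'k::field, 'z) linear_data_scheme" (structure) +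
 fixes B :: "'o set"
 assumes B_obj: "S : B ==> S : Obj C"
  and B_End: "S : B ==> bij_betw (\<lambda>c. Scale C c (Ident C S)) UNIV (Hom C S S)"
  and B_schur: "S : B ==> T : B ==> f : Hom C S T ==> f \<noteq> Zero C S T ==> is_iso C f"
  and B_sum: "X : Obj C ==> \<exists>n S i p. (\<forall>k<n. S k : B) \<and> is_direct_sum C n S X i p"
  and sums: "(\<And>k. k < (n::nat) ==> Xs k : Obj C) ==> \<exists>S i p. is_direct_sum C n Xs S i p"
begin

lemma obtain_decomposition:
 assumes "X : Obj C"
 obtains n S i p where "\<And>k. k : {..<n::nat} ==> S k : B" "direct_sum_over C {..<n} S X i p"
 using B_sum[OF assms] is_direct_sum_iff by (metis lessThan_iff)

lemma obtain_direct_sum: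
 assumes "finite I" "\<And>k. k : I ==> X k : Obj C"
 obtains S i p where "direct_sum_over C I X S i p"
proof -
 obtain e where e: "bij_betw e I {..<card I}"
  using ex_bij_betw_finite_nat[OF assms(1)] by (auto simp: atLeast0LessThan)
 define e' where "e' = inv_into I e"
 have e': "bij_betw e' {..<card I} I" unfolding e'_def using e by (rule bij_betw_inv_into)
 obtain S i p where "is_direct_sum C (card I) (\<lambda>k. X (e' k)) S i p"
  using sums[of "card I" "\<lambda>k. X (e' k)"] assms(2) bij_betwE[OF e'] by fastforce
 then have "direct_sum_over C I (\<lambda>j. X (e' (e j))) S (\<lambda>j. i (e j)) (\<lambda>j. p (e j))"
  using direct_sum_reindex[OF _ e] by (simp add: is_direct_sum_iff)
 moreover have "e' (e j) = j" if "j : I" for j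
  using e that by (simp add: e'_def bij_betw_def)
 ultimately have "direct_sum_over C I X S (\<lambda>j. i (e j)) (\<lambda>j. p (e j))"
  by (simp add: direct_sum_over_def)
 then show thesis by (rule that)
qed

lemma B_Ident_nonzero: "S : B ==> Ident C S \<noteq> Zero C S S"
proof
 assume S: "S : B" "Ident C S = Zero C S S"
 have "Scale C 0 (Ident C S) = Scale C 1 (Ident C S)" using S B_obj by simp
 moreover have "inj (\<lambda>c. Scale C c (Ident C S))" using B_End[OF S(1)] by (simp add: bij_betw_def)
 ultimately have "(0::'k) = 1" by (rule injD[rotated])
 then show False by simp
qed

lemma nonzero_component_from:
 assumes "direct_sum_over C I S X i p" "f : Hom C X Y" "f \<noteq> Zero C X Y"
 shows "\<exists>k\<in>I. f ** i k \<noteq> Zero C (S k) Y"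
proof (rule ccontr)
 assume a: "\<not> ?thesis"
 have "f = Zero C X Y"
  by (rule direct_sum_eqI_from[OF assms(1,2) Zero_hom])
   (use a direct_sum_overD[OF assms(1)] hom_obj[OF assms(2)] in "auto simp: hom_iff")
 then show False using assms by simp
qed

lemma nonzero_component_into:
 assumes "direct_sum_over C I S Y i p" "f : Hom C X Y" "f \<noteq> Zero C X Y"
 shows "\<exists>k\<in>I. p k ** f \<noteq> Zero C X (S k)"
proof (rule ccontr)
 assume a: "\<not> ?thesis"
 have "f = Zero C X Y"
  by (rule direct_sum_eqI_into[OF assms(1,2) Zero_hom])
   (use a direct_sum_overD[OF assms(1)] hom_obj[OF assms(2)] in "auto simp: hom_iff")
 then show False using assms by simp
qed

text \<open>A matrix entry of \<open>f\<close> between simple objects that does not vanish is invertible and can be used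
  as a pivot: \<open>x\<close> is a section of the row \<open>q f\<close>.\<close>

lemma obtain_pivot:
 assumes f: "f : Hom C X T" "f \<noteq> Zero C X T" and T: "T : B"
 obtains x where "x : Hom C T X" "f ** x = Ident C T"
proof -
 have X: "X : Obj C" using hom_obj[OF f(1)] by simp
 obtain n S i p where S: "\<And>k. k : {..<n::nat} ==> S k : B" and d: "direct_sum_over C {..<n} S X i p"
  using obtain_decomposition[OF X] by metis
 obtain k where k: "k : {..<n}" "f ** i k \<noteq> Zero C (S k) T"
  using nonzero_component_from[OF d f] by blast
 have iso: "is_iso C (f ** i k)"
  using B_schur[OF S[OF k(1)] T _ k(2)] direct_sum_overD[OF d] f(1) k(1) by (auto simp: hom_iff)
 show thesis
 proof (rule that)
  show "i k ** inverse_of C (f ** i k) : Hom C T X"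
   using iso f(1) direct_sum_overD(4)[OF d k(1)] by (simp add: hom_iff)
  have "f ** i k ** inverse_of C (f ** i k) = Ident C T"
   using iso f(1) direct_sum_overD(4)[OF d k(1)] by (simp add: hom_iff)
  then show "f ** (i k ** inverse_of C (f ** i k)) = Ident C T"
   using iso f(1) direct_sum_overD(4)[OF d k(1)] by (subst comp_assoc[symmetric]) (auto simp: hom_iff)
 qed
qed

text \<open>Gaussian elimination: subtracting the rank one arrow \<open>f x q f\<close> given by a pivot clears a row.
  If \<open>h\<close> is a generalised inverse of the remainder, then \<open>(1 - x q f) h (1 - f x q) + x q\<close> is one
  of \<open>f\<close>.\<close>

lemma generalised_inverse:
 assumes "f : Hom C X Y"
 shows "\<exists>h\<in>Hom C Y X. f ** (h ** f) = f"
proof -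
 have Y: "Y : Obj C" and X: "X : Obj C" using hom_obj[OF assms] by auto
 obtain n T j q where T: "\<And>k. k : {..<n::nat} ==> T k : B" and d: "direct_sum_over C {..<n} T Y j q"
  using obtain_decomposition[OF Y] by metis
 note D = direct_sum_overD[OF d]
 define row where "row f = {k\<in>{..<n}. q k ** f \<noteq> Zero C X (T k)}" for f
 show ?thesis using assms
 proof (induction "card (row f)" arbitrary: f rule: less_induct)
  case less
  note f = less.prems
  show ?case
  proof (cases "f = Zero C X Y")
   case True
   then show ?thesis using X Y Zero_hom by (intro bexI[of _ "Zero C Y X"]) (auto simp: hom_iff)
  next
   case False
   obtain k where k: "k : {..<n}" "q k ** f \<noteq> Zero C X (T k)"
    using nonzero_component_into[OF d f False] by blast
   have qk: "q k : Hom C Y (T k)" using D(5)[OF k(1)] .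
   have qf: "q k ** f : Hom C X (T k)" using qk f by (simp add: hom_iff)
   obtain x where x: "x : Hom C (T k) X" "q k ** f ** x = Ident C (T k)"
    using obtain_pivot[OF qf k(2) T[OF k(1)]] by metis
   have x': "q k ** (f ** x) = Ident C (T k)" using x qk f by (simp add: hom_iff comp_assoc)
   note ar = f[unfolded hom_iff] x(1)[unfolded hom_iff] qk[unfolded hom_iff]
   define f' where "f' = sub C f (f ** (x ** (q k ** f)))"
   have f': "f' : Hom C X Y" using ar by (simp add: f'_def hom_iff)
   have r1: "q k ** (f ** (x ** z)) = z" if "z : Arr C" "Cod C z = T k" for z
   proof -
    have "q k ** (f ** (x ** z)) = (q k ** (f ** x)) ** z" using ar that by (simp add: comp_assoc)
    then show ?thesis using x' that by simp
   qed
   have sub: "row f' \<subseteq> row f - {k}"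
   proof
    fix l assume l: "l : row f'"
    then have ln: "l : {..<n}" and nz: "q l ** f' \<noteq> Zero C X (T l)" by (auto simp: row_def)
    note ql = D(5)[OF ln, unfolded hom_iff]
    have e: "q l ** f' = sub C (q l ** f) (q l ** (f ** (x ** (q k ** f))))"
     using ar ql by (simp add: f'_def Comp_sub)
    have "q l ** f \<noteq> Zero C X (T l)"
    proof
     assume z: "q l ** f = Zero C X (T l)"
     have "q l ** (f ** (x ** (q k ** f))) = Zero C X (T l) ** (x ** (q k ** f))"
      by (rule comp_cong_left[OF z]) (use ar ql in auto)
     then show False using nz e z ar ql X D(3)[OF ln] by simp
    qed
    moreover have "l \<noteq> k"
    proof
     assume "l = k"
     then show False using nz e r1 ar by simp
    qed
    ultimately show "l : row f - {k}" using ln by (auto simp: row_def)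
   qed
   have "k : row f" using k by (simp add: row_def)
   then have "card (row f') < card (row f)"
    using sub by (intro psubset_card_mono) (auto simp: row_def)
   then obtain h where h: "h : Hom C Y X" "f' ** (h ** f') = f'"
    using less.hyps f' by blast
   note arh = h(1)[unfolded hom_iff]
   let ?a = "sub C (Ident C X) (x ** (q k ** f))" and ?b = "sub C (Ident C Y) (f ** (x ** q k))"
   have fa: "f ** ?a = f'" using ar X by (simp add: Comp_sub f'_def)
   have bf: "?b ** f = f'" using ar Y by (simp add: Comp_sub f'_def comp_assoc)
   let ?g = "Add C (?a ** (h ** ?b)) (x ** q k)"
   have a: "?a : Hom C X X" and b: "?b : Hom C Y Y" using ar X Y by (auto simp: hom_iff)
   have "?g ** f = Add C (?a ** (h ** ?b) ** f) (x ** q k ** f)"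
    using ar arh a b by (intro Comp_Add) (auto simp: hom_iff)
   also have "... = Add C (?a ** (h ** f')) (x ** (q k ** f))"
    using ar arh a b bf by (simp add: hom_iff comp_assoc)
   finally have "f ** (?g ** f) = Add C (f ** (?a ** (h ** f'))) (f ** (x ** (q k ** f)))"
    using ar arh a f' by (simp add: hom_iff Comp_Add)
   also have "f ** (?a ** (h ** f')) = f' ** (h ** f')"
    by (rule comp_cong_left[OF fa]) (use ar arh a f' in "auto simp: hom_iff")
   also have "Add C (f' ** (h ** f')) (f ** (x ** (q k ** f))) = f"
    unfolding h(2) unfolding f'_def by (rule sub_Add_cancel[of _ X Y]) (use ar in "auto simp: hom_iff")
   finally have "f ** (?g ** f) = f" .
   moreover have "?g : Hom C Y X" using ar arh a b by (auto simp: hom_iff)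
   ultimately show ?thesis by blast
  qed
 qed
qed

text \<open>An idempotent is a sum of rank one idempotents \<open>a k b k\<close> through simple objects, obtained by
  splitting off pivots; the joint kernel of the \<open>b k\<close> is the kernel of the idempotent.\<close>

definition rank_one_decomposition ::
  "'o => 'a => nat => (nat => 'o) => (nat => 'a) => (nat => 'a) => bool" where
 "rank_one_decomposition X g m T a b \<longleftrightarrow>
   (\<forall>k<m. T k : B \<and> a k : Hom C (T k) X \<and> b k : Hom C X (T k) \<and>
    g ** a k = a k \<and> b k ** g = b k \<and> b k ** a k = Ident C (T k)) \<and>
   (\<forall>j<m. \<forall>k<m. j \<noteq> k \<longrightarrow> b j ** a k = Zero C (T k) (T j)) \<and>
   (\<forall>W. \<forall>h\<in>Hom C W X. (\<forall>k<m. b k ** h = Zero C W (T k)) \<longrightarrow> g ** h = Zero C W X)"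

lemma rank_one_decompositionD:
 assumes "rank_one_decomposition X g m T a b"
 shows "l < m ==> T l : B" "l < m ==> a l : Hom C (T l) X" "l < m ==> b l : Hom C X (T l)"
  "l < m ==> g ** a l = a l" "l < m ==> b l ** g = b l" "l < m ==> b l ** a l = Ident C (T l)"
  "l < m ==> l' < m ==> l \<noteq> l' ==> b l ** a l' = Zero C (T l') (T l)"
  "h : Hom C W X ==> (\<And>k. k < m ==> b k ** h = Zero C W (T k)) ==> g ** h = Zero C W X"
 using assms unfolding rank_one_decomposition_def by blast+

lemma idempotent_decomposition:
 assumes "g : Hom C X X" "g ** g = g"
 shows "\<exists>m T a b. rank_one_decomposition X g m T a b"
proof -
 have X: "X : Obj C" using hom_obj[OF assms(1)] by simp
 obtain n T q0 q where T: "\<And>k. k : {..<n::nat} ==> T k : B" and d: "direct_sum_over C {..<n} T X q0 q"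
  using obtain_decomposition[OF X] by metis
 note D = direct_sum_overD[OF d]
 define row where "row f = {k\<in>{..<n}. q k ** f \<noteq> Zero C X (T k)}" for f
 show ?thesis using assms
 proof (induction "card (row g)" arbitrary: g rule: less_induct)
  case less
  note g = less.prems
  show ?case
  proof (cases "g = Zero C X X")
   case True
   have "\<forall>W. \<forall>h\<in>Hom C W X. g ** h = Zero C W X"
    using True X hom_obj by (auto simp: hom_iff)
   then have "rank_one_decomposition X g 0 T a b" for T a b by (simp add: rank_one_decomposition_def)
   then show ?thesis by blast
  next
   case False
   obtain k where k: "k : {..<n}" "q k ** g \<noteq> Zero C X (T k)"
    using nonzero_component_into[OF d g(1) False] by blast
   have qk: "q k : Hom C X (T k)" using D(5)[OF k(1)] .
   have qf: "q k ** g : Hom C X (T k)" using qk g by (simp add: hom_iff)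
   obtain x where x: "x : Hom C (T k) X" "q k ** g ** x = Ident C (T k)"
    using obtain_pivot[OF qf k(2) T[OF k(1)]] by metis
   note ar = g(1)[unfolded hom_iff] x(1)[unfolded hom_iff] qk[unfolded hom_iff]
   define a0 where "a0 = g ** x"
   define b0 where "b0 = q k ** g"
   have a0: "a0 : Arr C" "Dom C a0 = T k" "Cod C a0 = X" using ar by (auto simp: a0_def)
   have b0: "b0 : Arr C" "Dom C b0 = X" "Cod C b0 = T k" using ar by (auto simp: b0_def)
   have ga: "g ** a0 = a0" unfolding a0_def using ar g(2) by (simp add: comp_assoc[symmetric])
   have bg: "b0 ** g = b0" unfolding b0_def using ar g(2) by (simp add: comp_assoc)
   have qa: "q k ** a0 = Ident C (T k)" using x(2) ar by (simp add: a0_def comp_assoc)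
   have ba: "b0 ** a0 = Ident C (T k)" using ar a0 ga qa by (simp add: b0_def comp_assoc)
   define g' where "g' = sub C g (a0 ** b0)"
   have g': "g' : Hom C X X" using ar a0 b0 by (simp add: g'_def hom_iff)
   note ar' = g'[unfolded hom_iff]
   have ba': "b0 ** (a0 ** z) = z" if "z : Arr C" "Cod C z = T k" for z
    using comp_cong_left[OF ba] that a0 b0 by simp
   have Tk: "T k : Obj C" using B_obj T k by auto
   have g'a: "g' ** a0 = Zero C (T k) X" using ar a0 b0 ga ba Tk
    by (simp add: g'_def Comp_sub comp_assoc)
   have bg': "b0 ** g' = Zero C X (T k)" using ar a0 b0 bg ba' Tk
    by (simp add: g'_def Comp_sub)
   have gg': "g ** g' = g'" using ar a0 b0 g(2) comp_cong_left[OF ga] by (simp add: g'_def Comp_sub)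
   have g'g: "g' ** g = g'" using ar a0 b0 g(2) bg by (simp add: g'_def Comp_sub comp_assoc)
   have idem: "g' ** g' = g'"
   proof -
    have "g' ** g' = sub C (g' ** g) (g' ** (a0 ** b0))"
     using ar ar' a0 b0 by (subst (2) g'_def) (simp add: Comp_sub)
    also have "g' ** (a0 ** b0) = Zero C (T k) X ** b0"
     by (rule comp_cong_left[OF g'a]) (use ar' a0 b0 in auto)
    finally show ?thesis using ar' b0 X g'g by simp
   qed
   have sub: "row g' \<subseteq> row g - {k}"
   proof
    fix l assume l: "l : row g'"
    then have ln: "l : {..<n}" and nz: "q l ** g' \<noteq> Zero C X (T l)" by (auto simp: row_def)
    note ql = D(5)[OF ln, unfolded hom_iff]
    have "q l ** g \<noteq> Zero C X (T l)"
    proof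
     assume z: "q l ** g = Zero C X (T l)"
     have "q l ** (g ** g') = Zero C X (T l) ** g'"
      by (rule comp_cong_left[OF z]) (use ar ar' ql in auto)
     then show False using nz gg' ar' ql D(3)[OF ln] by simp
    qed
    moreover have "l \<noteq> k"
    proof
     assume "l = k"
     have "q k ** (a0 ** b0) = Ident C (T k) ** b0"
      by (rule comp_cong_left[OF qa]) (use ar a0 b0 in auto)
     then have "q k ** g' = Zero C X (T k)"
      using ar a0 b0 by (simp add: g'_def Comp_sub) (simp add: b0_def)
     then show False using nz \<open>l = k\<close> by simp
    qed
    ultimately show "l : row g - {k}" using ln by (auto simp: row_def)
   qed
   have "k : row g" using k by (simp add: row_def)
   then have "card (row g') < card (row g)"
    using sub by (intro psubset_card_mono) (auto simp: row_def)
   from less.hyps[OF this g' idem] obtain m T' a b where rd: "rank_one_decomposition X g' m T' a b"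
    by blast
   note T' = rank_one_decompositionD(1)[OF rd] and a = rank_one_decompositionD(2)[OF rd]
    and b = rank_one_decompositionD(3)[OF rd] and g'a' = rank_one_decompositionD(4)[OF rd]
    and bg'' = rank_one_decompositionD(5)[OF rd] and bal = rank_one_decompositionD(6)[OF rd]
    and orth = rank_one_decompositionD(7)[OF rd] and ker = rank_one_decompositionD(8)[OF rd]
   have b0a: "b0 ** a l = Zero C (T' l) (T k)" if "l < m" for l
   proof -
    have "b0 ** (g' ** a l) = Zero C X (T k) ** a l"
     by (rule comp_cong_left[OF bg']) (use ar' b0 a[OF that] in "auto simp: hom_iff")
    then show ?thesis using g'a'[OF that] a[OF that] Tk by (simp add: hom_iff)
   qed
   have ba0: "b l ** a0 = Zero C (T k) (T' l)" if "l < m" for l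
   proof -
    have "b l ** g' ** a0 = b l ** Zero C (T k) X"
     using ar' a0 b[OF that] g'a by (simp add: hom_iff comp_assoc)
    then show ?thesis using bg''[OF that] b[OF that] Tk by (simp add: hom_iff)
   qed
   have ga': "g ** a l = a l" if "l < m" for l
    using comp_cong_left[OF gg', of "a l"] g'a'[OF that] a[OF that] ar ar' by (simp add: hom_iff)
   have bg3: "b l ** g = b l" if "l < m" for l
    using bg''[OF that] b[OF that] ar ar' g'g comp_assoc[of g g' "b l"] by (simp add: hom_iff)
   have ker': "g ** h = Zero C W X"
    if h: "h : Hom C W X" "\<And>l. l < m ==> b l ** h = Zero C W (T' l)" "b0 ** h = Zero C W (T k)" for W h
   proof -
    have W: "W : Obj C" using hom_obj[OF h(1)] by simp
    have "g' ** h = sub C (g ** h) (a0 ** (b0 ** h))"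
     using h(1) ar a0 b0 by (simp add: g'_def Comp_sub hom_iff comp_assoc)
    then have "g' ** h = g ** h" using h(1,3) ar a0 W by (simp add: hom_iff)
    then show ?thesis using ker[OF h(1,2)] by simp
   qed
   let ?T = "case_nat (T k) T'" and ?a = "case_nat a0 a" and ?b = "case_nat b0 b"
   have "rank_one_decomposition X g (Suc m) ?T ?a ?b"
    unfolding rank_one_decomposition_def
   proof (intro conjI allI ballI impI)
    fix l assume l: "l < Suc m"
    show "?T l : B" "?a l : Hom C (?T l) X" "?b l : Hom C X (?T l)" "g ** ?a l = ?a l"
     "?b l ** g = ?b l" "?b l ** ?a l = Ident C (?T l)"
     using l T' a b ga' bg3 bal ga bg ba a0 b0 T[OF k(1)] by (auto simp: hom_iff split: nat.splits)
    fix l' assume "l' < Suc m" "l \<noteq> l'"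
    then show "?b l ** ?a l' = Zero C (?T l') (?T l)"
     using l orth b0a ba0 by (cases l; cases l') auto
   next
    fix W h assume h: "h : Hom C W X" and z: "\<forall>l<Suc m. ?b l ** h = Zero C W (?T l)"
    show "g ** h = Zero C W X"
    proof (rule ker'[OF h])
     show "b0 ** h = Zero C W (T k)" using spec[OF z, of 0] by simp
     show "b l ** h = Zero C W (T' l)" if "l < m" for l using spec[OF z, of "Suc l"] that by simp
    qed
   qed
   then show ?thesis by blast
  qed
 qed
qed

lemma idempotent_splits:
 assumes g: "g : Hom C X X" "g ** g = g"
 shows "\<exists>Z r s. s : Hom C Z X \<and> r : Hom C X Z \<and> r ** s = Ident C Z \<and> s ** r = g"
proof -
 have X: "X : Obj C" using hom_obj[OF g(1)] by simp
 from idempotent_decomposition[OF g] obtain m T a b where rd: "rank_one_decomposition X g m T a b"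
  by blast
 note rd = rank_one_decompositionD[OF rd]
 have T: "T l : B" and a: "a l : Hom C (T l) X" and b: "b l : Hom C X (T l)"
  and ga: "g ** a l = a l" and bg: "b l ** g = b l" and ba: "b l ** a l = Ident C (T l)"
  if "l : {..<m}" for l using rd(1-6) that by auto
 have orth: "b l ** a l' = Zero C (T l') (T l)" if "l : {..<m}" "l' : {..<m}" "l \<noteq> l'" for l l'
  using rd(7) that by auto
 have ker: "g ** h = Zero C W X"
  if "h : Hom C W X" "\<And>k. k : {..<m} ==> b k ** h = Zero C W (T k)" for W h
  using rd(8) that by auto
 obtain Z i p where d: "direct_sum_over C {..<m} T Z i p"
  using obtain_direct_sum[of "{..<m}" T] T B_obj by blast
 note D = direct_sum_overD[OF d]
 obtain s where s: "s : Hom C Z X" "\<And>k. k : {..<m} ==> s ** i k = a k"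
  using direct_sum_cotuple[OF d X a] by blast
 obtain r where r: "r : Hom C X Z" "\<And>k. k : {..<m} ==> p k ** r = b k"
  using direct_sum_tuple[OF d X b] by blast
 note ar = s(1)[unfolded hom_iff] r(1)[unfolded hom_iff] g(1)[unfolded hom_iff]
 have rs: "r ** s = Ident C Z"
 proof (rule direct_sum_eqI_from[OF d])
  fix k assume k: "k : {..<m}"
  have "r ** a k = i k"
  proof (rule direct_sum_eqI_into[OF d])
   fix l assume l: "l : {..<m}"
   have "p l ** (r ** a k) = b l ** a k"
    by (rule comp_cong_left[OF r(2)[OF l]]) (use ar D(5)[OF l] a[OF k] in "auto simp: hom_iff")
   then show "p l ** (r ** a k) = p l ** i k" using ba orth D(6,7) k l by metis
  qed (use ar a[OF k] D(4)[OF k] in "auto simp: hom_iff")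
  then show "r ** s ** i k = Ident C Z ** i k"
   using s(2)[OF k] ar D(4)[OF k] by (simp add: hom_iff comp_assoc)
 qed (use ar D(1) in "auto simp: hom_iff")
 have gs: "g ** s = s"
 proof (rule direct_sum_eqI_from[OF d])
  fix k assume k: "k : {..<m}"
  show "g ** s ** i k = s ** i k" using s(2)[OF k] ga[OF k] ar D(4)[OF k] by (simp add: hom_iff comp_assoc)
 qed (use ar in "auto simp: hom_iff")
 have "g ** sub C (s ** r) g = Zero C X X"
 proof (rule ker)
  fix k assume k: "k : {..<m}"
  have "b k ** (s ** r) = p k ** (r ** s) ** r"
   using r(2)[OF k, symmetric] ar D(5)[OF k] by (simp add: hom_iff comp_assoc)
  also have "... = b k" using rs r(2)[OF k] D(5)[OF k] by (simp add: hom_iff)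
  finally show "b k ** sub C (s ** r) g = Zero C X (T k)"
   using b[OF k] bg[OF k] ar by (simp add: hom_iff Comp_sub)
 qed (use ar in "auto simp: hom_iff")
 then have "sub C (s ** r) g = Zero C X X"
  using ar g(2) comp_cong_left[OF gs, of r] by (simp add: Comp_sub)
 then have "s ** r = g" using sub_eq_Zero_iff[of "s ** r" X X g] ar by (simp add: hom_iff)
 then show ?thesis using s r rs by blast
qed

lemma complement_idempotent:
 assumes "g : Hom C X X" "g ** g = g"
 shows "sub C (Ident C X) g ** sub C (Ident C X) g = sub C (Ident C X) g"
proof -
 have X: "X : Obj C" using hom_obj[OF assms(1)] by simp
 have "sub C (Ident C X) g ** g = Zero C X X" using assms X by (simp add: Comp_sub hom_iff)
 then show ?thesis using assms X
  by (subst Comp_sub(1)) (auto simp: hom_iff)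
qed

lemma mono_splits:
 assumes "is_mono C f" obtains h where "h : Hom C (Cod C f) (Dom C f)" "h ** f = Ident C (Dom C f)"
proof -
 have f: "f : Arr C" using assms by (simp add: is_mono_def)
 obtain h where h: "h : Hom C (Cod C f) (Dom C f)" "f ** (h ** f) = f"
  using generalised_inverse[of f "Dom C f" "Cod C f"] f by (auto simp: hom_iff)
 have "f ** (h ** f) = f ** Ident C (Dom C f)" using h f by simp
 then have "h ** f = Ident C (Dom C f)"
  using assms h(1) f Dom_closed[OF f] unfolding is_mono_def by (auto simp: hom_iff)
 then show thesis using that h(1) by blast
qed

lemma epi_splits:
 assumes "is_epi C f" obtains h where "h : Hom C (Cod C f) (Dom C f)" "f ** h = Ident C (Cod C f)"
proof -
 have f: "f : Arr C" using assms by (simp add: is_epi_def)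
 obtain h where h: "h : Hom C (Cod C f) (Dom C f)" "f ** (h ** f) = f"
  using generalised_inverse[of f "Dom C f" "Cod C f"] f by (auto simp: hom_iff)
 have "f ** h ** f = Ident C (Cod C f) ** f" using h f by (simp add: hom_iff comp_assoc)
 then have "f ** h = Ident C (Cod C f)"
  using assms h(1) f Cod_closed[OF f] unfolding is_epi_def by (auto simp: hom_iff)
 then show thesis using that h(1) by blast
qed

text \<open>With a generalised inverse \<open>h\<close> of \<open>f\<close>, the images of the idempotents \<open>1 - h f\<close> and \<open>1 - f h\<close>
  are a kernel and a cokernel of \<open>f\<close>.\<close>

lemma abelian: "abelian_category C"
proof unfold_locales
 fix f assume f: "f : Arr C"
 let ?X = "Dom C f" and ?Y = "Cod C f"
 have XY: "?X : Obj C" "?Y : Obj C" using f Dom_closed Cod_closed by auto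
 obtain h where h: "h : Hom C ?Y ?X" "f ** (h ** f) = f"
  using generalised_inverse[of f ?X ?Y] f by (auto simp: hom_iff)
 note ar = f h(1)[unfolded hom_iff]
 have hff: "h ** f ** (h ** f) = h ** f" using ar h(2) by (simp add: comp_assoc)
 have "f ** h ** (f ** h) = f ** (h ** f) ** h" using ar by (simp add: comp_assoc)
 then have fhh: "f ** h ** (f ** h) = f ** h" unfolding h(2) .
 show "\<exists>k. is_kernel C k f"
 proof -
  have e: "sub C (Ident C ?X) (h ** f) : Hom C ?X ?X" using ar XY by (simp add: hom_iff)
  obtain Z r s where s: "s : Hom C Z ?X" "r : Hom C ?X Z" "r ** s = Ident C Z"
   "s ** r = sub C (Ident C ?X) (h ** f)"
   using idempotent_splits[OF e complement_idempotent[OF _ hff]] ar by (auto simp: hom_iff)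
  note sr = s(1,2)[unfolded hom_iff]
  have Z: "Z : Obj C" using hom_obj[OF s(1)] by simp
  have "is_kernel C s f" unfolding is_kernel_def
  proof (intro conjI allI ballI impI)
   have "s = s ** (r ** s)" using sr s(3) by simp
   also have "... = sub C (Ident C ?X) (h ** f) ** s" using sr s(4) comp_assoc[of s r s] by simp
   also have "... = sub C s (h ** (f ** s))" using sr ar XY by (simp add: Comp_sub comp_assoc)
   finally have "f ** s = f ** sub C s (h ** (f ** s))" by simp
   also have "... = sub C (f ** s) (f ** (h ** f) ** s)" using sr ar by (simp add: Comp_sub comp_assoc)
   finally show "f ** s = Zero C (Dom C s) ?Y" using sr ar h(2) by simp
   fix W g assume g: "g : Hom C W ?X" "f ** g = Zero C W ?Y"
   have W: "W : Obj C" using hom_obj[OF g(1)] by simp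
   have "s ** r ** g = sub C g (h ** (f ** g))" using s(4) g(1) ar XY by (simp add: Comp_sub hom_iff comp_assoc)
   then have sg: "s ** (r ** g) = g" using g sr ar W XY by (simp add: hom_iff comp_assoc)
   show "\<exists>!u. u : Hom C W (Dom C s) \<and> s ** u = g"
   proof (rule ex1I[of _ "r ** g"])
    show "r ** g : Hom C W (Dom C s) \<and> s ** (r ** g) = g" using sg g(1) sr by (simp add: hom_iff)
    fix u assume u: "u : Hom C W (Dom C s) \<and> s ** u = g"
    then have "r ** g = (r ** s) ** u" using sr by (auto simp: hom_iff comp_assoc)
    then show "u = r ** g" using u s(3) sr by (simp add: hom_iff)
   qed
  qed (use sr f in auto)
  then show ?thesis by blast
 qed
 show "\<exists>q. is_cokernel C q f"
 proof -
  have e: "sub C (Ident C ?Y) (f ** h) : Hom C ?Y ?Y" using ar XY by (simp add: hom_iff)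
  obtain Z r s where s: "s : Hom C Z ?Y" "r : Hom C ?Y Z" "r ** s = Ident C Z"
   "s ** r = sub C (Ident C ?Y) (f ** h)"
   using idempotent_splits[OF e complement_idempotent[OF _ fhh]] ar by (auto simp: hom_iff)
  note sr = s(1,2)[unfolded hom_iff]
  have Z: "Z : Obj C" using hom_obj[OF s(1)] by simp
  have "is_cokernel C r f" unfolding is_cokernel_def
  proof (intro conjI allI ballI impI)
   have "r = r ** s ** r" using sr s(3) by simp
   also have "... = r ** sub C (Ident C ?Y) (f ** h)" using sr s(4) comp_assoc[of r s r] by simp
   also have "... = sub C r (r ** (f ** h))" using sr ar XY by (simp add: Comp_sub)
   finally have "r ** f = sub C r (r ** (f ** h)) ** f" by simp
   also have "... = sub C (r ** f) (r ** (f ** (h ** f)))" using sr ar by (simp add: Comp_sub comp_assoc)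
   finally show "r ** f = Zero C ?X (Cod C r)" using sr ar h(2) by simp
   fix W g assume g: "g : Hom C ?Y W" "g ** f = Zero C ?X W"
   have W: "W : Obj C" using hom_obj[OF g(1)] by simp
   have "g ** (s ** r) = sub C g (g ** f ** h)" using s(4) g(1) ar XY by (simp add: Comp_sub hom_iff comp_assoc)
   then have sg: "g ** s ** r = g" using g sr ar W XY by (simp add: hom_iff comp_assoc)
   show "\<exists>!u. u : Hom C (Cod C r) W \<and> u ** r = g"
   proof (rule ex1I[of _ "g ** s"])
    show "g ** s : Hom C (Cod C r) W \<and> g ** s ** r = g" using sg g(1) sr by (simp add: hom_iff)
    fix u assume u: "u : Hom C (Cod C r) W \<and> u ** r = g"
    then have "g ** s = u ** (r ** s)" using sr by (auto simp: hom_iff comp_assoc)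
    then show "u = g ** s" using u s(3) sr by (simp add: hom_iff)
   qed
  qed (use sr f in auto)
  then show ?thesis by blast
 qed
next
 fix f assume m: "is_mono C f"
 have f: "f : Arr C" using m by (simp add: is_mono_def)
 let ?X = "Dom C f" and ?Y = "Cod C f"
 have XY: "?X : Obj C" "?Y : Obj C" using f Dom_closed Cod_closed by auto
 obtain h where h: "h : Hom C ?Y ?X" "h ** f = Ident C ?X" using mono_splits[OF m] by metis
 note ar = f h(1)[unfolded hom_iff]
 have "is_kernel C f (sub C (Ident C ?Y) (f ** h))" unfolding is_kernel_def
 proof (intro conjI allI ballI impI)
  show "sub C (Ident C ?Y) (f ** h) ** f = Zero C ?X (Cod C (sub C (Ident C ?Y) (f ** h)))"
   using ar h(2) XY by (simp add: Comp_sub comp_assoc)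
  fix W g assume g: "g : Hom C W (Dom C (sub C (Ident C ?Y) (f ** h)))"
   "sub C (Ident C ?Y) (f ** h) ** g = Zero C W (Cod C (sub C (Ident C ?Y) (f ** h)))"
  then have g': "g : Hom C W ?Y" "sub C (Ident C ?Y) (f ** h) ** g = Zero C W ?Y" using ar XY by auto
  have "sub C g (f ** (h ** g)) = Zero C W ?Y" using g' ar XY by (simp add: Comp_sub hom_iff comp_assoc)
  then have fhg: "f ** (h ** g) = g" using sub_eq_Zero_iff[of g W ?Y] g' ar by (auto simp: hom_iff)
  show "\<exists>!u. u : Hom C W (Dom C f) \<and> f ** u = g"
  proof (rule ex1I[of _ "h ** g"])
   show "h ** g : Hom C W ?X \<and> f ** (h ** g) = g" using fhg g' ar by (simp add: hom_iff)
   fix u assume u: "u : Hom C W ?X \<and> f ** u = g"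
   then have "h ** g = (h ** f) ** u" using ar by (auto simp: hom_iff comp_assoc)
   then show "u = h ** g" using u h(2) by (simp add: hom_iff)
  qed
 qed (use ar XY in auto)
 then show "\<exists>g. is_kernel C f g" by blast
next
 fix f assume m: "is_epi C f"
 have f: "f : Arr C" using m by (simp add: is_epi_def)
 let ?X = "Dom C f" and ?Y = "Cod C f"
 have XY: "?X : Obj C" "?Y : Obj C" using f Dom_closed Cod_closed by auto
 obtain h where h: "h : Hom C ?Y ?X" "f ** h = Ident C ?Y" using epi_splits[OF m] by metis
 note ar = f h(1)[unfolded hom_iff]
 have "is_cokernel C f (sub C (Ident C ?X) (h ** f))" unfolding is_cokernel_def
 proof (intro conjI allI ballI impI)
  have "f ** (h ** f) = f" using comp_cong_left[OF h(2), of f] ar by simp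
  then show "f ** sub C (Ident C ?X) (h ** f) = Zero C (Dom C (sub C (Ident C ?X) (h ** f))) ?Y"
   using ar XY by (simp add: Comp_sub)
  fix W g assume g: "g : Hom C (Cod C (sub C (Ident C ?X) (h ** f))) W"
   "g ** sub C (Ident C ?X) (h ** f) = Zero C (Dom C (sub C (Ident C ?X) (h ** f))) W"
  then have g': "g : Hom C ?X W" "g ** sub C (Ident C ?X) (h ** f) = Zero C ?X W" using ar XY by auto
  have "sub C g (g ** h ** f) = Zero C ?X W" using g' ar XY by (simp add: Comp_sub hom_iff comp_assoc)
  then have fhg: "g ** h ** f = g" using sub_eq_Zero_iff[of g ?X W] g' ar by (auto simp: hom_iff)
  show "\<exists>!u. u : Hom C (Cod C f) W \<and> u ** f = g"
  proof (rule ex1I[of _ "g ** h"])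
   show "g ** h : Hom C ?Y W \<and> g ** h ** f = g" using fhg g' ar by (simp add: hom_iff)
   fix u assume u: "u : Hom C ?Y W \<and> u ** f = g"
   then have "g ** h = u ** (f ** h)" using ar by (auto simp: hom_iff comp_assoc)
   then show "u = g ** h" using u h(2) by (simp add: hom_iff)
  qed
 qed (use ar XY in auto)
 then show "\<exists>g. is_cokernel C f g" by blast
qed (rule sums)

text \<open>Monomorphisms and epimorphisms split.  Hence every short exact sequence is split, and every linear
  functor is exact.\<close>

lemma short_exact_splits:
 assumes e: "short_exact C i q" and i: "i : Hom C X Y" and q: "q : Hom C Y Z"
 obtains r s where "r : Hom C Y X" "s : Hom C Z Y" "r ** i = Ident C X" "q ** s = Ident C Z"
  "q ** i = Zero C X Z" "r ** s = Zero C Z X" "Add C (i ** r) (s ** q) = Ident C Y"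
proof -
 have ob: "X : Obj C" "Y : Obj C" "Z : Obj C" using hom_obj[OF i] hom_obj[OF q] by auto
 have k: "is_kernel C i q" and ck: "is_cokernel C q i" using e by (auto simp: short_exact_def)
 have qi: "q ** i = Zero C X Z" using k i q by (simp add: is_kernel_def hom_iff)
 have epi: "is_epi C q" unfolding is_epi_def
 proof (intro conjI allI ballI impI)
  fix W g h assume g: "g : Hom C (Cod C q) W" "h : Hom C (Cod C q) W" "g ** q = h ** q"
  have W: "W : Obj C" using hom_obj[OF g(1)] by simp
  have "g ** q ** i = Zero C X W" using g qi i q ob W by (simp add: hom_iff comp_assoc)
  then have "\<exists>!u. u : Hom C (Cod C q) W \<and> u ** q = g ** q"
   using ck i q g(1) unfolding is_cokernel_def by (auto simp: hom_iff)
  then show "g = h" using g by metis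
 qed (use q in "auto simp: hom_iff")
 obtain s where s: "s : Hom C Z Y" "q ** s = Ident C Z" using epi_splits[OF epi] q by (auto simp: hom_iff)
 let ?g = "sub C (Ident C Y) (s ** q)"
 note ar = i[unfolded hom_iff] q[unfolded hom_iff] s(1)[unfolded hom_iff]
 have "q ** (s ** q) = q" using comp_cong_left[OF s(2), of q] ar by simp
 then have "q ** ?g = Zero C Y Z" using ar ob by (simp add: Comp_sub)
 moreover have g: "?g : Hom C Y Y" using ar ob by (simp add: hom_iff)
 ultimately have "\<exists>!u. u : Hom C Y (Dom C i) \<and> i ** u = ?g"
  using k ar unfolding is_kernel_def by (metis (no_types, lifting))
 then obtain r where r: "r : Hom C Y X" "i ** r = ?g" using ar by auto
 have uniq: "u = v" if "u : Hom C W X" "v : Hom C W X" "i ** u = i ** v" for u v W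
 proof -
  have "q ** (i ** u) = Zero C X Z ** u" by (rule comp_cong_left[OF qi]) (use that ar in "auto simp: hom_iff")
  then have "q ** (i ** u) = Zero C W Z" using that ob by (simp add: hom_iff)
  then have "\<exists>!w. w : Hom C W X \<and> i ** w = i ** u"
   using k ar that(1) unfolding is_kernel_def by (auto simp: hom_iff)
  then show ?thesis using that by metis
 qed
 note ar = ar r(1)[unfolded hom_iff]
 have ri: "r ** i = Ident C X"
 proof (rule uniq)
  have "i ** (r ** i) = ?g ** i" by (rule comp_cong_left[OF r(2)]) (use ar in auto)
  also have "... = i" using ar qi ob by (simp add: Comp_sub comp_assoc)
  finally show "i ** (r ** i) = i ** Ident C X" using ar by simp
 qed (use ar ob in "auto simp: hom_iff")
 have rs: "r ** s = Zero C Z X"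
 proof (rule uniq)
  have "i ** (r ** s) = ?g ** s" by (rule comp_cong_left[OF r(2)]) (use ar in auto)
  also have "... = Zero C Z Y" using ar s(2) ob by (simp add: Comp_sub comp_assoc)
  finally show "i ** (r ** s) = i ** Zero C Z X" using ar ob by simp
 qed (use ar ob in "auto simp: hom_iff")
 have "Add C (i ** r) (s ** q) = Ident C Y"
  unfolding r(2) by (rule sub_Add_cancel[of _ Y Y]) (use ar ob in "auto simp: hom_iff")
 then show thesis using that r s ri qi rs by blast
qed

end

lemma (in linear_functor) preserves_short_exact:
 assumes "split_semisimple_category C B" and e: "short_exact C i q"
 shows "short_exact D (Fa i) (Fa q)"
proof -
 interpret S: split_semisimple_category C B by fact
 define X where "X = Dom C i" define Y where "Y = Dom C q" define Z where "Z = Cod C q"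
 have i: "i : Hom C X Y" and q: "q : Hom C Y Z"
  using e by (auto simp: short_exact_def is_kernel_def X_def Y_def Z_def C.hom_iff)
 have ob: "X : Obj C" "Y : Obj C" "Z : Obj C" using C.hom_obj[OF i] C.hom_obj[OF q] by auto
 obtain r s where r: "r : Hom C Y X" and s: "s : Hom C Z Y" and eq: "r **[C] i = Ident C X"
  "q **[C] s = Ident C Z" "q **[C] i = Zero C X Z" "Add C (i **[C] r) (s **[C] q) = Ident C Y"
  using S.short_exact_splits[OF e i q] by metis
 have ir: "i **[C] r : Hom C Y Y" "s **[C] q : Hom C Y Y" using i q r s by (auto simp: C.hom_iff)
 show ?thesis
 proof (rule D.split_short_exactI[OF Fa_hom[OF i] Fa_hom[OF q] Fa_hom[OF r] Fa_hom[OF s]])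
  show "Fa r **[D] Fa i = Ident D (Fo X)" using Fa_Comp[OF i r] eq(1) Fa_Ident ob by simp
  show "Fa q **[D] Fa s = Ident D (Fo Z)" using Fa_Comp[OF s q] eq(2) Fa_Ident ob by simp
  show "Fa q **[D] Fa i = Zero D (Fo X) (Fo Z)" using Fa_Comp[OF i q] eq(3) Fa_Zero ob by simp
  show "Add D (Fa i **[D] Fa r) (Fa s **[D] Fa q) = Ident D (Fo Y)"
   using Fa_Comp[OF r i] Fa_Comp[OF q s] Fa_Add[OF ir] eq(4) Fa_Ident ob by simp
 qed
qed

section \<open>Multiplicities and the Grothendieck group\<close>

context linear_category
begin

lemma direct_sum_empty_zero: "direct_sum_over C {} X S i p ==> is_zero_obj C S"
 using arrow_sum_empty[of S S] by (auto simp: direct_sum_over_def zero_obj_iff)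

lemma direct_sum_single:
 assumes "a : Hom C X Y" "is_iso C a"
 shows "direct_sum_over C {()} (\<lambda>_. X) Y (\<lambda>_. a) (\<lambda>_. inverse_of C a)"
proof (rule direct_sum_overI)
 fix f assume "f : Hom C Y Y" "\<And>k. k : {()} ==> inverse_of C a ** f = Zero C Y X"
 then have f: "f : Hom C Y Y" "inverse_of C a ** f = Zero C Y X" by auto
 then have "a ** (inverse_of C a ** f) = Zero C Y Y"
  using assms hom_obj[OF assms(1)] by (simp add: hom_iff)
 then show "f = Zero C Y Y" using f(1) assms by (simp add: hom_iff)
qed (use assms hom_obj[OF assms(1)] in "auto simp: hom_iff")

text \<open>Adding one summand gives a short exact sequence, and conversely a split short exact sequence
  adds its quotient as a summand.  So composition series of a semisimple object and direct sum
  decompositions are the same thing.\<close>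

lemma direct_sum_insert_short_exact:
 assumes d: "direct_sum_over C I X S i p" and d': "direct_sum_over C (insert k I) X S' i' p'" and k: "k \<notin> I"
 shows "\<exists>f\<in>Hom C S S'. short_exact C f (p' k)"
proof -
 note D = direct_sum_overD[OF d] and D' = direct_sum_overD[OF d']
 have ik': "i' l : Hom C (X l) S'" "p' l : Hom C S' (X l)" if "l : I" for l
  using D'(4,5) that by auto
 obtain f where f: "f : Hom C S S'" "\<And>l. l : I ==> f ** i l = i' l"
  using direct_sum_cotuple[OF d D'(1) ik'(1)] by blast
 obtain r where r: "r : Hom C S' S" "\<And>l. l : I ==> p l ** r = p' l"
  using direct_sum_tuple[OF d D'(1) ik'(2)] by blast
 have pk: "p' k : Hom C S' (X k)" "i' k : Hom C (X k) S'" "X k : Obj C" using D'(3-5) by auto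
 note ar = f(1)[unfolded hom_iff] r(1)[unfolded hom_iff] pk(1,2)[unfolded hom_iff]
 have pf: "p' l ** f = p l" if l: "l : I" for l
 proof (rule direct_sum_eqI_from[OF d])
  fix l' assume l': "l' : I"
  have "p' l ** f ** i l' = p' l ** i' l'" using f(2)[OF l'] ar ik'[OF l] D(4)[OF l'] by (simp add: hom_iff comp_assoc)
  also have "... = p l ** i l'" using D(6,7) D'(6,7) l l' by (cases "l = l'") auto
  finally show "p' l ** f ** i l' = p l ** i l'" .
 qed (use ar ik'[OF l] D(5)[OF l] in "auto simp: hom_iff")
 have qf: "p' k ** f = Zero C S (X k)"
 proof (rule direct_sum_eqI_from[OF d])
  fix l' assume l': "l' : I"
  have "p' k ** f ** i l' = p' k ** i' l'" using f(2)[OF l'] ar D(4)[OF l'] by (simp add: hom_iff comp_assoc)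
  also have "... = Zero C (X l') (X k)" using D'(7) l' k by auto
  finally show "p' k ** f ** i l' = Zero C S (X k) ** i l'" using D(4)[OF l'] pk by (simp add: hom_iff)
 qed (use ar pk D(1) in "auto simp: hom_iff")
 have rf: "r ** f = Ident C S"
 proof (rule direct_sum_eqI_into[OF d])
  fix l assume l: "l : I"
  have "p l ** (r ** f) = p' l ** f" by (rule comp_cong_left[OF r(2)[OF l]]) (use ar D(5)[OF l] in "auto simp: hom_iff")
  then show "p l ** (r ** f) = p l ** Ident C S" using pf[OF l] D(5)[OF l] by (simp add: hom_iff)
 qed (use ar D(1) in "auto simp: hom_iff")
 have sum: "Add C (f ** r) (i' k ** p' k) = Ident C S'"
 proof (rule direct_sum_eqI_into[OF d'])
  fix l assume l: "l : insert k I"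
  note pl = D'(5)[OF l, unfolded hom_iff]
  have e: "p' l ** Add C (f ** r) (i' k ** p' k) = Add C (p' l ** f ** r) (p' l ** i' k ** p' k)"
   using ar pl by (simp add: Comp_Add comp_assoc)
  show "p' l ** Add C (f ** r) (i' k ** p' k) = p' l ** Ident C S'"
  proof (cases "l = k")
   case True
   then show ?thesis using e qf D'(6)[OF l] ar pk D'(1) D(1) by simp
  next
   case False
   then have lI: "l : I" using l by simp
   have "p' l ** i' k = Zero C (X k) (X l)" using D'(7)[OF l _ False] by simp
   then show ?thesis using e pf[OF lI] r(2)[OF lI] ar pl pk D'(1) D(3)[OF lI] by simp
  qed
 qed (use ar D'(1) in "auto simp: hom_iff")
 have "short_exact C f (p' k)"
  by (rule split_short_exactI[OF f(1) pk(1) r(1) pk(2) rf _ qf sum]) (use D'(6) in auto)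
 then show ?thesis using f(1) by blast
qed

lemma direct_sum_extend:
 assumes d: "direct_sum_over C I X S i p" and k: "k \<notin> I"
  and f: "f : Hom C S S'" and q: "q : Hom C S' (X k)"
  and r: "r : Hom C S' S" and s: "s : Hom C (X k) S'"
  and eq: "r ** f = Ident C S" "q ** s = Ident C (X k)" "q ** f = Zero C S (X k)" "r ** s = Zero C (X k) S"
   "Add C (f ** r) (s ** q) = Ident C S'"
 shows "direct_sum_over C (insert k I) X S' (\<lambda>l. if l = k then s else f ** i l)
  (\<lambda>l. if l = k then q else p l ** r)"
proof (rule direct_sum_overI)
 note D = direct_sum_overD[OF d]
 note ar = f[unfolded hom_iff] q[unfolded hom_iff] r[unfolded hom_iff] s[unfolded hom_iff]
 have ob: "S' : Obj C" "X k : Obj C" "S : Obj C" using hom_obj[OF q] D by auto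
 show "S' : Obj C" "finite (insert k I)" using ob D(2) by auto
 note arl = D(4)[unfolded hom_iff] D(5)[unfolded hom_iff]
 fix l assume l: "l : insert k I"
 show "(if l = k then s else f ** i l) : Hom C (X l) S'"
  "(if l = k then q else p l ** r) : Hom C S' (X l)"
  using l ar arl by (auto simp: hom_iff)
 have rfi: "r ** (f ** i l) = i l" if "l : I" for l
  using comp_cong_left[OF eq(1), of "i l"] ar arl(1)[OF that] by simp
 have qfi: "q ** (f ** i l) = Zero C (X l) (X k)" if "l : I" for l
  using comp_cong_left[OF eq(3), of "i l"] ar arl(1)[OF that] ob by simp
 show "(if l = k then q else p l ** r) ** (if l = k then s else f ** i l) = Ident C (X l)"
  using l eq(2) rfi D(6)[of l] ar arl by (auto simp: comp_assoc)
 fix j assume j: "j : insert k I" "l \<noteq> j"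
 have "p l ** r ** s = Zero C (X k) (X l)" if "l : I"
  using ar arl(2)[OF that] eq(4) ob by (simp add: comp_assoc)
 moreover have "p l ** r ** (f ** i j) = Zero C (X j) (X l)" if "l : I" "j : I"
  using ar arl(2)[OF that(1)] arl(1)[OF that(2)] rfi[OF that(2)] D(7)[OF that j(2)] by (simp add: comp_assoc)
 ultimately show "(if l = k then q else p l ** r) ** (if j = k then s else f ** i j) = Zero C (X j) (X l)"
  using l j qfi by auto
next
 note D = direct_sum_overD[OF d]
 note ar = f[unfolded hom_iff] q[unfolded hom_iff] r[unfolded hom_iff] s[unfolded hom_iff]
 have ob: "S' : Obj C" "X k : Obj C" "S : Obj C" using hom_obj[OF q] D by auto
 fix h assume h: "h : Hom C S' S'"
  "\<And>l. l : insert k I ==> (if l = k then q else p l ** r) ** h = Zero C S' (X l)"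
 note arh = h(1)[unfolded hom_iff]
 have qh: "q ** h = Zero C S' (X k)" using h(2)[of k] by simp
 have rh: "r ** h = Zero C S' S"
 proof (rule direct_sum_eqI_into[OF d])
  fix l assume l: "l : I"
  then have "l \<noteq> k" using k by auto
  then have "p l ** r ** h = Zero C S' (X l)" using h(2)[of l] l by simp
  then show "p l ** (r ** h) = p l ** Zero C S' S" using ar arh ob D(5)[OF l] by (simp add: hom_iff comp_assoc)
 qed (use ar arh ob in "auto simp: hom_iff")
 have "h = Add C (f ** r) (s ** q) ** h" using eq(5) arh by simp
 also have "... = Add C (f ** r ** h) (s ** q ** h)" using ar arh by (intro Comp_Add) auto
 also have "... = Zero C S' S'" using ar arh qh rh ob by (simp add: comp_assoc)
 finally show "h = Zero C S' S'" .
qed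

end

definition hom_dim :: "('o, 'a, 'k::field, 'z) linear_data_scheme => 'o => 'o => nat" where
 "hom_dim C X Y = vectorspace.dim class_ring (hom_space C X Y)"

lemma linear_bijection_hom_dim:
 assumes A: "vectorspace class_ring (hom_space A X Y)" "vectorspace.fin_dim class_ring (hom_space A X Y)"
  and B: "vectorspace class_ring (hom_space B X' Y')"
  and bij: "bij_betw \<phi> (Hom A X Y) (Hom B X' Y')"
  and lin: "\<And>f g. f : Hom A X Y ==> g : Hom A X Y ==> \<phi> (Add A f g) = Add B (\<phi> f) (\<phi> g)"
   "\<And>f c. f : Hom A X Y ==> \<phi> (Scale A c f) = Scale B c (\<phi> f)"
 shows "hom_dim A X Y = hom_dim B X' Y'"
proof -
 interpret A: vectorspace class_ring "hom_space A X Y" by fact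
 interpret B: vectorspace class_ring "hom_space B X' Y'" by fact
 have "\<phi> : LinearCombinations.module_hom class_ring (hom_space A X Y) (hom_space B X' Y')"
  unfolding LinearCombinations.module_hom_def using lin bij_betwE[OF bij] by (simp add: hom_space_def Pi_iff)
 then interpret linear_map class_ring "hom_space A X Y" "hom_space B X' Y'" \<phi>
  by (intro linear_map.intro mod_hom.intro mod_hom_axioms.intro A.vectorspace_axioms B.vectorspace_axioms
    A.module_axioms B.module_axioms)
 show ?thesis unfolding hom_dim_def
  using dim_eq[OF A(2)] bij by (simp add: hom_space_def bij_betw_def)
qed

context split_semisimple_category
begin

lemma B_not_zero: "S : B ==> \<not> is_zero_obj C S"
 using B_Ident_nonzero by (auto simp: zero_obj_iff)

lemma B_simple:
 assumes S: "S : B" shows "is_simple C S"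
 unfolding is_simple_def
proof (intro conjI allI impI)
 fix i assume i: "is_mono C i \<and> Cod C i = S"
 then have ia: "i : Arr C" by (simp add: is_mono_def)
 then have W: "Dom C i : Obj C" by (rule Dom_closed)
 have ih: "i : Hom C (Dom C i) S" using i ia by (simp add: hom_iff)
 show "is_zero_obj C (Dom C i) \<or> is_iso C i"
 proof (cases "i = Zero C (Dom C i) S")
  case True
  have "i ** Ident C (Dom C i) = i ** Zero C (Dom C i) (Dom C i)"
   using True ia W i by simp
  then have "Ident C (Dom C i) = Zero C (Dom C i) (Dom C i)"
   using i W unfolding is_mono_def by (metis Ident_hom Zero_hom)
  then show ?thesis using W by (simp add: zero_obj_iff)
 next
  case False
  then obtain x where "x : Hom C S (Dom C i)" "i ** x = Ident C S"
   using obtain_pivot[OF ih _ S] by metis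
  then show ?thesis using split_mono_iso i by metis
 qed
qed (use S B_obj B_not_zero in auto)

lemma simple_isomorphic_B:
 assumes "is_simple C X" shows "\<exists>S\<in>B. isomorphic C S X"
proof -
 have X: "X : Obj C" "\<not> is_zero_obj C X" using assms by (auto simp: is_simple_def)
 obtain n S i p where S: "\<And>k. k : {..<n::nat} ==> S k : B" and d: "direct_sum_over C {..<n} S X i p"
  using obtain_decomposition[OF X(1)] by metis
 have "n \<noteq> 0" using direct_sum_empty_zero[of S X i p] d X(2) by (cases n) auto
 then have 0: "0 : {..<n}" by simp
 note D = direct_sum_overD[OF d]
 have "is_mono C (i 0)" by (rule split_monoI[OF D(4)[OF 0] D(5)[OF 0] D(6)[OF 0]])
 moreover have "\<not> is_zero_obj C (Dom C (i 0))" using B_not_zero[OF S[OF 0]] D(4)[OF 0] by (simp add: hom_iff)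
 ultimately have "is_iso C (i 0)" using assms D(4)[OF 0] unfolding is_simple_def by (auto simp: hom_iff)
 then show ?thesis using D(4)[OF 0] S[OF 0] unfolding isomorphic_def by blast
qed

lemma finite_length:
 assumes X: "X : Obj C" shows "finite_length C X"
proof -
 obtain n S i p where S: "\<And>k. k : {..<n::nat} ==> S k : B" and d: "direct_sum_over C {..<n} S X i p"
  using obtain_decomposition[OF X] by metis
 have "\<exists>Y i p. direct_sum_over C {..<k} S Y i p \<and> (k = n \<longrightarrow> Y = X)" if "k \<le> n" for k
 proof (cases "k = n")
  case False
  then show ?thesis using obtain_direct_sum[of "{..<k}" S] S B_obj that
   by (metis finite_lessThan le_neq_implies_less lessThan_iff less_trans)
 qed (use d in blast)
 then obtain Y i p where Y: "\<And>k. k \<le> n ==> direct_sum_over C {..<k} S (Y k) (i k) (p k)"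
  "Y n = X" by (metis order_refl)
 have "composition_series C n Y S X" unfolding composition_series_def
 proof (intro conjI allI impI)
  have "direct_sum_over C {} S (Y 0) (i 0) (p 0)" using Y(1)[of 0] by simp
  then show "is_zero_obj C (Y 0)" by (rule direct_sum_empty_zero)
  show "Y n = X" by (rule Y(2))
  fix k assume k: "k < n"
  show "is_simple C (S k)" using B_simple S k by simp
  have d': "direct_sum_over C (insert k {..<k}) S (Y (Suc k)) (i (Suc k)) (p (Suc k))"
   using Y(1)[of "Suc k"] k by (simp add: lessThan_Suc)
  obtain f where "f : Hom C (Y k) (Y (Suc k))" "short_exact C f (p (Suc k) k)"
   using direct_sum_insert_short_exact[OF Y(1) d'] k by auto
  moreover have "p (Suc k) k : Hom C (Y (Suc k)) (S k)" using direct_sum_overD(5)[OF d'] by simp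
  ultimately show "\<exists>i\<in>Hom C (Y k) (Y (Suc k)). \<exists>q\<in>Hom C (Y (Suc k)) (S k). short_exact C i q"
   by blast
 qed
 then show ?thesis unfolding finite_length_def by blast
qed

lemma composition_series_direct_sum:
 assumes cs: "composition_series C n Y Q X" shows "\<exists>i p. direct_sum_over C {..<n} Q X i p"
proof -
 have "\<exists>i p. direct_sum_over C {..<k} Q (Y k) i p" if "k \<le> n" for k using that
 proof (induction k)
  case 0
  have "is_zero_obj C (Y 0)" using cs by (simp add: composition_series_def)
  then have "direct_sum_over C {} Q (Y 0) i p" for i p
   by (simp add: direct_sum_over_def zero_obj_iff)
  then show ?case by auto
 next
  case (Suc k)
  then obtain i p where d: "direct_sum_over C {..<k} Q (Y k) i p" by auto
  obtain f q where f: "f : Hom C (Y k) (Y (Suc k))" and q: "q : Hom C (Y (Suc k)) (Q k)"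
   and e: "short_exact C f q" using cs Suc.prems by (auto simp: composition_series_def Suc_le_eq)
  obtain r s where rs: "r : Hom C (Y (Suc k)) (Y k)" "s : Hom C (Q k) (Y (Suc k))"
   "r ** f = Ident C (Y k)" "q ** s = Ident C (Q k)" "q ** f = Zero C (Y k) (Q k)"
   "r ** s = Zero C (Q k) (Y k)" "Add C (f ** r) (s ** q) = Ident C (Y (Suc k))"
   using short_exact_splits[OF e f q] by blast
  show ?case using direct_sum_extend[OF d _ f q rs(1,2) rs(3-7)] by (auto simp: lessThan_Suc)
 qed
 then show ?thesis using cs by (auto simp: composition_series_def)
qed

text \<open>The scalars of the matrix entries between isomorphic summands are coordinates on
  \<open>Hom(X, Y)\<close>.\<close>

lemma hom_dim_count:
 assumes dX: "direct_sum_over C I S X i p" and S: "\<And>k. k : I ==> S k : B"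
  and dY: "direct_sum_over C J T Y j q" and T: "\<And>l. l : J ==> T l : B"
 shows "vectorspace.fin_dim class_ring (hom_space C X Y)"
  and "hom_dim C X Y = card {(k, l). k : I \<and> l : J \<and> isomorphic C (S k) (T l)}"
proof -
 define P where "P = {(k, l). k : I \<and> l : J \<and> isomorphic C (S k) (T l)}"
 note DX = direct_sum_overD[OF dX] and DY = direct_sum_overD[OF dY]
 have finP: "finite P" by (rule finite_subset[of _ "I \<times> J"]) (use DX(2) DY(2) in "auto simp: P_def")
 define N where "N = card P"
 obtain ix where ix: "bij_betw ix P {..<N}"
  using ex_bij_betw_finite_nat[OF finP] by (auto simp: N_def atLeast0LessThan)
 have "\<exists>a. a : Hom C (S k) (T l) \<and> is_iso C a" if "(k, l) : P" for k l
  using that by (auto simp: P_def isomorphic_def)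
 then obtain al where al: "\<And>k l. (k, l) : P ==> al k l : Hom C (S k) (T l) \<and> is_iso C (al k l)"
  by metis
 define cmp where "cmp v k l = (if (k, l) : P then Scale C (v $ ix (k, l)) (al k l) else Zero C (S k) (T l))"
  for v :: "'k vec" and k l
 have cmp_hom: "cmp v k l : Hom C (S k) (T l)" if "k : I" "l : J" for v k l
  using that al[of k l] DX(3) DY(3) Zero_hom Scale_hom by (auto simp: cmp_def)
 define is_map where "is_map v h \<longleftrightarrow> h : Hom C X Y \<and> (\<forall>k\<in>I. \<forall>l\<in>J. q l ** (h ** i k) = cmp v k l)" for v h
 have ex: "\<exists>h. is_map v h" for v
 proof -
  have "\<exists>g\<in>Hom C (S k) Y. \<forall>l\<in>J. q l ** g = cmp v k l" if k: "k : I" for k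
   by (rule direct_sum_tuple[OF dY DX(3)[OF k]]) (use cmp_hom k in auto)
  then obtain g where g: "\<And>k. k : I ==> g k : Hom C (S k) Y" "\<And>k l. k : I ==> l : J ==> q l ** g k = cmp v k l"
   by metis
  obtain h where "h : Hom C X Y" "\<And>k. k : I ==> h ** i k = g k"
   using direct_sum_cotuple[OF dX DY(1) g(1)] by blast
  then show ?thesis using g(2) unfolding is_map_def by auto
 qed
 have uniq: "h = h'" if "h : Hom C X Y" "h' : Hom C X Y"
   "\<And>k l. k : I ==> l : J ==> q l ** (h ** i k) = q l ** (h' ** i k)" for h h'
 proof (rule direct_sum_eqI_from[OF dX that(1,2)])
  fix k assume k: "k : I"
  show "h ** i k = h' ** i k"
   by (rule direct_sum_eqI_into[OF dY, of _ "S k"]) (use that k DX(4)[OF k] in "auto simp: hom_iff")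
 qed
 define \<Psi> where "\<Psi> v = (SOME h. is_map v h)" for v
 have \<Psi>: "is_map v (\<Psi> v)" for v unfolding \<Psi>_def using someI_ex[OF ex] .
 then have \<Psi>_hom: "\<Psi> v : Hom C X Y" and \<Psi>_cmp: "k : I ==> l : J ==> q l ** (\<Psi> v ** i k) = cmp v k l" for v k l
  by (auto simp: is_map_def)
 have ixN: "ix (k, l) < N" if "(k, l) : P" for k l using bij_betwE[OF ix] that by auto
 have scal_inj: "c = d" if "(k, l) : P" "Scale C c (al k l) = Scale C d (al k l)" for c d k l
 proof -
  have a: "al k l : Hom C (S k) (T l)" "is_iso C (al k l)" and k: "k : I" using al[OF that(1)] that by (auto simp: P_def)
  have "Scale C c (Ident C (S k)) = inverse_of C (al k l) ** Scale C c (al k l)" for c using a by (simp add: hom_iff)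
  then have "Scale C c (Ident C (S k)) = Scale C d (Ident C (S k))" using that(2) by simp
  then show ?thesis using B_End[OF S[OF k]] by (auto simp: bij_betw_def dest: injD)
 qed
 have scal_ex: "\<exists>c. f = Scale C c (al k l)" if kl: "(k, l) : P" and f: "f : Hom C (S k) (T l)" for k l f
 proof -
  have a: "al k l : Hom C (S k) (T l)" "is_iso C (al k l)" and k: "k : I" using al[OF kl] kl by (auto simp: P_def)
  have "inverse_of C (al k l) ** f : Hom C (S k) (S k)" using a f by (simp add: hom_iff)
  then obtain c where c: "inverse_of C (al k l) ** f = Scale C c (Ident C (S k))"
   using B_End[OF S[OF k]] by (auto simp: bij_betw_def)
  have "al k l ** (inverse_of C (al k l) ** f) = Scale C c (al k l)" unfolding c using a DX(3)[OF k] by (simp add: hom_iff)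
  then show ?thesis using a f by (auto simp: hom_iff)
 qed
 have XY: "X : Obj C" "Y : Obj C" using DX DY by auto
 have Add: "\<Psi> (v + w) = Add C (\<Psi> v) (\<Psi> w)" if vw: "v : carrier_vec N" "w : carrier_vec N" for v w
 proof (rule uniq)
  fix k l assume kl: "k : I" "l : J"
  have "q l ** (Add C (\<Psi> v) (\<Psi> w) ** i k) = Add C (cmp v k l) (cmp w k l)"
   using \<Psi>_cmp[OF kl, symmetric] \<Psi>_hom[of v] \<Psi>_hom[of w] DX(4)[OF kl(1)] DY(5)[OF kl(2)]
   by (simp add: hom_iff Comp_Add)
  also have "... = cmp (v + w) k l"
   using vw al[of k l] ixN DX(3)[OF kl(1)] DY(3)[OF kl(2)] by (auto simp: cmp_def Scale_add_left hom_iff)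
  finally show "q l ** (\<Psi> (v + w) ** i k) = q l ** (Add C (\<Psi> v) (\<Psi> w) ** i k)" using \<Psi>_cmp[OF kl] by simp
 qed (use \<Psi>_hom Add_hom in auto)
 have Scale: "\<Psi> (c \<cdot>\<^sub>v v) = Scale C c (\<Psi> v)" if v: "v : carrier_vec N" for v c
 proof (rule uniq)
  fix k l assume kl: "k : I" "l : J"
  have "q l ** (Scale C c (\<Psi> v) ** i k) = Scale C c (cmp v k l)"
   using \<Psi>_cmp[OF kl, symmetric] \<Psi>_hom[of v] DX(4)[OF kl(1)] DY(5)[OF kl(2)] by (simp add: hom_iff)
  also have "... = cmp (c \<cdot>\<^sub>v v) k l"
   using v al[of k l] ixN DX(3)[OF kl(1)] DY(3)[OF kl(2)] by (auto simp: cmp_def Scale_Scale hom_iff)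
  finally show "q l ** (\<Psi> (c \<cdot>\<^sub>v v) ** i k) = q l ** (Scale C c (\<Psi> v) ** i k)" using \<Psi>_cmp[OF kl] by simp
 qed (use \<Psi>_hom Scale_hom in auto)
 have inj: "inj_on \<Psi> (carrier_vec N)"
 proof (rule inj_onI)
  fix v w assume vw: "v : carrier_vec N" "w : carrier_vec N" "\<Psi> v = \<Psi> w"
  show "v = w"
  proof (rule eq_vecI)
   fix t assume "t < dim_vec w"
   then have t: "t < N" using vw by simp
   then have "t : ix ` P" using ix by (simp add: bij_betw_def)
   then obtain k l where kl: "(k, l) : P" "ix (k, l) = t" by force
   then have "k : I" "l : J" by (auto simp: P_def)
   then have "cmp v k l = cmp w k l" using \<Psi>_cmp vw(3) by metis
   then show "v $ t = w $ t" using scal_inj[OF kl(1)] kl by (simp add: cmp_def)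
  qed (use vw in auto)
 qed
 have surj: "\<Psi> ` carrier_vec N = Hom C X Y"
 proof (intro equalityI subsetI)
  fix f assume f: "f : Hom C X Y"
  have c: "q l ** (f ** i k) : Hom C (S k) (T l)" if "k : I" "l : J" for k l
   using f DX(4)[OF that(1)] DY(5)[OF that(2)] by (simp add: hom_iff)
  define sc where "sc k l = (SOME c. q l ** (f ** i k) = Scale C c (al k l))" for k l
  have sc: "q l ** (f ** i k) = Scale C (sc k l) (al k l)" if "(k, l) : P" for k l
   unfolding sc_def by (rule someI_ex[OF scal_ex[OF that c]]) (use that in "auto simp: P_def")
  define v where "v = vec N (\<lambda>t. let (k, l) = inv_into P ix t in sc k l)"
  have "f = \<Psi> v"
  proof (rule uniq[OF f \<Psi>_hom])
   fix k l assume kl: "k : I" "l : J"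
   have "q l ** (f ** i k) = cmp v k l"
   proof (cases "(k, l) : P")
    case True
    have "inv_into P ix (ix (k, l)) = (k, l)" using ix True by (simp add: bij_betw_def)
    then show ?thesis using True sc ixN[OF True] by (simp add: cmp_def v_def)
   next
    case False
    then have "\<not> isomorphic C (S k) (T l)" using kl by (auto simp: P_def)
    then have "q l ** (f ** i k) = Zero C (S k) (T l)"
     using B_schur[OF S[OF kl(1)] T[OF kl(2)] c[OF kl]] c[OF kl] unfolding isomorphic_def by blast
    then show ?thesis using False by (simp add: cmp_def)
   qed
   then show "q l ** (f ** i k) = q l ** (\<Psi> v ** i k)" using \<Psi>_cmp[OF kl] by simp
  qed
  moreover have "v : carrier_vec N" by (simp add: v_def)
  ultimately show "f : \<Psi> ` carrier_vec N" by blast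
 qed (use \<Psi>_hom in auto)
 interpret V: vec_space "TYPE('k)" N .
 interpret W: vectorspace class_ring "hom_space C X Y" by (rule hom_vectorspace[OF XY])
 have "\<Psi> : LinearCombinations.module_hom class_ring (module_vec TYPE('k) N) (hom_space C X Y)"
  unfolding LinearCombinations.module_hom_def using Add Scale \<Psi>_hom by (simp add: hom_space_def module_vec_def Pi_iff)
 then interpret L: linear_map class_ring "module_vec TYPE('k) N" "hom_space C X Y" \<Psi>
  by (intro linear_map.intro mod_hom.intro mod_hom_axioms.intro vec_vs vec_module
    W.vectorspace_axioms W.module_axioms)
 show "vectorspace.fin_dim class_ring (hom_space C X Y)"
  using L.surj_fin_dim[OF V.fin_dim] surj by (simp add: hom_space_def module_vec_def)
 show "hom_dim C X Y = card {(k, l). k : I \<and> l : J \<and> isomorphic C (S k) (T l)}"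
  using L.dim_eq[OF V.fin_dim] inj surj V.dim_is_n
  unfolding hom_dim_def P_def[symmetric] N_def[symmetric] by (simp add: hom_space_def module_vec_def)
qed

lemma hom_fin_dim:
 assumes "X : Obj C" "Y : Obj C" shows "vectorspace.fin_dim class_ring (hom_space C X Y)"
proof -
 obtain n S i p where S: "\<And>k. k : {..<n::nat} ==> S k : B" "direct_sum_over C {..<n} S X i p"
  using obtain_decomposition[OF assms(1)] by metis
 obtain m T j q where T: "\<And>k. k : {..<m::nat} ==> T k : B" "direct_sum_over C {..<m} T Y j q"
  using obtain_decomposition[OF assms(2)] by metis
 show ?thesis using hom_dim_count(1)[OF S(2) S(1) T(2) T(1)] by simp
qed

lemma direct_sum_trivial: "X : Obj C ==> direct_sum_over C {()} (\<lambda>_. X) X (\<lambda>_. Ident C X) (\<lambda>_. inverse_of C (Ident C X))"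
 by (rule direct_sum_single) (auto simp: hom_iff)

lemma hom_dim_from_B:
 assumes U: "U : B" and d: "direct_sum_over C J T Y j q" and T: "\<And>l. l : J ==> T l : B"
 shows "hom_dim C U Y = card {l\<in>J. isomorphic C U (T l)}"
proof -
 have "hom_dim C U Y = card {(k, l). k : {()} \<and> l : J \<and> isomorphic C U (T l)}"
  by (rule hom_dim_count(2)[OF direct_sum_trivial[OF B_obj[OF U]] _ d T]) (use U in auto)
 also have "... = card (Pair () ` {l\<in>J. isomorphic C U (T l)})" by (rule arg_cong[of _ _ card]) auto
 finally show ?thesis by (simp add: card_image inj_on_def)
qed

lemma hom_dim_into_B:
 assumes U: "U : B" and d: "direct_sum_over C J T Y j q" and T: "\<And>l. l : J ==> T l : B"
 shows "hom_dim C Y U = hom_dim C U Y"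
proof -
 have "hom_dim C Y U = card {(l, k). l : J \<and> k : {()} \<and> isomorphic C (T l) U}"
  by (rule hom_dim_count(2)[OF d T direct_sum_trivial[OF B_obj[OF U]]]) (use U in auto)
 also have "... = card ((\<lambda>l. (l, ())) ` {l\<in>J. isomorphic C U (T l)})"
  by (rule arg_cong[of _ _ card]) (use isomorphic_sym in auto)
 also have "... = card {l\<in>J. isomorphic C U (T l)}" by (simp add: card_image inj_on_def)
 also have "... = hom_dim C U Y" by (rule hom_dim_from_B[OF U d T, symmetric])
 finally show ?thesis .
qed

lemma hom_dim_flip: "U : B ==> Y : Obj C ==> hom_dim C Y U = hom_dim C U Y"
 using obtain_decomposition[of Y] hom_dim_into_B by metis

lemma hom_dim_B: "U : B ==> T : B ==> hom_dim C U T = (if isomorphic C U T then 1 else 0)"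
 using hom_dim_from_B[OF _ direct_sum_trivial[OF B_obj]] by simp

text \<open>Decomposing the summands further reduces additivity to counting.\<close>

lemma hom_dim_direct_sum:
 assumes U: "U : B" and d: "direct_sum_over C K X Y i p"
 shows "hom_dim C U Y = (\<Sum>k\<in>K. hom_dim C U (X k))"
proof -
 note D = direct_sum_overD[OF d]
 have "\<exists>n S i p. (\<forall>l\<in>{..<n::nat}. S l : B) \<and> direct_sum_over C {..<n} S (X k) i p" if "k : K" for k
  using obtain_decomposition[OF D(3)[OF that]] by metis
 then obtain n S j q where S: "\<And>k l. k : K ==> l : {..<(n k::nat)} ==> S k l : B"
  and dk: "\<And>k. k : K ==> direct_sum_over C {..<n k} (S k) (X k) (j k) (q k)" by metis
 have "hom_dim C U Y = card {a\<in>Sigma K (\<lambda>k. {..<n k}). isomorphic C U ((\<lambda>(k, l). S k l) a)}"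
  by (rule hom_dim_from_B[OF U direct_sum_flatten[OF d dk]]) (use S in auto)
 also have "{a\<in>Sigma K (\<lambda>k. {..<n k}). isomorphic C U ((\<lambda>(k, l). S k l) a)}
   = Sigma K (\<lambda>k. {l\<in>{..<n k}. isomorphic C U (S k l)})" by auto
 also have "card ... = (\<Sum>k\<in>K. card {l\<in>{..<n k}. isomorphic C U (S k l)})"
  using D(2) by (intro card_SigmaI) auto
 also have "... = (\<Sum>k\<in>K. hom_dim C U (X k))"
  using hom_dim_from_B[OF U dk S] by (intro sum.cong) auto
 finally show ?thesis .
qed

lemma hom_dim_iso_target:
 assumes "U : B" "isomorphic C X Y" shows "hom_dim C U X = hom_dim C U Y"
proof -
 obtain a where "a : Hom C X Y" "is_iso C a" using assms(2) by (auto simp: isomorphic_def)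
 from hom_dim_direct_sum[OF assms(1) direct_sum_single[OF this]] show ?thesis by simp
qed

lemma hom_dim_iso_source:
 assumes "U : B" "V : B" "isomorphic C U V" "X : Obj C" shows "hom_dim C U X = hom_dim C V X"
 using hom_dim_flip[OF assms(1,4)] hom_dim_flip[OF assms(2,4)]
proof -
 obtain n S i p where S: "\<And>k. k : {..<n::nat} ==> S k : B" "direct_sum_over C {..<n} S X i p"
  using obtain_decomposition[OF assms(4)] by metis
 have "isomorphic C U W \<longleftrightarrow> isomorphic C V W" for W
  using assms(3) isomorphic_sym isomorphic_trans by blast
 then show ?thesis using hom_dim_from_B[OF assms(1) S(2,1)] hom_dim_from_B[OF assms(2) S(2,1)] by simp
qed

lemma hom_dim_pos_iff:
 assumes "U : B" "X : Obj C"
 shows "hom_dim C U X > 0 \<longleftrightarrow> (\<exists>f\<in>Hom C U X. f \<noteq> Zero C U X)"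
proof -
 obtain n S i p where S: "\<And>k. k : {..<n::nat} ==> S k : B" and d: "direct_sum_over C {..<n} S X i p"
  using obtain_decomposition[OF assms(2)] by metis
 note D = direct_sum_overD[OF d]
 have "hom_dim C U X > 0 \<longleftrightarrow> (\<exists>k\<in>{..<n}. isomorphic C U (S k))"
  using hom_dim_from_B[OF assms(1) d S] by (auto simp: card_gt_0_iff)
 also have "... \<longleftrightarrow> (\<exists>f\<in>Hom C U X. f \<noteq> Zero C U X)"
 proof
  assume "\<exists>k\<in>{..<n}. isomorphic C U (S k)"
  then obtain k a where k: "k : {..<n}" and a: "a : Hom C U (S k)" "is_iso C a" by (auto simp: isomorphic_def)
  have "i k ** a \<noteq> Zero C U X"
  proof
   assume z: "i k ** a = Zero C U X"
   have "p k ** (i k ** a) = a" using comp_cong_left[OF D(6)[OF k], of a] D(4,5)[OF k] a by (simp add: hom_iff)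
   then have "a = Zero C U (S k)" unfolding z using D(1,5) k B_obj[OF assms(1)] by (simp add: hom_iff)
   then have "inverse_of C a ** a = Zero C U U"
    using a B_obj[OF assms(1)] by (metis Comp_Zero(1) hom_iff inverse_of_arrow(1-3))
   then show False using a B_Ident_nonzero[OF assms(1)] by (simp add: hom_iff)
  qed
  moreover have "i k ** a : Hom C U X" using D(4)[OF k] a by (simp add: hom_iff)
  ultimately show "\<exists>f\<in>Hom C U X. f \<noteq> Zero C U X" by blast
 next
  assume "\<exists>f\<in>Hom C U X. f \<noteq> Zero C U X"
  then obtain f where f: "f : Hom C U X" "f \<noteq> Zero C U X" by blast
  obtain k where k: "k : {..<n}" "p k ** f \<noteq> Zero C U (S k)" using nonzero_component_into[OF d f] by blast
  have "p k ** f : Hom C U (S k)" using D(5)[OF k(1)] f by (simp add: hom_iff)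
  then show "\<exists>k\<in>{..<n}. isomorphic C U (S k)"
   using B_schur[OF assms(1) S[OF k(1)] _ k(2)] k(1) unfolding isomorphic_def by blast
 qed
 finally show ?thesis .
qed

end

text \<open>Schur's lemma: a proper subobject of \<open>S\<close> is zero, so \<open>f\<close> has no kernel, and a nonzero subobject of
  \<open>T\<close> is all of \<open>T\<close>.\<close>

lemma (in abelian_category) simple_hom_iso:
 assumes S: "is_simple C S" and T: "is_simple C T" and f: "f : Hom C S T" "f \<noteq> Zero C S T"
 shows "is_iso C f"
proof -
 have ob: "S : Obj C" "T : Obj C" using hom_obj[OF f(1)] by auto
 obtain k where k: "is_kernel C k f" using kernels f(1) by (auto simp: hom_iff)
 have kh: "k : Hom C (Dom C k) S" "Dom C k : Obj C" using k f(1) Dom_closed by (auto simp: is_kernel_def hom_iff)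
 have fk: "f ** k = Zero C (Dom C k) T" using k f(1) by (simp add: is_kernel_def hom_iff)
 have "is_mono C k" unfolding is_mono_def
 proof (intro conjI allI ballI impI)
  fix W g h assume g: "g : Hom C W (Dom C k)" "h : Hom C W (Dom C k)" "k ** g = k ** h"
  have W: "W : Obj C" using hom_obj[OF g(1)] by simp
  have "f ** (k ** g) = Zero C (Dom C k) T ** g"
   by (rule comp_cong_left[OF fk]) (use f kh g in "auto simp: hom_iff")
  then have "f ** (k ** g) = Zero C W T" using g ob by (simp add: hom_iff)
  moreover have "k ** g : Hom C W (Dom C f)" using g kh f by (simp add: hom_iff)
  ultimately have "\<exists>!u. u : Hom C W (Dom C k) \<and> k ** u = k ** g"
   using k f(1) unfolding is_kernel_def by (metis hom_iff)
  then show "g = h" using g by metis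
 qed (use kh in "simp add: hom_iff")
 moreover have "\<not> is_iso C k"
 proof
  assume i: "is_iso C k"
  have "f = (f ** k) ** inverse_of C k" using i f kh by (simp add: hom_iff comp_assoc)
  also have "... = Zero C S T" unfolding fk using i kh ob by (simp add: hom_iff)
  finally show False using f(2) by simp
 qed
 ultimately have zk: "is_zero_obj C (Dom C k)" using S kh(1) unfolding is_simple_def by (auto simp: hom_iff)
 have "is_mono C f" unfolding is_mono_def
 proof (intro conjI allI ballI impI)
  fix W g h assume g: "g : Hom C W (Dom C f)" "h : Hom C W (Dom C f)" "f ** g = f ** h"
  have W: "W : Obj C" using hom_obj[OF g(1)] by simp
  have gS: "g : Hom C W S" "h : Hom C W S" using g f(1) by (auto simp: hom_iff)
  have "f ** sub C g h = Zero C W T" using gS g(3) f(1) by (simp add: Comp_sub hom_iff)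
  moreover have "sub C g h : Hom C W (Dom C f)" using gS f(1) by (simp add: hom_iff)
  ultimately obtain u where u: "u : Hom C W (Dom C k)" "k ** u = sub C g h"
   using k f(1) unfolding is_kernel_def by (metis hom_iff)
  have "u = Zero C W (Dom C k)" using arrow_zero_obj(2)[OF zk u(1)] .
  then have "sub C g h = Zero C W S" using u(2) kh W by (simp add: hom_iff)
  then show "g = h" using sub_eq_Zero_iff[OF gS] by simp
 qed (use f in "simp add: hom_iff")
 then show ?thesis using T S f(1) unfolding is_simple_def by (auto simp: hom_iff)
qed

sublocale fusion_category \<subseteq> split_semisimple_category C "{X. is_simple C X}"
proof unfold_locales
 fix X :: 'o assume "X : Obj C"
 then show "\<exists>n S i p. (\<forall>k<n. S k : {X. is_simple C X}) \<and> is_direct_sum C n S X i p"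
  using semisimple by simp
next
 fix n :: nat and Xs assume "\<And>k. k < n ==> Xs k : Obj C"
 then show "\<exists>S i p. is_direct_sum C n Xs S i p" by (rule direct_sums)
next
 fix S assume "S : {X. is_simple C X}"
 then show "S : Obj C" "bij_betw (\<lambda>c. Scale C c (Ident C S)) UNIV (Hom C S S)"
  using split by (auto simp: is_simple_def)
next
 fix S T f assume "S : {X. is_simple C X}" "T : {X. is_simple C X}" "f : Hom C S T" "f \<noteq> Zero C S T"
 then show "is_iso C f" using simple_hom_iso by blast
qed

lemma (in category) class_rep_iso_class:
 assumes "X : Obj C" shows "isomorphic C X (class_rep (iso_class C X))"
proof -
 have "X : iso_class C X" using assms by (simp add: iso_class_def)
 then have "class_rep (iso_class C X) : iso_class C X" unfolding class_rep_def by (rule someI)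
 then show ?thesis by (simp add: iso_class_def)
qed

lemma (in split_semisimple_category) simple_isomorphic:
 assumes "is_simple C X" "isomorphic C X Y" shows "is_simple C Y"
proof -
 obtain a where a: "a : Hom C X Y" "is_iso C a" using assms(2) by (auto simp: isomorphic_def)
 have ob: "X : Obj C" "Y : Obj C" using hom_obj[OF a(1)] by auto
 show ?thesis unfolding is_simple_def
 proof (intro conjI allI impI)
  show "\<not> is_zero_obj C Y"
  proof
   assume "is_zero_obj C Y"
   then have "a = Zero C X Y" using arrow_zero_obj(2) a(1) by blast
   then have "inverse_of C a ** a = Zero C X X" using a ob by (metis Comp_Zero(1) hom_iff inverse_of_arrow(1-3))
   then show False using a assms(1) ob by (simp add: hom_iff is_simple_def zero_obj_iff)
  qed
  fix i assume i: "is_mono C i \<and> Cod C i = Y"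
  then have ia: "i : Arr C" by (simp add: is_mono_def)
  let ?i = "inverse_of C a ** i"
  have ar: "?i : Arr C" "Dom C ?i = Dom C i" "Cod C ?i = X" using i ia a by (auto simp: hom_iff)
  have "is_mono C ?i" unfolding is_mono_def
  proof (intro conjI allI ballI impI)
   fix W g h assume g: "g : Hom C W (Dom C ?i)" "h : Hom C W (Dom C ?i)" "?i ** g = ?i ** h"
   then have "inverse_of C a ** (i ** g) = inverse_of C a ** (i ** h)"
    using a i ia ar by (simp add: hom_iff comp_assoc)
   then have "i ** g = i ** h"
    using iso_cancel_left[of "inverse_of C a" "i ** g" "i ** h"] a i ia g ar by (simp add: hom_iff)
   then show "g = h" using i g ar unfolding is_mono_def by auto
  qed (rule ar)
  then have "is_zero_obj C (Dom C ?i) \<or> is_iso C ?i" using assms(1) ar unfolding is_simple_def by auto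
  moreover have "is_iso C i" if "is_iso C ?i"
  proof -
   have "i = a ** ?i" using a i ia by (simp add: hom_iff)
   then show ?thesis using iso_Comp[OF that a(2)] ar a by (simp add: hom_iff)
  qed
  ultimately show "is_zero_obj C (Dom C i) \<or> is_iso C i" using ar by auto
 qed (rule ob)
qed

context fusion_category
begin

lemma class_rep_simple:
 assumes "S : simple_classes C"
 shows "is_simple C (class_rep S)" "class_rep S : Obj C" "S = iso_class C (class_rep S)"
proof -
 obtain X where X: "is_simple C X" "S = iso_class C X" using assms by (auto simp: simple_classes_def)
 then have ob: "X : Obj C" by (simp add: is_simple_def)
 have i: "isomorphic C X (class_rep S)" unfolding X(2) by (rule class_rep_iso_class[OF ob])
 show "is_simple C (class_rep S)" by (rule simple_isomorphic[OF X(1) i])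
 then show o: "class_rep S : Obj C" by (simp add: is_simple_def)
 show "S = iso_class C (class_rep S)" using X(2) iso_class_eq_iff[OF ob o] i by simp
qed

lemma class_rep_inject:
 assumes "S : simple_classes C" "T : simple_classes C"
 shows "isomorphic C (class_rep S) (class_rep T) \<longleftrightarrow> S = T"
 using iso_class_eq_iff class_rep_simple assms by metis

lemma iso_class_simple: "is_simple C X ==> iso_class C X : simple_classes C"
 by (simp add: simple_classes_def)

lemma multiplicity_in_eq:
 assumes S: "S : simple_classes C" and X: "X : Obj C"
 shows "multiplicity_in C S X = hom_dim C (class_rep S) X"
proof -
 have count: "card {k. k < n \<and> Q k : S} = hom_dim C (class_rep S) X"
  if cs: "composition_series C n Y Q X" for n Y Q
 proof -
  obtain i p where d: "direct_sum_over C {..<n} Q X i p" using composition_series_direct_sum[OF cs] by blast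
  have simp: "is_simple C (Q k)" if "k < n" for k using cs that by (simp add: composition_series_def)
  have "hom_dim C (class_rep S) X = card {k\<in>{..<n}. isomorphic C (class_rep S) (Q k)}"
   by (rule hom_dim_from_B[OF _ d]) (use class_rep_simple[OF S] simp in auto)
  also have "{k\<in>{..<n}. isomorphic C (class_rep S) (Q k)} = {k. k < n \<and> Q k : S}"
   using class_rep_simple(3)[OF S] isomorphic_obj(2) unfolding iso_class_def by blast
  finally show ?thesis by simp
 qed
 obtain n Y Q where cs: "composition_series C n Y Q X"
  using obj_finite_length[OF X] by (auto simp: finite_length_def)
 show ?thesis unfolding multiplicity_in_def
 proof (rule the_equality)
  show "\<exists>n Y Q. composition_series C n Y Q X \<and> hom_dim C (class_rep S) X = card {k. k < n \<and> Q k : S}"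
   using cs count[OF cs, symmetric] by blast
 next
  fix m assume "\<exists>n Y Q. composition_series C n Y Q X \<and> m = card {k. k < n \<and> Q k : S}"
  then show "m = hom_dim C (class_rep S) X" using count by auto
 qed
qed

lemma gr_class_eq:
 "S : simple_classes C ==> X : Obj C ==> gr_class C X S = int (hom_dim C (class_rep S) X)"
 by (simp add: gr_class_def multiplicity_in_eq)

text \<open>Multiplicities in an additive image of \<open>X\<close> are determined by the class of \<open>X\<close>.\<close>

lemma sum_over_simple_classes:
 assumes d: "direct_sum_over C I S X i p" and S: "\<And>k. k : I ==> is_simple C (S k)"
  and inv: "\<And>Y Z. is_simple C Y ==> isomorphic C Y Z ==> h Y = h Z"
 shows "(\<Sum>k\<in>I. h (S k)) = (\<Sum>T\<in>simple_classes C. of_nat (hom_dim C (class_rep T) X) * (h (class_rep T) :: 'r::comm_semiring_1))"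
proof -
 note D = direct_sum_overD[OF d]
 have "(\<Sum>k\<in>I. h (S k)) = (\<Sum>k\<in>I. h (class_rep (iso_class C (S k))))"
  using inv S class_rep_iso_class D(3) by (intro sum.cong) auto
 also have "... = (\<Sum>T\<in>simple_classes C. \<Sum>k | k : I \<and> iso_class C (S k) = T. h (class_rep (iso_class C (S k))))"
  by (rule sum.group[symmetric]) (use D(2) S finite_simple_classes iso_class_simple in auto)
 also have "... = (\<Sum>T\<in>simple_classes C. of_nat (hom_dim C (class_rep T) X) * h (class_rep T))"
 proof (rule sum.cong[OF refl])
  fix T assume T: "T : simple_classes C"
  have "iso_class C (S k) = T \<longleftrightarrow> isomorphic C (class_rep T) (S k)" if "k : I" for k
   using iso_class_eq_iff[OF D(3)[OF that] class_rep_simple(2)[OF T]] class_rep_simple(3)[OF T] isomorphic_sym by metis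
  then have "{k\<in>I. iso_class C (S k) = T} = {k\<in>I. isomorphic C (class_rep T) (S k)}" by auto
  then have "hom_dim C (class_rep T) X = card {k\<in>I. iso_class C (S k) = T}"
   using hom_dim_from_B[OF _ d] class_rep_simple(1)[OF T] S by simp
  then show "(\<Sum>k | k : I \<and> iso_class C (S k) = T. h (class_rep (iso_class C (S k))))
    = of_nat (hom_dim C (class_rep T) X) * h (class_rep T)" by simp
 qed
 finally show ?thesis .
qed

end

lemma additive_functor_multiplicity:
 assumes C: "fusion_category C" and D: "split_semisimple_category D B" and F: "linear_functor C D Fo Fa"
  and X: "X : Obj C" and U: "U : B"
 shows "hom_dim D U (Fo X) = (\<Sum>T\<in>simple_classes C. hom_dim C (class_rep T) X * hom_dim D U (Fo (class_rep T)))"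
proof -
 interpret C: fusion_category C by fact
 interpret D: split_semisimple_category D B by fact
 interpret F: linear_functor C D Fo Fa by fact
 obtain n S i p where S: "\<And>k. k : {..<n::nat} ==> S k : {X. is_simple C X}"
  and d: "direct_sum_over C {..<n} S X i p" using C.obtain_decomposition[OF X] by metis
 have "hom_dim D U (Fo X) = (\<Sum>k\<in>{..<n}. hom_dim D U (Fo (S k)))"
  by (rule D.hom_dim_direct_sum[OF U F.Fa_direct_sum[OF d]])
 also have "... = (\<Sum>T\<in>simple_classes C. of_nat (hom_dim C (class_rep T) X) * hom_dim D U (Fo (class_rep T)))"
  by (rule C.sum_over_simple_classes[OF d]) (use S D.hom_dim_iso_target[OF U] F.Fo_isomorphic in auto)
 finally show ?thesis by simp
qed

section \<open>Monoidal categories\<close>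

lemma (in category) comp_cong2:
 assumes "g ** f = g' ** f'" "f : Arr C" "g : Arr C" "Dom C g = Cod C f"
  "f' : Arr C" "g' : Arr C" "Dom C g' = Cod C f'" "x : Arr C" "Dom C f = Cod C x"
 shows "g ** (f ** x) = g' ** (f' ** x)"
proof -
 have "Dom C f = Dom C (g ** f)" using assms(2-4) by simp
 also have "... = Dom C f'" unfolding assms(1) using assms(5-7) by simp
 finally have "Dom C f' = Cod C x" using assms(9) by simp
 then have "g' ** (f' ** x) = (g' ** f') ** x" using assms(5-8) by (simp add: comp_assoc)
 then show ?thesis using comp_assoc[of x f g] assms(1-4,8,9) by simp
qed

lemma (in category) isomorphicI: "f : Hom C X Y ==> is_iso C f ==> isomorphic C X Y"
 by (auto simp: isomorphic_def)

context monoidal_category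
begin

lemma TensO_obj [simp]: "X : Obj C ==> Y : Obj C ==> X \<boxtimes> Y : Obj C"
 by (rule TensO_closed)

lemma Unit_obj [simp]: "Unit C : Obj C" by (rule Unit_closed)

lemma TensA_arrow [simp]:
 assumes "f : Arr C" "g : Arr C"
 shows "f \<star> g : Arr C" "Dom C (f \<star> g) = Dom C f \<boxtimes> Dom C g" "Cod C (f \<star> g) = Cod C f \<boxtimes> Cod C g"
 using TensA_hom[of f "Dom C f" "Cod C f" g "Dom C g" "Cod C g"] assms by (auto simp: hom_iff)

lemma Assoc_arrow [simp]:
 assumes "X : Obj C" "Y : Obj C" "Z : Obj C"
 shows "Assoc C X Y Z : Arr C" "Dom C (Assoc C X Y Z) = (X \<boxtimes> Y) \<boxtimes> Z" "Cod C (Assoc C X Y Z) = X \<boxtimes> (Y \<boxtimes> Z)"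
  "is_iso C (Assoc C X Y Z)"
 using Assoc_hom[OF assms] Assoc_iso[OF assms] by (auto simp: hom_iff)

lemma unitor_arrow [simp]:
 assumes "X : Obj C"
 shows "Lunit C X : Arr C" "Dom C (Lunit C X) = Unit C \<boxtimes> X" "Cod C (Lunit C X) = X" "is_iso C (Lunit C X)"
  "Runit C X : Arr C" "Dom C (Runit C X) = X \<boxtimes> Unit C" "Cod C (Runit C X) = X" "is_iso C (Runit C X)"
 using Lunit_hom[OF assms] Lunit_iso[OF assms] Runit_hom[OF assms] Runit_iso[OF assms] by (auto simp: hom_iff)

lemma interchange:
 assumes "f : Arr C" "g : Arr C" "f' : Arr C" "g' : Arr C" "Dom C f' = Cod C f" "Dom C g' = Cod C g"
 shows "(f' \<star> g') ** (f \<star> g) = (f' ** f) \<star> (g' ** g)"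
 using TensA_Comp[of f "Dom C f" "Cod C f" f' "Cod C f'" g "Dom C g" "Cod C g" g' "Cod C g'"] assms
 by (simp add: hom_iff)

lemma TensA_Idents [simp]: "X : Obj C ==> Y : Obj C ==> Ident C X \<star> Ident C Y = Ident C (X \<boxtimes> Y)"
 by (rule TensA_Ident)

lemma Assoc_nat:
 assumes "f : Arr C" "g : Arr C" "h : Arr C"
 shows "Assoc C (Cod C f) (Cod C g) (Cod C h) ** ((f \<star> g) \<star> h)
  = (f \<star> (g \<star> h)) ** Assoc C (Dom C f) (Dom C g) (Dom C h)"
 using Assoc_natural[of f "Dom C f" "Cod C f" g "Dom C g" "Cod C g" h "Dom C h" "Cod C h"] assms
 by (simp add: hom_iff)

lemma Lunit_nat: "f : Arr C ==> Lunit C (Cod C f) ** (Ident C (Unit C) \<star> f) = f ** Lunit C (Dom C f)"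
 using Lunit_natural[of f "Dom C f" "Cod C f"] by (simp add: hom_iff)

lemma Runit_nat: "f : Arr C ==> Runit C (Cod C f) ** (f \<star> Ident C (Unit C)) = f ** Runit C (Dom C f)"
 using Runit_natural[of f "Dom C f" "Cod C f"] by (simp add: hom_iff)

lemma TensA_iso:
 assumes "is_iso C f" "is_iso C g"
 shows "is_iso C (f \<star> g)" "inverse_of C (f \<star> g) = inverse_of C f \<star> inverse_of C g"
proof -
 have "inverse_arrows C (f \<star> g) (inverse_of C f \<star> inverse_of C g)"
  unfolding inverse_arrows_def using assms Dom_closed Cod_closed by (simp add: hom_iff interchange)
 then show "is_iso C (f \<star> g)" "inverse_of C (f \<star> g) = inverse_of C f \<star> inverse_of C g"
  by (auto simp: is_iso_def intro: inverse_ofI)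
qed

lemma isomorphic_TensO:
 assumes "isomorphic C X X'" "isomorphic C Y Y'" shows "isomorphic C (X \<boxtimes> Y) (X' \<boxtimes> Y')"
proof -
 obtain f g where "f : Hom C X X'" "is_iso C f" "g : Hom C Y Y'" "is_iso C g"
  using assms unfolding isomorphic_def by blast
 then show ?thesis unfolding isomorphic_def using TensA_hom TensA_iso(1) by blast
qed

lemma isomorphic_Lunit: "X : Obj C ==> isomorphic C (Unit C \<boxtimes> X) X"
 and isomorphic_Runit: "X : Obj C ==> isomorphic C (X \<boxtimes> Unit C) X"
 and isomorphic_Assoc: "X : Obj C ==> Y : Obj C ==> Z : Obj C ==>
  isomorphic C ((X \<boxtimes> Y) \<boxtimes> Z) (X \<boxtimes> (Y \<boxtimes> Z))"
 by (rule isomorphicI[OF Lunit_hom Lunit_iso] isomorphicI[OF Runit_hom Runit_iso]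
   isomorphicI[OF Assoc_hom Assoc_iso]; assumption)+

lemma Unit_tensor_faithful:
 assumes "f : Hom C X Y" "g : Hom C X Y" "Ident C (Unit C) \<star> f = Ident C (Unit C) \<star> g"
 shows "f = g"
proof (rule iso_cancel_right[of "Lunit C X"])
 show "f ** Lunit C X = g ** Lunit C X"
  using Lunit_natural[OF assms(1)] Lunit_natural[OF assms(2)] assms(3) by simp
qed (use assms hom_obj[OF assms(1)] in "auto simp: hom_iff")

text \<open>Kelly's lemma: tensoring with the unit is faithful, and after tensoring the identity is a
  consequence of the pentagon, the triangle and naturality.\<close>

lemma Lunit_TensO:
 assumes X: "X : Obj C" and Y: "Y : Obj C"
 shows "Lunit C (X \<boxtimes> Y) ** Assoc C (Unit C) X Y = Lunit C X \<star> Ident C Y"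
proof (rule Unit_tensor_faithful)
 let ?u = "Unit C"
 let ?iu = "Ident C ?u" and ?Y = "Ident C Y"
 let ?K = "Assoc C ?u (?u \<boxtimes> X) Y ** (Assoc C ?u ?u X \<star> ?Y)"
 have iso: "is_iso C ?K" using X Y TensA_iso(1)[of "Assoc C ?u ?u X" ?Y] by simp
 have p: "(?iu \<star> Assoc C ?u X Y) ** ?K = Assoc C ?u ?u (X \<boxtimes> Y) ** Assoc C (?u \<boxtimes> ?u) X Y"
  using pentagon[of ?u ?u X Y] X Y by (simp add: comp_assoc)
 have t: "(?iu \<star> Lunit C (X \<boxtimes> Y)) ** Assoc C ?u ?u (X \<boxtimes> Y) = Runit C ?u \<star> Ident C (X \<boxtimes> Y)"
  using triangle[of ?u "X \<boxtimes> Y"] X Y by simp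
 have "(?iu \<star> (Lunit C (X \<boxtimes> Y) ** Assoc C ?u X Y)) ** ?K
   = (?iu \<star> Lunit C (X \<boxtimes> Y)) ** ((?iu \<star> Assoc C ?u X Y) ** ?K)"
  using X Y interchange[of ?iu "Assoc C ?u X Y" ?iu "Lunit C (X \<boxtimes> Y)"] by (simp add: comp_assoc[symmetric])
 also have "... = (Runit C ?u \<star> Ident C (X \<boxtimes> Y)) ** Assoc C (?u \<boxtimes> ?u) X Y"
  unfolding p using comp_cong_left[OF t] X Y by simp
 also have "... = Assoc C ?u X Y ** ((Runit C ?u \<star> Ident C X) \<star> ?Y)"
  using Assoc_nat[of "Runit C ?u" "Ident C X" ?Y] X Y by simp
 finally have 1: "(?iu \<star> (Lunit C (X \<boxtimes> Y) ** Assoc C ?u X Y)) ** ?K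
   = Assoc C ?u X Y ** ((Runit C ?u \<star> Ident C X) \<star> ?Y)" .
 have n: "Assoc C ?u X Y ** ((?iu \<star> Lunit C X) \<star> ?Y) = (?iu \<star> (Lunit C X \<star> ?Y)) ** Assoc C ?u (?u \<boxtimes> X) Y"
  using Assoc_nat[of ?iu "Lunit C X" ?Y] X Y by simp
 have "(?iu \<star> (Lunit C X \<star> ?Y)) ** ?K
   = Assoc C ?u X Y ** (((?iu \<star> Lunit C X) \<star> ?Y) ** (Assoc C ?u ?u X \<star> ?Y))"
  using comp_cong2[OF n[symmetric]] X Y by simp
 also have "((?iu \<star> Lunit C X) \<star> ?Y) ** (Assoc C ?u ?u X \<star> ?Y) = (Runit C ?u \<star> Ident C X) \<star> ?Y"
  using triangle[of ?u X] X Y by (simp add: interchange)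
 finally have 2: "(?iu \<star> (Lunit C X \<star> ?Y)) ** ?K
   = Assoc C ?u X Y ** ((Runit C ?u \<star> Ident C X) \<star> ?Y)" .
 show "?iu \<star> (Lunit C (X \<boxtimes> Y) ** Assoc C ?u X Y) = ?iu \<star> (Lunit C X \<star> ?Y)"
  by (rule iso_cancel_right[OF iso]) (use 1 2 X Y in auto)
qed (use X Y in "auto simp: hom_iff")

lemma Lunit_Unit_eq_Runit: "Lunit C (Unit C) = Runit C (Unit C)"
proof (rule iso_cancel_right[of "Lunit C (Unit C \<boxtimes> Unit C)"])
 let ?u = "Unit C"
 let ?l = "Lunit C ?u" and ?r = "Runit C ?u"
 have e: "Lunit C (?u \<boxtimes> ?u) = Ident C ?u \<star> ?l"
  by (rule iso_cancel_left[of ?l]) (use Lunit_nat[of ?l] in auto)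
 have "?l \<star> Ident C ?u = ?r \<star> Ident C ?u"
  using Lunit_TensO[of ?u ?u] triangle[of ?u ?u] e by simp
 then have "Runit C ?u ** (?l \<star> Ident C ?u) = Runit C ?u ** (?r \<star> Ident C ?u)" by simp
 then have "?l ** Runit C (?u \<boxtimes> ?u) = ?r ** Runit C (?u \<boxtimes> ?u)"
  using Runit_nat[of ?l] Runit_nat[of ?r] by simp
 then have "?l = ?r" using iso_cancel_right[of "Runit C (?u \<boxtimes> ?u)" ?l ?r] by simp
 then show "?l ** Lunit C (?u \<boxtimes> ?u) = ?r ** Lunit C (?u \<boxtimes> ?u)" by simp
qed auto

lemma TensA_Ident_Comp:
 assumes "f : Arr C" "g : Arr C" "Dom C g = Cod C f" "A : Obj C"
 shows "(g \<star> Ident C A) ** (f \<star> Ident C A) = (g ** f) \<star> Ident C A"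
  "(Ident C A \<star> g) ** (Ident C A \<star> f) = Ident C A \<star> (g ** f)"
 using assms by (simp_all add: interchange)

text \<open>Tensoring with a left dual \<open>T\<close> of \<open>X\<close> is left adjoint to tensoring with \<open>X\<close>.  The unit and the
  counit are \<open>coev\<close> and \<open>ev\<close> tensored with an object; the zigzag identities of the duality become the
  triangle identities, up to the pentagon and the compatibility of unit and associativity
  constraints.\<close>

lemma dual_adjunction:
 assumes d: "is_dual C T X ev coev" and A: "A : Obj C" and B: "B : Obj C"
 shows "bij_betw (\<lambda>f. (Ident C X \<star> f) ** (Assoc C X T A ** ((coev \<star> Ident C A) ** inverse_of C (Lunit C A))))
  (Hom C (T \<boxtimes> A) B) (Hom C A (X \<boxtimes> B))"
proof -
 have T: "T : Obj C" and X: "X : Obj C"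
  and ev: "ev : Arr C" "Dom C ev = T \<boxtimes> X" "Cod C ev = Unit C"
  and coev: "coev : Arr C" "Dom C coev = Unit C" "Cod C coev = X \<boxtimes> T"
  and zX: "Runit C X ** (Ident C X \<star> ev) ** Assoc C X T X ** (coev \<star> Ident C X) ** inverse_of C (Lunit C X) = Ident C X"
  and zT: "Lunit C T ** (ev \<star> Ident C T) ** inverse_of C (Assoc C T X T) ** (Ident C T \<star> coev)
    ** inverse_of C (Runit C T) = Ident C T"
  using d by (auto simp: is_dual_def hom_iff)
 let ?u = "Unit C" and ?iX = "Ident C X" and ?iT = "Ident C T"
 note ty = T X ev coev A B
 have zX': "Runit C X ** ((?iX \<star> ev) ** (Assoc C X T X ** ((coev \<star> ?iX) ** inverse_of C (Lunit C X)))) = ?iX"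
  using zX ty by (simp add: comp_assoc)
 have zT': "Lunit C T ** ((ev \<star> ?iT) ** (inverse_of C (Assoc C T X T) ** ((?iT \<star> coev) ** inverse_of C (Runit C T)))) = ?iT"
  using zT ty by (simp add: comp_assoc)
 define \<phi> where "\<phi> f = (?iX \<star> f) ** (Assoc C X T A ** ((coev \<star> Ident C A) ** inverse_of C (Lunit C A)))" for f
 define \<psi> where "\<psi> h = Lunit C B ** ((ev \<star> Ident C B) ** (inverse_of C (Assoc C T X B) ** (?iT \<star> h)))" for h
 have \<phi>_hom: "\<phi> f : Hom C A (X \<boxtimes> B)" if "f : Hom C (T \<boxtimes> A) B" for f
  using that ty by (simp add: \<phi>_def hom_iff)
 have \<psi>_hom: "\<psi> h : Hom C (T \<boxtimes> A) B" if "h : Hom C A (X \<boxtimes> B)" for h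
  using that ty by (simp add: \<psi>_def hom_iff)
 have invA: "inverse_of C (Assoc C T X Z') ** (?iT \<star> (?iX \<star> f)) = (Ident C (T \<boxtimes> X) \<star> f) ** inverse_of C (Assoc C T X Z)"
  if f: "f : Hom C Z Z'" for f Z Z'
 proof (rule iso_cancel_left[of "Assoc C T X Z'"])
  have ob: "Z : Obj C" "Z' : Obj C" using hom_obj[OF f] by auto
  show "Assoc C T X Z' ** (inverse_of C (Assoc C T X Z') ** (?iT \<star> (?iX \<star> f)))
    = Assoc C T X Z' ** ((Ident C (T \<boxtimes> X) \<star> f) ** inverse_of C (Assoc C T X Z))"
   using comp_cong2[OF Assoc_nat[of ?iT ?iX f], of "inverse_of C (Assoc C T X Z)"] f ob ty by (simp add: hom_iff)
 qed (use hom_obj[OF f] f ty in "auto simp: hom_iff")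
 have \<psi>\<phi>: "\<psi> (\<phi> f) = f" if f: "f : Hom C (T \<boxtimes> A) B" for f
 proof -
  let ?TA = "T \<boxtimes> A" and ?iA = "Ident C A"
  note f' = f[unfolded hom_iff]
  let ?w = "Assoc C X T A ** ((coev \<star> ?iA) ** inverse_of C (Lunit C A))"
  have w: "?w : Arr C" "Dom C ?w = A" "Cod C ?w = X \<boxtimes> ?TA" using ty by auto
  let ?E = "Lunit C ?TA ** ((ev \<star> Ident C ?TA) ** (inverse_of C (Assoc C T X ?TA) ** (?iT \<star> ?w)))"
  have s1: "?iT \<star> \<phi> f = (?iT \<star> (?iX \<star> f)) ** (?iT \<star> ?w)"
   unfolding \<phi>_def using f' w ty by (subst TensA_Ident_Comp) auto
  have s2: "(ev \<star> Ident C B) ** (Ident C (T \<boxtimes> X) \<star> f) = (Ident C ?u \<star> f) ** (ev \<star> Ident C ?TA)"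
   using f' ty by (simp add: interchange)
  have "\<psi> (\<phi> f) = Lunit C B ** ((ev \<star> Ident C B) ** ((Ident C (T \<boxtimes> X) \<star> f) ** (inverse_of C (Assoc C T X ?TA) ** (?iT \<star> ?w))))"
   unfolding \<psi>_def s1 by (subst comp_cong2[OF invA[OF f]]) (use f' w ty in auto)
  also have "... = Lunit C B ** ((Ident C ?u \<star> f) ** ((ev \<star> Ident C ?TA) ** (inverse_of C (Assoc C T X ?TA) ** (?iT \<star> ?w))))"
   by (subst comp_cong2[OF s2]) (use f' w ty in auto)
  also have "... = f ** ?E"
   by (subst comp_cong2[of "Lunit C B" "Ident C ?u \<star> f" f "Lunit C ?TA"])
    (use Lunit_nat[of f] f' w ty in auto)
  also have "?E = Ident C ?TA"
  proof -
   have tr: "?iT \<star> inverse_of C (Lunit C A) = Assoc C T ?u A ** (inverse_of C (Runit C T) \<star> ?iA)"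
   proof (rule iso_cancel_left[of "?iT \<star> Lunit C A"])
    have "(?iT \<star> Lunit C A) ** (Assoc C T ?u A ** (inverse_of C (Runit C T) \<star> ?iA))
      = (Runit C T \<star> ?iA) ** (inverse_of C (Runit C T) \<star> ?iA)"
     by (rule comp_cong_left[OF triangle]) (use ty in auto)
    then show "(?iT \<star> Lunit C A) ** (?iT \<star> inverse_of C (Lunit C A))
      = (?iT \<star> Lunit C A) ** (Assoc C T ?u A ** (inverse_of C (Runit C T) \<star> ?iA))"
     using ty by (simp add: interchange)
   qed (use ty TensA_iso in auto)
   have n1: "(?iT \<star> (coev \<star> ?iA)) ** Assoc C T ?u A = Assoc C T (X \<boxtimes> T) A ** ((?iT \<star> coev) \<star> ?iA)"
    using Assoc_nat[of ?iT coev ?iA] ty by simp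
   have pe: "(?iT \<star> Assoc C X T A) ** Assoc C T (X \<boxtimes> T) A
     = Assoc C T X ?TA ** (Assoc C (T \<boxtimes> X) T A ** (inverse_of C (Assoc C T X T) \<star> ?iA))"
   proof (rule iso_cancel_right[of "Assoc C T X T \<star> ?iA"])
    show "(?iT \<star> Assoc C X T A) ** Assoc C T (X \<boxtimes> T) A ** (Assoc C T X T \<star> ?iA)
      = Assoc C T X ?TA ** (Assoc C (T \<boxtimes> X) T A ** (inverse_of C (Assoc C T X T) \<star> ?iA)) ** (Assoc C T X T \<star> ?iA)"
     using pentagon[of T X T A] ty by (simp add: comp_assoc interchange)
   qed (use ty TensA_iso in auto)
   have n2: "(ev \<star> Ident C ?TA) ** Assoc C (T \<boxtimes> X) T A = Assoc C ?u T A ** ((ev \<star> ?iT) \<star> ?iA)"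
    using Assoc_nat[of ev ?iT ?iA] ty by simp
   have e1: "?iT \<star> ?w = (?iT \<star> Assoc C X T A) ** ((?iT \<star> (coev \<star> ?iA)) ** (Assoc C T ?u A ** (inverse_of C (Runit C T) \<star> ?iA)))"
    unfolding tr[symmetric] using ty by (simp add: TensA_Ident_Comp)
   also have "... = (?iT \<star> Assoc C X T A) ** (Assoc C T (X \<boxtimes> T) A ** (((?iT \<star> coev) \<star> ?iA) ** (inverse_of C (Runit C T) \<star> ?iA)))"
    by (subst comp_cong2[OF n1]) (use ty in auto)
   also have "... = Assoc C T X ?TA ** ((Assoc C (T \<boxtimes> X) T A ** (inverse_of C (Assoc C T X T) \<star> ?iA)) ** (((?iT \<star> coev) \<star> ?iA) ** (inverse_of C (Runit C T) \<star> ?iA)))"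
    by (subst comp_cong2[OF pe]) (use ty in auto)
   finally have "?E = Lunit C ?TA ** ((ev \<star> Ident C ?TA) ** (Assoc C (T \<boxtimes> X) T A ** ((inverse_of C (Assoc C T X T) \<star> ?iA) ** (((?iT \<star> coev) \<star> ?iA) ** (inverse_of C (Runit C T) \<star> ?iA)))))"
    using ty by (simp add: comp_assoc)
   also have "... = Lunit C ?TA ** (Assoc C ?u T A ** (((ev \<star> ?iT) \<star> ?iA) ** ((inverse_of C (Assoc C T X T) \<star> ?iA) ** (((?iT \<star> coev) \<star> ?iA) ** (inverse_of C (Runit C T) \<star> ?iA)))))"
    by (subst comp_cong2[OF n2]) (use ty in auto)
   also have "... = (Lunit C T \<star> ?iA) ** (((ev \<star> ?iT) \<star> ?iA) ** ((inverse_of C (Assoc C T X T) \<star> ?iA) ** (((?iT \<star> coev) \<star> ?iA) ** (inverse_of C (Runit C T) \<star> ?iA))))"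
    by (rule comp_cong_left[OF Lunit_TensO]) (use ty in auto)
   also have "... = (Lunit C T ** ((ev \<star> ?iT) ** (inverse_of C (Assoc C T X T) ** ((?iT \<star> coev) ** inverse_of C (Runit C T))))) \<star> ?iA"
    using ty by (simp add: TensA_Ident_Comp)
   finally show ?thesis unfolding zT' using ty by simp
  qed
  finally show ?thesis using f' ty by simp
 qed
 have \<phi>\<psi>: "\<phi> (\<psi> h) = h" if h: "h : Hom C A (X \<boxtimes> B)" for h
 proof -
  let ?XB = "X \<boxtimes> B" and ?iA = "Ident C A" and ?iB = "Ident C B"
  note h' = h[unfolded hom_iff]
  let ?v = "Lunit C B ** ((ev \<star> ?iB) ** inverse_of C (Assoc C T X B))"
  have v: "?v : Arr C" "Dom C ?v = T \<boxtimes> ?XB" "Cod C ?v = B" using ty by auto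
  let ?E = "(?iX \<star> ?v) ** (Assoc C X T ?XB ** ((coev \<star> Ident C ?XB) ** inverse_of C (Lunit C ?XB)))"
  have "\<psi> h = ?v ** (?iT \<star> h)" unfolding \<psi>_def using h' ty by (simp add: comp_assoc)
  then have s1: "?iX \<star> \<psi> h = (?iX \<star> ?v) ** (?iX \<star> (?iT \<star> h))"
   using h' v ty by (simp add: TensA_Ident_Comp)
  have s2: "(?iX \<star> (?iT \<star> h)) ** Assoc C X T A = Assoc C X T ?XB ** (Ident C (X \<boxtimes> T) \<star> h)"
   using Assoc_nat[of ?iX ?iT h] h' ty by simp
  have s3: "(Ident C (X \<boxtimes> T) \<star> h) ** (coev \<star> ?iA) = (coev \<star> Ident C ?XB) ** (Ident C ?u \<star> h)"
   using h' ty by (simp add: interchange)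
  have s4: "(Ident C ?u \<star> h) ** inverse_of C (Lunit C A) = inverse_of C (Lunit C ?XB) ** h"
  proof (rule iso_cancel_left[of "Lunit C ?XB"])
   show "Lunit C ?XB ** ((Ident C ?u \<star> h) ** inverse_of C (Lunit C A)) = Lunit C ?XB ** (inverse_of C (Lunit C ?XB) ** h)"
    using comp_cong2[OF Lunit_nat[of h], of "inverse_of C (Lunit C A)"] h' ty by simp
  qed (use h' ty in auto)
  have "\<phi> (\<psi> h) = (?iX \<star> ?v) ** ((?iX \<star> (?iT \<star> h)) ** (Assoc C X T A ** ((coev \<star> ?iA) ** inverse_of C (Lunit C A))))"
   unfolding \<phi>_def s1 using h' v ty by (simp add: comp_assoc)
  also have "... = (?iX \<star> ?v) ** (Assoc C X T ?XB ** ((Ident C (X \<boxtimes> T) \<star> h) ** ((coev \<star> ?iA) ** inverse_of C (Lunit C A))))"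
   by (subst comp_cong2[OF s2]) (use h' ty in auto)
  also have "... = (?iX \<star> ?v) ** (Assoc C X T ?XB ** ((coev \<star> Ident C ?XB) ** ((Ident C ?u \<star> h) ** inverse_of C (Lunit C A))))"
   by (subst comp_cong2[OF s3]) (use h' ty in auto)
  also have "... = ?E ** h" unfolding s4 using h' v ty by (simp add: comp_assoc)
  also have "?E = Ident C ?XB"
  proof -
   have k: "inverse_of C (Lunit C ?XB) = Assoc C ?u X B ** (inverse_of C (Lunit C X) \<star> ?iB)"
   proof (rule iso_cancel_left[of "Lunit C ?XB"])
    have "Lunit C ?XB ** (Assoc C ?u X B ** (inverse_of C (Lunit C X) \<star> ?iB)) = (Lunit C X \<star> ?iB) ** (inverse_of C (Lunit C X) \<star> ?iB)"
     by (rule comp_cong_left[OF Lunit_TensO]) (use ty in auto)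
    then show "Lunit C ?XB ** inverse_of C (Lunit C ?XB) = Lunit C ?XB ** (Assoc C ?u X B ** (inverse_of C (Lunit C X) \<star> ?iB))"
     using ty by (simp add: interchange)
   qed (use ty in auto)
   have n1: "(coev \<star> Ident C ?XB) ** Assoc C ?u X B = Assoc C (X \<boxtimes> T) X B ** ((coev \<star> ?iX) \<star> ?iB)"
    using Assoc_nat[of coev ?iX ?iB] ty by simp
   have pe: "Assoc C X T ?XB ** Assoc C (X \<boxtimes> T) X B
     = (?iX \<star> Assoc C T X B) ** (Assoc C X (T \<boxtimes> X) B ** (Assoc C X T X \<star> ?iB))"
    using pentagon[of X T X B] ty by (simp add: comp_assoc)
   have n2: "(?iX \<star> (ev \<star> ?iB)) ** Assoc C X (T \<boxtimes> X) B = Assoc C X ?u B ** ((?iX \<star> ev) \<star> ?iB)"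
    using Assoc_nat[of ?iX ev ?iB] ty by simp
   have vi: "(?iX \<star> ?v) ** (?iX \<star> Assoc C T X B) = (?iX \<star> Lunit C B) ** (?iX \<star> (ev \<star> ?iB))"
    using ty by (simp add: TensA_Ident_Comp comp_assoc)
   have "?E = (?iX \<star> ?v) ** (Assoc C X T ?XB ** ((coev \<star> Ident C ?XB) ** (Assoc C ?u X B ** (inverse_of C (Lunit C X) \<star> ?iB))))"
    unfolding k by simp
   also have "... = (?iX \<star> ?v) ** (Assoc C X T ?XB ** (Assoc C (X \<boxtimes> T) X B ** (((coev \<star> ?iX) \<star> ?iB) ** (inverse_of C (Lunit C X) \<star> ?iB))))"
    by (subst comp_cong2[OF n1]) (use ty in auto)
   also have "... = (?iX \<star> ?v) ** ((?iX \<star> Assoc C T X B) ** ((Assoc C X (T \<boxtimes> X) B ** (Assoc C X T X \<star> ?iB)) ** (((coev \<star> ?iX) \<star> ?iB) ** (inverse_of C (Lunit C X) \<star> ?iB))))"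
    by (subst comp_cong2[OF pe]) (use ty in auto)
   also have "... = (?iX \<star> Lunit C B) ** ((?iX \<star> (ev \<star> ?iB)) ** (Assoc C X (T \<boxtimes> X) B ** ((Assoc C X T X \<star> ?iB) ** (((coev \<star> ?iX) \<star> ?iB) ** (inverse_of C (Lunit C X) \<star> ?iB)))))"
    by (subst comp_cong2[OF vi]) (use v ty in "auto simp: comp_assoc")
   also have "... = (?iX \<star> Lunit C B) ** (Assoc C X ?u B ** (((?iX \<star> ev) \<star> ?iB) ** ((Assoc C X T X \<star> ?iB) ** (((coev \<star> ?iX) \<star> ?iB) ** (inverse_of C (Lunit C X) \<star> ?iB)))))"
    by (subst comp_cong2[OF n2]) (use ty in auto)
   also have "... = (Runit C X \<star> ?iB) ** (((?iX \<star> ev) \<star> ?iB) ** ((Assoc C X T X \<star> ?iB) ** (((coev \<star> ?iX) \<star> ?iB) ** (inverse_of C (Lunit C X) \<star> ?iB))))"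
    by (rule comp_cong_left[OF triangle]) (use ty in auto)
   also have "... = (Runit C X ** ((?iX \<star> ev) ** (Assoc C X T X ** ((coev \<star> ?iX) ** inverse_of C (Lunit C X))))) \<star> ?iB"
    using ty by (simp add: TensA_Ident_Comp)
   finally show ?thesis unfolding zX' using ty by simp
  qed
  finally show ?thesis using h' ty by simp
 qed
 have "bij_betw \<phi> (Hom C (T \<boxtimes> A) B) (Hom C A (X \<boxtimes> B))"
  by (rule bij_betwI[where g = \<psi>]) (use \<phi>_hom \<psi>_hom \<psi>\<phi> \<phi>\<psi> in auto)
 then show ?thesis unfolding \<phi>_def .
qed

end

context tensor_category
begin

lemma TensA_linear_functor:
 assumes "T : Obj C"
 shows "linear_functor C C (\<lambda>X. T \<boxtimes> X) (\<lambda>f. Ident C T \<star> f)" and "linear_functor C C (\<lambda>X. X \<boxtimes> T) (\<lambda>f. f \<star> Ident C T)"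
proof -
 have T: "Ident C T : Hom C T T" by (rule Ident_hom[OF assms])
 show "linear_functor C C (\<lambda>X. T \<boxtimes> X) (\<lambda>f. Ident C T \<star> f)"
  by unfold_locales (use assms T TensA_hom TensA_Add_right TensA_Scale_right in "auto simp: TensA_Ident_Comp hom_iff")
 show "linear_functor C C (\<lambda>X. X \<boxtimes> T) (\<lambda>f. f \<star> Ident C T)"
  by unfold_locales (use assms T TensA_hom TensA_Add_left TensA_Scale_left in "auto simp: TensA_Ident_Comp hom_iff")
qed

lemma TensA_Zero:
 assumes "f : Hom C X Y" "A : Obj C" "B : Obj C"
 shows "f \<star> Zero C A B = Zero C (X \<boxtimes> A) (Y \<boxtimes> B)" "Zero C A B \<star> f = Zero C (A \<boxtimes> X) (B \<boxtimes> Y)"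
 using TensA_Scale_right[OF assms(1) Zero_hom[OF assms(2,3)], of 0]
  TensA_Scale_left[OF Zero_hom[OF assms(2,3)] assms(1), of 0] assms hom_obj[OF assms(1)]
 by (simp_all add: hom_iff)

lemma Unit_nonzero: "Ident C (Unit C) \<noteq> Zero C (Unit C) (Unit C)"
proof
 assume "Ident C (Unit C) = Zero C (Unit C) (Unit C)"
 then have "Scale C 0 (Ident C (Unit C)) = Scale C 1 (Ident C (Unit C))" by simp
 moreover have "inj (\<lambda>c. Scale C c (Ident C (Unit C)))" using End_Unit by (simp add: bij_betw_def)
 ultimately have "(0::'k) = 1" by (rule injD[rotated])
 then show False by simp
qed

text \<open>If \<open>ev\<close> vanished, the zigzag identities would make the identities of both objects zero.\<close>

lemma evaluation_nonzero:
 assumes d: "is_dual C T X ev coev" and nz: "Ident C T \<noteq> Zero C T T \<or> Ident C X \<noteq> Zero C X X"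
 shows "ev \<noteq> Zero C (T \<boxtimes> X) (Unit C)"
proof
 assume z: "ev = Zero C (T \<boxtimes> X) (Unit C)"
 have T: "T : Obj C" and X: "X : Obj C"
  and coev: "coev : Arr C" "Dom C coev = Unit C" "Cod C coev = X \<boxtimes> T"
  and zX: "Runit C X ** (Ident C X \<star> ev) ** Assoc C X T X ** (coev \<star> Ident C X) ** inverse_of C (Lunit C X) = Ident C X"
  and zT: "Lunit C T ** (ev \<star> Ident C T) ** inverse_of C (Assoc C T X T) ** (Ident C T \<star> coev)
    ** inverse_of C (Runit C T) = Ident C T"
  using d by (auto simp: is_dual_def hom_iff)
 have "Ident C X \<star> ev = Zero C (X \<boxtimes> (T \<boxtimes> X)) (X \<boxtimes> Unit C)"
  unfolding z by (rule TensA_Zero) (use T X Ident_hom in auto)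
 then have "Ident C X = Zero C X X" using zX T X coev by simp
 moreover have "ev \<star> Ident C T = Zero C ((T \<boxtimes> X) \<boxtimes> T) (Unit C \<boxtimes> T)"
  unfolding z by (rule TensA_Zero) (use T X Ident_hom in auto)
 then have "Ident C T = Zero C T T" using zT T X coev by simp
 ultimately show False using nz by simp
qed

end

section \<open>Frobenius-Perron dimension of fusion categories\<close>

context fusion_category
begin

text \<open>Every endomorphism of \<open>1\<close> is a scalar.  For a simple summand \<open>S\<close> of \<open>1\<close> the idempotent with image
  \<open>S\<close> is a nonzero scalar, hence the identity.\<close>

lemma Unit_simple: "is_simple C (Unit C)"
proof -
 let ?u = "Unit C"
 obtain n S i p where S: "\<And>k. k : {..<n::nat} ==> S k : {X. is_simple C X}" and d: "direct_sum_over C {..<n} S ?u i p"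
  using obtain_decomposition[OF Unit_obj] by metis
 have "n \<noteq> 0"
  using direct_sum_empty_zero[of S ?u i p] d Unit_nonzero by (cases n) (auto simp: zero_obj_iff)
 then have 0: "0 : {..<n}" by simp
 note D = direct_sum_overD[OF d]
 note ar = D(4)[OF 0, unfolded hom_iff] D(5)[OF 0, unfolded hom_iff]
 have "i 0 ** p 0 : Hom C ?u ?u" using ar by (simp add: hom_iff)
 then obtain c where c: "i 0 ** p 0 = Scale C c (Ident C ?u)" using End_Unit by (auto simp: bij_betw_def)
 have "p 0 ** (i 0 ** p 0) = p 0" using comp_cong_left[OF D(6)[OF 0], of "p 0"] ar by simp
 then have 1: "Scale C c (p 0) = p 0" unfolding c using ar by simp
 have pnz: "p 0 \<noteq> Zero C ?u (S 0)"
 proof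
  assume "p 0 = Zero C ?u (S 0)"
  then have "Ident C (S 0) = Zero C (S 0) (S 0)" using D(6)[OF 0] ar D(3)[OF 0] by simp
  then show False using S[OF 0] D(3)[OF 0] by (simp add: is_simple_def zero_obj_iff)
 qed
 have "c = 1"
 proof (rule ccontr)
  assume "c \<noteq> 1"
  have "Scale C (c - 1) (p 0) = Add C (Scale C c (p 0)) (Scale C (-1) (p 0))"
   using Scale_add_left[of "p 0" c "-1"] ar by simp
  then have "Scale C (c - 1) (p 0) = Zero C (Dom C (p 0)) (Cod C (p 0))"
   unfolding 1 using Add_Scale_minus ar by simp
  then show False using Scale_eq_Zero[of "p 0" "c - 1"] \<open>c \<noteq> 1\<close> pnz ar by simp
 qed
 then have "is_iso C (i 0)" by (intro isoI[OF D(4)[OF 0] D(5)[OF 0] D(6)[OF 0]]) (simp add: c)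
 then have "isomorphic C (S 0) ?u" using D(4)[OF 0] unfolding isomorphic_def by blast
 then show ?thesis using simple_isomorphic S[OF 0] by blast
qed

definition fusion_coeff :: "'o set => 'o set => 'o set => real" where
 "fusion_coeff X T U = real (hom_dim C (class_rep U) (class_rep X \<boxtimes> class_rep T))"

lemma hom_dim_TensO_left:
 assumes "is_simple C U" "X : Obj C" "Y : Obj C"
 shows "hom_dim C U (X \<boxtimes> Y) = (\<Sum>T\<in>simple_classes C. hom_dim C (class_rep T) X * hom_dim C U (class_rep T \<boxtimes> Y))"
 using additive_functor_multiplicity[OF fusion_category_axioms split_semisimple_category_axioms
   TensA_linear_functor(2)[OF assms(3)] assms(2)] assms(1) by simp

lemma hom_dim_TensO_right:
 assumes "is_simple C U" "X : Obj C" "Y : Obj C"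
 shows "hom_dim C U (X \<boxtimes> Y) = (\<Sum>T\<in>simple_classes C. hom_dim C (class_rep T) Y * hom_dim C U (X \<boxtimes> class_rep T))"
 using additive_functor_multiplicity[OF fusion_category_axioms split_semisimple_category_axioms
   TensA_linear_functor(1)[OF assms(2)] assms(3)] assms(1) by simp

lemma hom_dim_class_rep:
 "S : simple_classes C ==> T : simple_classes C ==>
  hom_dim C (class_rep S) (class_rep T) = (if S = T then 1 else 0)"
 using hom_dim_B class_rep_inject class_rep_simple by simp

lemma Unit_class: "iso_class C (Unit C) : simple_classes C" "isomorphic C (Unit C) (class_rep (iso_class C (Unit C)))"
 using Unit_simple iso_class_simple class_rep_iso_class by auto

lemma hom_dim_dual:
 assumes d: "is_dual C T X ev coev" and A: "A : Obj C" and B: "B : Obj C"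
 shows "hom_dim C (T \<boxtimes> A) B = hom_dim C A (X \<boxtimes> B)"
proof (rule linear_bijection_hom_dim[OF _ _ _ dual_adjunction[OF d A B]])
 have T: "T : Obj C" and X: "X : Obj C" and coev: "coev : Arr C" "Dom C coev = Unit C" "Cod C coev = X \<boxtimes> T"
  using d by (auto simp: is_dual_def hom_iff)
 show "vectorspace class_ring (hom_space C (T \<boxtimes> A) B)" "vectorspace class_ring (hom_space C A (X \<boxtimes> B))"
  "vectorspace.fin_dim class_ring (hom_space C (T \<boxtimes> A) B)"
  using hom_vectorspace hom_fin_dim T X A B by auto
 let ?w = "Assoc C X T A ** ((coev \<star> Ident C A) ** inverse_of C (Lunit C A))"
 have w: "?w : Arr C" "Dom C ?w = A" "Cod C ?w = X \<boxtimes> (T \<boxtimes> A)" using T X A coev by auto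
 fix f assume f: "f : Hom C (T \<boxtimes> A) B"
 show "(Ident C X \<star> Scale C c f) ** ?w = Scale C c ((Ident C X \<star> f) ** ?w)" for c
  using TensA_Scale_right[OF Ident_hom[OF X] f] w f X by (simp add: hom_iff)
 fix g assume g: "g : Hom C (T \<boxtimes> A) B"
 show "(Ident C X \<star> Add C f g) ** ?w = Add C ((Ident C X \<star> f) ** ?w) ((Ident C X \<star> g) ** ?w)"
  unfolding TensA_Add_right[OF Ident_hom[OF X] f g] using w f g X by (intro Comp_Add) (auto simp: hom_iff)
qed

lemma retract_hom_dim_pos:
 assumes U: "is_simple C U" and s: "s : Hom C U X" and r: "r : Hom C X U" "r ** s = Ident C U"
 shows "hom_dim C U X > 0"
proof -
 have ob: "U : Obj C" "X : Obj C" using hom_obj[OF s] by auto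
 have "s \<noteq> Zero C U X"
 proof
  assume "s = Zero C U X"
  then have "Ident C U = Zero C U U" using r ob by (simp add: hom_iff)
  then show False using U ob by (simp add: is_simple_def zero_obj_iff)
 qed
 then show ?thesis using hom_dim_pos_iff[of U X] U s ob by auto
qed

text \<open>As \<open>1\<close> is simple, a nonzero evaluation splits, so \<open>U\<close> is a summand of \<open>(T \<otimes> T') \<otimes> U\<close> and of
  \<open>U \<otimes> (T' \<otimes> T)\<close>.\<close>

lemma summand_of_tensor:
 assumes U: "is_simple C U" and e: "e : Hom C Z (Unit C)" "e \<noteq> Zero C Z (Unit C)"
 shows "hom_dim C U (Z \<boxtimes> U) > 0" "hom_dim C U (U \<boxtimes> Z) > 0"
proof -
 obtain x where x: "x : Hom C (Unit C) Z" "e ** x = Ident C (Unit C)"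
  using obtain_pivot[OF e] Unit_simple by auto
 have ob: "U : Obj C" "Z : Obj C" using U hom_obj[OF e(1)] by (auto simp: is_simple_def)
 note ar = x(1)[unfolded hom_iff] e(1)[unfolded hom_iff]
 have m: "(e \<star> Ident C U) ** (x \<star> Ident C U) = Ident C (Unit C \<boxtimes> U)"
  "(Ident C U \<star> e) ** (Ident C U \<star> x) = Ident C (U \<boxtimes> Unit C)"
  using ar x(2) ob by (simp_all add: interchange)
 show "hom_dim C U (Z \<boxtimes> U) > 0"
 proof (rule retract_hom_dim_pos[OF U])
  show "(x \<star> Ident C U) ** inverse_of C (Lunit C U) : Hom C U (Z \<boxtimes> U)"
   "Lunit C U ** (e \<star> Ident C U) : Hom C (Z \<boxtimes> U) U" using ar ob by (auto simp: hom_iff)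
  show "Lunit C U ** (e \<star> Ident C U) ** ((x \<star> Ident C U) ** inverse_of C (Lunit C U)) = Ident C U"
   using comp_cong_left[OF m(1), of "inverse_of C (Lunit C U)"] ar ob by (simp add: comp_assoc)
 qed
 show "hom_dim C U (U \<boxtimes> Z) > 0"
 proof (rule retract_hom_dim_pos[OF U])
  show "(Ident C U \<star> x) ** inverse_of C (Runit C U) : Hom C U (U \<boxtimes> Z)"
   "Runit C U ** (Ident C U \<star> e) : Hom C (U \<boxtimes> Z) U" using ar ob by (auto simp: hom_iff)
  show "Runit C U ** (Ident C U \<star> e) ** ((Ident C U \<star> x) ** inverse_of C (Runit C U)) = Ident C U"
   using comp_cong_left[OF m(2), of "inverse_of C (Runit C U)"] ar ob by (simp add: comp_assoc)
 qed
qed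

lemma simple_TensO_trans_right:
 assumes "is_simple C T" "is_simple C U" shows "\<exists>W\<in>simple_classes C. hom_dim C U (T \<boxtimes> class_rep W) > 0"
proof -
 have T: "T : Obj C" "Ident C T \<noteq> Zero C T T" and U: "U : Obj C"
  using assms by (auto simp: is_simple_def zero_obj_iff)
 obtain T' ev coev where d: "is_dual C T T' ev coev" using right_duals[OF T(1)] by blast
 then have T': "T' : Obj C" and ev: "ev : Hom C (T \<boxtimes> T') (Unit C)" by (auto simp: is_dual_def)
 have "hom_dim C U ((T \<boxtimes> T') \<boxtimes> U) > 0"
  using summand_of_tensor(1)[OF assms(2) ev] evaluation_nonzero[OF d] T by simp
 then have "hom_dim C U (T \<boxtimes> (T' \<boxtimes> U)) > 0"
  using hom_dim_iso_target[OF _ isomorphic_Assoc[OF T(1) T' U], of U] assms by simp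
 then have "(\<Sum>W\<in>simple_classes C. hom_dim C (class_rep W) (T' \<boxtimes> U) * hom_dim C U (T \<boxtimes> class_rep W)) \<noteq> 0"
  using hom_dim_TensO_right[OF assms(2) T(1), of "T' \<boxtimes> U"] T' U by simp
 then show ?thesis by (rule contrapos_np) (auto intro: sum.neutral)
qed

lemma simple_TensO_trans_left:
 assumes "is_simple C T" "is_simple C U" shows "\<exists>W\<in>simple_classes C. hom_dim C U (class_rep W \<boxtimes> T) > 0"
proof -
 have T: "T : Obj C" "Ident C T \<noteq> Zero C T T" and U: "U : Obj C"
  using assms by (auto simp: is_simple_def zero_obj_iff)
 obtain T' ev coev where d: "is_dual C T' T ev coev" using left_duals[OF T(1)] by blast
 then have T': "T' : Obj C" and ev: "ev : Hom C (T' \<boxtimes> T) (Unit C)" by (auto simp: is_dual_def)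
 have "hom_dim C U (U \<boxtimes> (T' \<boxtimes> T)) > 0"
  using summand_of_tensor(2)[OF assms(2) ev] evaluation_nonzero[OF d] T by simp
 then have "hom_dim C U ((U \<boxtimes> T') \<boxtimes> T) > 0"
  using hom_dim_iso_target[OF _ isomorphic_Assoc[OF U T' T(1)], of U] assms by simp
 then have "(\<Sum>W\<in>simple_classes C. hom_dim C (class_rep W) (U \<boxtimes> T') * hom_dim C U (class_rep W \<boxtimes> T)) \<noteq> 0"
  using hom_dim_TensO_left[OF assms(2) _ T(1), of "U \<boxtimes> T'"] T' U by simp
 then show ?thesis by (rule contrapos_np) (auto intro: sum.neutral)
qed

text \<open>Transitivity and adjointness both come from duality: an evaluation is a nonzero arrow from
  \<open>T \<otimes> T'\<close> to \<open>1\<close>, and \<open>Hom(T \<otimes> A, B) \<cong> Hom(A, X \<otimes> B)\<close> for a right dual \<open>X\<close> of \<open>T\<close>.\<close>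

lemma fusion_based_ring: "based_ring (simple_classes C) (iso_class C (Unit C)) fusion_coeff"
proof
 let ?L = "simple_classes C" and ?e = "iso_class C (Unit C)"
 note rep = class_rep_simple
 show "finite ?L" by (rule finite_simple_classes)
 show "?e : ?L" by (rule Unit_class)
 show "fusion_coeff X T U \<ge> 0" for X T U by (simp add: fusion_coeff_def)
 fix T U assume T: "T : ?L" and U: "U : ?L"
 have ob: "class_rep T : Obj C" using rep(2)[OF T] .
 have "isomorphic C (class_rep ?e \<boxtimes> class_rep T) (class_rep T)"
  using isomorphic_TensO[OF isomorphic_sym[OF Unit_class(2)] isomorphic_refl[OF ob]] isomorphic_Lunit[OF ob]
   isomorphic_trans by blast
 then show "fusion_coeff ?e T U = (if T = U then 1 else 0)"
  using hom_dim_iso_target[of "class_rep U"] rep(1)[OF U] hom_dim_class_rep[OF U T] by (auto simp: fusion_coeff_def)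
 have "isomorphic C (class_rep T \<boxtimes> class_rep ?e) (class_rep T)"
  using isomorphic_TensO[OF isomorphic_refl[OF ob] isomorphic_sym[OF Unit_class(2)]] isomorphic_Runit[OF ob]
   isomorphic_trans by blast
 then show "fusion_coeff T ?e U = (if T = U then 1 else 0)"
  using hom_dim_iso_target[of "class_rep U"] rep(1)[OF U] hom_dim_class_rep[OF U T] by (auto simp: fusion_coeff_def)
 show "\<exists>X\<in>?L. fusion_coeff T X U > 0" "\<exists>X\<in>?L. fusion_coeff X T U > 0"
  using simple_TensO_trans_right simple_TensO_trans_left rep(1) T U by (auto simp: fusion_coeff_def)
next
 let ?L = "simple_classes C"
 note rep = class_rep_simple
 fix X T Y U assume *: "X : ?L" "T : ?L" "Y : ?L" "U : ?L"
 note ob = rep(2)[OF *(1)] rep(2)[OF *(2)] rep(2)[OF *(3)]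
 have "(\<Sum>W\<in>?L. fusion_coeff X T W * fusion_coeff W Y U)
   = real (hom_dim C (class_rep U) ((class_rep X \<boxtimes> class_rep T) \<boxtimes> class_rep Y))"
  using hom_dim_TensO_left[OF rep(1)[OF *(4)], of "class_rep X \<boxtimes> class_rep T" "class_rep Y"] ob
  by (simp add: fusion_coeff_def)
 also have "... = real (hom_dim C (class_rep U) (class_rep X \<boxtimes> (class_rep T \<boxtimes> class_rep Y)))"
  using hom_dim_iso_target[OF _ isomorphic_Assoc[OF ob]] rep(1)[OF *(4)] by simp
 also have "... = (\<Sum>W\<in>?L. fusion_coeff T Y W * fusion_coeff X W U)"
  using hom_dim_TensO_right[OF rep(1)[OF *(4)], of "class_rep X" "class_rep T \<boxtimes> class_rep Y"] ob
  by (simp add: fusion_coeff_def)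
 finally show "(\<Sum>W\<in>?L. fusion_coeff X T W * fusion_coeff W Y U) = (\<Sum>W\<in>?L. fusion_coeff T Y W * fusion_coeff X W U)" .
next
 let ?L = "simple_classes C"
 note rep = class_rep_simple
 fix T assume T: "T : ?L"
 obtain X ev coev where d: "is_dual C (class_rep T) X ev coev" using right_duals[OF rep(2)[OF T]] by blast
 have X: "X : Obj C" using d by (simp add: is_dual_def)
 show "\<exists>x. (\<forall>S\<in>?L. x S \<ge> 0) \<and> (\<forall>A\<in>?L. \<forall>B\<in>?L. fusion_coeff T A B = (\<Sum>S\<in>?L. x S * fusion_coeff S B A))"
 proof (rule exI[of _ "\<lambda>S. real (hom_dim C (class_rep S) X)"], intro conjI ballI)
  fix A B assume A: "A : ?L" and B: "B : ?L"
  have "hom_dim C (class_rep B) (class_rep T \<boxtimes> class_rep A) = hom_dim C (class_rep T \<boxtimes> class_rep A) (class_rep B)"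
   using hom_dim_flip[of "class_rep B" "class_rep T \<boxtimes> class_rep A"] rep[OF A] rep[OF B] rep[OF T] by simp
  also have "... = hom_dim C (class_rep A) (X \<boxtimes> class_rep B)"
   by (rule hom_dim_dual[OF d rep(2)[OF A] rep(2)[OF B]])
  also have "... = (\<Sum>S\<in>?L. hom_dim C (class_rep S) X * hom_dim C (class_rep A) (class_rep S \<boxtimes> class_rep B))"
   by (rule hom_dim_TensO_left[OF rep(1)[OF A] X rep(2)[OF B]])
  finally show "fusion_coeff T A B = (\<Sum>S\<in>?L. real (hom_dim C (class_rep S) X) * fusion_coeff S B A)"
   by (simp add: fusion_coeff_def)
 qed simp
qed

abbreviation fp_dim :: "'o set => real" where
 "fp_dim \<equiv> based_ring.dim (simple_classes C) (iso_class C (Unit C)) fusion_coeff"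

lemma left_mult_matrix_eq:
 assumes X: "X : Obj C" and U: "U : simple_classes C" and T: "T : simple_classes C"
 shows "of_int (left_mult_matrix C X U T) = (\<Sum>S\<in>simple_classes C. real (hom_dim C (class_rep S) X) * fusion_coeff S T U)"
proof -
 let ?L = "simple_classes C"
 note rep = class_rep_simple
 have "left_mult_matrix C X U T = (\<Sum>S\<in>?L. \<Sum>T'\<in>?L. gr_class C X S * gr_class C (class_rep T) T' *
   gr_class C (class_rep S \<boxtimes> class_rep T') U)"
  by (simp add: left_mult_matrix_def grothendieck_ring_def)
 also have "... = (\<Sum>S\<in>?L. gr_class C X S * gr_class C (class_rep S \<boxtimes> class_rep T) U)"
 proof (rule sum.cong[OF refl])
  fix S assume S: "S : ?L"
  have "(\<Sum>T'\<in>?L. gr_class C X S * gr_class C (class_rep T) T' * gr_class C (class_rep S \<boxtimes> class_rep T') U)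
    = (\<Sum>T'\<in>?L. if T' = T then gr_class C X S * gr_class C (class_rep S \<boxtimes> class_rep T) U else 0)"
   using rep(2)[OF T] hom_dim_class_rep T by (intro sum.cong) (auto simp: gr_class_eq)
  then show "(\<Sum>T'\<in>?L. gr_class C X S * gr_class C (class_rep T) T' * gr_class C (class_rep S \<boxtimes> class_rep T') U)
    = gr_class C X S * gr_class C (class_rep S \<boxtimes> class_rep T) U" using T finite_simple_classes by simp
 qed
 also have "... = (\<Sum>S\<in>?L. int (hom_dim C (class_rep S) X * hom_dim C (class_rep U) (class_rep S \<boxtimes> class_rep T)))"
  using rep(2) T U X by (intro sum.cong) (auto simp: gr_class_eq)
 finally show ?thesis by (simp add: fusion_coeff_def)
qed

lemma FPdim_class_rep:
 assumes X: "X : simple_classes C" shows "FPdim C (class_rep X) = fp_dim X"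
proof -
 let ?L = "simple_classes C"
 interpret R: based_ring ?L "iso_class C (Unit C)" fusion_coeff by (rule fusion_based_ring)
 let ?x = "\<lambda>S. real (hom_dim C (class_rep S) (class_rep X))"
 have x: "?x S = (if S = X then 1 else 0)" if "S : ?L" for S using hom_dim_class_rep[OF that X] by simp
 have "FPdim C (class_rep X) = (GREATEST r. r > 0 \<and> (\<exists>w. (\<exists>T\<in>?L. w T \<noteq> 0) \<and>
   (\<forall>U\<in>?L. (\<Sum>T\<in>?L. (\<Sum>S\<in>?L. ?x S * fusion_coeff S T U) * w T) = r * w U)))"
  unfolding FPdim_def left_mult_eigenvalue_def
  using left_mult_matrix_eq[OF class_rep_simple(2)[OF X]] by (simp cong: sum.cong)
 also have "... = (\<Sum>S\<in>?L. ?x S * fp_dim S)"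
  by (rule R.greatest_eigenvalue_left_mult) (use x X in auto)
 also have "... = (\<Sum>S\<in>?L. if S = X then fp_dim X else 0)" using x by (intro sum.cong) auto
 also have "... = fp_dim X" using X finite_simple_classes by simp
 finally show ?thesis .
qed

lemma FPdim_category_eq: "FPdim_category C = (\<Sum>X\<in>simple_classes C. (fp_dim X)\<^sup>2)"
 unfolding FPdim_category_def using FPdim_class_rep by simp

end

section \<open>Tensor functors of index two\<close>

sublocale tensor_functor \<subseteq> linear_functor C D "FObj F" "FArr F"
 by unfold_locales (use FObj_closed FArr_hom FArr_Ident FArr_Comp FArr_Add FArr_Scale in auto)

context tensor_functor
begin

lemma FTens_arrow [simp]:
 assumes "X : Obj C" "Y : Obj C"
 shows "FTens F X Y : Arr D" "Dom D (FTens F X Y) = FObj F X \<boxtimes>[D] FObj F Y"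
  "Cod D (FTens F X Y) = FObj F (X \<boxtimes>[C] Y)" "is_iso D (FTens F X Y)"
 using FTens_hom[OF assms] FTens_iso[OF assms] by (auto simp: D.hom_iff)

lemma FUnit_arrow [simp]:
 "FUnit F : Arr D" "Dom D (FUnit F) = Unit D" "Cod D (FUnit F) = FObj F (Unit C)" "is_iso D (FUnit F)"
 using FUnit_hom FUnit_iso by (auto simp: D.hom_iff)

lemma FObj_obj [simp]: "X : Obj C ==> FObj F X : Obj D"
 by (rule FObj_closed)

lemma FObj_TensO: "X : Obj C ==> Y : Obj C ==> isomorphic D (FObj F X \<boxtimes>[D] FObj F Y) (FObj F (X \<boxtimes>[C] Y))"
 by (rule D.isomorphicI[OF FTens_hom FTens_iso])

lemma FObj_Unit: "isomorphic D (Unit D) (FObj F (Unit C))"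
 by (rule D.isomorphicI[OF FUnit_hom FUnit_iso])

end

lemma (in fusion_category) isomorphic_of_multiplicity:
 assumes X: "X : Obj C" and T0: "T0 : simple_classes C"
  and m: "\<And>T. T : simple_classes C ==> hom_dim C (class_rep T) X = (if T = T0 then 1 else 0)"
 shows "isomorphic C (class_rep T0) X"
proof -
 obtain n S i p where S: "\<And>k. k : {..<n::nat} ==> S k : {X. is_simple C X}" and d: "direct_sum_over C {..<n} S X i p"
  using obtain_decomposition[OF X] by metis
 note D = direct_sum_overD[OF d]
 have iso: "isomorphic C (class_rep T0) (S k)" if k: "k : {..<n}" for k
 proof -
  let ?T = "iso_class C (S k)"
  have T: "?T : simple_classes C" using S[OF k] iso_class_simple by simp
  have i: "isomorphic C (class_rep ?T) (S k)" by (rule isomorphic_sym[OF class_rep_iso_class[OF D(3)[OF k]]])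
  have "hom_dim C (class_rep ?T) X = card {l\<in>{..<n}. isomorphic C (class_rep ?T) (S l)}"
   by (rule hom_dim_from_B[OF _ d S]) (use class_rep_simple[OF T] in auto)
  also have "... \<noteq> 0" using i k by auto
  finally have "?T = T0" using m[OF T] by (auto split: if_splits)
  then show ?thesis using i by simp
 qed
 have "1 = card {l\<in>{..<n}. isomorphic C (class_rep T0) (S l)}"
  using hom_dim_from_B[OF _ d S, of "class_rep T0"] class_rep_simple[OF T0] m[OF T0] by simp
 also have "{l\<in>{..<n}. isomorphic C (class_rep T0) (S l)} = {..<n}" using iso by auto
 finally have n: "n = 1" by simp
 then have 0: "0 : {..<n}" by simp
 note ar = D(4)[OF 0, unfolded hom_iff] D(5)[OF 0, unfolded hom_iff]
 have "i 0 ** p 0 = Ident C X"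
 proof (rule direct_sum_eqI_into[OF d])
  fix k assume "k : {..<n}"
  then have "k = 0" using n by simp
  then show "p k ** (i 0 ** p 0) = p k ** Ident C X" using comp_cong_left[OF D(6)[OF 0], of "p 0"] ar by simp
 qed (use ar X in "auto simp: hom_iff")
 then have "is_iso C (i 0)" by (rule isoI[OF D(4)[OF 0] D(5)[OF 0] D(6)[OF 0]])
 then show ?thesis using isomorphic_trans[OF iso[OF 0]] isomorphicI[OF D(4)[OF 0]] by blast
qed

text \<open>Weights that are at least \<open>1\<close> leave room for a single term of a sum with value \<open>1\<close>.\<close>

lemma weighted_sum_eq_1:
 fixes h :: "'x => nat" and d :: "'x => real"
 assumes fin: "finite L" and d: "\<And>x. x : L ==> d x \<ge> 1" and sum: "(\<Sum>x\<in>L. real (h x) * d x) = 1"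
 shows "\<exists>a\<in>L. d a = 1 \<and> (\<forall>x\<in>L. h x = (if x = a then 1 else 0))"
proof -
 obtain a where a: "a : L" "h a \<noteq> 0"
  using sum by (metis (no_types, lifting) mult_zero_left of_nat_0 sum.neutral zero_neq_one)
 have split: "(\<Sum>x\<in>L. real (h x) * d x) = real (h a) * d a + (\<Sum>x\<in>L - {a}. real (h x) * d x)"
  using fin a(1) by (rule sum.remove)
 have h1: "real (h a) \<ge> 1" using a(2) by simp
 have nn: "real (h x) * d x \<ge> 0" if "x : L" for x using d[OF that] by simp
 have ge: "real (h a) \<le> real (h a) * d a" "d a \<le> real (h a) * d a"
  using h1 d[OF a(1)] by (simp_all add: mult_le_cancel_left1 mult_le_cancel_right1)
 have rest: "(\<Sum>x\<in>L - {a}. real (h x) * d x) \<ge> 0" by (rule sum_nonneg) (use nn in auto)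
 have ha: "real (h a) * d a = 1" using split sum rest ge h1 by linarith
 then have r0: "(\<Sum>x\<in>L - {a}. real (h x) * d x) = 0" using split sum by simp
 have "h x = 0" if "x : L" "x \<noteq> a" for x
 proof -
  have "real (h x) * d x = 0"
   using r0 fin that nn by (subst (asm) sum_nonneg_eq_0_iff) auto
  then show ?thesis using d[OF that(1)] by simp
 qed
 moreover have "real (h a) = 1" "d a = 1" using ha ge h1 d[OF a(1)] by linarith+
 ultimately show ?thesis using a(1) by (intro bexI[of _ a]) auto
qed

text \<open>The structure that index two forces: besides \<open>1\<close>, a single simple object \<open>G\<close> has an image that
  contains the unit.\<close>

locale functor_with_kernel_of_order_two =
 C: fusion_category C + D: fusion_category D + tensor_functor C D F
 for C :: "('o, 'a, 'k::field, 'z) monoidal_data_scheme"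
  and D :: "('p, 'b, 'k, 'y) monoidal_data_scheme"
  and F :: "('o, 'a, 'p, 'b) functor_data" +
 fixes G :: 'o
 assumes G_simple: "is_simple C G"
  and G_not_Unit: "\<not> isomorphic C (Unit C) G"
  and FG: "isomorphic D (FObj F G) (Unit D)"
  and GG: "isomorphic C (G \<boxtimes>[C] G) (Unit C)"
  and other_simple: "is_simple C X ==> isomorphic C X (Unit C) \<or> isomorphic C X G \<or> hom_dim D (Unit D) (FObj F X) = 0"

text \<open>By the comparison of regular elements, the index is the sum of the dimensions of the simple
  objects \<open>X\<close>, each counted with the multiplicity of \<open>1\<close> in \<open>F X\<close>.  The unit contributes \<open>1\<close> and
  dimensions are at least \<open>1\<close>, so index \<open>2\<close> leaves room for exactly one further object \<open>G\<close>, of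
  dimension \<open>1\<close> and multiplicity \<open>1\<close>.  As \<open>G \<otimes> G\<close> has image \<open>1\<close>, it is \<open>1\<close> or \<open>G\<close>.  The unit
  occurs in \<open>G \<otimes> W\<close> for some simple \<open>W\<close>; this \<open>W\<close> is \<open>1\<close> or \<open>G\<close> too, and \<open>G \<otimes> G \<cong> G\<close> would
  contradict both.\<close>

theorem index_two_kernel:
 assumes C: "fusion_category C" and D: "fusion_category D" and F: "tensor_functor C D F"
  and dom: "dominant C D F" and ind: "FP_index C D = 2"
 shows "\<exists>G. functor_with_kernel_of_order_two C D F G"
proof -
 interpret C: fusion_category C by fact
 interpret D: fusion_category D by fact
 interpret F: tensor_functor C D F by fact
 let ?L = "simple_classes C" and ?L' = "simple_classes D"
 let ?e = "iso_class C (Unit C)" and ?e' = "iso_class D (Unit D)"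
 define mm where "mm X Y = hom_dim D (class_rep Y) (FObj F (class_rep X))" for X Y
 note C_rep = C.class_rep_simple and D_rep = D.class_rep_simple
 have Fmult: "hom_dim D (class_rep Y) (FObj F X) = (\<Sum>T\<in>?L. hom_dim C (class_rep T) X * mm T Y)"
  if "X : Obj C" "Y : ?L'" for X Y
  unfolding mm_def
  by (rule additive_functor_multiplicity[OF C D.split_semisimple_category_axioms F.linear_functor_axioms that(1)])
   (use D_rep[OF that(2)] in auto)
 have unit_rep: "hom_dim D (Unit D) X = hom_dim D (class_rep ?e') X" if "X : Obj D" for X
  by (rule D.hom_dim_iso_source) (use D.Unit_simple D_rep[OF D.Unit_class(1)] D.Unit_class(2) that in auto)
 have iso_mult: "hom_dim D (class_rep Y) X = (if Y = ?e' then 1 else 0)"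
  if "isomorphic D X (Unit D)" "Y : ?L'" for X Y
  using D.hom_dim_iso_target[OF _ that(1), of "class_rep Y"] D.hom_dim_iso_target[OF _ D.Unit_class(2), of "class_rep Y"]
   D.hom_dim_class_rep[OF that(2) D.Unit_class(1)] D_rep[OF that(2)] by simp
 have A: "based_ring ?L ?e C.fusion_coeff" and B: "based_ring ?L' ?e' D.fusion_coeff"
  by (rule C.fusion_based_ring D.fusion_based_ring)+
 interpret A: based_ring ?L ?e C.fusion_coeff by fact
 interpret B: based_ring ?L' ?e' D.fusion_coeff by fact
 let ?m = "\<lambda>X Y. real (mm X Y)"
 have hom: "(\<Sum>U\<in>?L. C.fusion_coeff X T U * ?m U V) = (\<Sum>P\<in>?L'. \<Sum>R\<in>?L'. ?m X P * ?m T R * D.fusion_coeff P R V)"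
  if *: "X : ?L" "T : ?L" "V : ?L'" for X T V
 proof -
  note ob = C_rep(2)[OF *(1)] C_rep(2)[OF *(2)]
  note V = D_rep(1)[OF *(3)]
  have "(\<Sum>U\<in>?L. C.fusion_coeff X T U * ?m U V) = real (hom_dim D (class_rep V) (FObj F (class_rep X \<boxtimes>[C] class_rep T)))"
   using Fmult[of "class_rep X \<boxtimes>[C] class_rep T" V] ob * by (simp add: C.fusion_coeff_def)
  also have "hom_dim D (class_rep V) (FObj F (class_rep X \<boxtimes>[C] class_rep T))
    = hom_dim D (class_rep V) (FObj F (class_rep X) \<boxtimes>[D] FObj F (class_rep T))"
   using D.hom_dim_iso_target[OF _ F.FObj_TensO[OF ob]] V by simp
  also have "... = (\<Sum>P\<in>?L'. mm X P * hom_dim D (class_rep V) (class_rep P \<boxtimes>[D] FObj F (class_rep T)))"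
   using D.hom_dim_TensO_left[OF V F.FObj_obj[OF ob(1)] F.FObj_obj[OF ob(2)]] by (simp add: mm_def)
  also have "... = (\<Sum>P\<in>?L'. mm X P * (\<Sum>R\<in>?L'. mm T R * hom_dim D (class_rep V) (class_rep P \<boxtimes>[D] class_rep R)))"
  proof (rule sum.cong[OF refl])
   fix P assume "P : ?L'"
   from D.hom_dim_TensO_right[OF V D_rep(2)[OF this] F.FObj_obj[OF ob(2)]]
   show "mm X P * hom_dim D (class_rep V) (class_rep P \<boxtimes>[D] FObj F (class_rep T))
     = mm X P * (\<Sum>R\<in>?L'. mm T R * hom_dim D (class_rep V) (class_rep P \<boxtimes>[D] class_rep R))"
    by (simp add: mm_def)
  qed
  finally show ?thesis by (simp add: D.fusion_coeff_def sum_distrib_left mult.assoc)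
 qed
 have dominant: "\<exists>X\<in>?L. ?m X Y > 0" if Y: "Y : ?L'" for Y
 proof -
  have oY: "class_rep Y : Obj D" using D_rep(2)[OF Y] .
  then obtain X i where X: "X : Obj C" and i: "i : Hom D (class_rep Y) (FObj F X)" "is_mono D i"
   using dom unfolding dominant_def by blast
  obtain h where h: "h : Hom D (FObj F X) (class_rep Y)" "h **[D] i = Ident D (class_rep Y)"
   using D.mono_splits[OF i(2)] i(1) by (auto simp: D.hom_iff)
  have "hom_dim D (class_rep Y) (FObj F X) > 0" by (rule D.retract_hom_dim_pos[OF D_rep(1)[OF Y] i(1) h])
  then have "(\<Sum>T\<in>?L. hom_dim C (class_rep T) X * mm T Y) \<noteq> 0" using Fmult[OF X Y] by simp
  then show ?thesis by (rule contrapos_np) (auto intro: sum.neutral)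
 qed
 note comparison = based_ring_hom_dimension[OF A B, of ?m, OF _ hom dominant, simplified]
 have dimF: "(\<Sum>Y\<in>?L'. ?m X Y * B.dim Y) = A.dim X" if "X : ?L" for X
  using comparison(1)[OF that] by simp
 have "(\<Sum>X\<in>?L. A.dim X * ?m X ?e') = 2"
  using comparison(2) ind by (simp add: FP_index_def C.FPdim_category_eq D.FPdim_category_eq)
 then have total: "(\<Sum>X\<in>?L. ?m X ?e' * A.dim X) = 2" by (simp add: mult.commute)
 have FU: "isomorphic D (FObj F (class_rep ?e)) (Unit D)"
  using F.Fo_isomorphic[OF C.isomorphic_sym[OF C.Unit_class(2)]] D.isomorphic_sym[OF F.FObj_Unit] D.isomorphic_trans by blast
 have me: "mm ?e ?e' = 1" using iso_mult[OF FU D.Unit_class(1)] by (simp add: mm_def)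
 have "(\<Sum>X\<in>?L. ?m X ?e' * A.dim X) = ?m ?e ?e' * A.dim ?e + (\<Sum>X\<in>?L - {?e}. ?m X ?e' * A.dim X)"
  by (rule sum.remove[OF A.fin A.e])
 then have "(\<Sum>X\<in>?L - {?e}. ?m X ?e' * A.dim X) = 1" using total me A.dim_unit by simp
 from weighted_sum_eq_1[OF _ _ this] obtain g where g: "g : ?L - {?e}" "A.dim g = 1"
  "\<And>X. X : ?L - {?e} ==> mm X ?e' = (if X = g then 1 else 0)"
  using A.fin A.dim_ge_1 by auto
 define G where "G = class_rep g"
 have gL: "g : ?L" using g(1) by simp
 have Gs: "is_simple C G" and Go: "G : Obj C" using C_rep[OF gL] by (auto simp: G_def)
 have trivial_image: "isomorphic D (FObj F X) (Unit D)"
  if X: "X : Obj C" and s: "(\<Sum>Y\<in>?L'. real (hom_dim D (class_rep Y) (FObj F X)) * B.dim Y) = 1"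
   and p: "hom_dim D (class_rep ?e') (FObj F X) \<noteq> 0" for X
 proof -
  from weighted_sum_eq_1[OF B.fin B.dim_ge_1 s] obtain Y0 where Y0: "Y0 : ?L'"
   "\<And>Y. Y : ?L' ==> hom_dim D (class_rep Y) (FObj F X) = (if Y = Y0 then 1 else 0)" by blast
  have "Y0 = ?e'" using Y0(2)[OF D.Unit_class(1)] p by (auto split: if_splits)
  then have "isomorphic D (class_rep ?e') (FObj F X)"
   using D.isomorphic_of_multiplicity[OF F.FObj_obj[OF X] Y0] by simp
  then show ?thesis using D.Unit_class(2) D.isomorphic_sym D.isomorphic_trans by blast
 qed
 have FG: "isomorphic D (FObj F G) (Unit D)"
  by (rule trivial_image[OF Go]) (use dimF[OF gL] g gL in "auto simp: G_def mm_def")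
 have class_cases: "T = ?e \<or> T = g" if "T : ?L" "mm T ?e' \<noteq> 0" for T
  using g(3)[of T] that by (cases "T = ?e"; cases "T = g") simp_all
 have G_class: "isomorphic C X G" if "X : Obj C" "iso_class C X = g" for X
  using C.class_rep_iso_class[OF that(1)] that by (simp add: G_def)
 have U_class: "isomorphic C X (Unit C)" if "X : Obj C" "iso_class C X = ?e" for X
  using C.iso_class_eq_iff[OF that(1) C.Unit_obj] that by simp
 have not_unit: "\<not> isomorphic C (Unit C) G"
 proof
  assume "isomorphic C (Unit C) G"
  then have "?e = iso_class C G" using C.iso_class_eq_iff[OF C.Unit_obj Go] by simp
  then show False using g(1) C_rep(3)[OF gL] by (simp add: G_def)
 qed
 have other: "isomorphic C X (Unit C) \<or> isomorphic C X G \<or> hom_dim D (Unit D) (FObj F X) = 0"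
  if X: "is_simple C X" for X
 proof -
  have Xo: "X : Obj C" using X by (simp add: is_simple_def)
  let ?T = "iso_class C X"
  have T: "?T : ?L" using C.iso_class_simple[OF X] .
  have "isomorphic D (FObj F X) (FObj F (class_rep ?T))" by (rule F.Fo_isomorphic[OF C.class_rep_iso_class[OF Xo]])
  then have "hom_dim D (Unit D) (FObj F X) = mm ?T ?e'"
   using D.hom_dim_iso_target[of "class_rep ?e'"] D_rep[OF D.Unit_class(1)] unit_rep Xo by (simp add: mm_def)
  then show ?thesis using class_cases[OF T] G_class[OF Xo] U_class[OF Xo] by auto
 qed
 have kernel_cases: "isomorphic C X (Unit C) \<or> isomorphic C X G"
  if X: "X : Obj C" and FX: "isomorphic D (FObj F X) (Unit D)" for X
 proof -
  have "(\<Sum>T\<in>?L. real (hom_dim C (class_rep T) X) * A.dim T)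
    = (\<Sum>T\<in>?L. \<Sum>Y\<in>?L'. real (hom_dim C (class_rep T) X * mm T Y) * B.dim Y)"
   using dimF by (simp add: sum_distrib_left mult.assoc flip: dimF)
  also have "... = (\<Sum>Y\<in>?L'. real (hom_dim D (class_rep Y) (FObj F X)) * B.dim Y)"
   by (subst sum.swap) (simp add: Fmult[OF X] sum_distrib_right)
  also have "... = (\<Sum>Y\<in>?L'. if Y = ?e' then 1 else 0)"
   using iso_mult[OF FX] B.dim_unit by (intro sum.cong) auto
  also have "... = 1" using B.fin B.e by simp
  finally have "(\<Sum>T\<in>?L. real (hom_dim C (class_rep T) X) * A.dim T) = 1" .
  from weighted_sum_eq_1[OF A.fin A.dim_ge_1 this] obtain T0 where T0: "T0 : ?L"
   "\<And>T. T : ?L ==> hom_dim C (class_rep T) X = (if T = T0 then 1 else 0)" by blast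
  have i: "isomorphic C (class_rep T0) X" by (rule C.isomorphic_of_multiplicity[OF X T0])
  have "mm T0 ?e' = hom_dim D (class_rep ?e') (FObj F X)"
   using D.hom_dim_iso_target[OF _ F.Fo_isomorphic[OF i], of "class_rep ?e'"] D_rep[OF D.Unit_class(1)]
   by (simp add: mm_def)
  then have "mm T0 ?e' \<noteq> 0" using iso_mult[OF FX D.Unit_class(1)] by simp
  then have "T0 = ?e \<or> T0 = g" using class_cases[OF T0(1)] by simp
  then show ?thesis
   using i C.Unit_class(2) C.isomorphic_sym C.isomorphic_trans unfolding G_def by metis
 qed
 have "isomorphic C (G \<boxtimes>[C] G) (Unit C)"
 proof (rule ccontr)
  assume not: "\<not> ?thesis"
  have GGo: "G \<boxtimes>[C] G : Obj C" using Go by simp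
  have "isomorphic D (FObj F (G \<boxtimes>[C] G)) (Unit D)"
   using D.isomorphic_sym[OF F.FObj_TensO[OF Go Go]] D.isomorphic_TensO[OF FG FG] D.isomorphic_Lunit[OF D.Unit_obj]
    D.isomorphic_trans by blast
  then have GGG: "isomorphic C (G \<boxtimes>[C] G) G" using kernel_cases[OF GGo] not by blast
  have UG: "hom_dim C (Unit C) G = 0"
   using C.hom_dim_B[of "Unit C" G] C.Unit_simple Gs not_unit by simp
  obtain W where W: "W : ?L" "hom_dim C (Unit C) (G \<boxtimes>[C] class_rep W) > 0"
   using C.simple_TensO_trans_right[OF Gs C.Unit_simple] by blast
  have Wo: "class_rep W : Obj C" using C_rep(2)[OF W(1)] .
  let ?GW = "G \<boxtimes>[C] class_rep W"
  have GWo: "?GW : Obj C" using Go Wo by simp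
  have "hom_dim C (class_rep ?e) ?GW \<noteq> 0"
   using W(2) C.hom_dim_iso_source[OF _ _ C.Unit_class(2) GWo] C.Unit_simple C_rep[OF C.Unit_class(1)] by simp
  then have "hom_dim D (class_rep ?e') (FObj F ?GW) \<noteq> 0"
   unfolding Fmult[OF GWo D.Unit_class(1)] using A.fin A.e me by auto
  moreover have "isomorphic D (FObj F ?GW) (FObj F (class_rep W))"
   using D.isomorphic_sym[OF F.FObj_TensO[OF Go Wo]] D.isomorphic_TensO[OF FG D.isomorphic_refl[OF F.FObj_obj[OF Wo]]]
    D.isomorphic_Lunit[OF F.FObj_obj[OF Wo]] D.isomorphic_trans by blast
  ultimately have "mm W ?e' \<noteq> 0"
   using D.hom_dim_iso_target[of "class_rep ?e'"] D_rep[OF D.Unit_class(1)] by (simp add: mm_def)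
  then consider "W = ?e" | "W = g" using class_cases[OF W(1)] by blast
  then have "isomorphic C ?GW G"
  proof cases
   case 1
   then show ?thesis
    using C.isomorphic_TensO[OF C.isomorphic_refl[OF Go] C.isomorphic_sym[OF C.Unit_class(2)]]
     C.isomorphic_Runit[OF Go] C.isomorphic_trans by blast
  next
   case 2
   then show ?thesis using GGG by (simp add: G_def)
  qed
  then have "hom_dim C (Unit C) ?GW = 0" using C.hom_dim_iso_target[of "Unit C"] C.Unit_simple UG by simp
  then show False using W(2) by simp
 qed
 then have "functor_with_kernel_of_order_two C D F G"
  by unfold_locales (use Gs not_unit FG other in auto)
 then show ?thesis by blast
qed

lemma (in tensor_category) is_trivialI:
 assumes "direct_sum_over C I (\<lambda>_. Unit C) X i p" shows "is_trivial C X"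
proof -
 obtain e where "is_direct_sum C (card I) (\<lambda>_. Unit C) X (\<lambda>k. i (e k)) (\<lambda>k. p (e k))"
  using direct_sum_over_nat[OF assms] by metis
 moreover have "isomorphic C X X" using direct_sum_overD(1)[OF assms] by simp
 ultimately show ?thesis unfolding is_trivial_def by blast
qed

lemma (in tensor_category) is_trivialE:
 assumes "is_trivial C X" obtains n i p where "direct_sum_over C {..<n::nat} (\<lambda>_. Unit C) X i p"
proof -
 obtain n S i p where d: "direct_sum_over C {..<n::nat} (\<lambda>_. Unit C) S i p" and iso: "isomorphic C X S"
  using assms by (auto simp: is_trivial_def is_direct_sum_iff)
 obtain a where "a : Hom C S X" "is_iso C a" using isomorphic_sym[OF iso] by (auto simp: isomorphic_def)
 from direct_sum_transport[OF d this] show thesis by (rule that)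
qed

context functor_with_kernel_of_order_two
begin

lemma G_obj [simp]: "G : Obj C"
 using G_simple by (simp add: is_simple_def)

lemma arrow_Unit_to_F_other:
 assumes "is_simple C X" "\<not> isomorphic C X (Unit C)" "\<not> isomorphic C X G" "f : Hom D (Unit D) (FObj F X)"
 shows "f = Zero D (Unit D) (FObj F X)"
proof -
 have "X : Obj C" using assms(1) by (simp add: is_simple_def)
 then show ?thesis using other_simple[OF assms(1)] assms(2-4) D.hom_dim_pos_iff[of "Unit D" "FObj F X"] D.Unit_simple by auto
qed

lemma F_kernel_simple:
 assumes "isomorphic C X (Unit C) \<or> isomorphic C X G" shows "isomorphic D (Unit D) (FObj F X)"
 using assms
proof
 assume "isomorphic C X (Unit C)"
 then show ?thesis using Fo_isomorphic[OF C.isomorphic_sym] FObj_Unit D.isomorphic_trans by blast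
next
 assume "isomorphic C X G"
 then show ?thesis using Fo_isomorphic[OF C.isomorphic_sym] D.isomorphic_sym[OF FG] D.isomorphic_trans by blast
qed

lemma F_trivial:
 assumes d: "direct_sum_over C I S X i p"
  and S: "\<And>k. k : I ==> isomorphic C (S k) (Unit C) \<or> isomorphic C (S k) G"
 shows "is_trivial D (FObj F X)"
proof -
 have "\<exists>a. a : Hom D (Unit D) (FObj F (S k)) \<and> is_iso D a" if "k : I" for k
  using F_kernel_simple[OF S[OF that]] by (auto simp: isomorphic_def)
 then obtain a where a: "\<And>k. k : I ==> a k : Hom D (Unit D) (FObj F (S k)) \<and> is_iso D (a k)" by metis
 have "direct_sum_over D I (\<lambda>_. Unit D) (FObj F X) (\<lambda>k. FArr F (i k) **[D] a k) (\<lambda>k. inverse_of D (a k) **[D] FArr F (p k))"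
  by (rule D.direct_sum_of_isos[OF Fa_direct_sum[OF d], where Y = "\<lambda>_. Unit D"]) (use a in auto)
 then show ?thesis by (rule D.is_trivialI)
qed

text \<open>The largest trivial subobject of \<open>F X\<close> is the image of the sum of those simple summands of \<open>X\<close>
  that are isomorphic to \<open>1\<close> or \<open>G\<close>.\<close>

theorem normal: "normal_functor C D F"
 unfolding normal_functor_def
proof
 fix X assume X: "X : Obj C"
 obtain n S i p where S: "\<And>k. k : {..<n::nat} ==> S k : {X. is_simple C X}" and d: "direct_sum_over C {..<n} S X i p"
  using C.obtain_decomposition[OF X] by metis
 note di = C.direct_sum_overD[OF d]
 define J where "J = {k\<in>{..<n}. isomorphic C (S k) (Unit C) \<or> isomorphic C (S k) G}"
 have J: "J \<subseteq> {..<n}" "finite J" by (auto simp: J_def)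
 have So: "S k : Obj C" if "k : J" for k using di(3) J that by auto
 obtain X0 i0 p0 where d0: "direct_sum_over C J S X0 i0 p0"
  using C.obtain_direct_sum[of J S] J So by metis
 note di0 = C.direct_sum_overD[OF d0]
 have iJ: "i k : Hom C (S k) X" "p k : Hom C X (S k)" if "k : J" for k using di(4,5) J that by auto
 obtain s where s: "s : Hom C X0 X" "\<And>k. k : J ==> s **[C] i0 k = i k"
  using C.direct_sum_cotuple[OF d0 X iJ(1)] by blast
 obtain r where r: "r : Hom C X X0" "\<And>k. k : J ==> p0 k **[C] r = p k"
  using C.direct_sum_tuple[OF d0 X iJ(2)] by blast
 note ar = s(1)[unfolded C.hom_iff] r(1)[unfolded C.hom_iff]
 have ps: "p k **[C] s = (if k : J then p0 k else Zero C X0 (S k))" if k: "k : {..<n}" for k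
 proof (rule C.direct_sum_eqI_from[OF d0])
  show "p k **[C] s : Hom C X0 (S k)" using ar di(5)[OF k] by (simp add: C.hom_iff)
  show "(if k : J then p0 k else Zero C X0 (S k)) : Hom C X0 (S k)"
   using di0(1,5) di(3)[OF k] C.Zero_hom by auto
  fix l assume l: "l : J"
  have "p k **[C] s **[C] i0 l = p k **[C] i l"
   using s(2)[OF l] ar di(5)[OF k] di0(4)[OF l] by (simp add: C.hom_iff C.comp_assoc)
  also have "... = (if k : J then p0 k else Zero C X0 (S k)) **[C] i0 l"
   using di(3,6,7)[OF k] di0(6,7) di0(4)[OF l] l J k by (cases "k = l") (auto simp: C.hom_iff)
  finally show "p k **[C] s **[C] i0 l = (if k : J then p0 k else Zero C X0 (S k)) **[C] i0 l" .
 qed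
 have rs: "r **[C] s = Ident C X0"
 proof (rule C.direct_sum_eqI_into[OF d0])
  fix k assume k: "k : J"
  have "p0 k **[C] (r **[C] s) = p k **[C] s"
   by (rule C.comp_cong_left[OF r(2)[OF k]]) (use ar di0(5)[OF k] in "auto simp: C.hom_iff")
  then show "p0 k **[C] (r **[C] s) = p0 k **[C] Ident C X0" using ps k J di0(5)[OF k] by (auto simp: C.hom_iff)
 qed (use ar di0(1) in "auto simp: C.hom_iff")
 have Frs: "FArr F r **[D] FArr F s = Ident D (FObj F X0)"
  using Fa_Comp[OF s(1) r(1)] rs Fa_Ident[OF di0(1)] by simp
 have "\<forall>T\<in>Obj D. \<forall>j\<in>Hom D T (FObj F X). is_trivial D T \<and> is_mono D j \<longrightarrow>
   (\<exists>u\<in>Hom D T (FObj F X0). FArr F s **[D] u = j)"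
 proof (intro ballI impI)
  fix T j assume T: "T : Obj D" and j: "j : Hom D T (FObj F X)" and tm: "is_trivial D T \<and> is_mono D j"
  obtain m i1 p1 where dT: "direct_sum_over D {..<m::nat} (\<lambda>_. Unit D) T i1 p1" using tm D.is_trivialE by blast
  have vanish: "FArr F (p k) **[D] j = Zero D T (FObj F (S k))" if k: "k : {..<n}" "k \<notin> J" for k
  proof (rule D.direct_sum_eqI_from[OF dT])
   fix l assume l: "l : {..<m}"
   have h: "FArr F (p k) **[D] j **[D] i1 l : Hom D (Unit D) (FObj F (S k))"
    using j di(5)[OF k(1)] D.direct_sum_overD(4)[OF dT l] by (simp add: C.hom_iff D.hom_iff)
   have "FArr F (p k) **[D] j **[D] i1 l = Zero D (Unit D) (FObj F (S k))"
    by (rule arrow_Unit_to_F_other[OF _ _ _ h]) (use S k in "auto simp: J_def")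
   then show "FArr F (p k) **[D] j **[D] i1 l = Zero D T (FObj F (S k)) **[D] i1 l"
    using D.direct_sum_overD(4)[OF dT l] di(3)[OF k(1)] by (simp add: D.hom_iff)
  qed (use j T di(3)[OF k(1)] di(5)[OF k(1)] in "auto simp: C.hom_iff D.hom_iff")
  show "\<exists>u\<in>Hom D T (FObj F X0). FArr F s **[D] u = j"
  proof (intro bexI[of _ "FArr F r **[D] j"])
   show "FArr F r **[D] j : Hom D T (FObj F X0)" using ar j by (simp add: D.hom_iff)
   show "FArr F s **[D] (FArr F r **[D] j) = j"
   proof (rule D.direct_sum_eqI_into[OF Fa_direct_sum[OF d]])
    fix k assume k: "k : {..<n}"
    note pk = di(5)[OF k]
    have "FArr F (p k) **[D] FArr F s = FArr F (p k **[C] s)" using Fa_Comp[OF s(1) pk] by simp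
    then have "FArr F (p k) **[D] (FArr F s **[D] (FArr F r **[D] j)) = FArr F (p k **[C] s) **[D] (FArr F r **[D] j)"
     by (rule D.comp_cong_left) (use ar pk j in "auto simp: C.hom_iff D.hom_iff")
    also have "... = FArr F (p k) **[D] j"
    proof (cases "k : J")
     case True
     have "FArr F (p0 k) **[D] FArr F r = FArr F (p k)" using Fa_Comp[OF r(1) di0(5)[OF True]] r(2)[OF True] by simp
     then have "FArr F (p0 k) **[D] (FArr F r **[D] j) = FArr F (p k) **[D] j"
      by (rule D.comp_cong_left) (use ar di0(5)[OF True] j in "auto simp: C.hom_iff D.hom_iff")
     then show ?thesis using ps[OF k] True by simp
    next
     case False
     then show ?thesis using ps[OF k] vanish[OF k False] Fa_Zero[OF di0(1) di(3)[OF k]] ar j di(3)[OF k]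
      by (simp add: D.hom_iff)
    qed
    finally show "FArr F (p k) **[D] (FArr F s **[D] (FArr F r **[D] j)) = FArr F (p k) **[D] j" .
   qed (use ar j in "auto simp: D.hom_iff")
  qed
 qed
 moreover have "is_trivial D (FObj F X0)" by (rule F_trivial[OF d0]) (simp add: J_def)
 moreover have "is_mono C s" by (rule C.split_monoI[OF s(1) r(1) rs])
 moreover have "is_mono D (FArr F s)" by (rule D.split_monoI[OF Fa_hom[OF s(1)] Fa_hom[OF r(1)] Frs])
 ultimately show "\<exists>X0\<in>Obj C. \<exists>i\<in>Hom C X0 X. is_mono C i \<and> is_mono D (FArr F i) \<and> is_trivial D (FObj F X0) \<and>
   (\<forall>T\<in>Obj D. \<forall>j\<in>Hom D T (FObj F X). is_trivial D T \<and> is_mono D j \<longrightarrow>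
     (\<exists>u\<in>Hom D T (FObj F X0). FArr F i **[D] u = j))"
  using di0(1) s(1) by blast
qed

end

section \<open>Kronecker products\<close>

lemma sum_div_mod:
 fixes f :: "nat => nat => 'r::comm_monoid_add"
 shows "(\<Sum>t<n * s. f (t div s) (t mod s)) = (\<Sum>a<n. \<Sum>b<s. f a b)"
proof -
 have "(\<Sum>t<n * s. f (t div s) (t mod s)) = (\<Sum>a<n. \<Sum>t\<in>{a * s..<a * s + s}. f (t div s) (t mod s))"
  by (rule sum.nat_group[symmetric])
 also have "... = (\<Sum>a<n. \<Sum>b<s. f a b)"
 proof (rule sum.cong[OF refl])
  fix a
  have "(\<Sum>t\<in>{a * s..<a * s + s}. f (t div s) (t mod s)) = (\<Sum>b\<in>{0..<s}. f ((a * s + b) div s) ((a * s + b) mod s))"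
   by (simp add: sum.atLeastLessThan_shift_0[of _ "a * s"] o_def)
  also have "... = (\<Sum>b<s. f a b)" by (rule sum.cong) auto
  finally show "(\<Sum>t\<in>{a * s..<a * s + s}. f (t div s) (t mod s)) = (\<Sum>b<s. f a b)" .
 qed
 finally show ?thesis .
qed

lemma kronecker_carrier: "A : carrier_mat m n ==> B : carrier_mat r s ==> kronecker A B : carrier_mat (m * r) (n * s)"
 by (simp add: kronecker_def)

lemma kronecker_index:
 assumes "A : carrier_mat m n" "B : carrier_mat r s" "i < m * r" "j < n * s"
 shows "kronecker A B $$ (i, j) = A $$ (i div r, j div s) * B $$ (i mod r, j mod s)"
 using assms by (auto simp: kronecker_def)

lemma div_mod_less: "(i::nat) < m * r ==> i div r < m \<and> i mod r < r"
 by (cases "r = 0") (auto simp: less_mult_imp_div_less)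

lemma kronecker_mult:
 assumes A: "A : carrier_mat m n" and A': "A' : carrier_mat n p"
  and B: "B : carrier_mat r s" and B': "B' : carrier_mat s t"
 shows "kronecker (A * A') (B * B') = kronecker A B * kronecker A' B'"
proof (rule eq_matI)
 note c1 = kronecker_carrier[OF A B] and c2 = kronecker_carrier[OF A' B']
 have c3: "kronecker (A * A') (B * B') : carrier_mat (m * r) (p * t)"
  using assms by (intro kronecker_carrier) auto
 show "dim_row (kronecker (A * A') (B * B')) = dim_row (kronecker A B * kronecker A' B')"
  "dim_col (kronecker (A * A') (B * B')) = dim_col (kronecker A B * kronecker A' B')"
  using c1 c2 c3 by auto
 fix i j assume "i < dim_row (kronecker A B * kronecker A' B')" "j < dim_col (kronecker A B * kronecker A' B')"
 then have i: "i < m * r" and j: "j < p * t" using c1 c2 by auto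
 note i' = div_mod_less[OF i] and j' = div_mod_less[OF j]
 have "(kronecker A B * kronecker A' B') $$ (i, j) = (\<Sum>k<n * s. kronecker A B $$ (i, k) * kronecker A' B' $$ (k, j))"
  using c1 c2 i j by (simp add: scalar_prod_def lessThan_atLeast0)
 also have "... = (\<Sum>k<n * s. (A $$ (i div r, k div s) * A' $$ (k div s, j div t)) * (B $$ (i mod r, k mod s) * B' $$ (k mod s, j mod t)))"
  using kronecker_index[OF A B i] kronecker_index[OF A' B' _ j] by (intro sum.cong) (auto simp: mult_ac)
 also have "... = (\<Sum>a<n. \<Sum>b<s. (A $$ (i div r, a) * A' $$ (a, j div t)) * (B $$ (i mod r, b) * B' $$ (b, j mod t)))"
  by (rule sum_div_mod)
 also have "... = (\<Sum>a<n. A $$ (i div r, a) * A' $$ (a, j div t)) * (\<Sum>b<s. B $$ (i mod r, b) * B' $$ (b, j mod t))"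
  by (simp add: sum_product)
 also have "... = (A * A') $$ (i div r, j div t) * (B * B') $$ (i mod r, j mod t)"
  using assms i' j' by (simp add: scalar_prod_def lessThan_atLeast0)
 also have "... = kronecker (A * A') (B * B') $$ (i, j)"
  by (rule kronecker_index[symmetric]) (use assms i j in auto)
 finally show "kronecker (A * A') (B * B') $$ (i, j) = (kronecker A B * kronecker A' B') $$ (i, j)" by simp
qed

lemma kronecker_one: "kronecker (1\<^sub>m m) (1\<^sub>m n) = 1\<^sub>m (m * n)"
proof (rule eq_matI)
 fix i j assume "i < dim_row (1\<^sub>m (m * n) :: 'a mat)" "j < dim_col (1\<^sub>m (m * n) :: 'a mat)"
 then have i: "i < m * n" and j: "j < m * n" by auto
 have "i = j \<longleftrightarrow> i div n = j div n \<and> i mod n = j mod n" by (metis div_mult_mod_eq)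
 then show "kronecker (1\<^sub>m m) (1\<^sub>m n) $$ (i, j) = (1\<^sub>m (m * n) :: 'a mat) $$ (i, j)"
  using div_mod_less[OF i] div_mod_less[OF j] i j by (simp add: kronecker_def)
qed (auto simp: kronecker_def)

lemma kronecker_assoc:
 assumes "A : carrier_mat m n" "B : carrier_mat r s" "C : carrier_mat p q"
 shows "kronecker (kronecker A B) C = kronecker A (kronecker B C)"
proof (rule eq_matI)
 have c: "kronecker A B : carrier_mat (m * r) (n * s)" "kronecker B C : carrier_mat (r * p) (s * q)"
  "kronecker (kronecker A B) C : carrier_mat (m * r * p) (n * s * q)"
  "kronecker A (kronecker B C) : carrier_mat (m * (r * p)) (n * (s * q))"
  using assms by (auto intro!: kronecker_carrier)
 then show "dim_row (kronecker (kronecker A B) C) = dim_row (kronecker A (kronecker B C))"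
  "dim_col (kronecker (kronecker A B) C) = dim_col (kronecker A (kronecker B C))" by auto
 fix i j assume "i < dim_row (kronecker A (kronecker B C))" "j < dim_col (kronecker A (kronecker B C))"
 then have i: "i < m * r * p" "i < m * (r * p)" and j: "j < n * s * q" "j < n * (s * q)" using c(4) by (auto simp: mult.assoc)
 have p0: "p > 0" "q > 0" using i j by (auto intro: Nat.gr0I)
 have md: "t mod (c * b) div c = t div c mod b" "t mod (c * b) mod c = t mod c" if "c > 0" for t b c :: nat
  using mod_mult2_eq[of t c b] that by simp_all
 have i1: "i div p < m * r" "i mod p < p" "i div (r * p) < m" "i mod (r * p) < r * p"
  using div_mod_less[OF i(1)] div_mod_less[OF i(2)] by auto
 have j1: "j div q < n * s" "j mod q < q" "j div (s * q) < n" "j mod (s * q) < s * q"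
  using div_mod_less[OF j(1)] div_mod_less[OF j(2)] by auto
 show "kronecker (kronecker A B) C $$ (i, j) = kronecker A (kronecker B C) $$ (i, j)"
  using kronecker_index[OF c(1) assms(3) i(1) j(1)] kronecker_index[OF assms(1,2) i1(1) j1(1)]
   kronecker_index[OF assms(1) c(2) i(2) j(2)] kronecker_index[OF assms(2,3) i1(4) j1(4)]
  by (simp add: md[OF p0(1)] md[OF p0(2)] div_mult2_eq mult.commute[of _ p] mult.commute[of _ q] mult.assoc)
qed

lemma kronecker_one_left: "kronecker (1\<^sub>m 1) A = A"
 by (rule eq_matI) (auto simp: kronecker_def)

lemma kronecker_one_right: "kronecker A (1\<^sub>m 1) = A"
 by (rule eq_matI) (auto simp: kronecker_def)

lemma kronecker_linear:
 assumes "A : carrier_mat m n" "A' : carrier_mat m n" "B : carrier_mat r s" "B' : carrier_mat r s"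
 shows "kronecker (A + A') B = kronecker A B + kronecker A' B"
  and "kronecker A (B + B') = kronecker A B + kronecker A B'"
  and "kronecker (c \<cdot>\<^sub>m A) B = c \<cdot>\<^sub>m kronecker A B" and "kronecker A (c \<cdot>\<^sub>m B) = c \<cdot>\<^sub>m kronecker A B"
proof -
 note c = kronecker_carrier[OF assms(1,3)] kronecker_carrier[OF assms(2,3)] kronecker_carrier[OF assms(1,4)]
  kronecker_carrier[OF add_carrier_mat[OF assms(2), of A] assms(3)] kronecker_carrier[OF assms(1) add_carrier_mat[OF assms(4), of B]]
  kronecker_carrier[OF smult_carrier_mat[OF assms(1), of c] assms(3)] kronecker_carrier[OF assms(1) smult_carrier_mat[OF assms(3), of c]]
 note ix = kronecker_index[OF assms(1,3)] kronecker_index[OF assms(2,3)] kronecker_index[OF assms(1,4)]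
  kronecker_index[OF add_carrier_mat[OF assms(2), of A] assms(3)] kronecker_index[OF assms(1) add_carrier_mat[OF assms(4), of B]]
  kronecker_index[OF smult_carrier_mat[OF assms(1), of c] assms(3)] kronecker_index[OF assms(1) smult_carrier_mat[OF assms(3), of c]]
 have *: "kronecker (A + A') B $$ (i, j) = (kronecker A B + kronecker A' B) $$ (i, j)"
  "kronecker A (B + B') $$ (i, j) = (kronecker A B + kronecker A B') $$ (i, j)"
  "kronecker (c \<cdot>\<^sub>m A) B $$ (i, j) = (c \<cdot>\<^sub>m kronecker A B) $$ (i, j)"
  "kronecker A (c \<cdot>\<^sub>m B) $$ (i, j) = (c \<cdot>\<^sub>m kronecker A B) $$ (i, j)"
  if "i < m * r" "j < n * s" for i j
  using that div_mod_less[OF that(1)] div_mod_less[OF that(2)] assms c ix[OF that] by (simp_all add: algebra_simps)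
 show "kronecker (A + A') B = kronecker A B + kronecker A' B"
  by (rule eq_matI) (use * c in auto)
 show "kronecker A (B + B') = kronecker A B + kronecker A B'"
  by (rule eq_matI) (use * c in auto)
 show "kronecker (c \<cdot>\<^sub>m A) B = c \<cdot>\<^sub>m kronecker A B"
  by (rule eq_matI) (use * c in auto)
 show "kronecker A (c \<cdot>\<^sub>m B) = c \<cdot>\<^sub>m kronecker A B"
  by (rule eq_matI) (use * c in auto)
qed

section \<open>The linear monoidal category of representations\<close>

definition intertwiners :: "('g, 'z) monoid_scheme => ('g, 'k::field) rep => ('g, 'k) rep => 'k mat set" where
 "intertwiners G X Y = {A : carrier_mat (fst Y) (fst X). \<forall>g\<in>carrier G. A * snd X g = snd Y g * A}"

lemma rep_category_simps [simp]:
 "Obj (rep_category G) = rep_objects G" "Arr (rep_category G) = rep_arrows G"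
 "Dom (rep_category G) (X, Y, A) = X" "Cod (rep_category G) (X, Y, A) = Y"
 "Ident (rep_category G) X = (X, X, 1\<^sub>m (fst X))"
 "Comp (rep_category G) (Y', Z, B) (X, Y, A) = (X, Z, B * A)"
 "Add (rep_category G) (X, Y, A) (X', Y', B) = (X, Y, A + B)"
 "Zero (rep_category G) X Y = (X, Y, 0\<^sub>m (fst Y) (fst X))"
 "Scale (rep_category G) c (X, Y, A) = (X, Y, c \<cdot>\<^sub>m A)"
 "TensO (rep_category G) = rep_tensor G"
 "TensA (rep_category G) (X, Y, A) (X', Y', B) = (rep_tensor G X X', rep_tensor G Y Y', kronecker A B)"
 "Unit (rep_category G) = rep_unit G"
 "Assoc (rep_category G) X Y Z = (rep_tensor G (rep_tensor G X Y) Z, rep_tensor G X (rep_tensor G Y Z), 1\<^sub>m (fst X * fst Y * fst Z))"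
 "Lunit (rep_category G) X = (rep_tensor G (rep_unit G) X, X, 1\<^sub>m (fst X))"
 "Runit (rep_category G) X = (rep_tensor G X (rep_unit G), X, 1\<^sub>m (fst X))"
 by (simp_all add: rep_category_def)

lemma rep_objectD:
 assumes "X : rep_objects G"
 shows "snd X : extensional (carrier G)" "g : carrier G ==> snd X g : carrier_mat (fst X) (fst X)"
  "snd X \<one>\<^bsub>G\<^esub> = 1\<^sub>m (fst X)"
  "g : carrier G ==> h : carrier G ==> snd X (g \<otimes>\<^bsub>G\<^esub> h) = snd X g * snd X h"
 using assms by (auto simp: rep_objects_def PiE_def)

lemma rep_object_dims:
 assumes "X : rep_objects G" "g : carrier G"
 shows "dim_row (snd X g) = fst X" "dim_col (snd X g) = fst X"
 using rep_objectD(2)[OF assms] by auto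

lemma rep_objectI:
 assumes "snd X : extensional (carrier G)" "\<And>g. g : carrier G ==> snd X g : carrier_mat (fst X) (fst X)"
  "snd X \<one>\<^bsub>G\<^esub> = 1\<^sub>m (fst X)"
  "\<And>g h. g : carrier G ==> h : carrier G ==> snd X (g \<otimes>\<^bsub>G\<^esub> h) = snd X g * snd X h"
 shows "X : rep_objects G"
 using assms by (cases X) (auto simp: rep_objects_def PiE_def)

lemma intertwinersD:
 assumes "A : intertwiners G X Y"
 shows "A : carrier_mat (fst Y) (fst X)" "g : carrier G ==> A * snd X g = snd Y g * A"
 using assms by (auto simp: intertwiners_def)

lemma rep_arrow_iff:
 "(X, Y, A) : rep_arrows G \<longleftrightarrow> X : rep_objects G \<and> Y : rep_objects G \<and> A : intertwiners G X Y"
 by (cases X; cases Y) (auto simp: rep_arrows_def intertwiners_def)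

lemma rep_hom_iff:
 "f : Hom (rep_category G) X Y \<longleftrightarrow> (\<exists>A. f = (X, Y, A) \<and> X : rep_objects G \<and> Y : rep_objects G \<and> A : intertwiners G X Y)"
 by (cases f) (auto simp: hom_set_def rep_arrow_iff)

lemma rep_homE:
 assumes "f : Hom (rep_category G) X Y"
 obtains A where "f = (X, Y, A)" "X : rep_objects G" "Y : rep_objects G" "A : intertwiners G X Y" "A : carrier_mat (fst Y) (fst X)"
proof -
 obtain A where A: "f = (X, Y, A)" "X : rep_objects G" "Y : rep_objects G" "A : intertwiners G X Y"
  using assms unfolding rep_hom_iff by blast
 show thesis by (rule that[OF A intertwinersD(1)[OF A(4)]])
qed

lemma intertwiners_comp:
 assumes X: "X : rep_objects G" and Y: "Y : rep_objects G" and Z: "Z : rep_objects G"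
  and A: "A : intertwiners G X Y" and B: "B : intertwiners G Y Z"
 shows "B * A : intertwiners G X Z"
proof -
 note a = intertwinersD[OF A] and b = intertwinersD[OF B]
 have "B * A * snd X g = snd Z g * (B * A)" if g: "g : carrier G" for g
 proof -
  note c = rep_objectD(2)[OF X g] rep_objectD(2)[OF Y g] rep_objectD(2)[OF Z g]
  have "B * A * snd X g = B * (A * snd X g)" by (rule assoc_mult_mat[OF b(1) a(1) c(1)])
  also have "... = B * snd Y g * A" unfolding a(2)[OF g] by (rule assoc_mult_mat[symmetric, OF b(1) c(2) a(1)])
  also have "... = snd Z g * (B * A)" unfolding b(2)[OF g] by (rule assoc_mult_mat[OF c(3) b(1) a(1)])
  finally show ?thesis .
 qed
 then show ?thesis using a(1) b(1) by (auto simp: intertwiners_def)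
qed

lemma one_intertwiner: "X : rep_objects G ==> 1\<^sub>m (fst X) : intertwiners G X X"
 using rep_object_dims[of X G] by (simp add: intertwiners_def)

lemma zero_intertwiner:
 assumes "X : rep_objects G" "Y : rep_objects G"
 shows "0\<^sub>m (fst Y) (fst X) : intertwiners G X Y"
 using left_mult_zero_mat[OF rep_objectD(2)[OF assms(1)]] right_mult_zero_mat[OF rep_objectD(2)[OF assms(2)]]
 by (simp add: intertwiners_def)

lemma add_intertwiner:
 assumes "X : rep_objects G" "Y : rep_objects G" "A : intertwiners G X Y" "B : intertwiners G X Y"
 shows "A + B : intertwiners G X Y"
proof -
 note a = intertwinersD[OF assms(3)] and b = intertwinersD[OF assms(4)]
 have "(A + B) * snd X g = snd Y g * (A + B)" if g: "g : carrier G" for g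
  using add_mult_distrib_mat[OF a(1) b(1) rep_objectD(2)[OF assms(1) g]]
   mult_add_distrib_mat[OF rep_objectD(2)[OF assms(2) g] a(1) b(1)] a(2)[OF g] b(2)[OF g] by simp
 then show ?thesis using a b by (auto simp: intertwiners_def)
qed

lemma smult_intertwiner:
 assumes "X : rep_objects G" "Y : rep_objects G" "A : intertwiners G X Y"
 shows "c \<cdot>\<^sub>m A : intertwiners G X Y"
proof -
 note a = intertwinersD[OF assms(3)]
 have "(c \<cdot>\<^sub>m A) * snd X g = snd Y g * (c \<cdot>\<^sub>m A)" if g: "g : carrier G" for g
  using mult_smult_assoc_mat[OF a(1) rep_objectD(2)[OF assms(1) g]]
   mult_smult_distrib[OF rep_objectD(2)[OF assms(2) g] a(1)] a(2)[OF g] by simp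
 then show ?thesis using a by (auto simp: intertwiners_def)
qed

lemma kronecker_intertwiner:
 assumes "X : rep_objects G" "X' : rep_objects G" "Y : rep_objects G" "Y' : rep_objects G"
  "A : intertwiners G X X'" "B : intertwiners G Y Y'"
 shows "kronecker A B : intertwiners G (rep_tensor G X Y) (rep_tensor G X' Y')"
proof -
 note a = intertwinersD[OF assms(5)] and b = intertwinersD[OF assms(6)]
 have "kronecker A B * kronecker (snd X g) (snd Y g) = kronecker (snd X' g) (snd Y' g) * kronecker A B"
  if g: "g : carrier G" for g
  using kronecker_mult[OF a(1) rep_objectD(2)[OF assms(1) g] b(1) rep_objectD(2)[OF assms(3) g]]
   kronecker_mult[OF rep_objectD(2)[OF assms(2) g] a(1) rep_objectD(2)[OF assms(4) g] b(1)] a(2)[OF g] b(2)[OF g] by simp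
 then show ?thesis using kronecker_carrier[OF a(1) b(1)] by (auto simp: intertwiners_def rep_tensor_def)
qed

context group
begin

lemma rep_unit_obj: "(rep_unit G :: ('a, 'k::field) rep) : rep_objects G"
 by (rule rep_objectI) (auto simp: rep_unit_def)

lemma rep_tensor_obj:
 assumes "X : rep_objects G" "Y : rep_objects G" shows "rep_tensor G X Y : rep_objects G"
proof (rule rep_objectI)
 fix g h assume "g : carrier G" "h : carrier G"
 then show "snd (rep_tensor G X Y) (g \<otimes> h) = snd (rep_tensor G X Y) g * snd (rep_tensor G X Y) h"
  using rep_objectD(4)[OF assms(1)] rep_objectD(4)[OF assms(2)]
   kronecker_mult[OF rep_objectD(2)[OF assms(1)] rep_objectD(2)[OF assms(1)] rep_objectD(2)[OF assms(2)] rep_objectD(2)[OF assms(2)]]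
  by (simp add: rep_tensor_def)
qed (use rep_objectD(2,3)[OF assms(1)] rep_objectD(2,3)[OF assms(2)] in
  \<open>auto simp: rep_tensor_def kronecker_one intro!: kronecker_carrier\<close>)

lemma rep_category_category: "category (rep_category G :: ('a, 'k::field) rep_cat)"
proof
 let ?R = "rep_category G :: ('a, 'k) rep_cat"
 fix f assume "f : Arr ?R"
 then show "Dom ?R f : Obj ?R" "Cod ?R f : Obj ?R" by (cases f; auto simp: rep_arrow_iff)+
next
 fix X assume "X : Obj (rep_category G :: ('a, 'k) rep_cat)"
 then show "Ident (rep_category G) X : Hom (rep_category G) X X" by (simp add: rep_hom_iff one_intertwiner)
next
 fix f g X Y Z assume "f : Hom (rep_category G :: ('a, 'k) rep_cat) X Y"
  "g : Hom (rep_category G) Y Z"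
 then show "g **[rep_category G] f : Hom (rep_category G) X Z" by (auto simp: rep_hom_iff intertwiners_comp)
next
 fix f g h W X Y Z assume "f : Hom (rep_category G :: ('a, 'k) rep_cat) W X"
  "g : Hom (rep_category G) X Y" "h : Hom (rep_category G) Y Z"
 then show "h **[rep_category G] g **[rep_category G] f = h **[rep_category G] (g **[rep_category G] f)"
  by (elim rep_homE) (simp add: assoc_mult_mat)
next
 fix f X Y assume "f : Hom (rep_category G :: ('a, 'k) rep_cat) X Y"
 then show "f **[rep_category G] Ident (rep_category G) X = f" "Ident (rep_category G) Y **[rep_category G] f = f"
  by (elim rep_homE; simp)+
qed

lemma rep_hom_vectorspace:
 assumes X: "X : rep_objects G" and Y: "Y : rep_objects G"
 shows "vectorspace class_ring (hom_space (rep_category G :: ('a, 'k::field) rep_cat) X Y)"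
proof -
 let ?R = "rep_category G :: ('a, 'k) rep_cat"
 let ?V = "hom_space ?R X Y"
 have ab: "abelian_group ?V"
 proof (rule abelian_groupI)
  fix f assume f: "f : carrier ?V"
  then obtain A where A: "f = (X, Y, A)" "A : intertwiners G X Y" "A : carrier_mat (fst Y) (fst X)"
   by (auto simp: hom_space_def elim: rep_homE)
  have "(X, Y, - 1 \<cdot>\<^sub>m A) : carrier ?V" using X Y smult_intertwiner[OF X Y A(2)] by (simp add: hom_space_def rep_hom_iff)
  moreover have "- 1 \<cdot>\<^sub>m A + A = 0\<^sub>m (fst Y) (fst X)" using A(3) by (intro eq_matI) auto
  ultimately show "\<exists>g\<in>carrier ?V. g \<oplus>\<^bsub>?V\<^esub> f = \<zero>\<^bsub>?V\<^esub>" using A(1) by (intro bexI) (auto simp: hom_space_def)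
 next
  fix f g assume "f : carrier ?V" "g : carrier ?V"
  then show "f \<oplus>\<^bsub>?V\<^esub> g : carrier ?V" "f \<oplus>\<^bsub>?V\<^esub> g = g \<oplus>\<^bsub>?V\<^esub> f"
   using add_intertwiner[OF X Y] X Y by (auto simp: hom_space_def rep_hom_iff intertwiners_def comm_add_mat)
 next
  fix f g h assume "f : carrier ?V" "g : carrier ?V" "h : carrier ?V"
  then show "f \<oplus>\<^bsub>?V\<^esub> g \<oplus>\<^bsub>?V\<^esub> h = f \<oplus>\<^bsub>?V\<^esub> (g \<oplus>\<^bsub>?V\<^esub> h)"
   by (auto simp: hom_space_def rep_hom_iff intertwiners_def assoc_add_mat)
 qed (use X Y zero_intertwiner[OF X Y] in "auto simp: hom_space_def rep_hom_iff intertwiners_def")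
 have mod: "module class_ring ?V"
 proof (rule moduleI[OF class_cring.cring_axioms ab])
  fix c d :: 'k and f assume "f : carrier ?V"
  then obtain A where A: "f = (X, Y, A)" "A : intertwiners G X Y" "A : carrier_mat (fst Y) (fst X)"
   by (auto simp: hom_space_def elim: rep_homE)
  show "c \<odot>\<^bsub>?V\<^esub> f : carrier ?V" using A X Y smult_intertwiner[OF X Y A(2)] by (simp add: hom_space_def rep_hom_iff)
  show "(c \<oplus>\<^bsub>class_ring\<^esub> d) \<odot>\<^bsub>?V\<^esub> f = c \<odot>\<^bsub>?V\<^esub> f \<oplus>\<^bsub>?V\<^esub> d \<odot>\<^bsub>?V\<^esub> f"
   using A(1) add_smult_distrib_right_mat[OF A(3), of c d] by (simp add: hom_space_def)
  show "(c \<otimes>\<^bsub>class_ring\<^esub> d) \<odot>\<^bsub>?V\<^esub> f = c \<odot>\<^bsub>?V\<^esub> (d \<odot>\<^bsub>?V\<^esub> f)" "\<one>\<^bsub>class_ring\<^esub> \<odot>\<^bsub>?V\<^esub> f = f"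
   using A(1) by (auto simp: hom_space_def mult.assoc intro: eq_matI)
  fix g assume "g : carrier ?V"
  then obtain B where B: "g = (X, Y, B)" "B : carrier_mat (fst Y) (fst X)"
   by (auto simp: hom_space_def elim: rep_homE)
  show "c \<odot>\<^bsub>?V\<^esub> (f \<oplus>\<^bsub>?V\<^esub> g) = c \<odot>\<^bsub>?V\<^esub> f \<oplus>\<^bsub>?V\<^esub> c \<odot>\<^bsub>?V\<^esub> g"
   using A(1) B add_smult_distrib_left_mat[OF A(3) B(2), of c] by (simp add: hom_space_def)
 qed
 show ?thesis using mod class_field by (simp add: vectorspace_def)
qed

lemma rep_linear_category: "linear_category (rep_category G :: ('a, 'k::field) rep_cat)"
proof -
 let ?R = "rep_category G :: ('a, 'k) rep_cat"
 show ?thesis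
 proof (intro linear_category.intro linear_category_axioms.intro)
  show "category ?R" by (rule rep_category_category)
  show "vectorspace class_ring (hom_space ?R X Y)" if "X : Obj ?R" "Y : Obj ?R" for X Y
   using that by (simp add: rep_hom_vectorspace)
  show "Add ?R g h **[?R] f = Add ?R (g **[?R] f) (h **[?R] f)"
   if "f : Hom ?R X Y" "g : Hom ?R Y Z" "h : Hom ?R Y Z" for f g h X Y Z
   using that by (elim rep_homE) (simp add: add_mult_distrib_mat)
  show "h **[?R] Add ?R f g = Add ?R (h **[?R] f) (h **[?R] g)"
   if "f : Hom ?R X Y" "g : Hom ?R X Y" "h : Hom ?R Y Z" for f g h X Y Z
   using that by (elim rep_homE) (simp add: mult_add_distrib_mat)
  fix f g X Y Z c assume f: "f : Hom ?R X Y" and g: "g : Hom ?R Y Z"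
  obtain A where A: "f = (X, Y, A)" "A : carrier_mat (fst Y) (fst X)" using f by (rule rep_homE)
  obtain B where B: "g = (Y, Z, B)" "B : carrier_mat (fst Z) (fst Y)" using g by (rule rep_homE)
  show "Scale ?R c g **[?R] f = Scale ?R c (g **[?R] f)" "g **[?R] Scale ?R c f = Scale ?R c (g **[?R] f)"
   using A(1) B(1) mult_smult_assoc_mat[OF B(2) A(2), of c] mult_smult_distrib[OF B(2) A(2), of c] by simp_all
 qed
qed

text \<open>The Kronecker product is strictly associative and unital, so the constraints are identity matrices
  between representations that agree on the group.\<close>

lemma rep_identity_iso:
 assumes "X : rep_objects G" "Y : rep_objects G" "fst X = fst Y" "\<And>g. g : carrier G ==> snd X g = snd Y g" "n = fst X"
 shows "(X, Y, 1\<^sub>m n) : Hom (rep_category G) X Y"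
  "inverse_arrows (rep_category G) (X, Y, 1\<^sub>m n) (Y, X, 1\<^sub>m n)"
proof -
 have "1\<^sub>m n : intertwiners G X Y" "1\<^sub>m n : intertwiners G Y X"
  using assms rep_object_dims[OF assms(1)] rep_object_dims[OF assms(2)] by (simp_all add: intertwiners_def)
 then show "(X, Y, 1\<^sub>m n) : Hom (rep_category G) X Y"
  "inverse_arrows (rep_category G) (X, Y, 1\<^sub>m n) (Y, X, 1\<^sub>m n)"
  using assms by (auto simp: inverse_arrows_def rep_hom_iff rep_arrow_iff)
qed

lemma rep_structure_isos:
 assumes X: "X : rep_objects G" and Y: "Y : rep_objects G" and Z: "Z : rep_objects G"
 shows "Assoc (rep_category G) X Y Z : Hom (rep_category G) (rep_tensor G (rep_tensor G X Y) Z) (rep_tensor G X (rep_tensor G Y Z))"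
  "inverse_arrows (rep_category G) (Assoc (rep_category G) X Y Z)
   (rep_tensor G X (rep_tensor G Y Z), rep_tensor G (rep_tensor G X Y) Z, 1\<^sub>m (fst X * fst Y * fst Z))"
  "Lunit (rep_category G) X : Hom (rep_category G) (rep_tensor G (rep_unit G) X) X"
  "inverse_arrows (rep_category G) (Lunit (rep_category G) X) (X, rep_tensor G (rep_unit G) X, 1\<^sub>m (fst X))"
  "Runit (rep_category G) X : Hom (rep_category G) (rep_tensor G X (rep_unit G)) X"
  "inverse_arrows (rep_category G) (Runit (rep_category G) X) (X, rep_tensor G X (rep_unit G), 1\<^sub>m (fst X))"
proof -
 have o: "rep_tensor G (rep_tensor G X Y) Z : rep_objects G" "rep_tensor G X (rep_tensor G Y Z) : rep_objects G"
  "rep_tensor G (rep_unit G) X : rep_objects G" "rep_tensor G X (rep_unit G) : rep_objects G"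
  using assms rep_tensor_obj rep_unit_obj by blast+
 have a: "snd (rep_tensor G (rep_tensor G X Y) Z) g = snd (rep_tensor G X (rep_tensor G Y Z)) g" if "g : carrier G" for g
  using kronecker_assoc[OF rep_objectD(2)[OF X that] rep_objectD(2)[OF Y that] rep_objectD(2)[OF Z that]] that
  by (simp add: rep_tensor_def)
 have l: "snd (rep_tensor G (rep_unit G) X) g = snd X g" "snd (rep_tensor G X (rep_unit G)) g = snd X g" if "g : carrier G" for g
  using that kronecker_one_left[of "snd X g"] kronecker_one_right[of "snd X g"] by (simp_all add: rep_tensor_def rep_unit_def)
 show "Assoc (rep_category G) X Y Z : Hom (rep_category G) (rep_tensor G (rep_tensor G X Y) Z) (rep_tensor G X (rep_tensor G Y Z))"
  "inverse_arrows (rep_category G) (Assoc (rep_category G) X Y Z)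
   (rep_tensor G X (rep_tensor G Y Z), rep_tensor G (rep_tensor G X Y) Z, 1\<^sub>m (fst X * fst Y * fst Z))"
  unfolding rep_category_simps by (rule rep_identity_iso[OF o(1,2)]; use a in "simp add: rep_tensor_def")+
 show "Lunit (rep_category G) X : Hom (rep_category G) (rep_tensor G (rep_unit G) X) X"
  "inverse_arrows (rep_category G) (Lunit (rep_category G) X) (X, rep_tensor G (rep_unit G) X, 1\<^sub>m (fst X))"
  unfolding rep_category_simps by (rule rep_identity_iso[OF o(3) X]; use l in "simp add: rep_tensor_def rep_unit_def")+
 show "Runit (rep_category G) X : Hom (rep_category G) (rep_tensor G X (rep_unit G)) X"
  "inverse_arrows (rep_category G) (Runit (rep_category G) X) (X, rep_tensor G X (rep_unit G), 1\<^sub>m (fst X))"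
  unfolding rep_category_simps by (rule rep_identity_iso[OF o(4) X]; use l in "simp add: rep_tensor_def rep_unit_def")+
qed

lemma rep_monoidal_category: "monoidal_category (rep_category G :: ('a, 'k::field) rep_cat)"
proof -
 let ?R = "rep_category G :: ('a, 'k) rep_cat"
 interpret category ?R by (rule rep_category_category)
 have ft: "fst (rep_tensor G X Y) = fst X * fst Y" "fst (rep_unit G) = 1" for X Y :: "('a, 'k) rep"
  by (simp_all add: rep_tensor_def rep_unit_def)
 have iso: "is_iso ?R f" if "inverse_arrows ?R f g" for f g unfolding is_iso_def using that by (rule exI)
 show ?thesis
 proof unfold_locales
  show "Unit ?R : Obj ?R" using rep_unit_obj by simp
  show "X \<boxtimes>[?R] Y : Obj ?R" if "X : Obj ?R" "Y : Obj ?R" for X Y using that rep_tensor_obj by simp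
  show "f \<star>[?R] g : Hom ?R (X \<boxtimes>[?R] Y) (X' \<boxtimes>[?R] Y')"
   if "f : Hom ?R X X'" "g : Hom ?R Y Y'" for f g X X' Y Y'
   using that by (elim rep_homE) (simp add: rep_hom_iff rep_tensor_obj kronecker_intertwiner)
  show "Ident ?R X \<star>[?R] Ident ?R Y = Ident ?R (X \<boxtimes>[?R] Y)" if "X : Obj ?R" "Y : Obj ?R" for X Y
   by (simp add: kronecker_one ft)
  show "(f' **[?R] f) \<star>[?R] (g' **[?R] g) = (f' \<star>[?R] g') **[?R] (f \<star>[?R] g)"
   if "f : Hom ?R X X'" "f' : Hom ?R X' X''" "g : Hom ?R Y Y'" "g' : Hom ?R Y' Y''" for f f' g g' X X' X'' Y Y' Y''
   using that by (elim rep_homE) (simp add: kronecker_mult)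
  fix X Y Z assume X: "X : Obj ?R" and Y: "Y : Obj ?R" and Z: "Z : Obj ?R"
  note i = rep_structure_isos[OF X[simplified] Y[simplified] Z[simplified]]
  show "Assoc ?R X Y Z : Hom ?R ((X \<boxtimes>[?R] Y) \<boxtimes>[?R] Z) (X \<boxtimes>[?R] (Y \<boxtimes>[?R] Z))" using i(1) by simp
  show "is_iso ?R (Assoc ?R X Y Z)" by (rule iso[OF i(2)])
 next
  fix X assume X: "X : Obj ?R"
  note i = rep_structure_isos[OF X[simplified] X[simplified] X[simplified]]
  show "Lunit ?R X : Hom ?R (Unit ?R \<boxtimes>[?R] X) X" using i(3) by simp
  show "is_iso ?R (Lunit ?R X)" by (rule iso[OF i(4)])
  show "Runit ?R X : Hom ?R (X \<boxtimes>[?R] Unit ?R) X" using i(5) by simp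
  show "is_iso ?R (Runit ?R X)" by (rule iso[OF i(6)])
 next
  fix f g h X X' Y Y' Z Z' assume "f : Hom ?R X X'" "g : Hom ?R Y Y'" "h : Hom ?R Z Z'"
  then show "Assoc ?R X' Y' Z' **[?R] ((f \<star>[?R] g) \<star>[?R] h) = (f \<star>[?R] (g \<star>[?R] h)) **[?R] Assoc ?R X Y Z"
  proof (elim rep_homE)
   fix A B C assume *: "f = (X, X', A)" "g = (Y, Y', B)" "h = (Z, Z', C)"
    "A : carrier_mat (fst X') (fst X)" "B : carrier_mat (fst Y') (fst Y)" "C : carrier_mat (fst Z') (fst Z)"
   have "kronecker (kronecker A B) C : carrier_mat (fst X' * fst Y' * fst Z') (fst X * fst Y * fst Z)"
    using * by (intro kronecker_carrier)
   then show ?thesis using * kronecker_assoc[of A _ _ B _ _ C] by simp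
  qed
 next
  fix f X Y assume "f : Hom ?R X Y"
  then obtain A where A: "f = (X, Y, A)" "A : carrier_mat (fst Y) (fst X)" by (elim rep_homE)
  show "Lunit ?R Y **[?R] (Ident ?R (Unit ?R) \<star>[?R] f) = f **[?R] Lunit ?R X"
   "Runit ?R Y **[?R] (f \<star>[?R] Ident ?R (Unit ?R)) = f **[?R] Runit ?R X"
   using A kronecker_one_left[of A] kronecker_one_right[of A] by (simp_all add: ft)
 next
  fix W X Y Z
  show "(Ident ?R W \<star>[?R] Assoc ?R X Y Z) **[?R] Assoc ?R W (X \<boxtimes>[?R] Y) Z **[?R] (Assoc ?R W X Y \<star>[?R] Ident ?R Z)
    = Assoc ?R W X (Y \<boxtimes>[?R] Z) **[?R] Assoc ?R (W \<boxtimes>[?R] X) Y Z"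
   by (simp add: kronecker_one ft mult.assoc)
  show "(Ident ?R X \<star>[?R] Lunit ?R Y) **[?R] Assoc ?R X (Unit ?R) Y = Runit ?R X \<star>[?R] Ident ?R Y"
   by (simp add: kronecker_one ft)
 qed
qed

end

text \<open>The trace form, read as a row and as a column, serves as evaluation and as coevaluation.\<close>

definition trace_row :: "nat => 'k::field mat" where
 "trace_row n = mat 1 (n * n) (\<lambda>(_, t). if t div n = t mod n then 1 else 0)"

definition trace_col :: "nat => 'k::field mat" where
 "trace_col n = mat (n * n) 1 (\<lambda>(t, _). if t div n = t mod n then 1 else 0)"

lemma trace_carrier [simp]: "trace_row n : carrier_mat 1 (n * n)" "trace_col n : carrier_mat (n * n) 1"
 by (simp_all add: trace_row_def trace_col_def)

lemma trace_row_kronecker: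
 assumes A: "A : carrier_mat n n" and B: "B : carrier_mat n n" and AB: "B * A = 1\<^sub>m n"
 shows "trace_row n * kronecker (transpose_mat B) A = trace_row n"
proof (rule eq_matI)
 have c: "kronecker (transpose_mat B) A : carrier_mat (n * n) (n * n)" using A B by (intro kronecker_carrier) auto
 then show "dim_row (trace_row n * kronecker (transpose_mat B) A) = dim_row (trace_row n :: 'a mat)"
  "dim_col (trace_row n * kronecker (transpose_mat B) A) = dim_col (trace_row n :: 'a mat)" by (auto simp: trace_row_def)
 fix i j assume "i < dim_row (trace_row n :: 'a mat)" "j < dim_col (trace_row n :: 'a mat)"
 then have i: "i = 0" and j: "j < n * n" by (auto simp: trace_row_def)
 note j' = div_mod_less[OF j]
 have "(trace_row n * kronecker (transpose_mat B) A) $$ (i, j) = (\<Sum>t<n * n. trace_row n $$ (0, t) * kronecker (transpose_mat B) A $$ (t, j))"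
  using c i j by (simp add: scalar_prod_def lessThan_atLeast0 trace_row_def)
 also have "... = (\<Sum>t<n * n. if t div n = t mod n then B $$ (j div n, t div n) * A $$ (t mod n, j mod n) else 0)"
  by (rule sum.cong) (use A B j j' div_mod_less in "auto simp: trace_row_def kronecker_def")
 also have "... = (\<Sum>a<n. \<Sum>b<n. if a = b then B $$ (j div n, a) * A $$ (b, j mod n) else 0)" by (rule sum_div_mod)
 also have "... = (\<Sum>a<n. B $$ (j div n, a) * A $$ (a, j mod n))" by (simp add: sum.delta)
 also have "... = (B * A) $$ (j div n, j mod n)" using A B j' by (simp add: scalar_prod_def lessThan_atLeast0)
 also have "... = trace_row n $$ (i, j)" unfolding AB using i j j' by (simp add: trace_row_def)
 finally show "(trace_row n * kronecker (transpose_mat B) A) $$ (i, j) = trace_row n $$ (i, j)" .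
qed

lemma kronecker_trace_col:
 assumes A: "A : carrier_mat n n" and B: "B : carrier_mat n n" and AB: "A * B = 1\<^sub>m n"
 shows "kronecker A (transpose_mat B) * trace_col n = trace_col n"
proof (rule eq_matI)
 have c: "kronecker A (transpose_mat B) : carrier_mat (n * n) (n * n)" using A B by (intro kronecker_carrier) auto
 then show "dim_row (kronecker A (transpose_mat B) * trace_col n) = dim_row (trace_col n :: 'a mat)"
  "dim_col (kronecker A (transpose_mat B) * trace_col n) = dim_col (trace_col n :: 'a mat)" by (auto simp: trace_col_def)
 fix j i assume "j < dim_row (trace_col n :: 'a mat)" "i < dim_col (trace_col n :: 'a mat)"
 then have i: "i = 0" and j: "j < n * n" by (auto simp: trace_col_def)
 note j' = div_mod_less[OF j]
 have "(kronecker A (transpose_mat B) * trace_col n) $$ (j, i) = (\<Sum>t<n * n. kronecker A (transpose_mat B) $$ (j, t) * trace_col n $$ (t, 0))"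
  using c i j by (simp add: scalar_prod_def lessThan_atLeast0 trace_col_def)
 also have "... = (\<Sum>t<n * n. if t div n = t mod n then A $$ (j div n, t div n) * B $$ (t mod n, j mod n) else 0)"
  by (rule sum.cong) (use A B j j' div_mod_less in "auto simp: trace_col_def kronecker_def")
 also have "... = (\<Sum>a<n. \<Sum>b<n. if a = b then A $$ (j div n, a) * B $$ (b, j mod n) else 0)" by (rule sum_div_mod)
 also have "... = (\<Sum>a<n. A $$ (j div n, a) * B $$ (a, j mod n))" by (simp add: sum.delta)
 also have "... = (A * B) $$ (j div n, j mod n)" using A B j' by (simp add: scalar_prod_def lessThan_atLeast0)
 also have "... = trace_col n $$ (j, i)" unfolding AB using i j j' by (simp add: trace_col_def)
 finally show "(kronecker A (transpose_mat B) * trace_col n) $$ (j, i) = trace_col n $$ (j, i)" .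
qed

lemma trace_zigzag_right: "kronecker (1\<^sub>m n) (trace_row n :: 'a::field mat) * kronecker (trace_col n) (1\<^sub>m n) = 1\<^sub>m n"
proof (rule eq_matI)
 have c: "kronecker (1\<^sub>m n) (trace_row n :: 'a mat) : carrier_mat (n * 1) (n * (n * n))"
  "kronecker (trace_col n :: 'a mat) (1\<^sub>m n) : carrier_mat (n * n * n) (1 * n)"
  by (rule kronecker_carrier; rule one_carrier_mat trace_carrier)+
 show "dim_row (kronecker (1\<^sub>m n) (trace_row n :: 'a mat) * kronecker (trace_col n) (1\<^sub>m n)) = dim_row (1\<^sub>m n :: 'a mat)"
  "dim_col (kronecker (1\<^sub>m n) (trace_row n :: 'a mat) * kronecker (trace_col n) (1\<^sub>m n)) = dim_col (1\<^sub>m n :: 'a mat)" using c by auto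
 fix i j assume "i < dim_row (1\<^sub>m n :: 'a mat)" "j < dim_col (1\<^sub>m n :: 'a mat)"
 then have i: "i < n" and j: "j < n" by auto
 have "(kronecker (1\<^sub>m n) (trace_row n :: 'a mat) * kronecker (trace_col n) (1\<^sub>m n)) $$ (i, j)
   = (\<Sum>t<n * (n * n). kronecker (1\<^sub>m n) (trace_row n) $$ (i, t) * kronecker (trace_col n) (1\<^sub>m n) $$ (t, j))"
  using carrier_matD[OF c(1)] carrier_matD[OF c(2)] i j by (simp add: scalar_prod_def lessThan_atLeast0 mult.assoc)
 also have "... = (\<Sum>t<n * (n * n). if i = t div (n * n) \<and> t mod (n * n) div n = t mod (n * n) mod n \<and>
   t div (n * n) = t mod (n * n) div n \<and> t mod (n * n) mod n = j then 1 else 0)"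
 proof (rule sum.cong[OF refl])
  fix t assume "t : {..<n * (n * n)}"
  then have t: "t < n * (n * n)" "t < n * n * n" by (auto simp: mult.assoc)
  have n0: "n > 0" using i by simp
  have md: "t mod (n * n) div n = t div n mod n" "t mod (n * n) mod n = t mod n" "t div (n * n) = t div n div n"
   using mod_mult2_eq[of t n n] n0 by (simp_all add: div_mult2_eq)
  have 1: "kronecker (1\<^sub>m n) (trace_row n) $$ (i, t) = (if i = t div (n * n) \<and> t mod (n * n) div n = t mod (n * n) mod n then 1 else (0::'a))"
   using kronecker_index[of "1\<^sub>m n" n n "trace_row n" 1 "n * n" i t] t i div_mod_less[OF t(1)] by (auto simp: trace_row_def)
  have 2: "kronecker (trace_col n) (1\<^sub>m n) $$ (t, j) = (if t div n div n = t div n mod n \<and> t mod n = j then 1 else (0::'a))"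
   using kronecker_index[of "trace_col n" "n * n" 1 "1\<^sub>m n" n n t j] t j div_mod_less[OF t(2)] by (auto simp: trace_col_def)
  show "kronecker (1\<^sub>m n) (trace_row n) $$ (i, t) * kronecker (trace_col n) (1\<^sub>m n) $$ (t, j)
   = (if i = t div (n * n) \<and> t mod (n * n) div n = t mod (n * n) mod n \<and>
   t div (n * n) = t mod (n * n) div n \<and> t mod (n * n) mod n = j then 1 else (0::'a))"
   unfolding 1 2 by (simp add: md)
 qed
 also have "... = (\<Sum>a<n. \<Sum>r<n * n. if i = a \<and> r div n = r mod n \<and> a = r div n \<and> r mod n = j then 1 else 0)"
  by (rule sum_div_mod)
 also have "... = (\<Sum>a<n. \<Sum>b<n. \<Sum>c<n. if i = a \<and> b = c \<and> a = b \<and> c = j then 1 else 0)"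
  by (rule sum.cong[OF refl], rule sum_div_mod)
 also have "... = (\<Sum>a<n. \<Sum>b<n. \<Sum>c<n. if c = j then (if i = a \<and> b = j \<and> a = j then 1 else 0) else 0)"
  by (intro sum.cong) auto
 also have "... = (\<Sum>a<n. \<Sum>b<n. if b = j then (if i = a \<and> a = j then 1 else 0) else 0)"
  using j by (intro sum.cong refl) auto
 also have "... = (\<Sum>a<n. if a = j then (if i = j then 1 else 0) else 0)"
  using j by (intro sum.cong refl) auto
 also have "... = 1\<^sub>m n $$ (i, j)" using i j by simp
 finally show "(kronecker (1\<^sub>m n) (trace_row n) * kronecker (trace_col n) (1\<^sub>m n)) $$ (i, j) = (1\<^sub>m n :: 'a mat) $$ (i, j)" .
qed

text \<open>Transposition exchanges the two trace vectors and thereby the two zigzag identities.\<close>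

lemma transpose_kronecker: "transpose_mat (kronecker A B) = kronecker (transpose_mat A) (transpose_mat B)"
 by (rule eq_matI) (use div_mod_less in "auto simp: kronecker_def")

lemma trace_zigzag_left: "kronecker (trace_row n :: 'a::field mat) (1\<^sub>m n) * kronecker (1\<^sub>m n) (trace_col n) = 1\<^sub>m n"
proof -
 let ?r = "trace_row n :: 'a mat" and ?c = "trace_col n :: 'a mat"
 have t: "transpose_mat ?r = ?c" "transpose_mat ?c = ?r" by (auto simp: trace_row_def trace_col_def intro!: eq_matI)
 have c: "kronecker (1\<^sub>m n) ?r : carrier_mat (n * 1) (n * (n * n))" "kronecker ?c (1\<^sub>m n) : carrier_mat (n * (n * n)) (1 * n)"
  using kronecker_carrier[OF one_carrier_mat[of n] trace_carrier(1)] kronecker_carrier[OF trace_carrier(2) one_carrier_mat[of n]]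
  by (simp_all add: mult.assoc)
 from transpose_mult[OF c] show ?thesis by (simp add: trace_zigzag_right transpose_kronecker t)
qed

definition rep_dual :: "('g, 'z) monoid_scheme => ('g, 'k::field) rep => ('g, 'k) rep" where
 "rep_dual G X = (fst X, \<lambda>g\<in>carrier G. transpose_mat (snd X (inv\<^bsub>G\<^esub> g)))"

context group
begin

lemma rep_dual_obj:
 assumes "X : rep_objects G" shows "rep_dual G X : rep_objects G"
proof (rule rep_objectI)
 fix g h assume gh: "g : carrier G" "h : carrier G"
 have "snd X (inv (g \<otimes> h)) = snd X (inv h) * snd X (inv g)"
  using rep_objectD(4)[OF assms, of "inv h" "inv g"] gh by (simp add: inv_mult_group)
 then show "snd (rep_dual G X) (g \<otimes> h) = snd (rep_dual G X) g * snd (rep_dual G X) h"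
  using gh transpose_mult[of "snd X (inv h)" "fst X" "fst X" "snd X (inv g)" "fst X"] rep_objectD(2)[OF assms]
  by (simp add: rep_dual_def)
qed (use rep_objectD[OF assms] in "auto simp: rep_dual_def")

lemma rep_dual_dual: "X : rep_objects G ==> rep_dual G (rep_dual G X) = X"
 using rep_objectD(1)[of X G] by (auto simp: rep_dual_def prod_eq_iff extensional_def fun_eq_iff)

lemma rep_dual_is_dual:
 fixes X :: "('a, 'k::field) rep"
 assumes X: "X : rep_objects G"
 shows "is_dual (rep_category G) (rep_dual G X) X (rep_tensor G (rep_dual G X) X, rep_unit G, trace_row (fst X))
  (rep_unit G, rep_tensor G X (rep_dual G X), trace_col (fst X))"
proof -
 let ?Y = "rep_dual G X" and ?n = "fst X"
 have Y: "?Y : rep_objects G" and n: "fst ?Y = ?n" using rep_dual_obj[OF X] by (auto simp: rep_dual_def)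
 interpret category "rep_category G" by (rule rep_category_category)
 have inv: "snd X (inv g) * snd X g = 1\<^sub>m ?n" "snd X g * snd X (inv g) = 1\<^sub>m ?n" if "g : carrier G" for g
  using rep_objectD(4)[OF X, of "inv g" g] rep_objectD(4)[OF X, of g "inv g"] rep_objectD(3)[OF X] that by auto
 have ev: "trace_row ?n : intertwiners G (rep_tensor G ?Y X) (rep_unit G)"
  using trace_row_kronecker[OF rep_objectD(2)[OF X] rep_objectD(2)[OF X]] inv trace_carrier[of ?n]
  by (auto simp: intertwiners_def rep_tensor_def rep_unit_def rep_dual_def)
 have coev: "trace_col ?n : intertwiners G (rep_unit G) (rep_tensor G X ?Y)"
  using kronecker_trace_col[OF rep_objectD(2)[OF X] rep_objectD(2)[OF X]] inv trace_carrier[of ?n]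
  by (auto simp: intertwiners_def rep_tensor_def rep_unit_def rep_dual_def)
 note i = rep_structure_isos[OF X Y X] rep_structure_isos[OF Y X Y]
 note inv_of = inverse_ofI[OF i(4)] inverse_ofI[OF i(8)] inverse_ofI[OF i(12)]
 have c: "kronecker (1\<^sub>m ?n) (trace_row ?n :: 'k mat) : carrier_mat (?n * 1) (?n * (?n * ?n))"
  "kronecker (trace_col ?n :: 'k mat) (1\<^sub>m ?n) : carrier_mat (?n * ?n * ?n) (1 * ?n)"
  "kronecker (trace_row ?n :: 'k mat) (1\<^sub>m ?n) : carrier_mat (1 * ?n) (?n * ?n * ?n)"
  "kronecker (1\<^sub>m ?n) (trace_col ?n :: 'k mat) : carrier_mat (?n * (?n * ?n)) (?n * 1)"
  by (rule kronecker_carrier; rule one_carrier_mat trace_carrier)+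
 show ?thesis
  unfolding is_dual_def inv_of
  using X Y ev coev carrier_matD[OF c(1)] carrier_matD[OF c(2)] carrier_matD[OF c(3)] carrier_matD[OF c(4)]
   trace_zigzag_right[of ?n, where 'a = 'k] trace_zigzag_left[of ?n, where 'a = 'k] rep_tensor_obj[OF X Y] rep_tensor_obj[OF Y X] rep_unit_obj[where 'k = 'k]
  by (simp add: rep_hom_iff n mult.assoc)
qed

end

section \<open>Direct sums and one-dimensional representations\<close>

definition block_in :: "nat => nat => nat => 'k::field mat" where
 "block_in n c off = mat n c (\<lambda>(i, j). if i = off + j then 1 else 0)"

definition block_out :: "nat => nat => nat => 'k::field mat" where
 "block_out n c off = mat c n (\<lambda>(i, j). if j = off + i then 1 else 0)"

lemma block_carrier [simp]: "block_in n c off : carrier_mat n c" "block_out n c off : carrier_mat c n"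
 by (simp_all add: block_in_def block_out_def)

lemma block_mult:
 fixes A :: "'k::field mat"
 shows "A : carrier_mat r n ==> off + c \<le> n ==> A * block_in n c off = mat r c (\<lambda>(i, j). A $$ (i, off + j))"
  and "A : carrier_mat n r ==> off + c \<le> n ==> block_out n c off * A = mat c r (\<lambda>(i, j). A $$ (off + i, j))"
  and "A : carrier_mat c r ==> block_in n c off * A = mat n r (\<lambda>(i, j). if off \<le> i \<and> i < off + c then A $$ (i - off, j) else 0)"
  and "A : carrier_mat r c ==> A * block_out n c off = mat r n (\<lambda>(i, j). if off \<le> j \<and> j < off + c then A $$ (i, j - off) else 0)"
proof -
 show "A * block_in n c off = mat r c (\<lambda>(i, j). A $$ (i, off + j))" if "A : carrier_mat r n" "off + c \<le> n"
  by (rule eq_matI) (use that in \<open>auto simp: block_in_def scalar_prod_def if_distrib[where f = "\<lambda>x. _ * x"] cong: if_cong\<close>)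
 show "block_out n c off * A = mat c r (\<lambda>(i, j). A $$ (off + i, j))" if "A : carrier_mat n r" "off + c \<le> n"
  by (rule eq_matI) (use that in \<open>auto simp: block_out_def scalar_prod_def if_distrib[where f = "\<lambda>x. x * _"] cong: if_cong\<close>)
 have sh: "(\<Sum>k = 0..<c. if i = off + k then g k else 0) = (if off \<le> i \<and> i < off + c then g (i - off) else 0)" for i and g :: "nat => 'k"
 proof -
  have "(\<Sum>k = 0..<c. if i = off + k then g k else 0) = (\<Sum>k = 0..<c. if k = i - off then (if off \<le> i then g k else 0) else 0)"
   by (rule sum.cong) auto
  then show ?thesis by auto
 qed
 show "block_in n c off * A = mat n r (\<lambda>(i, j). if off \<le> i \<and> i < off + c then A $$ (i - off, j) else 0)" if A: "A : carrier_mat c r"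
 proof (rule eq_matI)
  fix i j assume "i < dim_row (mat n r (\<lambda>(i, j). if off \<le> i \<and> i < off + c then A $$ (i - off, j) else 0))"
   "j < dim_col (mat n r (\<lambda>(i, j). if off \<le> i \<and> i < off + c then A $$ (i - off, j) else 0))"
  then have ij: "i < n" "j < r" by auto
  have "(block_in n c off * A) $$ (i, j) = (\<Sum>k = 0..<c. if i = off + k then A $$ (k, j) else 0)"
   using A ij by (auto simp: block_in_def scalar_prod_def intro!: sum.cong)
  then show "(block_in n c off * A) $$ (i, j) = mat n r (\<lambda>(i, j). if off \<le> i \<and> i < off + c then A $$ (i - off, j) else 0) $$ (i, j)"
   using sh[of i "\<lambda>k. A $$ (k, j)"] ij by simp
 qed (use A in "auto simp: block_in_def")
 show "A * block_out n c off = mat r n (\<lambda>(i, j). if off \<le> j \<and> j < off + c then A $$ (i, j - off) else 0)" if A: "A : carrier_mat r c"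
 proof (rule eq_matI)
  fix i j assume "i < dim_row (mat r n (\<lambda>(i, j). if off \<le> j \<and> j < off + c then A $$ (i, j - off) else 0))"
   "j < dim_col (mat r n (\<lambda>(i, j). if off \<le> j \<and> j < off + c then A $$ (i, j - off) else 0))"
  then have ij: "i < r" "j < n" by auto
  have "(A * block_out n c off) $$ (i, j) = (\<Sum>k = 0..<c. if j = off + k then A $$ (i, k) else 0)"
   using A ij by (auto simp: block_out_def scalar_prod_def intro!: sum.cong)
  then show "(A * block_out n c off) $$ (i, j) = mat r n (\<lambda>(i, j). if off \<le> j \<and> j < off + c then A $$ (i, j - off) else 0) $$ (i, j)"
   using sh[of j "\<lambda>k. A $$ (i, k)"] ij by simp
 qed (use A in "auto simp: block_out_def")
qed

lemma (in linear_category) iterated_direct_sums: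
 assumes zero: "\<exists>Z. is_zero_obj C Z"
  and binary: "\<And>X Y. X : Obj C ==> Y : Obj C ==> \<exists>S. \<exists>f\<in>Hom C X S. \<exists>r\<in>Hom C S X. \<exists>s\<in>Hom C Y S. \<exists>q\<in>Hom C S Y.
   r ** f = Ident C X \<and> q ** s = Ident C Y \<and> q ** f = Zero C X Y \<and> r ** s = Zero C Y X \<and> Add C (f ** r) (s ** q) = Ident C S"
  and X: "\<And>k. k < (n::nat) ==> Xs k : Obj C"
 shows "\<exists>S i p. is_direct_sum C n Xs S i p"
 unfolding is_direct_sum_iff using X
proof (induction n)
 case 0
 obtain Z where "is_zero_obj C Z" using zero by blast
 then have "direct_sum_over C {..<0::nat} Xs Z i p" for i p by (simp add: direct_sum_over_def zero_obj_iff)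
 then show ?case by blast
next
 case (Suc n)
 then obtain S i p where d: "direct_sum_over C {..<n} Xs S i p" by auto
 have ob: "S : Obj C" "Xs n : Obj C" using direct_sum_overD(1)[OF d] Suc.prems by auto
 obtain S' f r s q where *: "f : Hom C S S'" "r : Hom C S' S" "s : Hom C (Xs n) S'" "q : Hom C S' (Xs n)"
  "r ** f = Ident C S" "q ** s = Ident C (Xs n)" "q ** f = Zero C S (Xs n)" "r ** s = Zero C (Xs n) S" "Add C (f ** r) (s ** q) = Ident C S'"
  using binary[OF ob] by blast
 show ?case using direct_sum_extend[OF d _ *(1,4,2,3,5,6,7,8,9)] by (auto simp: lessThan_Suc)
qed

lemma (in split_semisimple_category) simple_End:
 assumes "is_simple C X" shows "bij_betw (\<lambda>c. Scale C c (Ident C X)) UNIV (Hom C X X)"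
proof -
 obtain S a where S: "S : B" and a: "a : Hom C S X" "is_iso C a"
  using simple_isomorphic_B[OF assms] by (auto simp: isomorphic_def)
 have ob: "S : Obj C" "X : Obj C" using hom_obj[OF a(1)] by auto
 have c: "inverse_of C a ** (Scale C c (Ident C X) ** a) = Scale C c (Ident C S)" for c
  using a ob by (simp add: hom_iff)
 have "inj (\<lambda>c. Scale C c (Ident C X))"
 proof (rule injI)
  fix c d assume "Scale C c (Ident C X) = Scale C d (Ident C X)"
  then have "Scale C c (Ident C S) = Scale C d (Ident C S)" using c by metis
  then show "c = d" using B_End[OF S] by (auto simp: bij_betw_def dest: injD)
 qed
 moreover have "f : range (\<lambda>c. Scale C c (Ident C X))" if f: "f : Hom C X X" for f
 proof -
  have "inverse_of C a ** (f ** a) : Hom C S S" using f a by (simp add: hom_iff)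
  then obtain d where d: "inverse_of C a ** (f ** a) = Scale C d (Ident C S)" using B_End[OF S] by (auto simp: bij_betw_def)
  have "f ** a = a ** (inverse_of C a ** (f ** a))" using f a by (simp add: hom_iff)
  also have "... = Scale C d (Ident C X) ** a" unfolding d using a ob by (simp add: hom_iff)
  finally have fa: "f ** a = Scale C d (Ident C X) ** a" .
  have "f = Scale C d (Ident C X)" by (rule iso_cancel_right[OF a(2) _ _ _ _ fa]) (use f a ob in "simp_all add: hom_iff")
  then show ?thesis by blast
 qed
 ultimately show ?thesis using ob by (auto simp: bij_betw_def hom_iff)
qed

context group
begin

lemma rep_zero_obj: "\<exists>Z. is_zero_obj (rep_category G :: ('a, 'k::field) rep_cat) Z"
proof
 let ?R = "rep_category G :: ('a, 'k) rep_cat"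
 interpret linear_category ?R by (rule rep_linear_category)
 let ?Z = "(0, \<lambda>g\<in>carrier G. 1\<^sub>m 0) :: ('a, 'k) rep"
 have "?Z : rep_objects G" by (rule rep_objectI) auto
 then show "is_zero_obj ?R ?Z" unfolding zero_obj_iff by (auto intro: eq_matI)
qed

lemma rep_binary_sum:
 fixes X Y :: "('a, 'k::field) rep"
 assumes X: "X : rep_objects G" and Y: "Y : rep_objects G"
 defines "R \<equiv> rep_category G :: ('a, 'k) rep_cat"
 shows "\<exists>S. \<exists>f\<in>Hom R X S. \<exists>r\<in>Hom R S X. \<exists>s\<in>Hom R Y S. \<exists>q\<in>Hom R S Y.
   r **[R] f = Ident R X \<and> q **[R] s = Ident R Y \<and> q **[R] f = Zero R X Y \<and> r **[R] s = Zero R Y X \<and>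
   Add R (f **[R] r) (s **[R] q) = Ident R S"
proof -
 let ?n = "fst X" and ?m = "fst Y"
 define M where "M g = four_block_mat (snd X g) (0\<^sub>m ?n ?m) (0\<^sub>m ?m ?n) (snd Y g)" for g
 define S where "S = (?n + ?m, \<lambda>g\<in>carrier G. M g)"
 have Mc: "M g : carrier_mat (?n + ?m) (?n + ?m)" if "g : carrier G" for g
  unfolding M_def using rep_objectD(2)[OF X that] rep_objectD(2)[OF Y that] by (rule four_block_carrier_mat)
 have Mi: "M g $$ (i, j) = (if i < ?n then (if j < ?n then snd X g $$ (i, j) else 0) else if j < ?n then 0 else snd Y g $$ (i - ?n, j - ?n))"
  if "g : carrier G" "i < ?n + ?m" "j < ?n + ?m" for g i j
  using rep_object_dims[OF X that(1)] rep_object_dims[OF Y that(1)] that(2,3) by (auto simp: M_def)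
 have S: "S : rep_objects G"
 proof (rule rep_objectI)
  fix g h assume gh: "g : carrier G" "h : carrier G"
  note c = rep_objectD(2)[OF X gh(1)] rep_objectD(2)[OF X gh(2)] rep_objectD(2)[OF Y gh(1)] rep_objectD(2)[OF Y gh(2)]
  have "M g * M h = four_block_mat (snd X g * snd X h + 0\<^sub>m ?n ?m * 0\<^sub>m ?m ?n) (snd X g * 0\<^sub>m ?n ?m + 0\<^sub>m ?n ?m * snd Y h)
    (0\<^sub>m ?m ?n * snd X h + snd Y g * 0\<^sub>m ?m ?n) (0\<^sub>m ?m ?n * 0\<^sub>m ?n ?m + snd Y g * snd Y h)"
   unfolding M_def by (rule mult_four_block_mat) (use c in auto)
  also have "... = M (g \<otimes> h)" using c gh rep_objectD(4)[OF X gh] rep_objectD(4)[OF Y gh] by (simp add: M_def)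
  finally show "snd S (g \<otimes> h) = snd S g * snd S h" using gh by (simp add: S_def)
 qed (use Mc rep_objectD(3)[OF X] rep_objectD(3)[OF Y] in "auto simp: S_def M_def")
 let ?i = "block_in (?n + ?m) ?n 0" and ?j = "block_in (?n + ?m) ?m ?n"
 let ?p = "block_out (?n + ?m) ?n 0" and ?q = "block_out (?n + ?m) ?m ?n"
 have int: "?i : intertwiners G X S" "?j : intertwiners G Y S" "?p : intertwiners G S X" "?q : intertwiners G S Y"
 proof -
  have "M g * ?i = ?i * snd X g \<and> M g * ?j = ?j * snd Y g \<and> ?p * M g = snd X g * ?p \<and> ?q * M g = snd Y g * ?q" if g: "g : carrier G" for g
   by (intro conjI; rule eq_matI)
    (use Mi[OF g] Mc[OF g] rep_objectD(2)[OF X g] rep_objectD(2)[OF Y g] in \<open>auto simp: block_mult[of _ "?n + ?m"]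
     block_mult(3)[OF rep_objectD(2)[OF X g]] block_mult(3)[OF rep_objectD(2)[OF Y g]]
     block_mult(4)[OF rep_objectD(2)[OF X g]] block_mult(4)[OF rep_objectD(2)[OF Y g]] block_mult(1,2)[OF Mc[OF g]] simp del: index_mult_mat\<close>)
  then show "?i : intertwiners G X S" "?j : intertwiners G Y S" "?p : intertwiners G S X" "?q : intertwiners G S Y"
   by (auto simp: intertwiners_def S_def)
 qed
 have prods: "?p * ?i = 1\<^sub>m ?n" "?q * ?j = 1\<^sub>m ?m" "?q * ?i = 0\<^sub>m ?m ?n" "?p * ?j = 0\<^sub>m ?n ?m" "?i * ?p + ?j * ?q = 1\<^sub>m (?n + ?m)"
  by (rule eq_matI; simp add: block_mult(2)[OF block_carrier(1)] block_mult(3)[OF block_carrier(2)];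
    auto simp: block_in_def block_out_def)+
 show ?thesis
  by (rule exI[of _ S], rule bexI[of _ "(X, S, ?i)"], rule bexI[of _ "(S, X, ?p)"], rule bexI[of _ "(Y, S, ?j)"],
    rule bexI[of _ "(S, Y, ?q)"])
   (use int prods X Y S in "auto simp: R_def rep_hom_iff S_def")
qed

lemma one_dim_endomorphisms:
 fixes X :: "('a, 'k::field) rep"
 assumes X: "X : rep_objects G" "fst X = 1"
 shows "bij_betw (\<lambda>c. Scale (rep_category G) c (Ident (rep_category G) X)) UNIV (Hom (rep_category G) X X)"
proof -
 have "inj (\<lambda>c::'k. c \<cdot>\<^sub>m 1\<^sub>m 1)"
 proof (rule injI)
  fix c d :: 'k assume "c \<cdot>\<^sub>m 1\<^sub>m 1 = d \<cdot>\<^sub>m 1\<^sub>m 1"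
  then have "(c \<cdot>\<^sub>m 1\<^sub>m 1) $$ (0, 0) = (d \<cdot>\<^sub>m 1\<^sub>m 1) $$ (0, 0)" by simp
  then show "c = d" by simp
 qed
 moreover have "A : range (\<lambda>c. c \<cdot>\<^sub>m 1\<^sub>m 1)" if "A : intertwiners G X X" for A :: "'k mat"
  using intertwinersD(1)[OF that] X(2) by (intro image_eqI[of _ _ "A $$ (0, 0)"]) (auto intro!: eq_matI)
 moreover have "c \<cdot>\<^sub>m 1\<^sub>m 1 : intertwiners G X X" for c :: 'k
  using smult_intertwiner[OF X(1) X(1) one_intertwiner[OF X(1)], of c] X(2) by simp
 ultimately show ?thesis using X by (fastforce simp: bij_betw_def inj_on_def rep_hom_iff image_iff)
qed

lemma one_dim_schur:
 fixes X Y :: "('a, 'k::field) rep"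
 assumes d: "fst X = 1" "fst Y = 1"
  and f: "f : Hom (rep_category G) X Y" "f \<noteq> Zero (rep_category G) X Y"
 shows "is_iso (rep_category G) f"
proof -
 let ?R = "rep_category G :: ('a, 'k) rep_cat"
 obtain A where A: "f = (X, Y, A)" "X : rep_objects G" "Y : rep_objects G" "A : intertwiners G X Y" "A : carrier_mat 1 1"
  using f(1) d by (auto elim: rep_homE)
 let ?a = "A $$ (0, 0)"
 have Aa: "A = ?a \<cdot>\<^sub>m 1\<^sub>m 1" using A(5) by (intro eq_matI) auto
 have a0: "?a \<noteq> 0"
 proof
  assume "?a = 0"
  then have "A = 0\<^sub>m 1 1" using A(5) by (intro eq_matI) auto
  then show False using f(2) A(1) d by simp
 qed
 let ?I = "inverse ?a \<cdot>\<^sub>m (1\<^sub>m 1 :: 'k mat)"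
 have eq: "snd X g = snd Y g" if g: "g : carrier G" for g
 proof -
  note c = rep_objectD(2)[OF A(2) g] rep_objectD(2)[OF A(3) g]
  have "?a \<cdot>\<^sub>m snd X g = ?a \<cdot>\<^sub>m snd Y g"
  proof -
   have "?a \<cdot>\<^sub>m 1\<^sub>m 1 * snd X g = ?a \<cdot>\<^sub>m snd X g" "snd Y g * (?a \<cdot>\<^sub>m 1\<^sub>m 1) = ?a \<cdot>\<^sub>m snd Y g"
    using mult_smult_assoc_mat[of "1\<^sub>m 1" 1 1 "snd X g" 1 ?a] mult_smult_distrib[of "snd Y g" 1 1 "1\<^sub>m 1" 1 ?a] c d by auto
   then show ?thesis using intertwinersD(2)[OF A(4) g] Aa by metis
  qed
  then have "\<And>i j. i < 1 ==> j < 1 ==> ?a * snd X g $$ (i, j) = ?a * snd Y g $$ (i, j)"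
   using c d by (metis carrier_matD index_smult_mat(1))
  then show ?thesis using c d a0 by (intro eq_matI) auto
 qed
 have I: "?I : intertwiners G Y X"
  unfolding intertwiners_def
 proof (intro CollectI conjI ballI)
  fix g assume g: "g : carrier G"
  have c: "snd Y g : carrier_mat 1 1" using rep_objectD(2)[OF A(3) g] d by simp
  show "?I * snd Y g = snd X g * ?I" unfolding eq[OF g]
   using mult_smult_assoc_mat[of "1\<^sub>m 1" 1 1 "snd Y g" 1 "inverse ?a"] mult_smult_distrib[of "snd Y g" 1 1 "1\<^sub>m 1" 1 "inverse ?a"] c by simp
 qed (use d in simp)
 have "A * ?I = 1\<^sub>m 1" "?I * A = 1\<^sub>m 1" using A(5) a0 by (auto simp: scalar_prod_def intro!: eq_matI)
 then have "inverse_arrows ?R f (Y, X, ?I)"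
  using A I d by (auto simp: inverse_arrows_def rep_hom_iff rep_arrow_iff)
 then show ?thesis unfolding is_iso_def by (rule exI)
qed

text \<open>If every group element acts by a scalar, the coordinate axes are subrepresentations.\<close>

lemma scalar_rep_sum:
 fixes X :: "('a, 'k::field) rep"
 assumes c: "c : rep_objects G" "fst c = 1" and X: "X : rep_objects G"
  and sc: "\<And>g. g : carrier G ==> snd X g = snd c g $$ (0, 0) \<cdot>\<^sub>m 1\<^sub>m (fst X)"
 shows "direct_sum_over (rep_category G) {..<fst X} (\<lambda>_. c) X (\<lambda>k. (c, X, block_in (fst X) 1 k)) (\<lambda>k. (X, c, block_out (fst X) 1 k))"
proof (rule linear_category.direct_sum_overI[OF rep_linear_category])
 let ?R = "rep_category G :: ('a, 'k) rep_cat" and ?n = "fst X"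
 have c1: "snd c g = snd c g $$ (0, 0) \<cdot>\<^sub>m 1\<^sub>m 1" if "g : carrier G" for g
  using rep_objectD(2)[OF c(1) that] c(2) by (intro eq_matI) auto
 fix k assume k: "k : {..<?n}"
 have "block_in ?n 1 k * snd c g = snd X g * block_in ?n 1 k" "block_out ?n 1 k * snd X g = snd c g * block_out ?n 1 k" if g: "g : carrier G" for g
 proof -
  have i: "block_in ?n 1 k * (e \<cdot>\<^sub>m 1\<^sub>m 1) = (e \<cdot>\<^sub>m 1\<^sub>m ?n) * block_in ?n 1 k" for e :: 'k
   unfolding mult_smult_distrib[OF block_carrier(1) one_carrier_mat] mult_smult_assoc_mat[OF one_carrier_mat block_carrier(1)]
    right_mult_one_mat[OF block_carrier(1)] left_mult_one_mat[OF block_carrier(1)] ..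
  have o: "block_out ?n 1 k * (e \<cdot>\<^sub>m 1\<^sub>m ?n) = (e \<cdot>\<^sub>m 1\<^sub>m 1) * block_out ?n 1 k" for e :: 'k
   unfolding mult_smult_distrib[OF block_carrier(2) one_carrier_mat] mult_smult_assoc_mat[OF one_carrier_mat block_carrier(2)]
    right_mult_one_mat[OF block_carrier(2)] left_mult_one_mat[OF block_carrier(2)] ..
  show "block_in ?n 1 k * snd c g = snd X g * block_in ?n 1 k" "block_out ?n 1 k * snd X g = snd c g * block_out ?n 1 k"
   using i[of "snd c g $$ (0, 0)"] o[of "snd c g $$ (0, 0)"] c1[OF g] sc[OF g] by simp_all
 qed
 then show "(c, X, block_in ?n 1 k) : Hom ?R c X" "(X, c, block_out ?n 1 k) : Hom ?R X c"
  using c X by (auto simp: rep_hom_iff intertwiners_def)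
 show "(X, c, block_out ?n 1 k) **[?R] (c, X, block_in ?n 1 k) = Ident ?R c"
  using k c by (simp add: block_mult(2)[OF block_carrier(1)]) (auto simp: block_in_def intro!: eq_matI)
next
 let ?R = "rep_category G :: ('a, 'k) rep_cat"
 fix j k assume "j : {..<fst X}" "k : {..<fst X}" "j \<noteq> k"
 then show "(X, c, block_out (fst X) 1 j) **[?R] (c, X, block_in (fst X) 1 k) = Zero ?R c c"
  using c by (simp add: block_mult(2)[OF block_carrier(1)]) (auto simp: block_in_def intro!: eq_matI)
next
 let ?R = "rep_category G :: ('a, 'k) rep_cat"
 fix f assume f: "f : Hom ?R X X" "\<And>k. k : {..<fst X} ==> (X, c, block_out (fst X) 1 k) **[?R] f = Zero ?R X c"
 obtain A where A: "f = (X, X, A)" "A : carrier_mat (fst X) (fst X)" using f(1) by (rule rep_homE)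
 have "A $$ (k, j) = 0" if "k < fst X" "j < fst X" for k j
 proof -
  have "mat 1 (fst X) (\<lambda>(i, j). A $$ (k + i, j)) = 0\<^sub>m 1 (fst X)"
   using f(2)[of k] A that c block_mult(2)[OF A(2), of k 1] by simp
  then have "mat 1 (fst X) (\<lambda>(i, j). A $$ (k + i, j)) $$ (0, j) = 0\<^sub>m 1 (fst X) $$ (0, j)" by simp
  then show ?thesis using that by simp
 qed
 then show "f = Zero ?R X X" using A by (auto intro!: eq_matI)
qed (use X in auto)

text \<open>One-dimensional representations satisfy Schur's lemma with scalar endomorphisms over every field,
  so only the existence of decompositions depends on the group.\<close>

lemma rep_split_semisimple:
 assumes "\<And>X. X : rep_objects G ==> \<exists>n S i p. (\<forall>k<(n::nat). S k : rep_objects G \<and> fst (S k) = 1) \<and>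
   is_direct_sum (rep_category G :: ('a, 'k::field) rep_cat) n S X i p"
 shows "split_semisimple_category (rep_category G :: ('a, 'k) rep_cat)
  {X : rep_objects G. fst X = 1}"
proof (intro split_semisimple_category.intro split_semisimple_category_axioms.intro)
 let ?R = "rep_category G :: ('a, 'k) rep_cat"
 show "linear_category ?R" by (rule rep_linear_category)
 show "\<exists>n S i p. (\<forall>k<n. S k : {X : rep_objects G. fst X = 1}) \<and> is_direct_sum ?R n S X i p" if "X : Obj ?R" for X
  using assms[of X] that by simp
 show "\<exists>S i p. is_direct_sum ?R n Xs S i p" if "\<And>k. k < n ==> Xs k : Obj ?R" for n Xs
 proof (rule linear_category.iterated_direct_sums[OF rep_linear_category rep_zero_obj _ that])
  fix X Y assume "X : Obj ?R" "Y : Obj ?R"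
  then show "\<exists>S. \<exists>f\<in>Hom ?R X S. \<exists>r\<in>Hom ?R S X. \<exists>s\<in>Hom ?R Y S. \<exists>q\<in>Hom ?R S Y.
   r **[?R] f = Ident ?R X \<and> q **[?R] s = Ident ?R Y \<and> q **[?R] f = Zero ?R X Y \<and> r **[?R] s = Zero ?R Y X \<and>
   Add ?R (f **[?R] r) (s **[?R] q) = Ident ?R S" using rep_binary_sum[of X Y] by simp
 qed
next
 let ?R = "rep_category G :: ('a, 'k) rep_cat"
 fix S :: "('a, 'k) rep" assume S: "S : {X : rep_objects G. fst X = 1}"
 then show "S : Obj ?R" "bij_betw (\<lambda>c. Scale ?R c (Ident ?R S)) UNIV (Hom ?R S S)"
  using one_dim_endomorphisms[of S] by auto
 fix T f assume "T : {X : rep_objects G. fst X = 1}" "f : Hom ?R S T" "f \<noteq> Zero ?R S T"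
 then show "is_iso ?R f" using S one_dim_schur[of S T f] by auto
qed

end

text \<open>Representations of the trivial group are vector spaces, so the splitting of idempotents applies
  to square matrices.\<close>

lemma idempotent_matrix_splits:
 fixes E :: "'k::field mat"
 assumes E: "E : carrier_mat n n" "E * E = E"
 shows "\<exists>m s r. s : carrier_mat n m \<and> r : carrier_mat m n \<and> r * s = 1\<^sub>m m \<and> s * r = E"
proof -
 define T where "T = singleton_group ()"
 interpret T: group T unfolding T_def by simp
 have cT: "carrier T = {\<one>\<^bsub>T\<^esub>}" by (simp add: T_def singleton_group_def)
 let ?R = "rep_category T :: (unit, 'k) rep_cat"
 have u: "(rep_unit T :: (unit, 'k) rep) : rep_objects T" "fst (rep_unit T :: (unit, 'k) rep) = 1"
  using T.rep_unit_obj by (auto simp: rep_unit_def)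
 have "\<exists>n S i p. (\<forall>k<(n::nat). S k : rep_objects T \<and> fst (S k) = 1) \<and> is_direct_sum ?R n S X i p" if X: "X : rep_objects T" for X
  unfolding is_direct_sum_iff
  by (rule exI[of _ "fst X"], rule exI[of _ "\<lambda>_. rep_unit T"], intro exI conjI, use u in simp, rule T.scalar_rep_sum[OF u X])
   (use rep_objectD(3)[OF X] in "auto simp: cT rep_unit_def intro!: eq_matI")
 then interpret S: split_semisimple_category ?R "{X : rep_objects T. fst X = 1}" by (rule T.rep_split_semisimple)
 define X where "X = (n, \<lambda>g\<in>carrier T. 1\<^sub>m n :: 'k mat)"
 have "() : carrier T" by (simp add: T_def singleton_group_def)
 then have X: "X : rep_objects T" "fst X = n" by (auto simp: X_def intro!: rep_objectI)
 have "(X, X, E) : Hom ?R X X" "(X, X, E) **[?R] (X, X, E) = (X, X, E)"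
  using E X rep_objectD(3)[OF X(1)] by (auto simp: rep_hom_iff intertwiners_def cT)
 from S.idempotent_splits[OF this] obtain Z r s
  where s: "s : Hom ?R Z X" and r: "r : Hom ?R X Z" and rs: "r **[?R] s = Ident ?R Z" "s **[?R] r = (X, X, E)" by blast
 obtain A where A: "s = (Z, X, A)" "A : carrier_mat (fst X) (fst Z)" using s by (rule rep_homE)
 obtain B where B: "r = (X, Z, B)" "B : carrier_mat (fst Z) (fst X)" using r by (rule rep_homE)
 show ?thesis using A B rs X(2) by auto
qed

section \<open>The group of order two\<close>

abbreviation Z2 :: "int monoid" where "Z2 \<equiv> integer_mod_group 2"

lemma Z2_carrier: "carrier Z2 = {0, 1}" and Z2_one: "\<one>\<^bsub>Z2\<^esub> = 0" and Z2_mult: "g \<otimes>\<^bsub>Z2\<^esub> h = (g + h) mod 2"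
 by (auto simp: integer_mod_group_def integer_group_def)

lemma Z2_group: "group Z2"
 by (rule group_integer_mod_group)

text \<open>The generator acts by the scalar \<open>e\<close>; this is a representation if \<open>e\<close> is a square root
  of \<open>1\<close>.\<close>

definition scalar_rep :: "'k::field => nat => (int, 'k) rep" where
 "scalar_rep e n = (n, \<lambda>g\<in>carrier Z2. if g = 0 then 1\<^sub>m n else e \<cdot>\<^sub>m 1\<^sub>m n)"

abbreviation character :: "'k::field => (int, 'k) rep" where "character e \<equiv> scalar_rep e 1"

lemma scalar_rep_simps [simp]: "fst (scalar_rep e n) = n" "snd (scalar_rep e n) 0 = 1\<^sub>m n" "snd (scalar_rep e n) 1 = e \<cdot>\<^sub>m 1\<^sub>m n"
 by (auto simp: scalar_rep_def Z2_carrier)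

lemma scalar_rep_obj:
 assumes "e * e = 1" shows "scalar_rep e n : rep_objects Z2"
proof (rule rep_objectI)
 have "(e \<cdot>\<^sub>m 1\<^sub>m n) * (e \<cdot>\<^sub>m 1\<^sub>m n) = (e * e) \<cdot>\<^sub>m 1\<^sub>m n"
  using mult_smult_distrib[of "e \<cdot>\<^sub>m 1\<^sub>m n" n n "1\<^sub>m n" n e] by (auto intro!: eq_matI)
 also have "... = 1\<^sub>m n" unfolding assms by (auto intro!: eq_matI)
 finally have ee: "(e \<cdot>\<^sub>m 1\<^sub>m n) * (e \<cdot>\<^sub>m 1\<^sub>m n) = 1\<^sub>m n" .
 fix g h assume "g : carrier Z2" "h : carrier Z2"
 then show "snd (scalar_rep e n) (g \<otimes>\<^bsub>Z2\<^esub> h) = snd (scalar_rep e n) g * snd (scalar_rep e n) h"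
  using ee by (auto simp: Z2_carrier Z2_mult simp del: One_nat_def)
qed (auto simp: scalar_rep_def Z2_carrier Z2_one)

lemma rep_Z2_involution: "X : rep_objects Z2 ==> snd X 1 * snd X 1 = 1\<^sub>m (fst X)" "X : rep_objects Z2 ==> snd X 0 = 1\<^sub>m (fst X)"
 "X : rep_objects Z2 ==> snd X 1 : carrier_mat (fst X) (fst X)"
 using rep_objectD(4)[of X Z2 1 1] rep_objectD(3)[of X Z2] rep_objectD(2)[of X Z2 1] by (auto simp: Z2_carrier Z2_one Z2_mult)

lemma Z2_intertwinersI:
 assumes "X : rep_objects Z2" "Y : rep_objects Z2" "A : carrier_mat (fst Y) (fst X)" "A * snd X 1 = snd Y 1 * A"
 shows "A : intertwiners Z2 X Y"
 using assms rep_Z2_involution(2)[OF assms(1)] rep_Z2_involution(2)[OF assms(2)] by (auto simp: intertwiners_def Z2_carrier)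

lemma one_dim_Z2:
 fixes X :: "(int, 'k::field) rep"
 assumes X: "X : rep_objects Z2" "fst X = 1" shows "X = character 1 \<or> X = character (- 1)"
proof -
 let ?M = "snd X 1"
 have M: "?M : carrier_mat 1 1" "?M * ?M = 1\<^sub>m 1" using rep_Z2_involution[OF X(1)] X(2) by auto
 let ?c = "?M $$ (0, 0)"
 have Mc: "?M = ?c \<cdot>\<^sub>m 1\<^sub>m 1" using M(1) by (intro eq_matI) auto
 have "(?M * ?M) $$ (0, 0) = 1" unfolding M(2) by simp
 then have "?c * ?c = 1" using M(1) by (simp add: scalar_prod_def)
 then have c: "?c = 1 \<or> ?c = - 1" by (simp add: square_eq_1_iff)
 have "X = character ?c"
 proof (rule prod_eqI)
  show "snd X = snd (character ?c)"
  proof (rule extensionalityI[of _ "carrier Z2"])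
   show "snd X : extensional (carrier Z2)" by (rule rep_objectD(1)[OF X(1)])
   show "snd (character ?c) : extensional (carrier Z2)" by (simp add: scalar_rep_def)
   fix g assume "g : carrier Z2"
   then show "snd X g = snd (character ?c) g" using Mc rep_Z2_involution(2)[OF X(1)] X(2) by (auto simp: Z2_carrier scalar_rep_def)
  qed
 qed (simp add: X scalar_rep_def)
 then show ?thesis using c by auto
qed

text \<open>In characteristic other than \<open>2\<close> an involution \<open>M\<close> is diagonalisable, because \<open>(1 + M) / 2\<close> and
  \<open>(1 - M) / 2\<close> are complementary idempotents.\<close>

lemma rep_Z2_decomposition:
 fixes X :: "(int, 'k::field) rep"
 assumes two: "(2::'k) \<noteq> 0" and X: "X : rep_objects Z2"
 shows "\<exists>n S i p. (\<forall>k<(n::nat). S k : rep_objects Z2 \<and> fst (S k) = 1) \<and> is_direct_sum (rep_category Z2) n S X i p"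
proof -
 let ?R = "rep_category Z2 :: (int, 'k) rep_cat"
 interpret Z: group Z2 by (rule Z2_group)
 interpret L: linear_category ?R by (rule Z.rep_linear_category)
 let ?n = "fst X" and ?M = "snd X 1"
 note M = rep_Z2_involution[OF X]
 define E where "E e = (1 / 2) \<cdot>\<^sub>m (1\<^sub>m ?n + e \<cdot>\<^sub>m ?M)" for e :: 'k
 have Ec: "E e : carrier_mat ?n ?n" for e using M by (simp add: E_def)
 have ME: "?M * E e = e \<cdot>\<^sub>m E e" and EM: "E e * ?M = e \<cdot>\<^sub>m E e" if "e * e = 1" for e
 proof -
  have m: "e \<cdot>\<^sub>m ?M : carrier_mat ?n ?n" "1\<^sub>m ?n + e \<cdot>\<^sub>m ?M : carrier_mat ?n ?n" using M by auto
  have r: "(1 / 2) \<cdot>\<^sub>m (?M + e \<cdot>\<^sub>m 1\<^sub>m ?n) = e \<cdot>\<^sub>m E e"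
  proof (rule eq_matI)
   fix i j assume "i < dim_row (e \<cdot>\<^sub>m E e)" "j < dim_col (e \<cdot>\<^sub>m E e)"
   then have ij: "i < ?n" "j < ?n" using Ec[of e] by auto
   have "e * (e * y) = y" for y using that by (simp add: mult.assoc[symmetric])
   then show "((1 / 2) \<cdot>\<^sub>m (?M + e \<cdot>\<^sub>m 1\<^sub>m ?n)) $$ (i, j) = (e \<cdot>\<^sub>m E e) $$ (i, j)"
    using ij M(3) two by (auto simp: E_def field_simps)
  qed (use M Ec[of e] in auto)
  have "?M * E e = (1 / 2) \<cdot>\<^sub>m (?M * (1\<^sub>m ?n + e \<cdot>\<^sub>m ?M))" unfolding E_def by (rule mult_smult_distrib[OF M(3) m(2)])
  also have "?M * (1\<^sub>m ?n + e \<cdot>\<^sub>m ?M) = ?M * 1\<^sub>m ?n + ?M * (e \<cdot>\<^sub>m ?M)" by (rule mult_add_distrib_mat[OF M(3) _ m(1)]) simp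
  also have "... = ?M + e \<cdot>\<^sub>m 1\<^sub>m ?n" using M mult_smult_distrib[OF M(3) M(3), of e] by simp
  finally show "?M * E e = e \<cdot>\<^sub>m E e" using r by simp
  have "E e * ?M = (1 / 2) \<cdot>\<^sub>m ((1\<^sub>m ?n + e \<cdot>\<^sub>m ?M) * ?M)" unfolding E_def by (rule mult_smult_assoc_mat[OF m(2) M(3)])
  also have "(1\<^sub>m ?n + e \<cdot>\<^sub>m ?M) * ?M = 1\<^sub>m ?n * ?M + (e \<cdot>\<^sub>m ?M) * ?M" by (rule add_mult_distrib_mat[OF _ m(1) M(3)]) simp
  also have "... = ?M + e \<cdot>\<^sub>m 1\<^sub>m ?n" using M mult_smult_assoc_mat[OF M(3) M(3), of e] by simp
  finally show "E e * ?M = e \<cdot>\<^sub>m E e" using r by simp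
 qed
 have EE: "E d * E e = ((1 + d * e) / 2) \<cdot>\<^sub>m E e" if "e * e = 1" for d e
 proof -
  have m: "d \<cdot>\<^sub>m ?M : carrier_mat ?n ?n" "1\<^sub>m ?n + d \<cdot>\<^sub>m ?M : carrier_mat ?n ?n" using M by auto
  have "E d * E e = (1 / 2) \<cdot>\<^sub>m ((1\<^sub>m ?n + d \<cdot>\<^sub>m ?M) * E e)" unfolding E_def[of d] by (rule mult_smult_assoc_mat[OF m(2) Ec])
  also have "(1\<^sub>m ?n + d \<cdot>\<^sub>m ?M) * E e = 1\<^sub>m ?n * E e + (d \<cdot>\<^sub>m ?M) * E e" by (rule add_mult_distrib_mat[OF _ m(1) Ec]) simp
  also have "(d \<cdot>\<^sub>m ?M) * E e = d \<cdot>\<^sub>m (e \<cdot>\<^sub>m E e)" using mult_smult_assoc_mat[OF M(3) Ec, of d] ME[OF that] by simp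
  finally have "E d * E e = (1 / 2) \<cdot>\<^sub>m (E e + d \<cdot>\<^sub>m (e \<cdot>\<^sub>m E e))" using Ec[of e] by simp
  also have "... = ((1 + d * e) / 2) \<cdot>\<^sub>m E e" using Ec[of e] two by (intro eq_matI) (auto simp: field_simps)
  finally show ?thesis .
 qed
 have idem: "E e * E e = E e" if "e * e = 1" for e
 proof -
  have "(1 + e * e) / 2 = (1::'k)" using that two by simp
  then show ?thesis using EE[OF that, of e] Ec[of e] by (auto intro!: eq_matI)
 qed
 have E0: "E d * E e = 0\<^sub>m ?n ?n" if "e * e = 1" "d * e = - 1" for d e
  using EE[OF that(1), of d] that(2) Ec[of e] by (auto intro!: eq_matI)
 have E1: "E 1 + E (- 1) = 1\<^sub>m ?n" using M(3) two by (intro eq_matI) (auto simp: E_def field_simps)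
 let ?sg = "\<lambda>b. if b then 1 else - 1 :: 'k"
 have sg: "?sg b * ?sg b = 1" for b by simp
 have "\<exists>m s r. s : carrier_mat ?n m \<and> r : carrier_mat m ?n \<and> r * s = 1\<^sub>m m \<and> s * r = E (?sg b)" for b
  by (rule idempotent_matrix_splits[OF Ec idem[OF sg]])
 then obtain m s r where sc: "\<And>b. s b : carrier_mat ?n (m b)" and rc: "\<And>b. r b : carrier_mat (m b) ?n"
  and rs: "\<And>b. r b * s b = 1\<^sub>m (m b)" and sr: "\<And>b. s b * r b = E (?sg b)" by metis
 have sE: "E (?sg b) * s b = s b" and rE: "r b * E (?sg b) = r b" for b
  using assoc_mult_mat[OF sc[of b] rc[of b] sc[of b]] assoc_mult_mat[OF rc[of b] sc[of b] rc[of b]] rs[of b] sr[of b] sc[of b] rc[of b] by auto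
 let ?Z = "\<lambda>b. scalar_rep (?sg b) (m b)"
 have Z: "?Z b : rep_objects Z2" for b by (rule scalar_rep_obj[OF sg])
 have "?M * s b = ?sg b \<cdot>\<^sub>m s b" for b
  using assoc_mult_mat[OF M(3) Ec[of "?sg b"] sc[of b]] sE[of b] ME[OF sg, of b] mult_smult_assoc_mat[OF Ec[of "?sg b"] sc[of b], of "?sg b"] by (simp del: if_split)
 then have si: "s b : intertwiners Z2 (?Z b) X" for b
  using mult_smult_distrib[OF sc[of b] one_carrier_mat, of "?sg b"] sc[of b] by (intro Z2_intertwinersI[OF Z X]) (simp_all del: if_split)
 have "r b * ?M = ?sg b \<cdot>\<^sub>m r b" for b
  using assoc_mult_mat[OF rc[of b] Ec[of "?sg b"] M(3)] rE[of b] EM[OF sg, of b] mult_smult_distrib[OF rc[of b] Ec[of "?sg b"], of "?sg b"] by (simp del: if_split)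
 then have ri: "r b : intertwiners Z2 X (?Z b)" for b
  using mult_smult_assoc_mat[OF one_carrier_mat rc[of b], of "?sg b"] rc[of b] by (intro Z2_intertwinersI[OF X Z]) (simp_all del: if_split)
 have D: "direct_sum_over ?R UNIV ?Z X (\<lambda>b. (?Z b, X, s b)) (\<lambda>b. (X, ?Z b, r b))"
 proof (rule L.direct_sum_overI)
  show "(?Z b, X, s b) : Hom ?R (?Z b) X" "(X, ?Z b, r b) : Hom ?R X (?Z b)" for b
   using si[of b] ri[of b] X Z[of b] by (simp_all add: rep_hom_iff del: if_split)
  show "(X, ?Z b, r b) **[?R] (?Z b, X, s b) = Ident ?R (?Z b)" for b using rs[of b] by simp
  show "(X, ?Z b, r b) **[?R] (?Z c, X, s c) = Zero ?R (?Z c) (?Z b)" if "b \<noteq> c" for b c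
  proof -
   have "r b * s c = r b * E (?sg b) * (E (?sg c) * s c)" using sE[of c] rE[of b] by (simp del: if_split)
   also have "... = r b * (E (?sg b) * E (?sg c) * s c)"
    unfolding assoc_mult_mat[OF rc Ec mult_carrier_mat[OF Ec sc]] assoc_mult_mat[OF Ec Ec sc] ..
   also have "E (?sg b) * E (?sg c) = 0\<^sub>m ?n ?n" by (rule E0[OF sg]) (use that in auto)
   finally show ?thesis using sc[of c] rc[of b] by simp
  qed
  fix f assume f: "f : Hom ?R X X" "\<And>b. b : UNIV ==> (X, ?Z b, r b) **[?R] f = Zero ?R X (?Z b)"
  obtain A where A: "f = (X, X, A)" "A : carrier_mat ?n ?n" using f(1) by (rule rep_homE)
  have "E (?sg b) * A = 0\<^sub>m ?n ?n" for b
   unfolding sr[of b, symmetric] assoc_mult_mat[OF sc rc A(2)] using f(2)[of b] A sc[of b] by simp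
  from this[of True] this[of False] have "E 1 * A + E (- 1) * A = 0\<^sub>m ?n ?n" by simp
  moreover have "E 1 * A + E (- 1) * A = A" using add_mult_distrib_mat[OF Ec Ec A(2), of 1 "- 1"] E1 A(2) by simp
  ultimately show "f = Zero ?R X X" using A(1) by simp
 qed (use X in auto)
 have ch: "character (?sg b) : rep_objects Z2" for b by (rule scalar_rep_obj[OF sg])
 have Zs: "direct_sum_over ?R {..<m b} (\<lambda>_. character (?sg b)) (?Z b) (\<lambda>k. (character (?sg b), ?Z b, block_in (m b) 1 k)) (\<lambda>k. (?Z b, character (?sg b), block_out (m b) 1 k))" for b
 proof -
  have "snd (?Z b) g = snd (character (?sg b)) g $$ (0, 0) \<cdot>\<^sub>m 1\<^sub>m (fst (?Z b))" if "g : carrier Z2" for g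
   using that by (auto simp: Z2_carrier intro!: eq_matI simp del: if_split)
  from Z.scalar_rep_sum[OF ch[of b] _ Z[of b] this] show ?thesis by (simp del: if_split)
 qed
 note fl = L.direct_sum_flatten[OF D Zs]
 obtain e where e: "is_direct_sum ?R (card (Sigma UNIV (\<lambda>b. {..<m b}))) (\<lambda>k. (\<lambda>(b, l). character (?sg b)) (e k)) X
   (\<lambda>k. (\<lambda>(b, l). (?Z b, X, s b) **[?R] (character (?sg b), ?Z b, block_in (m b) 1 l)) (e k))
   (\<lambda>k. (\<lambda>(b, l). (?Z b, character (?sg b), block_out (m b) 1 l) **[?R] (X, ?Z b, r b)) (e k))"
  by (rule L.direct_sum_over_nat[OF fl])
 have "\<forall>k<card (Sigma UNIV (\<lambda>b. {..<m b})). (\<lambda>(b, l). character (?sg b)) (e k) : rep_objects Z2 \<and> fst ((\<lambda>(b, l). character (?sg b)) (e k)) = 1"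
  using ch by (simp add: case_prod_beta)
 note * = conjI[OF this e]
 show ?thesis by (intro exI) (rule *)
qed

lemma rep_Z2_split_semisimple:
 "(2::'k::field) \<noteq> 0 ==> split_semisimple_category (rep_category Z2 :: (int, 'k) rep_cat)
  {X : rep_objects Z2. fst X = 1}"
 by (rule group.rep_split_semisimple[OF Z2_group rep_Z2_decomposition])

theorem rep_Z2_fusion:
 assumes two: "(2::'k::field) \<noteq> 0"
 shows "fusion_category (rep_category Z2 :: (int, 'k) rep_cat)"
proof -
 let ?R = "rep_category Z2 :: (int, 'k) rep_cat"
 interpret Z: group Z2 by (rule Z2_group)
 interpret S: split_semisimple_category ?R "{X : rep_objects Z2. fst X = 1}" by (rule rep_Z2_split_semisimple[OF two])
 interpret M: monoidal_category ?R by (rule Z.rep_monoidal_category)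
 have fin: "finite (simple_classes ?R)"
 proof (rule finite_subset)
  show "simple_classes ?R \<subseteq> iso_class ?R ` {character 1, character (- 1)}"
  proof
   fix T assume "T : simple_classes ?R"
   then obtain X where X: "is_simple ?R X" "T = iso_class ?R X" by (auto simp: simple_classes_def)
   obtain S where S: "S : rep_objects Z2" "fst S = 1" "isomorphic ?R S X" using S.simple_isomorphic_B[OF X(1)] by auto
   have "T = iso_class ?R S" using X(2) S.iso_class_eq_iff[OF S.isomorphic_obj[OF S(3)]] S(3) by simp
   then show "T : iso_class ?R ` {character 1, character (- 1)}" using one_dim_Z2[OF S(1,2)] by auto
  qed
 qed simp
 have "tensor_category ?R"
 proof (intro tensor_category.intro tensor_category_axioms.intro)
  show "abelian_category ?R" by (rule S.abelian)
  show "monoidal_category ?R" by unfold_locales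
  show "vectorspace.fin_dim class_ring (hom_space ?R X Y)" if "X : Obj ?R" "Y : Obj ?R" for X Y by (rule S.hom_fin_dim[OF that])
  show "finite_length ?R X" if "X : Obj ?R" for X by (rule S.finite_length[OF that])
  show "\<exists>Y ev coev. is_dual ?R Y X ev coev" if "X : Obj ?R" for X
  proof -
   have "X : rep_objects Z2" using that by simp
   from Z.rep_dual_is_dual[OF this] show ?thesis by blast
  qed
  show "\<exists>Y ev coev. is_dual ?R X Y ev coev" if "X : Obj ?R" for X
  proof -
   have X: "X : rep_objects Z2" using that by simp
   from Z.rep_dual_is_dual[OF Z.rep_dual_obj[OF X]] show ?thesis unfolding Z.rep_dual_dual[OF X] by blast
  qed
  show "bij_betw (\<lambda>c. Scale ?R c (Ident ?R (Unit ?R))) UNIV (Hom ?R (Unit ?R) (Unit ?R))"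
   using Z.one_dim_endomorphisms[OF Z.rep_unit_obj] by (simp add: rep_unit_def)
 next
  fix f f' g X X' Y Y' assume "f : Hom ?R X X'" "f' : Hom ?R X X'" "g : Hom ?R Y Y'"
  then show "Add ?R f f' \<star>[?R] g = Add ?R (f \<star>[?R] g) (f' \<star>[?R] g)"
   by (elim rep_homE) (simp add: kronecker_linear(1)[OF _ _ _ zero_carrier_mat])
 next
  fix f g g' X X' Y Y' assume "f : Hom ?R X X'" "g : Hom ?R Y Y'" "g' : Hom ?R Y Y'"
  then show "f \<star>[?R] Add ?R g g' = Add ?R (f \<star>[?R] g) (f \<star>[?R] g')"
   by (elim rep_homE) (simp add: kronecker_linear(2)[OF _ zero_carrier_mat])
 next
  fix f g c X X' Y Y' assume "f : Hom ?R X X'" "g : Hom ?R Y Y'"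
  then show "Scale ?R c f \<star>[?R] g = Scale ?R c (f \<star>[?R] g)" "f \<star>[?R] Scale ?R c g = Scale ?R c (f \<star>[?R] g)"
   by (elim rep_homE; simp add: kronecker_linear(3)[OF _ zero_carrier_mat _ zero_carrier_mat] kronecker_linear(4)[OF _ zero_carrier_mat _ zero_carrier_mat])+
 qed
 then show ?thesis
 proof (intro fusion_category.intro fusion_category_axioms.intro)
  show "\<exists>n S i p. (\<forall>k<n. is_simple ?R (S k)) \<and> is_direct_sum ?R n S X i p" if X: "X : Obj ?R" for X
  proof -
   obtain n T i p where T: "\<forall>k<n. T k : {X : rep_objects Z2. fst X = 1}" "is_direct_sum ?R n T X i p"
    using S.B_sum[OF X] by blast
   have "\<forall>k<n. is_simple ?R (T k)" using T(1) S.B_simple by blast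
   with T(2) show ?thesis by blast
  qed
  show "bij_betw (\<lambda>c. Scale ?R c (Ident ?R X)) UNIV (Hom ?R X X)" if "is_simple ?R X" for X
   by (rule S.simple_End[OF that])
 qed (use fin in simp_all)
qed

section \<open>Lifting tensor functors along faithful functors\<close>

text \<open>On a split semisimple source exactness is automatic.  The coherence conditions are associated to
  the right, the normal form of compositions.\<close>

lemma tensor_functor_semisimpleI:
 assumes C: "tensor_category C" and D: "tensor_category D" and B: "split_semisimple_category C B"
  and lin: "linear_functor C D (FObj F) (FArr F)"
  and T: "\<And>X Y. X : Obj C ==> Y : Obj C ==> FTens F X Y : Hom D (FObj F X \<boxtimes>[D] FObj F Y) (FObj F (X \<boxtimes>[C] Y))"
  "\<And>X Y. X : Obj C ==> Y : Obj C ==> is_iso D (FTens F X Y)"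
  and nat: "\<And>X X' Y Y' f g. f : Hom C X X' ==> g : Hom C Y Y'
   ==> FArr F (f \<star>[C] g) **[D] FTens F X Y = FTens F X' Y' **[D] (FArr F f \<star>[D] FArr F g)"
  and U: "FUnit F : Hom D (Unit D) (FObj F (Unit C))" "is_iso D (FUnit F)"
  and coh: "\<And>X Y Z. X : Obj C ==> Y : Obj C ==> Z : Obj C
   ==> FArr F (Assoc C X Y Z) **[D] (FTens F (X \<boxtimes>[C] Y) Z **[D] (FTens F X Y \<star>[D] Ident D (FObj F Z)))
    = FTens F X (Y \<boxtimes>[C] Z) **[D] ((Ident D (FObj F X) \<star>[D] FTens F Y Z) **[D] Assoc D (FObj F X) (FObj F Y) (FObj F Z))"
  "\<And>X. X : Obj C ==> FArr F (Lunit C X) **[D] (FTens F (Unit C) X **[D] (FUnit F \<star>[D] Ident D (FObj F X))) = Lunit D (FObj F X)"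
  "\<And>X. X : Obj C ==> FArr F (Runit C X) **[D] (FTens F X (Unit C) **[D] (Ident D (FObj F X) \<star>[D] FUnit F)) = Runit D (FObj F X)"
 shows "tensor_functor C D F"
proof -
 interpret C: tensor_category C by fact
 interpret D: tensor_category D by fact
 interpret L: linear_functor C D "FObj F" "FArr F" by fact
 note Th = T(1)[unfolded D.hom_iff] and Uh = U(1)[unfolded D.hom_iff]
 show ?thesis
 proof (intro tensor_functor.intro tensor_functor_axioms.intro C D)
  show "short_exact C f g ==> short_exact D (FArr F f) (FArr F g)" for f g by (rule L.preserves_short_exact[OF B])
  show "FArr F (Assoc C X Y Z) **[D] FTens F (X \<boxtimes>[C] Y) Z **[D] (FTens F X Y \<star>[D] Ident D (FObj F Z))
    = FTens F X (Y \<boxtimes>[C] Z) **[D] (Ident D (FObj F X) \<star>[D] FTens F Y Z) **[D] Assoc D (FObj F X) (FObj F Y) (FObj F Z)"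
   if "X : Obj C" "Y : Obj C" "Z : Obj C" for X Y Z
   using coh(1)[OF that] that Th L.Fo_obj by (simp add: D.comp_assoc)
  show "FArr F (Lunit C X) **[D] FTens F (Unit C) X **[D] (FUnit F \<star>[D] Ident D (FObj F X)) = Lunit D (FObj F X)"
   "FArr F (Runit C X) **[D] FTens F X (Unit C) **[D] (Ident D (FObj F X) \<star>[D] FUnit F) = Runit D (FObj F X)"
   if "X : Obj C" for X
   using coh(2,3)[OF that] that Th Uh L.Fo_obj by (simp_all add: D.comp_assoc)
 qed (use L.Fo_obj L.Fa_hom L.Fa_Ident L.Fa_Comp L.Fa_Add L.Fa_Scale T nat U in auto)
qed

lemma (in tensor_functor) coherence:
 assumes "X : Obj C" "Y : Obj C" "Z : Obj C"
 shows "FArr F (Assoc C X Y Z) **[D] (FTens F (X \<boxtimes>[C] Y) Z **[D] (FTens F X Y \<star>[D] Ident D (FObj F Z)))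
    = FTens F X (Y \<boxtimes>[C] Z) **[D] ((Ident D (FObj F X) \<star>[D] FTens F Y Z) **[D] Assoc D (FObj F X) (FObj F Y) (FObj F Z))"
  "FArr F (Lunit C X) **[D] (FTens F (Unit C) X **[D] (FUnit F \<star>[D] Ident D (FObj F X))) = Lunit D (FObj F X)"
  "FArr F (Runit C X) **[D] (FTens F X (Unit C) **[D] (Ident D (FObj F X) \<star>[D] FUnit F)) = Runit D (FObj F X)"
 using FTens_Assoc[OF assms] FTens_Lunit[OF assms(1)] FTens_Runit[OF assms(1)] assms by (simp_all add: D.comp_assoc)

lemma (in monoidal_category) interchange':
 assumes "f : Arr C" "g : Arr C" "f' : Arr C" "g' : Arr C" "Dom C f' = Cod C f" "Dom C g' = Cod C g"
  "x : Arr C" "Cod C x = Dom C f \<boxtimes> Dom C g"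
 shows "(f' \<star> g') ** ((f \<star> g) ** x) = ((f' ** f) \<star> (g' ** g)) ** x"
 using assms by (simp add: comp_assoc[symmetric] interchange)

lemma (in tensor_functor) FTens_natural':
 assumes "f : Arr C" "g : Arr C"
 shows "FArr F (f \<star>[C] g) **[D] FTens F (Dom C f) (Dom C g) = FTens F (Cod C f) (Cod C g) **[D] (FArr F f \<star>[D] FArr F g)"
  and "x : Arr D ==> Cod D x = FObj F (Dom C f) \<boxtimes>[D] FObj F (Dom C g) ==>
   FArr F (f \<star>[C] g) **[D] (FTens F (Dom C f) (Dom C g) **[D] x) = FTens F (Cod C f) (Cod C g) **[D] ((FArr F f \<star>[D] FArr F g) **[D] x)"
proof -
 show *: "FArr F (f \<star>[C] g) **[D] FTens F (Dom C f) (Dom C g) = FTens F (Cod C f) (Cod C g) **[D] (FArr F f \<star>[D] FArr F g)"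
  by (rule FTens_natural) (use assms in "auto simp: C.hom_iff")
 show "FArr F (f \<star>[C] g) **[D] (FTens F (Dom C f) (Dom C g) **[D] x) = FTens F (Cod C f) (Cod C g) **[D] ((FArr F f \<star>[D] FArr F g) **[D] x)"
  if "x : Arr D" "Cod D x = FObj F (Dom C f) \<boxtimes>[D] FObj F (Dom C g)"
  by (rule D.comp_cong2[OF *]) (use assms that C.Dom_closed C.Cod_closed in auto)
qed

text \<open>Let \<open>\<theta>\<close> be a family of isomorphisms from \<open>F f\<close> to \<open>H\<close> that is compatible with the data of \<open>f\<close>.
  As \<open>F\<close> is faithful, an axiom of a tensor functor for \<open>f\<close> may be tested after applying \<open>F\<close>.
  There, the structure of \<open>F\<close> and \<open>\<theta>\<close> transform it into the same axiom for \<open>H\<close>.\<close>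

theorem lift_tensor_functor:
 assumes A: "tensor_category A" "split_semisimple_category A B" and F: "tensor_functor C D F" and H: "tensor_functor A D H"
  and K: "K \<subseteq> Obj C" "Unit C : K" "\<And>X Y. X : K ==> Y : K ==> X \<boxtimes>[C] Y : K"
  and faithful: "\<And>X Y. X : K ==> Y : K ==> inj_on (FArr F) (Hom C X Y)"
  and obj: "\<And>V. V : Obj A ==> FObj f V : K \<and> \<theta> V : Hom D (FObj F (FObj f V)) (FObj H V) \<and> is_iso D (\<theta> V)"
  and arr: "\<And>V W a. a : Hom A V W ==> FArr f a : Hom C (FObj f V) (FObj f W) \<and> \<theta> W **[D] FArr F (FArr f a) = FArr H a **[D] \<theta> V"
  and tens: "\<And>V W. V : Obj A ==> W : Obj A ==> FTens f V W : Hom C (FObj f V \<boxtimes>[C] FObj f W) (FObj f (V \<boxtimes>[A] W)) \<and> is_iso C (FTens f V W)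
   \<and> \<theta> (V \<boxtimes>[A] W) **[D] (FArr F (FTens f V W) **[D] FTens F (FObj f V) (FObj f W)) = FTens H V W **[D] (\<theta> V \<star>[D] \<theta> W)"
  and unit: "FUnit f : Hom C (Unit C) (FObj f (Unit A)) \<and> is_iso C (FUnit f) \<and> \<theta> (Unit A) **[D] (FArr F (FUnit f) **[D] FUnit F) = FUnit H"
 shows "tensor_functor A C f"
proof -
 interpret F: tensor_functor C D F by fact
 interpret H: tensor_functor A D H by fact
 have o [simp]: "FObj f V : K" "FObj f V : Obj C" "is_iso D (\<theta> V)" "\<theta> V : Arr D" "Dom D (\<theta> V) = FObj F (FObj f V)" "Cod D (\<theta> V) = FObj H V"
  if "V : Obj A" for V using obj[OF that] K(1) by (auto simp: F.D.hom_iff)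
 have a [simp]: "FArr f x : Arr C" "Dom C (FArr f x) = FObj f (Dom A x)" "Cod C (FArr f x) = FObj f (Cod A x)"
  "\<theta> (Cod A x) **[D] FArr F (FArr f x) = FArr H x **[D] \<theta> (Dom A x)" if "x : Arr A" for x
  using arr[of x "Dom A x" "Cod A x"] that by (auto simp: H.C.hom_iff F.C.hom_iff)
 have a': "\<theta> (Cod A x) **[D] (FArr F (FArr f x) **[D] y) = FArr H x **[D] (\<theta> (Dom A x) **[D] y)"
  if "x : Arr A" "y : Arr D" "Cod D y = FObj F (FObj f (Dom A x))" for x y
  by (rule F.D.comp_cong2[OF a(4)]) (use that H.C.Dom_closed H.C.Cod_closed in auto)
 have t [simp]: "FTens f V W : Arr C" "Dom C (FTens f V W) = FObj f V \<boxtimes>[C] FObj f W" "Cod C (FTens f V W) = FObj f (V \<boxtimes>[A] W)" "is_iso C (FTens f V W)"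
  "\<theta> (V \<boxtimes>[A] W) **[D] (FArr F (FTens f V W) **[D] FTens F (FObj f V) (FObj f W)) = FTens H V W **[D] (\<theta> V \<star>[D] \<theta> W)"
  if "V : Obj A" "W : Obj A" for V W using tens[OF that] by (auto simp: F.C.hom_iff)
 have t': "\<theta> (V \<boxtimes>[A] W) **[D] (FArr F (FTens f V W) **[D] (FTens F (FObj f V) (FObj f W) **[D] y)) = FTens H V W **[D] ((\<theta> V \<star>[D] \<theta> W) **[D] y)"
  if "V : Obj A" "W : Obj A" "y : Arr D" "Cod D y = FObj F (FObj f V) \<boxtimes>[D] FObj F (FObj f W)" for V W y
  using F.D.comp_cong2[OF t(5)[OF that(1,2)], of y] that by (simp add: F.D.comp_assoc)
 have u [simp]: "FUnit f : Arr C" "Dom C (FUnit f) = Unit C" "Cod C (FUnit f) = FObj f (Unit A)" "is_iso C (FUnit f)"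
  "\<theta> (Unit A) **[D] (FArr F (FUnit f) **[D] FUnit F) = FUnit H" using unit by (auto simp: F.C.hom_iff)
 have eqI: "x = y" if x: "x : Arr C" "Dom C x : K" "Cod C x = FObj f V" "V : Obj A" "y : Arr C" "Dom C y = Dom C x" "Cod C y = FObj f V"
  and P: "is_iso D P" "Cod D P = FObj F (Dom C x)" and eq: "\<theta> V **[D] (FArr F x **[D] P) = \<theta> V **[D] (FArr F y **[D] P)" for x y V P
 proof -
  have "FArr F x **[D] P = FArr F y **[D] P" by (rule F.D.iso_cancel_left[OF _ _ _ _ _ eq]) (use x P in auto)
  then have "FArr F x = FArr F y" by (rule F.D.iso_cancel_right[OF P(1), rotated 4]) (use x P in auto)
  then show ?thesis using faithful[of "Dom C x" "FObj f V"] x by (auto simp: inj_on_def F.C.hom_iff)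
 qed
 have eqI_Ident: "x = y" if "x : Arr C" "Dom C x : K" "Cod C x = FObj f V" "V : Obj A" "y : Arr C" "Dom C y = Dom C x" "Cod C y = FObj f V"
  "\<theta> V **[D] FArr F x = \<theta> V **[D] FArr F y" for x y V
  by (rule eqI[OF that(1-7), of "Ident D (FObj F (Dom C x))"]) (use that K(1) in auto)
 show ?thesis
 proof (rule tensor_functor_semisimpleI[OF A(1) F.C.tensor_category_axioms A(2)])
  show "linear_functor A C (FObj f) (FArr f)"
  proof (intro linear_functor.intro linear_functor_axioms.intro H.C.linear_category_axioms F.C.linear_category_axioms)
   fix X assume "X : Obj A" then show "FArr f (Ident A X) = Ident C (FObj f X)"
    using a(4)[of "Ident A X"] by (intro eqI_Ident[of _ X]) (auto simp: F.Fa_Ident H.Fa_Ident)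
  next
   fix X Y Z x y assume "x : Hom A X Y" "y : Hom A Y Z"
   then show "FArr f (y **[A] x) = FArr f y **[C] FArr f x"
    using H.C.Dom_closed H.C.Cod_closed a(4)[of "y **[A] x"] a(4)[of x] a'[of y "FArr F (FArr f x)"]
    by (intro eqI_Ident[of _ Z]) (auto simp: H.C.hom_iff F.Fa_Comp' H.Fa_Comp' F.D.comp_assoc)
  next
   fix X Y x y assume "x : Hom A X Y" "y : Hom A X Y"
   then show "FArr f (Add A x y) = Add C (FArr f x) (FArr f y)"
    using H.C.Dom_closed H.C.Cod_closed F.FArr_Add[of "FArr f x" "FObj f X" "FObj f Y" "FArr f y"] H.FArr_Add[of x X Y y]
     a(4)[of "Add A x y"] a(4)[of x] a(4)[of y]
    by (intro eqI_Ident[of _ Y]) (auto simp: H.C.hom_iff F.C.hom_iff F.D.Comp_Add)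
  next
   fix X Y x c assume "x : Hom A X Y"
   then show "FArr f (Scale A c x) = Scale C c (FArr f x)"
    using H.C.Dom_closed H.C.Cod_closed F.FArr_Scale[of "FArr f x" "FObj f X" "FObj f Y" c] H.FArr_Scale[of x X Y c]
     a(4)[of "Scale A c x"] a(4)[of x]
    by (intro eqI_Ident[of _ Y]) (auto simp: H.C.hom_iff F.C.hom_iff)
  qed (use obj arr K(1) in auto)
  show "FUnit f : Hom C (Unit C) (FObj f (Unit A))" "is_iso C (FUnit f)" using unit by auto
  fix X assume X: "X : Obj A"
  let ?X = "FObj f X"
  have fX: "?X : Obj C" "?X : K" using X by auto
  show "FArr f (Lunit A X) **[C] (FTens f (Unit A) X **[C] (FUnit f \<star>[C] Ident C ?X)) = Lunit C ?X" (is "?L = _")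
  proof (rule eqI[of _ X _ "FTens F (Unit C) ?X **[D] (FUnit F \<star>[D] Ident D (FObj F ?X))"])
   let ?P = "FTens F (Unit C) ?X **[D] (FUnit F \<star>[D] Ident D (FObj F ?X))"
   have "\<theta> X **[D] (FArr F ?L **[D] ?P) = FArr H (Lunit A X) **[D] (FTens H (Unit A) X **[D] (FUnit H \<star>[D] \<theta> X))"
    using X fX F.FTens_natural'(2)[of "FUnit f" "Ident C ?X"] a'[of "Lunit A X"]
    by (simp add: F.Fa_Comp' F.D.comp_assoc F.D.interchange F.Fa_Ident t')
   also have "FUnit H \<star>[D] \<theta> X = (FUnit H \<star>[D] Ident D (FObj H X)) **[D] (Ident D (Unit D) \<star>[D] \<theta> X)"
    using X by (simp add: F.D.interchange)
   also have "FArr H (Lunit A X) **[D] (FTens H (Unit A) X **[D] ...) = Lunit D (FObj H X) **[D] (Ident D (Unit D) \<star>[D] \<theta> X)"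
    unfolding H.coherence(2)[OF X X X, symmetric] using X by (simp add: F.D.comp_assoc)
   also have "... = \<theta> X **[D] (FArr F (Lunit C ?X) **[D] ?P)"
    unfolding F.coherence(2)[OF fX(1) fX(1) fX(1)] using F.D.Lunit_nat[of "\<theta> X"] X by simp
   finally show "\<theta> X **[D] (FArr F ?L **[D] ?P) = \<theta> X **[D] (FArr F (Lunit C ?X) **[D] ?P)" .
  qed (use X fX K in "auto simp: F.D.TensA_iso")
  show "FArr f (Runit A X) **[C] (FTens f X (Unit A) **[C] (Ident C ?X \<star>[C] FUnit f)) = Runit C ?X" (is "?L = _")
  proof (rule eqI[of _ X _ "FTens F ?X (Unit C) **[D] (Ident D (FObj F ?X) \<star>[D] FUnit F)"])
   let ?P = "FTens F ?X (Unit C) **[D] (Ident D (FObj F ?X) \<star>[D] FUnit F)"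
   have "\<theta> X **[D] (FArr F ?L **[D] ?P) = FArr H (Runit A X) **[D] (FTens H X (Unit A) **[D] (\<theta> X \<star>[D] FUnit H))"
    using X fX F.FTens_natural'(2)[of "Ident C ?X" "FUnit f"] a'[of "Runit A X"]
    by (simp add: F.Fa_Comp' F.D.comp_assoc F.D.interchange F.Fa_Ident t')
   also have "\<theta> X \<star>[D] FUnit H = (Ident D (FObj H X) \<star>[D] FUnit H) **[D] (\<theta> X \<star>[D] Ident D (Unit D))"
    using X by (simp add: F.D.interchange)
   also have "FArr H (Runit A X) **[D] (FTens H X (Unit A) **[D] ...) = Runit D (FObj H X) **[D] (\<theta> X \<star>[D] Ident D (Unit D))"
    unfolding H.coherence(3)[OF X X X, symmetric] using X by (simp add: F.D.comp_assoc)
   also have "... = \<theta> X **[D] (FArr F (Runit C ?X) **[D] ?P)"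
    unfolding F.coherence(3)[OF fX(1) fX(1) fX(1)] using F.D.Runit_nat[of "\<theta> X"] X by simp
   finally show "\<theta> X **[D] (FArr F ?L **[D] ?P) = \<theta> X **[D] (FArr F (Runit C ?X) **[D] ?P)" .
  qed (use X fX K in "auto simp: F.D.TensA_iso")
  fix Y assume Y: "Y : Obj A"
  show "FTens f X Y : Hom C (FObj f X \<boxtimes>[C] FObj f Y) (FObj f (X \<boxtimes>[A] Y))" "is_iso C (FTens f X Y)"
   using tens[OF X Y] by auto
  fix Z assume Z: "Z : Obj A"
  let ?Y = "FObj f Y" and ?Z = "FObj f Z"
  have fYZ: "?Y : Obj C" "?Y : K" "?Z : Obj C" "?Z : K" using Y Z by auto
  show "FArr f (Assoc A X Y Z) **[C] (FTens f (X \<boxtimes>[A] Y) Z **[C] (FTens f X Y \<star>[C] Ident C ?Z))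
    = FTens f X (Y \<boxtimes>[A] Z) **[C] ((Ident C ?X \<star>[C] FTens f Y Z) **[C] Assoc C ?X ?Y ?Z)" (is "?L = ?R")
  proof (rule eqI[of _ "X \<boxtimes>[A] Y \<boxtimes>[A] Z" _ "FTens F (?X \<boxtimes>[C] ?Y) ?Z **[D] (FTens F ?X ?Y \<star>[D] Ident D (FObj F ?Z))"])
   let ?P = "FTens F (?X \<boxtimes>[C] ?Y) ?Z **[D] (FTens F ?X ?Y \<star>[D] Ident D (FObj F ?Z))"
   let ?th = "\<theta> (X \<boxtimes>[A] Y \<boxtimes>[A] Z)"
   have "?th **[D] (FArr F ?L **[D] ?P) = FArr H (Assoc A X Y Z) **[D] (FTens H (X \<boxtimes>[A] Y) Z **[D] ((FTens H X Y **[D] (\<theta> X \<star>[D] \<theta> Y)) \<star>[D] \<theta> Z))"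
    using X Y Z fX fYZ F.FTens_natural'(2)[of "FTens f X Y" "Ident C ?Z"] a'[of "Assoc A X Y Z"]
    by (simp add: F.Fa_Comp' F.D.comp_assoc F.D.interchange F.Fa_Ident t')
   also have "(FTens H X Y **[D] (\<theta> X \<star>[D] \<theta> Y)) \<star>[D] \<theta> Z
     = (FTens H X Y \<star>[D] Ident D (FObj H Z)) **[D] ((\<theta> X \<star>[D] \<theta> Y) \<star>[D] \<theta> Z)" using X Y Z by (simp add: F.D.interchange)
   also have "FArr H (Assoc A X Y Z) **[D] (FTens H (X \<boxtimes>[A] Y) Z **[D] ...)
     = (FArr H (Assoc A X Y Z) **[D] (FTens H (X \<boxtimes>[A] Y) Z **[D] (FTens H X Y \<star>[D] Ident D (FObj H Z)))) **[D] ((\<theta> X \<star>[D] \<theta> Y) \<star>[D] \<theta> Z)"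
    using X Y Z by (simp add: F.D.comp_assoc)
   also have "... = FTens H X (Y \<boxtimes>[A] Z) **[D] ((Ident D (FObj H X) \<star>[D] FTens H Y Z) **[D] (Assoc D (FObj H X) (FObj H Y) (FObj H Z) **[D] ((\<theta> X \<star>[D] \<theta> Y) \<star>[D] \<theta> Z)))"
    unfolding H.coherence(1)[OF X Y Z] using X Y Z by (simp add: F.D.comp_assoc)
   also have "Assoc D (FObj H X) (FObj H Y) (FObj H Z) **[D] ((\<theta> X \<star>[D] \<theta> Y) \<star>[D] \<theta> Z)
     = (\<theta> X \<star>[D] (\<theta> Y \<star>[D] \<theta> Z)) **[D] Assoc D (FObj F ?X) (FObj F ?Y) (FObj F ?Z)"
    using F.D.Assoc_nat[of "\<theta> X" "\<theta> Y" "\<theta> Z"] X Y Z by simp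
   also have "FTens H X (Y \<boxtimes>[A] Z) **[D] ((Ident D (FObj H X) \<star>[D] FTens H Y Z) **[D] ...) = ?th **[D] (FArr F ?R **[D] ?P)"
    using X Y Z fX fYZ F.coherence(1)[OF fX(1) fYZ(1,3)] F.FTens_natural'(2)[of "Ident C ?X" "FTens f Y Z"]
    by (simp add: F.Fa_Comp' F.D.comp_assoc F.D.interchange' F.Fa_Ident t')
   finally show "?th **[D] (FArr F ?L **[D] ?P) = ?th **[D] (FArr F ?R **[D] ?P)" .
  qed (use X Y Z fX fYZ K in "auto simp: F.D.TensA_iso")
 next
  fix X X' Y Y' x y assume "x : Hom A X X'" "y : Hom A Y Y'"
  then have *: "x : Arr A" "y : Arr A" "Dom A x = X" "Cod A x = X'" "Dom A y = Y" "Cod A y = Y'" "X : Obj A" "X' : Obj A" "Y : Obj A" "Y' : Obj A"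
   using H.C.hom_obj by (auto simp: H.C.hom_iff)
  show "FArr f (x \<star>[A] y) **[C] FTens f X Y = FTens f X' Y' **[C] (FArr f x \<star>[C] FArr f y)" (is "?L = ?R")
  proof (rule eqI[of _ "X' \<boxtimes>[A] Y'" _ "FTens F (FObj f X) (FObj f Y)"])
   have "\<theta> (X' \<boxtimes>[A] Y') **[D] (FArr F ?L **[D] FTens F (FObj f X) (FObj f Y)) = FArr H (x \<star>[A] y) **[D] (FTens H X Y **[D] (\<theta> X \<star>[D] \<theta> Y))"
    using * a'[of "x \<star>[A] y"] by (simp add: F.Fa_Comp' F.D.comp_assoc)
   also have "... = FTens H X' Y' **[D] ((FArr H x \<star>[D] FArr H y) **[D] (\<theta> X \<star>[D] \<theta> Y))"
    using H.FTens_natural'(2)[OF *(1,2), of "\<theta> X \<star>[D] \<theta> Y"] * by simp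
   also have "... = \<theta> (X' \<boxtimes>[A] Y') **[D] (FArr F ?R **[D] FTens F (FObj f X) (FObj f Y))"
    using * a(4)[of x] a(4)[of y] F.FTens_natural'(1)[of "FArr f x" "FArr f y"] by (simp add: F.Fa_Comp' F.D.comp_assoc F.D.interchange t')
   finally show "\<theta> (X' \<boxtimes>[A] Y') **[D] (FArr F ?L **[D] FTens F (FObj f X) (FObj f Y)) = \<theta> (X' \<boxtimes>[A] Y') **[D] (FArr F ?R **[D] FTens F (FObj f X) (FObj f Y))" .
  qed (use * K in auto)
 qed
qed

text \<open>The endomorphism \<open>\<tau>\<close> records what the objects of \<open>K\<close> have besides their image: an arrow
  between the images comes from a unique arrow of \<open>C\<close> if and only if it commutes with \<open>\<tau>\<close>.\<close>

locale functor_with_endomorphism = tensor_functor C D F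
 for C :: "('o, 'a, 'k::field, 'z) monoidal_data_scheme"
  and D :: "('p, 'b, 'k, 'y) monoidal_data_scheme"
  and F :: "('o, 'a, 'p, 'b) functor_data" +
 fixes K :: "'o set" and \<tau> :: "'o => 'b"
 assumes K_obj: "K \<subseteq> Obj C" and K_Unit: "Unit C : K"
  and K_TensO: "X : K ==> Y : K ==> X \<boxtimes>[C] Y : K"
  and \<tau>_hom: "X : K ==> \<tau> X : Hom D (FObj F X) (FObj F X)"
  and lift: "X : K ==> Y : K ==>
   bij_betw (FArr F) (Hom C X Y) {h : Hom D (FObj F X) (FObj F Y). h **[D] \<tau> X = \<tau> Y **[D] h}"
  and \<tau>_TensO: "X : K ==> Y : K ==> \<tau> (X \<boxtimes>[C] Y) **[D] FTens F X Y = FTens F X Y **[D] (\<tau> X \<star>[D] \<tau> Y)"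
  and \<tau>_Unit: "\<tau> (Unit C) **[D] FUnit F = FUnit F"
begin

lemma K_simps [simp]: "X : K ==> X : Obj C" "Unit C : K" "X : K ==> Y : K ==> X \<boxtimes>[C] Y : K"
 using K_obj K_Unit K_TensO by auto

lemma \<tau>_arrow [simp]: "X : K ==> \<tau> X : Arr D" "X : K ==> Dom D (\<tau> X) = FObj F X" "X : K ==> Cod D (\<tau> X) = FObj F X"
 using \<tau>_hom by (auto simp: D.hom_iff)

definition lifted :: "'o => 'o => 'b => 'a" where
 "lifted X Y = the_inv_into (Hom C X Y) (FArr F)"

lemma lifted:
 assumes "X : K" "Y : K" "h : Hom D (FObj F X) (FObj F Y)" "h **[D] \<tau> X = \<tau> Y **[D] h"
 shows "lifted X Y h : Hom C X Y" "FArr F (lifted X Y h) = h"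
proof -
 have "inj_on (FArr F) (Hom C X Y)" "h : FArr F ` Hom C X Y" using lift[OF assms(1,2)] assms(3,4) by (auto simp: bij_betw_def)
 then show "lifted X Y h : Hom C X Y" "FArr F (lifted X Y h) = h"
  unfolding lifted_def using the_inv_into_into f_the_inv_into_f by fast+
qed

text \<open>The inverse of an arrow that commutes with \<open>\<tau>\<close> commutes with \<open>\<tau>\<close> as well, so it lifts.\<close>

lemma iso_lifted:
 assumes "X : K" "Y : K" "h : Hom D (FObj F X) (FObj F Y)" "h **[D] \<tau> X = \<tau> Y **[D] h" "is_iso D h"
 shows "is_iso C (lifted X Y h)"
proof -
 let ?h' = "inverse_of D h"
 note h = assms(3)[unfolded D.hom_iff]
 have "?h' **[D] \<tau> Y = ?h' **[D] (\<tau> Y **[D] (h **[D] ?h'))" using h assms by simp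
 also have "\<tau> Y **[D] (h **[D] ?h') = (\<tau> Y **[D] h) **[D] ?h'" by (rule D.comp_assoc[symmetric]) (use h assms in auto)
 also have "?h' **[D] ... = \<tau> X **[D] ?h'" unfolding assms(4)[symmetric] using h assms(1,2,5) by (simp add: D.comp_assoc)
 finally have c: "?h' **[D] \<tau> Y = \<tau> X **[D] ?h'" .
 have h': "?h' : Hom D (FObj F Y) (FObj F X)" using h assms(5) by (simp add: D.hom_iff)
 note l = lifted[OF assms(1-4)] and l' = lifted[OF assms(2,1) h' c]
 have inj: "x = y" if "X : K" "x : Hom C X X" "y : Hom C X X" "FArr F x = FArr F y" for x y X
  using lift[OF that(1,1)] that(2-4) by (auto simp: bij_betw_def inj_on_def)
 show ?thesis
 proof (rule C.isoI[OF l(1) l'(1)])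
  show "lifted Y X ?h' **[C] lifted X Y h = Ident C X"
   by (rule inj[OF assms(1)]) (use l l' h assms in "auto simp: C.hom_iff Fa_Comp' Fa_Ident")
  show "lifted X Y h **[C] lifted Y X ?h' = Ident C Y"
   by (rule inj[OF assms(2)]) (use l l' h assms in "auto simp: C.hom_iff Fa_Comp' Fa_Ident")
 qed
qed

end

text \<open>Inside \<open>D\<close> the objects of \<open>A\<close> and those of \<open>K\<close> are described by the same data, an object with an
  endomorphism.  Choose for each \<open>V\<close> an object \<open>X V\<close> with the same data, and an isomorphism \<open>\<theta> V\<close>
  that shows this.  The functor sends \<open>V\<close> to \<open>X V\<close>; its values on arrows and its monoidal structure
  are the unique lifts of those of \<open>H\<close>, conjugated by \<open>\<theta>\<close>.  They exist because the data of a tensor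
  product is the tensor product of the data.\<close>

theorem comparison_functor:
 assumes A: "functor_with_endomorphism A D H (Obj A) \<sigma>" "split_semisimple_category A B"
  and F: "functor_with_endomorphism C D F K \<tau>"
  and K_iso: "\<And>X Y. X : K ==> isomorphic C X Y ==> Y : K"
  and exX: "\<And>V. V : Obj A ==> \<exists>X\<in>K. \<exists>\<theta>\<in>Hom D (FObj F X) (FObj H V). is_iso D \<theta> \<and> \<theta> **[D] \<tau> X = \<sigma> V **[D] \<theta>"
  and exV: "\<And>X. X : K ==> \<exists>V\<in>Obj A. \<exists>\<theta>\<in>Hom D (FObj F X) (FObj H V). is_iso D \<theta> \<and> \<theta> **[D] \<tau> X = \<sigma> V **[D] \<theta>"
 shows "\<exists>f. tensor_functor A C f \<and> full_embedding A C f \<and> ess_image_objects A C f = K"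
proof -
 interpret H: functor_with_endomorphism A D H "Obj A" \<sigma> by fact
 interpret F: functor_with_endomorphism C D F K \<tau> by fact
 define P where "P V X \<theta> \<longleftrightarrow> X : K \<and> \<theta> : Hom D (FObj F X) (FObj H V) \<and> is_iso D \<theta> \<and> \<theta> **[D] \<tau> X = \<sigma> V **[D] \<theta>" for V X \<theta>
 have "\<exists>X \<theta>. P V X \<theta>" if "V : Obj A" for V using exX[OF that] unfolding P_def by blast
 then obtain X \<theta> where P: "\<And>V. V : Obj A ==> P V (X V) (\<theta> V)" by metis
 have x [simp]: "X V : K" "X V : Obj C" "\<theta> V : Arr D" "Dom D (\<theta> V) = FObj F (X V)" "Cod D (\<theta> V) = FObj H V" "is_iso D (\<theta> V)"
  "\<theta> V **[D] \<tau> (X V) = \<sigma> V **[D] \<theta> V" if "V : Obj A" for V using P[OF that] by (auto simp: P_def H.D.hom_iff)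
 have x' [simp]: "\<theta> V **[D] (\<tau> (X V) **[D] y) = \<sigma> V **[D] (\<theta> V **[D] y)" if "V : Obj A" "y : Arr D" "Cod D y = FObj F (X V)" for V y
  by (rule H.D.comp_cong2[OF x(7)]) (use that in auto)
 \<comment> \<open>an arrow that corresponds under \<open>\<theta>\<close> to one that commutes with the automorphisms lifts\<close>
 have lifts: "F.lifted Y (X W) (inverse_of D (\<theta> W) **[D] h) : Hom C Y (X W)"
   "\<theta> W **[D] FArr F (F.lifted Y (X W) (inverse_of D (\<theta> W) **[D] h)) = h"
   "is_iso D h ==> is_iso C (F.lifted Y (X W) (inverse_of D (\<theta> W) **[D] h))"
  if "Y : K" "W : Obj A" "h : Arr D" "Dom D h = FObj F Y" "Cod D h = FObj H W" "h **[D] \<tau> Y = \<sigma> W **[D] h" for Y W h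
 proof -
  let ?h = "inverse_of D (\<theta> W) **[D] h"
  have h: "?h : Hom D (FObj F Y) (FObj F (X W))" using that by (simp add: H.D.hom_iff)
  have c: "?h **[D] \<tau> Y = \<tau> (X W) **[D] ?h"
   by (rule H.D.iso_cancel_left[of "\<theta> W"]) (use that in "auto simp: H.D.comp_assoc")
  show "F.lifted Y (X W) ?h : Hom C Y (X W)" "\<theta> W **[D] FArr F (F.lifted Y (X W) ?h) = h"
   "is_iso D h ==> is_iso C (F.lifted Y (X W) ?h)"
   using F.lifted[OF that(1) x(1)[OF that(2)] h c] F.iso_lifted[OF that(1) x(1)[OF that(2)] h c] that by auto
 qed
 have Ha: "FArr H a **[D] \<theta> V **[D] \<tau> (X V) = \<sigma> W **[D] (FArr H a **[D] \<theta> V)" if a: "a : Hom A V W" for a V W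
 proof -
  have *: "a : Arr A" "Dom A a = V" "Cod A a = W" "V : Obj A" "W : Obj A" using a H.C.hom_obj[OF a] by (auto simp: H.C.hom_iff)
  have "FArr H a **[D] \<sigma> V = \<sigma> W **[D] FArr H a" using H.lift[OF *(4,5)] a by (auto simp: bij_betw_def)
  then have "FArr H a **[D] (\<sigma> V **[D] \<theta> V) = \<sigma> W **[D] (FArr H a **[D] \<theta> V)" by (rule H.D.comp_cong2) (use * in auto)
  then show ?thesis using * by (simp add: H.D.comp_assoc)
 qed
 define t where "t V W = FTens H V W **[D] ((\<theta> V \<star>[D] \<theta> W) **[D] inverse_of D (FTens F (X V) (X W)))" for V W
 have t: "t V W : Arr D" "Dom D (t V W) = FObj F (X V \<boxtimes>[C] X W)" "Cod D (t V W) = FObj H (V \<boxtimes>[A] W)" "is_iso D (t V W)"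
  "t V W **[D] FTens F (X V) (X W) = FTens H V W **[D] (\<theta> V \<star>[D] \<theta> W)" if "V : Obj A" "W : Obj A" for V W
  using that by (simp_all add: t_def H.D.TensA_iso H.D.comp_assoc)
 have tc: "t V W **[D] \<tau> (X V \<boxtimes>[C] X W) = \<sigma> (V \<boxtimes>[A] W) **[D] t V W" if V: "V : Obj A" "W : Obj A" for V W
 proof (rule H.D.iso_cancel_right[of "FTens F (X V) (X W)"])
  note t = t[OF V]
  have "t V W **[D] \<tau> (X V \<boxtimes>[C] X W) **[D] FTens F (X V) (X W) = t V W **[D] (FTens F (X V) (X W) **[D] (\<tau> (X V) \<star>[D] \<tau> (X W)))"
   using V t by (simp add: H.D.comp_assoc F.\<tau>_TensO)
  also have "... = (FTens H V W **[D] (\<theta> V \<star>[D] \<theta> W)) **[D] (\<tau> (X V) \<star>[D] \<tau> (X W))"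
   by (rule H.D.comp_cong_left[OF t(5)]) (use V t in auto)
  also have "... = FTens H V W **[D] ((\<sigma> V \<star>[D] \<sigma> W) **[D] (\<theta> V \<star>[D] \<theta> W))" using V by (simp add: H.D.comp_assoc H.D.interchange)
  also have "... = \<sigma> (V \<boxtimes>[A] W) **[D] (FTens H V W **[D] (\<theta> V \<star>[D] \<theta> W))"
   by (rule H.D.comp_cong2[OF H.\<tau>_TensO[symmetric]]) (use V in auto)
  finally show "t V W **[D] \<tau> (X V \<boxtimes>[C] X W) **[D] FTens F (X V) (X W) = \<sigma> (V \<boxtimes>[A] W) **[D] t V W **[D] FTens F (X V) (X W)"
   using V t by (simp add: H.D.comp_assoc)
 qed (use V t[OF V] in auto)
 let ?u = "FUnit H **[D] inverse_of D (FUnit F)"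
 have uc: "?u **[D] \<tau> (Unit C) = \<sigma> (Unit A) **[D] ?u"
  by (rule H.D.iso_cancel_right[of "FUnit F"]) (auto simp: H.D.comp_assoc F.\<tau>_Unit H.\<tau>_Unit)
 define f where "f = \<lparr>FObj = X, FArr = (\<lambda>a. F.lifted (X (Dom A a)) (X (Cod A a)) (inverse_of D (\<theta> (Cod A a)) **[D] (FArr H a **[D] \<theta> (Dom A a)))),
   FTens = (\<lambda>V W. F.lifted (X V \<boxtimes>[C] X W) (X (V \<boxtimes>[A] W)) (inverse_of D (\<theta> (V \<boxtimes>[A] W)) **[D] t V W)),
   FUnit = F.lifted (Unit C) (X (Unit A)) (inverse_of D (\<theta> (Unit A)) **[D] ?u)\<rparr>"
 have fo: "FObj f V = X V" for V by (simp add: f_def)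
 have fa: "FArr f a : Hom C (X V) (X W)" "\<theta> W **[D] FArr F (FArr f a) = FArr H a **[D] \<theta> V" if a: "a : Hom A V W" for a V W
  using lifts(1,2)[of "X V" W "FArr H a **[D] \<theta> V"] Ha[OF a] H.C.hom_obj[OF a] a by (auto simp: f_def H.C.hom_iff)
 have "tensor_functor A C f"
 proof (rule lift_tensor_functor[OF H.C.tensor_category_axioms A(2) F.tensor_functor_axioms H.tensor_functor_axioms F.K_obj F.K_Unit F.K_TensO])
  show "inj_on (FArr F) (Hom C Y Z)" if "Y : K" "Z : K" for Y Z using F.lift[OF that] by (simp add: bij_betw_def)
  show "FTens f V W : Hom C (FObj f V \<boxtimes>[C] FObj f W) (FObj f (V \<boxtimes>[A] W)) \<and> is_iso C (FTens f V W)
   \<and> \<theta> (V \<boxtimes>[A] W) **[D] (FArr F (FTens f V W) **[D] FTens F (FObj f V) (FObj f W)) = FTens H V W **[D] (\<theta> V \<star>[D] \<theta> W)"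
   if V: "V : Obj A" "W : Obj A" for V W
  proof -
   note l = lifts[of "X V \<boxtimes>[C] X W" "V \<boxtimes>[A] W" "t V W", OF _ _ t(1-3)[OF V] tc[OF V]]
   have "\<theta> (V \<boxtimes>[A] W) **[D] (FArr F (FTens f V W) **[D] FTens F (X V) (X W)) = t V W **[D] FTens F (X V) (X W)"
    by (rule H.D.comp_cong_left) (use V l(1,2) in "auto simp: f_def F.C.hom_iff")
   then show ?thesis using V l t(4,5)[OF V] by (simp add: f_def)
  qed
  note l = lifts[of "Unit C" "Unit A" ?u, OF _ _ _ _ _ uc]
  have "\<theta> (Unit A) **[D] (FArr F (FUnit f) **[D] FUnit F) = ?u **[D] FUnit F"
   by (rule H.D.comp_cong_left) (use l(1,2) in "auto simp: f_def F.C.hom_iff")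
  then show "FUnit f : Hom C (Unit C) (FObj f (Unit A)) \<and> is_iso C (FUnit f) \<and> \<theta> (Unit A) **[D] (FArr F (FUnit f) **[D] FUnit F) = FUnit H"
   using l by (simp add: f_def H.D.comp_assoc)
 qed (use fa in "auto simp: fo H.D.hom_iff")
 moreover have "full_embedding A C f"
  unfolding full_embedding_def
 proof (intro ballI)
  fix V W assume V: "V : Obj A" "W : Obj A"
  have inj: "inj_on (FArr f) (Hom A V W)"
  proof (rule inj_onI)
   fix a b assume ab: "a : Hom A V W" "b : Hom A V W" "FArr f a = FArr f b"
   then have "FArr H a **[D] \<theta> V = FArr H b **[D] \<theta> V" using fa(2) by metis
   then have "FArr H a = FArr H b"
    by (rule H.D.iso_cancel_right[rotated 5]) (use V ab(1,2) in "auto simp: H.C.hom_iff")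
   then show "a = b" using H.lift[OF V] ab(1,2) by (auto simp: bij_betw_def inj_on_def)
  qed
  have "g : FArr f ` Hom A V W" if g: "g : Hom C (X V) (X W)" for g
  proof -
   note g' = g[unfolded F.C.hom_iff]
   let ?h = "\<theta> W **[D] (FArr F g **[D] inverse_of D (\<theta> V))"
   have gt: "FArr F g **[D] \<tau> (X V) = \<tau> (X W) **[D] FArr F g" using F.lift[of "X V" "X W"] V g by (auto simp: bij_betw_def)
   have "?h **[D] \<sigma> V = \<sigma> W **[D] ?h"
   proof (rule H.D.iso_cancel_right[of "\<theta> V"])
    have "?h **[D] \<sigma> V **[D] \<theta> V = \<theta> W **[D] (FArr F g **[D] \<tau> (X V))"
     using V g' by (simp add: H.D.comp_assoc x(7)[symmetric] del: x(7))
    then show "?h **[D] \<sigma> V **[D] \<theta> V = \<sigma> W **[D] ?h **[D] \<theta> V" unfolding gt using V g' by (simp add: H.D.comp_assoc)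
   qed (use V g' in auto)
   moreover have "?h : Hom D (FObj H V) (FObj H W)" using V g' by (simp add: H.D.hom_iff)
   ultimately have "?h : FArr H ` Hom A V W" using H.lift[OF V] by (simp add: bij_betw_def)
   then obtain a where a: "a : Hom A V W" "FArr H a = ?h" by (auto simp del: H.Fa_arrow)
   have "\<theta> W **[D] FArr F (FArr f a) = \<theta> W **[D] FArr F g" using fa(2)[OF a(1)] a V g' by (simp add: H.D.comp_assoc)
   then have "FArr F (FArr f a) = FArr F g"
    by (rule H.D.iso_cancel_left[rotated 5]) (use V g' fa(1)[OF a(1)] in "auto simp: F.C.hom_iff")
   then have "FArr f a = g" using F.lift[of "X V" "X W"] V fa(1)[OF a(1)] g by (auto simp: bij_betw_def inj_on_def)
   then show ?thesis using a(1) by blast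
  qed
  then show "bij_betw (FArr f) (Hom A V W) (Hom C (FObj f V) (FObj f W))"
   unfolding fo bij_betw_def using inj fa(1) by blast
 qed
 moreover have "ess_image_objects A C f = K"
 proof (intro equalityI subsetI)
  fix Y assume "Y : ess_image_objects A C f"
  then obtain V where "V : Obj A" "isomorphic C (X V) Y" by (auto simp: ess_image_objects_def fo)
  then show "Y : K" using K_iso[of "X V"] by simp
 next
  fix Y assume Y: "Y : K"
  obtain V \<phi> where V: "V : Obj A" "\<phi> : Hom D (FObj F Y) (FObj H V)" "is_iso D \<phi>" "\<phi> **[D] \<tau> Y = \<sigma> V **[D] \<phi>"
   using exV[OF Y] by blast
  note l = lifts[OF Y V(1) _ _ _ V(4)]
  have "isomorphic C Y (X V)" by (rule F.C.isomorphicI[OF l(1,3)]) (use V in "auto simp: H.D.hom_iff")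
  then show "Y : ess_image_objects A C f" using V(1) Y F.C.isomorphic_sym by (auto simp: ess_image_objects_def fo)
 qed
 ultimately show ?thesis by blast
qed

section \<open>Matrices as arrows between copowers of the unit\<close>

context linear_category
begin

lemma direct_sum_matrix:
 assumes d: "direct_sum_over C I X S i p" and d': "direct_sum_over C J Y T j q"
  and g: "\<And>k l. k : I ==> l : J ==> g k l : Hom C (X k) (Y l)"
 shows "\<exists>h\<in>Hom C S T. \<forall>k\<in>I. \<forall>l\<in>J. q l ** (h ** i k) = g k l"
proof -
 have "\<exists>h\<in>Hom C (X k) T. \<forall>l\<in>J. q l ** h = g k l" if "k : I" for k
  by (rule direct_sum_tuple[OF d' direct_sum_overD(3)[OF d that] g[OF that]])
 then obtain h where h: "\<And>k. k : I ==> h k : Hom C (X k) T" "\<And>k l. k : I ==> l : J ==> q l ** h k = g k l" by metis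
 from direct_sum_cotuple[OF d direct_sum_overD(1)[OF d'] h(1)] h(2) show ?thesis by force
qed

lemma direct_sum_matrix_eqI:
 assumes d: "direct_sum_over C I X S i p" and d': "direct_sum_over C J Y T j q"
  and gh: "g : Hom C S T" "h : Hom C S T"
  and eq: "\<And>k l. k : I ==> l : J ==> q l ** (g ** i k) = q l ** (h ** i k)"
 shows "g = h"
proof (rule direct_sum_eqI_from[OF d gh])
 fix k assume k: "k : I"
 show "g ** i k = h ** i k"
  by (rule direct_sum_eqI_into[OF d' _ _ eq[OF k]]) (use gh direct_sum_overD(4)[OF d k] in "auto simp: hom_iff")
qed

lemma direct_sum_unique:
 assumes d: "direct_sum_over C I X S i p" and d': "direct_sum_over C I X T j q"
 shows "\<exists>a\<in>Hom C S T. is_iso C a \<and> (\<forall>k\<in>I. a ** i k = j k \<and> q k ** a = p k)"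
proof -
 note D = direct_sum_overD[OF d] and D' = direct_sum_overD[OF d']
 obtain a where a: "a : Hom C S T" "\<And>k. k : I ==> a ** i k = j k"
  using direct_sum_cotuple[OF d D'(1) D'(4)] by blast
 obtain b where b: "b : Hom C T S" "\<And>k. k : I ==> b ** j k = i k"
  using direct_sum_cotuple[OF d' D(1) D(4)] by blast
 have "b ** a = Ident C S"
  by (rule direct_sum_eqI_from[OF d]) (use a b D d in "auto simp: hom_iff comp_assoc")
 moreover have "a ** b = Ident C T"
  by (rule direct_sum_eqI_from[OF d']) (use a b D' d' in "auto simp: hom_iff comp_assoc")
 moreover have "q k ** a = p k" if k: "k : I" for k
 proof (rule direct_sum_eqI_from[OF d])
  fix l assume l: "l : I"
  have "q k ** a ** i l = q k ** j l" using a k l d d' by (simp add: hom_iff comp_assoc)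
  also have "... = p k ** i l" using D(6,7) D'(6,7) k l by (cases "k = l") auto
  finally show "q k ** a ** i l = p k ** i l" .
 qed (use a D D' k in "auto simp: hom_iff")
 ultimately show ?thesis using a b isoI by blast
qed

lemma arrow_sum_Scale:
 assumes "finite I" "f : Hom C X Y" shows "arrow_sum C X Y (\<lambda>k. Scale C (c k) f) I = Scale C (\<Sum>k\<in>I. c k) f"
 using assms(1)
proof induction
 case (insert k I)
 then have "arrow_sum C X Y (\<lambda>k. Scale C (c k) f) (insert k I) = Add C (Scale C (c k) f) (arrow_sum C X Y (\<lambda>k. Scale C (c k) f) I)"
  using assms(2) hom_obj[OF assms(2)] by (intro arrow_sum_insert) (auto simp: hom_iff)
 then show ?case using insert assms(2) by (simp add: Scale_add_left hom_iff)
qed (use assms(2) hom_obj[OF assms(2)] in "auto simp: hom_iff")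

end

lemma (in tensor_category) direct_sum_TensO:
 assumes d: "direct_sum_over C I X S i p" and d': "direct_sum_over C J Y T j q"
 shows "direct_sum_over C (I \<times> J) (\<lambda>(k, l). X k \<boxtimes> Y l) (S \<boxtimes> T) (\<lambda>(k, l). i k \<star> j l) (\<lambda>(k, l). p k \<star> q l)"
proof -
 note D = direct_sum_overD[OF d] and D' = direct_sum_overD[OF d']
 have "direct_sum_over C (I \<times> J) (\<lambda>(k, l). X k \<boxtimes> Y l) (S \<boxtimes> T)
   (\<lambda>(k, l). (i k \<star> Ident C T) ** (Ident C (X k) \<star> j l)) (\<lambda>(k, l). (Ident C (X k) \<star> q l) ** (p k \<star> Ident C T))"
  by (rule direct_sum_flatten[OF linear_functor.Fa_direct_sum[OF TensA_linear_functor(2)[OF D'(1)] d]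
    linear_functor.Fa_direct_sum[OF TensA_linear_functor(1) d']]) (use D in auto)
 note E = direct_sum_overD[OF this]
 have "(i k \<star> Ident C T) ** (Ident C (X k) \<star> j l) = i k \<star> j l" "(Ident C (X k) \<star> q l) ** (p k \<star> Ident C T) = p k \<star> q l"
  if "k : I" "l : J" for k l
  using that D D' d d' by (simp_all add: interchange)
 note * = this
 show ?thesis
 proof (rule direct_sum_overI)
  show "S \<boxtimes> T : Obj C" "finite (I \<times> J)" using E(1,2) by auto
  fix a assume a: "a : I \<times> J"
  then show "(case a of (k, l) => i k \<star> j l) : Hom C (case a of (k, l) => X k \<boxtimes> Y l) (S \<boxtimes> T)"
   "(case a of (k, l) => p k \<star> q l) : Hom C (S \<boxtimes> T) (case a of (k, l) => X k \<boxtimes> Y l)"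
   "(case a of (k, l) => p k \<star> q l) ** (case a of (k, l) => i k \<star> j l) = Ident C (case a of (k, l) => X k \<boxtimes> Y l)"
   using E(4,5,6)[OF a] * by auto
  fix b assume b: "b : I \<times> J" "a \<noteq> b"
  then show "(case a of (k, l) => p k \<star> q l) ** (case b of (k, l) => i k \<star> j l) = Zero C (case b of (k, l) => X k \<boxtimes> Y l) (case a of (k, l) => X k \<boxtimes> Y l)"
   using E(7)[OF a b(1,2)] a * by auto
 next
  fix f assume f: "f : Hom C (S \<boxtimes> T) (S \<boxtimes> T)"
   "\<And>a. a : I \<times> J ==> (case a of (k, l) => p k \<star> q l) ** f = Zero C (S \<boxtimes> T) (case a of (k, l) => X k \<boxtimes> Y l)"
  show "f = Zero C (S \<boxtimes> T) (S \<boxtimes> T)"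
   by (rule direct_sum_eqI_into[OF \<open>direct_sum_over C (I \<times> J) _ _ _ _\<close> f(1) Zero_hom[OF E(1,1)]]) (use f(2) * d d' D D' in auto)
 qed
qed

context tensor_category
begin

definition copower :: "nat => 'o \<times> (nat => 'a) \<times> (nat => 'a)" where
 "copower n = (SOME (S, i, p). direct_sum_over C {..<n} (\<lambda>_. Unit C) S i p)"

abbreviation "U n \<equiv> fst (copower n)"
abbreviation "inc n \<equiv> fst (snd (copower n))"
abbreviation "prj n \<equiv> snd (snd (copower n))"

lemma copower: "direct_sum_over C {..<n} (\<lambda>_. Unit C) (U n) (inc n) (prj n)"
proof -
 have "\<exists>x. (\<lambda>(S, i, p). direct_sum_over C {..<n} (\<lambda>_. Unit C) S i p) x"
  using direct_sums[of n "\<lambda>_. Unit C"] by (auto simp: is_direct_sum_iff)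
 from someI_ex[OF this] show ?thesis by (simp add: copower_def case_prod_unfold)
qed

lemma copower_arrow [simp]:
 "U n : Obj C" "k < n ==> inc n k : Arr C" "k < n ==> Dom C (inc n k) = Unit C" "k < n ==> Cod C (inc n k) = U n"
 "k < n ==> prj n k : Arr C" "k < n ==> Dom C (prj n k) = U n" "k < n ==> Cod C (prj n k) = Unit C"
 using direct_sum_overD(1)[OF copower, of n] direct_sum_overD(4,5)[OF copower, of k n] by (auto simp: hom_iff)

definition mat_arrow :: "'k mat => 'a" where
 "mat_arrow A = (SOME f. f : Hom C (U (dim_col A)) (U (dim_row A)) \<and>
   (\<forall>j\<in>{..<dim_col A}. \<forall>i\<in>{..<dim_row A}. prj (dim_row A) i ** (f ** inc (dim_col A) j) = Scale C (A $$ (i, j)) (Ident C (Unit C))))"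

lemma mat_arrow:
 assumes "A : carrier_mat m n"
 shows "mat_arrow A : Hom C (U n) (U m)"
  and "i < m ==> j < n ==> prj m i ** (mat_arrow A ** inc n j) = Scale C (A $$ (i, j)) (Ident C (Unit C))"
proof -
 have "\<exists>f\<in>Hom C (U n) (U m). \<forall>j\<in>{..<n}. \<forall>i\<in>{..<m}. prj m i ** (f ** inc n j) = Scale C (A $$ (i, j)) (Ident C (Unit C))"
  by (rule direct_sum_matrix[OF copower copower]) (simp add: hom_iff)
 then have "\<exists>f. f : Hom C (U (dim_col A)) (U (dim_row A)) \<and>
   (\<forall>j\<in>{..<dim_col A}. \<forall>i\<in>{..<dim_row A}. prj (dim_row A) i ** (f ** inc (dim_col A) j) = Scale C (A $$ (i, j)) (Ident C (Unit C)))"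
  using assms by (simp add: Bex_def)
 from someI_ex[OF this] show "mat_arrow A : Hom C (U n) (U m)"
  "i < m ==> j < n ==> prj m i ** (mat_arrow A ** inc n j) = Scale C (A $$ (i, j)) (Ident C (Unit C))"
  unfolding mat_arrow_def[symmetric] using assms by auto
qed

lemma mat_arrow_eqI:
 assumes "A : carrier_mat m n" "f : Hom C (U n) (U m)"
  "\<And>i j. i < m ==> j < n ==> prj m i ** (f ** inc n j) = Scale C (A $$ (i, j)) (Ident C (Unit C))"
 shows "mat_arrow A = f"
 by (rule direct_sum_matrix_eqI[OF copower copower mat_arrow(1)[OF assms(1)] assms(2)]) (use mat_arrow(2)[OF assms(1)] assms(3) in auto)

lemma scalar_eq_iff: "Scale C c (Ident C (Unit C)) = Scale C d (Ident C (Unit C)) \<longleftrightarrow> c = d"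
 using End_Unit by (auto simp: bij_betw_def dest: injD)

text \<open>As the endomorphisms of \<open>1\<close> are scalars, arrows between copowers of \<open>1\<close> are matrices.\<close>

lemma mat_arrow_bij: "bij_betw mat_arrow (carrier_mat m n) (Hom C (U n) (U m))"
proof (rule bij_betw_imageI)
 show "inj_on mat_arrow (carrier_mat m n)"
 proof (rule inj_onI)
  fix A B assume *: "A : carrier_mat m n" "B : carrier_mat m n" "mat_arrow A = mat_arrow B"
  have "A $$ (i, j) = B $$ (i, j)" if "i < m" "j < n" for i j
   using mat_arrow(2)[OF *(1) that] mat_arrow(2)[OF *(2) that] *(3) by (simp add: scalar_eq_iff)
  then show "A = B" using *(1,2) by (intro eq_matI) auto
 qed
 have "f : mat_arrow ` carrier_mat m n" if f: "f : Hom C (U n) (U m)" for f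
 proof -
  have "\<exists>c. prj m i ** (f ** inc n j) = Scale C c (Ident C (Unit C))" if "i < m" "j < n" for i j
  proof -
   have "prj m i ** (f ** inc n j) : Hom C (Unit C) (Unit C)" using f that by (simp add: hom_iff)
   then show ?thesis using End_Unit by (auto simp: bij_betw_def)
  qed
  then obtain c where c: "\<And>i j. i < m ==> j < n ==> prj m i ** (f ** inc n j) = Scale C (c i j) (Ident C (Unit C))" by metis
  have "mat_arrow (mat m n (\<lambda>(i, j). c i j)) = f" by (rule mat_arrow_eqI) (use f c in auto)
  then show ?thesis by (intro image_eqI[of _ _ "mat m n (\<lambda>(i, j). c i j)"]) auto
 qed
 then show "mat_arrow ` carrier_mat m n = Hom C (U n) (U m)" using mat_arrow(1) by blast
qed

lemma mat_arrow_simps [simp]: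
 "A : carrier_mat m n ==> mat_arrow A : Arr C" "A : carrier_mat m n ==> Dom C (mat_arrow A) = U n"
 "A : carrier_mat m n ==> Cod C (mat_arrow A) = U m"
 using mat_arrow(1)[of A m n] by (auto simp: hom_iff)

lemma mat_arrow_smult: "A : carrier_mat m n ==> mat_arrow (c \<cdot>\<^sub>m A) = Scale C c (mat_arrow A)"
 using mat_arrow[of A m n] by (intro mat_arrow_eqI[of _ m n]) (auto simp: hom_iff Scale_Scale)

lemma mat_arrow_add:
 assumes "A : carrier_mat m n" "B : carrier_mat m n" shows "mat_arrow (A + B) = Add C (mat_arrow A) (mat_arrow B)"
 using mat_arrow[OF assms(1)] mat_arrow[OF assms(2)] assms
 by (intro mat_arrow_eqI[of _ m n]) (auto simp: hom_iff Comp_Add Scale_add_left)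

lemma mat_arrow_one: "mat_arrow (1\<^sub>m n) = Ident C (U n)"
 using direct_sum_overD(6,7)[OF copower, of _ n] by (intro mat_arrow_eqI[of _ n n]) (auto simp: hom_iff)

lemma mat_arrow_mult:
 assumes A: "A : carrier_mat m n" and B: "B : carrier_mat r m"
 shows "mat_arrow (B * A) = mat_arrow B ** mat_arrow A"
proof (rule mat_arrow_eqI)
 let ?u = "Ident C (Unit C)"
 fix i j assume i: "i < r" and j: "j < n"
 have x: "mat_arrow A ** inc n j : Hom C (Unit C) (U m)" using A j by (simp add: hom_iff)
 have "prj r i ** ((mat_arrow B ** mat_arrow A) ** inc n j) = (prj r i ** mat_arrow B) ** (mat_arrow A ** inc n j)"
  using A B i j by (simp add: comp_assoc)
 also have "mat_arrow A ** inc n j = arrow_sum C (Unit C) (U m) (\<lambda>k. inc m k ** (prj m k ** (mat_arrow A ** inc n j))) {..<m}"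
  by (rule direct_sum_arrow_into[OF copower x])
 also have "(prj r i ** mat_arrow B) ** ... = arrow_sum C (Unit C) (Unit C) (\<lambda>k. (prj r i ** mat_arrow B) ** (inc m k ** (prj m k ** (mat_arrow A ** inc n j)))) {..<m}"
  by (rule Comp_arrow_sum) (use A B i j in "auto simp: hom_iff")
 also have "... = arrow_sum C (Unit C) (Unit C) (\<lambda>k. Scale C (B $$ (i, k) * A $$ (k, j)) ?u) {..<m}"
 proof (rule arrow_sum_cong)
  fix k assume "k : {..<m}"
  then show "(prj r i ** mat_arrow B) ** (inc m k ** (prj m k ** (mat_arrow A ** inc n j))) = Scale C (B $$ (i, k) * A $$ (k, j)) ?u"
   using mat_arrow(2)[OF B i, of k] mat_arrow(2)[OF A _ j, of k] B i by (simp add: comp_assoc Scale_Scale mult.commute)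
 qed (auto simp: hom_iff)
 also have "... = Scale C (\<Sum>k<m. B $$ (i, k) * A $$ (k, j)) ?u" by (rule arrow_sum_Scale) (auto simp: hom_iff)
 also have "(\<Sum>k<m. B $$ (i, k) * A $$ (k, j)) = (B * A) $$ (i, j)"
  using A B i j by (simp add: scalar_prod_def atLeast0LessThan)
 finally show "prj r i ** ((mat_arrow B ** mat_arrow A) ** inc n j) = Scale C ((B * A) $$ (i, j)) ?u" .
qed (use A B in "auto simp: hom_iff")

text \<open>The identification of \<open>(n \<cdot> 1) \<otimes> (m \<cdot> 1)\<close> with \<open>(n m) \<cdot> 1\<close>.  As in the Kronecker product, \<open>i * m + j\<close>
  is the position of the pair \<open>(i, j)\<close>.\<close>

definition copower_tensor :: "nat => nat => 'a" where
 "copower_tensor n m = (SOME f. f : Hom C (U n \<boxtimes> U m) (U (n * m)) \<and> is_iso C f \<and>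
   (\<forall>i<n. \<forall>j<m. f ** (inc n i \<star> inc m j) = inc (n * m) (i * m + j) ** Lunit C (Unit C) \<and>
    prj (n * m) (i * m + j) ** f = Lunit C (Unit C) ** (prj n i \<star> prj m j)))"

lemma mult_add_less: "(i::nat) < n ==> j < m ==> i * m + j < n * m"
 using mult_le_mono1[of "Suc i" n m] by simp

lemma copower_tensor:
 shows "copower_tensor n m : Hom C (U n \<boxtimes> U m) (U (n * m))" "is_iso C (copower_tensor n m)"
  and "i < n ==> j < m ==> copower_tensor n m ** (inc n i \<star> inc m j) = inc (n * m) (i * m + j) ** Lunit C (Unit C)"
  and "i < n ==> j < m ==> prj (n * m) (i * m + j) ** copower_tensor n m = Lunit C (Unit C) ** (prj n i \<star> prj m j)"
proof -
 let ?l = "Lunit C (Unit C)"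
 have b: "bij_betw (\<lambda>(i, j). i * m + j) ({..<n} \<times> {..<m}) {..<n * m}"
  by (rule bij_betw_byWitness[where f' = "\<lambda>k. (k div m, k mod m)"]) (use div_mod_less in "auto intro: mult_add_less")
 have d: "direct_sum_over C ({..<n} \<times> {..<m}) (\<lambda>(i, j). Unit C \<boxtimes> Unit C) (U n \<boxtimes> U m) (\<lambda>(i, j). inc n i \<star> inc m j) (\<lambda>(i, j). prj n i \<star> prj m j)"
  by (rule direct_sum_TensO[OF copower copower])
 have d': "direct_sum_over C ({..<n} \<times> {..<m}) (\<lambda>(i, j). Unit C \<boxtimes> Unit C) (U (n * m))
   (\<lambda>a. inc (n * m) ((\<lambda>(i, j). i * m + j) a) ** ?l) (\<lambda>a. inverse_of C ?l ** prj (n * m) ((\<lambda>(i, j). i * m + j) a))"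
  by (rule direct_sum_of_isos[OF direct_sum_reindex[OF copower b]]) (auto simp: hom_iff)
 obtain a where a: "a : Hom C (U n \<boxtimes> U m) (U (n * m))" "is_iso C a"
  "\<forall>k\<in>{..<n} \<times> {..<m}. a ** (\<lambda>(i, j). inc n i \<star> inc m j) k = inc (n * m) ((\<lambda>(i, j). i * m + j) k) ** ?l \<and>
    (inverse_of C ?l ** prj (n * m) ((\<lambda>(i, j). i * m + j) k)) ** a = (\<lambda>(i, j). prj n i \<star> prj m j) k"
  using direct_sum_unique[OF d d'] by blast
 have "prj (n * m) (i * m + j) ** a = ?l ** (prj n i \<star> prj m j)" if "i < n" "j < m" for i j
  using a(1) bspec[OF a(3), of "(i, j)", THEN conjunct2, symmetric] that mult_add_less[OF that] by (simp add: hom_iff comp_assoc)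
 then have "\<exists>f. f : Hom C (U n \<boxtimes> U m) (U (n * m)) \<and> is_iso C f \<and>
   (\<forall>i<n. \<forall>j<m. f ** (inc n i \<star> inc m j) = inc (n * m) (i * m + j) ** ?l \<and> prj (n * m) (i * m + j) ** f = ?l ** (prj n i \<star> prj m j))"
  using a by (intro exI[of _ a]) auto
 from someI_ex[OF this] show "copower_tensor n m : Hom C (U n \<boxtimes> U m) (U (n * m))" "is_iso C (copower_tensor n m)"
  "i < n ==> j < m ==> copower_tensor n m ** (inc n i \<star> inc m j) = inc (n * m) (i * m + j) ** ?l"
  "i < n ==> j < m ==> prj (n * m) (i * m + j) ** copower_tensor n m = ?l ** (prj n i \<star> prj m j)"
  unfolding copower_tensor_def[symmetric] by auto
qed

lemma copower_tensor_arrow [simp]: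
 "copower_tensor n m : Arr C" "Dom C (copower_tensor n m) = U n \<boxtimes> U m" "Cod C (copower_tensor n m) = U (n * m)"
 "is_iso C (copower_tensor n m)"
 using copower_tensor(1,2)[of n m] by (auto simp: hom_iff)

lemma copower_tensor_inj:
 assumes "i < n" "j < m" "x : Arr C" "Cod C x = Unit C \<boxtimes> Unit C"
 shows "copower_tensor n m ** ((inc n i \<star> inc m j) ** x) = inc (n * m) (i * m + j) ** (Lunit C (Unit C) ** x)"
 by (rule comp_cong2[OF copower_tensor(3)[OF assms(1,2)]]) (use assms mult_add_less in auto)

lemma copower_tensor_natural:
 assumes A: "A : carrier_mat n' n" and B: "B : carrier_mat m' m"
 shows "mat_arrow (kronecker A B) ** copower_tensor n m = copower_tensor n' m' ** (mat_arrow A \<star> mat_arrow B)"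
proof (rule direct_sum_matrix_eqI[OF direct_sum_TensO[OF copower copower] copower])
 let ?l = "Lunit C (Unit C)" and ?u = "Ident C (Unit C)"
 note K = kronecker_carrier[OF A B]
 show "mat_arrow (kronecker A B) ** copower_tensor n m : Hom C (U n \<boxtimes> U m) (U (n' * m'))"
  "copower_tensor n' m' ** (mat_arrow A \<star> mat_arrow B) : Hom C (U n \<boxtimes> U m) (U (n' * m'))"
  using K A B by (simp_all add: hom_iff)
 fix a k assume "a : {..<n} \<times> {..<m}" and k: "k : {..<n' * m'}"
 then obtain i j where ij: "a = (i, j)" "i < n" "j < m" by auto
 note ij' = mult_add_less[OF ij(2,3)]
 define k1 where "k1 = k div m'" define k2 where "k2 = k mod m'"
 have k12: "k1 < n'" "k2 < m'" "k = k1 * m' + k2" "k1 * m' + k2 < n' * m'" using div_mod_less[of k n' m'] k by (auto simp: k1_def k2_def)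
 have "prj (n' * m') k ** ((mat_arrow (kronecker A B) ** copower_tensor n m) ** (inc n i \<star> inc m j))
   = (prj (n' * m') k ** (mat_arrow (kronecker A B) ** inc (n * m) (i * m + j))) ** ?l"
  using K ij ij' k copower_tensor(3)[OF ij(2,3)] by (simp add: comp_assoc)
 also have "... = Scale C (A $$ (k1, i) * B $$ (k2, j)) ?l"
  using mat_arrow(2)[OF K _ ij', of k] k kronecker_index[OF A B _ ij', of k] ij k12 by (simp add: k1_def[symmetric] k2_def[symmetric])
 also have "... = ?l ** ((prj n' k1 ** (mat_arrow A ** inc n i)) \<star> (prj m' k2 ** (mat_arrow B ** inc m j)))"
  using mat_arrow(2)[OF A k12(1) ij(2)] mat_arrow(2)[OF B k12(2) ij(3)]
   TensA_Scale_left[OF Ident_hom[OF Unit_obj] Scale_hom[OF Ident_hom[OF Unit_obj]]] TensA_Scale_right[OF Ident_hom[OF Unit_obj] Ident_hom[OF Unit_obj]]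
  by (simp add: Scale_Scale)
 also have "... = (?l ** (prj n' k1 \<star> prj m' k2)) ** ((mat_arrow A ** inc n i) \<star> (mat_arrow B ** inc m j))"
  using A B ij k12 by (simp add: comp_assoc interchange)
 also have "... = prj (n' * m') k ** ((copower_tensor n' m' ** (mat_arrow A \<star> mat_arrow B)) ** (inc n i \<star> inc m j))"
  unfolding copower_tensor(4)[OF k12(1,2), symmetric] using A B ij k12 by (simp add: comp_assoc interchange)
 finally show "prj (n' * m') k ** ((mat_arrow (kronecker A B) ** copower_tensor n m) ** (case a of (i, j) => inc n i \<star> inc m j))
   = prj (n' * m') k ** ((copower_tensor n' m' ** (mat_arrow A \<star> mat_arrow B)) ** (case a of (i, j) => inc n i \<star> inc m j))"
  using ij by simp
qed

text \<open>On a component both sides consist of an injection and unit constraints of \<open>1\<close>.  These agree by the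
  triangle axiom for three units, because the left and the right unit constraint of \<open>1\<close> coincide.\<close>

lemma copower_tensor_assoc:
 "copower_tensor (n * m) r ** (copower_tensor n m \<star> Ident C (U r))
  = copower_tensor n (m * r) ** ((Ident C (U n) \<star> copower_tensor m r) ** Assoc C (U n) (U m) (U r))"
proof (rule direct_sum_eqI_from[OF direct_sum_TensO[OF direct_sum_TensO[OF copower copower] copower]])
 let ?l = "Lunit C (Unit C)" and ?u = "Ident C (Unit C)"
 show "copower_tensor (n * m) r ** (copower_tensor n m \<star> Ident C (U r)) : Hom C ((U n \<boxtimes> U m) \<boxtimes> U r) (U (n * m * r))"
  "copower_tensor n (m * r) ** ((Ident C (U n) \<star> copower_tensor m r) ** Assoc C (U n) (U m) (U r)) : Hom C ((U n \<boxtimes> U m) \<boxtimes> U r) (U (n * m * r))"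
  by (simp_all add: hom_iff mult.assoc)
 fix a assume "a : ({..<n} \<times> {..<m}) \<times> {..<r}"
 then obtain i j k where a: "a = ((i, j), k)" and i: "i < n" and j: "j < m" and k: "k < r" by auto
 note ij = mult_add_less[OF i j] and jk = mult_add_less[OF j k]
 note ijk = mult_add_less[OF ij k]
 have ix: "i * (m * r) + (j * r + k) = (i * m + j) * r + k" "n * (m * r) = n * m * r" by (simp_all add: algebra_simps)
 have "copower_tensor (n * m) r ** (copower_tensor n m \<star> Ident C (U r)) ** ((inc n i \<star> inc m j) \<star> inc r k)
   = copower_tensor (n * m) r ** ((inc (n * m) (i * m + j) ** ?l) \<star> (inc r k ** ?u))"
  using i j k ij by (simp add: comp_assoc interchange copower_tensor(3))
 also have "... = copower_tensor (n * m) r ** ((inc (n * m) (i * m + j) \<star> inc r k) ** (?l \<star> ?u))"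
  using ij k by (simp add: interchange)
 also have "... = inc (n * m * r) ((i * m + j) * r + k) ** (?l ** (?l \<star> ?u))"
  by (rule copower_tensor_inj) (use ij k in auto)
 also have "?l \<star> ?u = (?u \<star> ?l) ** Assoc C (Unit C) (Unit C) (Unit C)"
  using triangle[of "Unit C" "Unit C"] by (simp add: Lunit_Unit_eq_Runit)
 also have "inc (n * m * r) ((i * m + j) * r + k) ** (?l ** ...)
   = copower_tensor n (m * r) ** ((inc n i \<star> inc (m * r) (j * r + k)) ** ((?u \<star> ?l) ** Assoc C (Unit C) (Unit C) (Unit C)))"
  using copower_tensor_inj[OF i jk, of "(?u \<star> ?l) ** Assoc C (Unit C) (Unit C) (Unit C)"] by (simp add: ix)
 also have "... = copower_tensor n (m * r) ** ((inc n i \<star> (copower_tensor m r ** (inc m j \<star> inc r k))) ** Assoc C (Unit C) (Unit C) (Unit C))"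
  using i j k jk by (simp add: interchange' copower_tensor(3))
 also have "... = copower_tensor n (m * r) ** ((Ident C (U n) \<star> copower_tensor m r) ** ((inc n i \<star> (inc m j \<star> inc r k)) ** Assoc C (Unit C) (Unit C) (Unit C)))"
  using i j k by (simp add: interchange')
 also have "(inc n i \<star> (inc m j \<star> inc r k)) ** Assoc C (Unit C) (Unit C) (Unit C) = Assoc C (U n) (U m) (U r) ** ((inc n i \<star> inc m j) \<star> inc r k)"
  using Assoc_nat[of "inc n i" "inc m j" "inc r k"] i j k by simp
 finally show "copower_tensor (n * m) r ** (copower_tensor n m \<star> Ident C (U r)) ** (case a of (k, l) => (case k of (k, l) => inc n k \<star> inc m l) \<star> inc r l)
   = copower_tensor n (m * r) ** ((Ident C (U n) \<star> copower_tensor m r) ** Assoc C (U n) (U m) (U r)) ** (case a of (k, l) => (case k of (k, l) => inc n k \<star> inc m l) \<star> inc r l)"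
  using a i j k by (simp add: comp_assoc)
qed

lemma copower_unit:
 "is_iso C (inc 1 0)" "copower_tensor 1 n ** (inc 1 0 \<star> Ident C (U n)) = Lunit C (U n)"
 "copower_tensor n 1 ** (Ident C (U n) \<star> inc 1 0) = Runit C (U n)"
proof -
 let ?u = "Ident C (Unit C)"
 have pi: "prj 1 0 ** inc 1 0 = ?u" using direct_sum_overD(6)[OF copower, of 0 1] by simp
 have "inc 1 0 ** prj 1 0 = Ident C (U 1)"
  by (rule direct_sum_eqI_from[OF copower]) (use pi in "auto simp: hom_iff comp_assoc")
 then show "is_iso C (inc 1 0)" using pi by (intro isoI[of "inc 1 0" "Unit C" "U 1" "prj 1 0"]) (auto simp: hom_iff)
 show "copower_tensor 1 n ** (inc 1 0 \<star> Ident C (U n)) = Lunit C (U n)"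
 proof (rule direct_sum_eqI_from[OF linear_functor.Fa_direct_sum[OF TensA_linear_functor(1)[OF Unit_obj] copower]])
  fix k assume "k : {..<n}"
  then show "copower_tensor 1 n ** (inc 1 0 \<star> Ident C (U n)) ** (?u \<star> inc n k) = Lunit C (U n) ** (?u \<star> inc n k)"
   using copower_tensor(3)[of 0 1 k n] Lunit_nat[of "inc n k"] by (simp add: comp_assoc interchange)
 qed (auto simp: hom_iff)
 show "copower_tensor n 1 ** (Ident C (U n) \<star> inc 1 0) = Runit C (U n)"
 proof (rule direct_sum_eqI_from[OF linear_functor.Fa_direct_sum[OF TensA_linear_functor(2)[OF Unit_obj] copower]])
  fix k assume "k : {..<n}"
  then show "copower_tensor n 1 ** (Ident C (U n) \<star> inc 1 0) ** (inc n k \<star> ?u) = Runit C (U n) ** (inc n k \<star> ?u)"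
   using copower_tensor(3)[of k n 0 1] Runit_nat[of "inc n k"] by (simp add: comp_assoc interchange Lunit_Unit_eq_Runit)
 qed (auto simp: hom_iff)
qed

text \<open>The forgetful functor to vector spaces, followed by \<open>V \<mapsto> V \<otimes> 1\<close>.\<close>

definition trivial_functor :: "(('g, 'k) rep, ('g, 'k) rep_arrow, 'o, 'a) functor_data" where
 "trivial_functor = \<lparr>FObj = (\<lambda>V. U (fst V)), FArr = (\<lambda>(V, W, A). mat_arrow A),
   FTens = (\<lambda>V W. copower_tensor (fst V) (fst W)), FUnit = inc 1 0\<rparr>"

lemma trivial_tensor_functor:
 assumes R: "tensor_category (rep_category G :: ('g, 'k) rep_cat)"
  and B: "split_semisimple_category (rep_category G :: ('g, 'k) rep_cat) B"
 shows "tensor_functor (rep_category G) C (trivial_functor :: (('g, 'k) rep, ('g, 'k) rep_arrow, 'o, 'a) functor_data)"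
proof (rule tensor_functor_semisimpleI[OF R tensor_category_axioms B])
 let ?R = "rep_category G :: ('g, 'k) rep_cat"
 let ?H = "trivial_functor :: (('g, 'k) rep, ('g, 'k) rep_arrow, 'o, 'a) functor_data"
 interpret R: tensor_category ?R by fact
 have ft: "fst (rep_tensor G X Y) = fst X * fst Y" "fst (rep_unit G) = 1" for X Y :: "('g, 'k) rep"
  by (simp_all add: rep_tensor_def rep_unit_def)
 show "linear_functor ?R C (FObj ?H) (FArr ?H)"
 proof (intro linear_functor.intro linear_functor_axioms.intro R.linear_category_axioms linear_category_axioms)
  fix X Y f assume "f : Hom ?R X Y"
  then show "FArr ?H f : Hom C (FObj ?H X) (FObj ?H Y)" "FArr ?H (Scale ?R c f) = Scale C c (FArr ?H f)" for c
   by (auto elim!: rep_homE simp: trivial_functor_def hom_iff mat_arrow_smult)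
  fix Z g assume "g : Hom ?R Y Z"
  with \<open>f : Hom ?R X Y\<close> show "FArr ?H (g **[?R] f) = FArr ?H g ** FArr ?H f"
   by (elim rep_homE) (simp add: trivial_functor_def mat_arrow_mult)
 next
  fix X Y f g assume "f : Hom ?R X Y" "g : Hom ?R X Y"
  then show "FArr ?H (Add ?R f g) = Add C (FArr ?H f) (FArr ?H g)"
   by (elim rep_homE) (simp add: trivial_functor_def mat_arrow_add)
 qed (auto simp: trivial_functor_def mat_arrow_one)
 show "FTens ?H X Y : Hom C (FObj ?H X \<boxtimes> FObj ?H Y) (FObj ?H (X \<boxtimes>[?R] Y))" "is_iso C (FTens ?H X Y)" for X Y
  by (auto simp: trivial_functor_def hom_iff ft)
 show "FUnit ?H : Hom C (Unit C) (FObj ?H (Unit ?R))" "is_iso C (FUnit ?H)"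
  using copower_unit(1) by (auto simp: trivial_functor_def hom_iff ft)
 show "FArr ?H (Assoc ?R X Y Z) ** (FTens ?H (X \<boxtimes>[?R] Y) Z ** (FTens ?H X Y \<star> Ident C (FObj ?H Z)))
   = FTens ?H X (Y \<boxtimes>[?R] Z) ** ((Ident C (FObj ?H X) \<star> FTens ?H Y Z) ** Assoc C (FObj ?H X) (FObj ?H Y) (FObj ?H Z))" for X Y Z
  using copower_tensor_assoc[of "fst X" "fst Y" "fst Z"] by (simp add: trivial_functor_def ft mat_arrow_one mult.assoc)
 show "FArr ?H (Lunit ?R X) ** (FTens ?H (Unit ?R) X ** (FUnit ?H \<star> Ident C (FObj ?H X))) = Lunit C (FObj ?H X)"
  "FArr ?H (Runit ?R X) ** (FTens ?H X (Unit ?R) ** (Ident C (FObj ?H X) \<star> FUnit ?H)) = Runit C (FObj ?H X)" for X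
  using copower_unit(2,3)[of "fst X"] by (simp_all add: trivial_functor_def ft mat_arrow_one)
 fix f g X X' Y Y' assume "f : Hom ?R X X'" "g : Hom ?R Y Y'"
 then show "FArr ?H (f \<star>[?R] g) ** FTens ?H X Y = FTens ?H X' Y' ** (FArr ?H f \<star> FArr ?H g)"
  by (elim rep_homE) (simp add: trivial_functor_def copower_tensor_natural)
qed

end

section \<open>The kernel as the representation category of the group of order two\<close>

definition Z2_action :: "('o, 'a, 'k::field, 'z) monoidal_data_scheme => (int, 'k) rep => 'a" where
 "Z2_action D V = tensor_category.mat_arrow D (snd V 1)"

lemma (in tensor_category) trivial_functor_Z2:
 assumes two: "(2::'k) \<noteq> 0"
 shows "functor_with_endomorphism (rep_category Z2) C trivial_functor (Obj (rep_category Z2)) (Z2_action C)"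
proof -
 let ?R = "rep_category Z2 :: (int, 'k) rep_cat"
 let ?H = "trivial_functor :: ((int, 'k) rep, (int, 'k) rep_arrow, 'o, 'a) functor_data"
 interpret Z: group Z2 by (rule Z2_group)
 interpret R: fusion_category ?R by (rule rep_Z2_fusion[OF two])
 interpret H: tensor_functor ?R C ?H by (rule trivial_tensor_functor[OF R.tensor_category_axioms R.split_semisimple_category_axioms])
 have Ho: "FObj ?H V = U (fst V)" "FArr ?H (V, W, A) = mat_arrow A" "FTens ?H V W = copower_tensor (fst V) (fst W)" "FUnit ?H = inc 1 0" for V W A
  by (auto simp: trivial_functor_def)
 show ?thesis
 proof (intro functor_with_endomorphism.intro functor_with_endomorphism_axioms.intro H.tensor_functor_axioms)
  fix V assume V: "V : Obj ?R"
  note v = rep_Z2_involution(3)[of V]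
  have V': "V : rep_objects Z2" using V by simp
  show "Z2_action C V : Hom C (FObj ?H V) (FObj ?H V)" using v[OF V'] by (simp add: Z2_action_def Ho mat_arrow(1))
  fix W assume W: "W : Obj ?R"
  have W': "W : rep_objects Z2" using W by simp
  note v = rep_Z2_involution(3)[OF V'] and w = rep_Z2_involution(3)[OF W']
  have "kronecker (snd V 1) (snd W 1) = snd (rep_tensor Z2 V W) 1" by (simp add: rep_tensor_def Z2_carrier)
  then show "Z2_action C (V \<boxtimes>[?R] W) ** FTens ?H V W = FTens ?H V W ** (Z2_action C V \<star> Z2_action C W)"
   using copower_tensor_natural[OF v w] by (simp add: Z2_action_def Ho)
  show "bij_betw (FArr ?H) (Hom ?R V W) {h : Hom C (FObj ?H V) (FObj ?H W). h ** Z2_action C V = Z2_action C W ** h}"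
  proof (rule bij_betw_imageI)
   note inj = mat_arrow_bij[of "fst W" "fst V", unfolded bij_betw_def, THEN conjunct1]
   show "inj_on (FArr ?H) (Hom ?R V W)"
   proof (rule inj_onI)
    fix x y assume xy: "x : Hom ?R V W" "y : Hom ?R V W" "FArr ?H x = FArr ?H y"
    obtain A where A: "x = (V, W, A)" "A : carrier_mat (fst W) (fst V)" using xy(1) by (rule rep_homE)
    obtain B where B: "y = (V, W, B)" "B : carrier_mat (fst W) (fst V)" using xy(2) by (rule rep_homE)
    show "x = y" using inj_onD[OF inj _ A(2) B(2)] xy(3) A(1) B(1) by (simp add: Ho)
   qed
   have comm: "mat_arrow A ** Z2_action C V = Z2_action C W ** mat_arrow A \<longleftrightarrow> A * snd V 1 = snd W 1 * A"
    if A: "A : carrier_mat (fst W) (fst V)" for A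
    using inj_on_eq_iff[OF inj mult_carrier_mat[OF A v] mult_carrier_mat[OF w A]]
    by (simp only: Z2_action_def mat_arrow_mult[OF v A] mat_arrow_mult[OF A w])
   show "FArr ?H ` Hom ?R V W = {h : Hom C (FObj ?H V) (FObj ?H W). h ** Z2_action C V = Z2_action C W ** h}"
   proof (intro equalityI subsetI)
    fix h assume "h : FArr ?H ` Hom ?R V W"
    then obtain A where A: "h = mat_arrow A" "A : intertwiners Z2 V W" by (auto simp: Ho elim!: rep_homE)
    then show "h : {h : Hom C (FObj ?H V) (FObj ?H W). h ** Z2_action C V = Z2_action C W ** h}"
     using comm[of A] intertwinersD(1)[OF A(2)] intertwinersD(2)[OF A(2), of 1] by (auto simp: Ho mat_arrow(1) Z2_carrier)
   next
    fix h assume h: "h : {h : Hom C (FObj ?H V) (FObj ?H W). h ** Z2_action C V = Z2_action C W ** h}"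
    then have "h : mat_arrow ` carrier_mat (fst W) (fst V)" using mat_arrow_bij[of "fst W" "fst V"] by (simp add: bij_betw_def Ho)
    then obtain A where A: "A : carrier_mat (fst W) (fst V)" "h = mat_arrow A" by blast
    then have "A : intertwiners Z2 V W" using comm[OF A(1)] h by (intro Z2_intertwinersI[OF V' W']) auto
    then show "h : FArr ?H ` Hom ?R V W" using A(2) V' W' by (intro image_eqI[of _ _ "(V, W, A)"]) (auto simp: Ho rep_hom_iff)
   qed
  qed
 next
  have "snd (rep_unit Z2 :: (int, 'k) rep) 1 = 1\<^sub>m 1" by (simp add: rep_unit_def Z2_carrier)
  then show "Z2_action C (Unit ?R) ** FUnit ?H = FUnit ?H" by (simp add: Z2_action_def Ho mat_arrow_one)
 qed (auto simp: Z.rep_unit_obj Z.rep_tensor_obj)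
qed

lemma (in tensor_category) is_trivial_iso:
 assumes "is_trivial C X" "isomorphic C X Y" shows "is_trivial C Y"
proof -
 obtain a where "a : Hom C X Y" "is_iso C a" using assms(2) by (auto simp: isomorphic_def)
 moreover obtain n i p where "direct_sum_over C {..<n::nat} (\<lambda>_. Unit C) X i p" using assms(1) by (rule is_trivialE)
 ultimately show ?thesis using is_trivialI[OF direct_sum_transport] by blast
qed

lemma (in fusion_category) simple_eqI:
 assumes "g : Hom C X Y" "h : Hom C X Y" "\<And>S f. is_simple C S ==> f : Hom C S X ==> g ** f = h ** f"
 shows "g = h"
proof -
 obtain n S i p where S: "\<And>k. k : {..<n::nat} ==> S k : {X. is_simple C X}" and d: "direct_sum_over C {..<n} S X i p"
  using obtain_decomposition[of X] hom_obj[OF assms(1)] by metis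
 show ?thesis by (rule direct_sum_eqI_from[OF d assms(1,2)]) (use S assms(3) direct_sum_overD(4)[OF d] in blast)
qed

text \<open>The evaluation of a dual \<open>T\<close> of \<open>S\<close> splits, so \<open>1\<close> is a direct summand of \<open>T \<otimes> S\<close>, and \<open>F S = 0\<close>
  would imply \<open>F 1 = 0\<close>.\<close>

lemma (in tensor_functor) simple_image_nonzero:
 assumes C: "fusion_category C" and S: "is_simple C S" shows "Ident D (FObj F S) \<noteq> Zero D (FObj F S) (FObj F S)"
proof
 interpret C: fusion_category C by fact
 assume z: "Ident D (FObj F S) = Zero D (FObj F S) (FObj F S)"
 have So: "S : Obj C" using S by (simp add: is_simple_def)
 obtain T ev coev where d: "is_dual C T S ev coev" using C.left_duals[OF So] by blast
 have T: "T : Obj C" and ev: "ev : Hom C (T \<boxtimes>[C] S) (Unit C)" using d by (auto simp: is_dual_def)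
 have "Ident C S \<noteq> Zero C S S" using C.B_Ident_nonzero[of S] S by simp
 then have "ev \<noteq> Zero C (T \<boxtimes>[C] S) (Unit C)" using C.evaluation_nonzero[OF d] by simp
 then obtain x where x: "x : Hom C (Unit C) (T \<boxtimes>[C] S)" "ev **[C] x = Ident C (Unit C)"
  using C.obtain_pivot[OF ev] C.Unit_simple by blast
 let ?TS = "FObj F T \<boxtimes>[D] FObj F S"
 have "Ident D ?TS = Zero D ?TS ?TS"
  using D.TensA_Idents[of "FObj F T" "FObj F S"] D.TensA_Zero(1)[OF D.Ident_hom[of "FObj F T"], of "FObj F S" "FObj F S"] z T So by simp
 then have "is_zero_obj D ?TS" using T So by (simp add: D.zero_obj_iff)
 then have "inverse_of D (FTens F T S) **[D] (FArr F x **[D] FUnit F) = Zero D (Unit D) ?TS"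
  by (rule D.arrow_zero_obj) (use x(1) T So in "auto simp: C.hom_iff D.hom_iff")
 then have "FTens F T S **[D] (inverse_of D (FTens F T S) **[D] (FArr F x **[D] FUnit F)) = FTens F T S **[D] Zero D (Unit D) ?TS" by simp
 then have 0: "FArr F x **[D] FUnit F = Zero D (Unit D) (FObj F (T \<boxtimes>[C] S))" using x(1) T So by (simp add: C.hom_iff)
 have "FArr F ev **[D] FArr F x = Ident D (FObj F (Unit C))" using Fa_Comp[OF x(1) ev] x(2) by (simp add: Fa_Ident)
 then have "FUnit F = (FArr F ev **[D] FArr F x) **[D] FUnit F" by simp
 also have "... = Zero D (Unit D) (FObj F (Unit C))" using ev x(1) T So 0 by (simp add: C.hom_iff D.comp_assoc)
 finally have "inverse_of D (FUnit F) **[D] FUnit F = inverse_of D (FUnit F) **[D] Zero D (Unit D) (FObj F (Unit C))" by simp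
 then show False using D.Unit_nonzero by simp
qed

context functor_with_kernel_of_order_two
begin

definition kernel_simples :: "'o set" where
 "kernel_simples = {S. isomorphic C S (Unit C) \<or> isomorphic C S G}"

text \<open>The sign by which the generator of the group of order two acts on \<open>S\<close>.  This has a meaning for the
  simple objects \<open>1\<close> and \<open>G\<close> of the kernel; elsewhere \<open>- 1\<close> is a default value.\<close>

definition grade :: "'o => 'k" where "grade S = (if isomorphic C S (Unit C) then 1 else - 1)"

lemma kernel_simple: "S : kernel_simples ==> is_simple C S" "S : kernel_simples ==> S : Obj C"
 unfolding kernel_simples_def using C.simple_isomorphic C.Unit_simple G_simple C.isomorphic_sym C.isomorphic_obj by blast+

lemma grade_iso: "isomorphic C S T ==> grade S = grade T"
 unfolding grade_def using C.isomorphic_trans C.isomorphic_sym by metis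

lemma grade_square: "grade S * grade S = 1" by (simp add: grade_def)

text \<open>The grading is multiplicative because the product of two copies of \<open>G\<close> is the unit.\<close>

lemma kernel_simples_TensO:
 assumes S: "S : kernel_simples" and T: "T : kernel_simples"
 shows "S \<boxtimes>[C] T : kernel_simples" "grade (S \<boxtimes>[C] T) = grade S * grade T"
proof -
 note ob = kernel_simple(2)[OF S] kernel_simple(2)[OF T]
 have iso: "Y : kernel_simples \<and> grade Y = grade X" if "X : kernel_simples" "isomorphic C Y X" for X Y
  using that grade_iso[OF that(2)] C.isomorphic_trans unfolding kernel_simples_def by blast
 have G: "grade G = - 1" "grade (Unit C) = 1" using G_not_Unit C.isomorphic_sym by (auto simp: grade_def)
 have "S \<boxtimes>[C] T : kernel_simples \<and> grade (S \<boxtimes>[C] T) = grade S * grade T"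
 proof (cases "isomorphic C S (Unit C)")
  case True
  have "isomorphic C (S \<boxtimes>[C] T) T"
   using C.isomorphic_trans[OF C.isomorphic_TensO[OF True] C.isomorphic_Lunit] ob by simp
  then show ?thesis using iso[OF T] True by (simp add: grade_def)
 next
  case False
  then have SG: "isomorphic C S G" using S by (simp add: kernel_simples_def)
  show ?thesis
  proof (cases "isomorphic C T (Unit C)")
   case True
   have "isomorphic C (S \<boxtimes>[C] T) S"
    using C.isomorphic_trans[OF C.isomorphic_TensO[OF _ True] C.isomorphic_Runit] ob by simp
   then show ?thesis using iso[OF S] True by (simp add: grade_def)
  next
   case False
   then have TG: "isomorphic C T G" using T by (simp add: kernel_simples_def)
   have "isomorphic C (S \<boxtimes>[C] T) (Unit C)" by (rule C.isomorphic_trans[OF C.isomorphic_TensO[OF SG TG] GG])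
   then show ?thesis using grade_iso[OF SG] grade_iso[OF TG] G by (simp add: grade_def kernel_simples_def)
  qed
 qed
 then show "S \<boxtimes>[C] T : kernel_simples" "grade (S \<boxtimes>[C] T) = grade S * grade T" by auto
qed

text \<open>The automorphism that acts on each simple subobject by its grade.  The description by all arrows from
  simple objects avoids the choice of a decomposition and makes naturality evident.\<close>

definition parity :: "'o => 'a" where
 "parity X = (THE t. t : Hom C X X \<and> (\<forall>S f. is_simple C S \<longrightarrow> f : Hom C S X \<longrightarrow> t **[C] f = Scale C (grade S) f))"

lemma parity:
 assumes X: "X : Obj C"
 shows "parity X : Hom C X X" "is_simple C S ==> f : Hom C S X ==> parity X **[C] f = Scale C (grade S) f"
proof -
 let ?P = "\<lambda>t. t : Hom C X X \<and> (\<forall>S f. is_simple C S \<longrightarrow> f : Hom C S X \<longrightarrow> t **[C] f = Scale C (grade S) f)"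
 obtain n S i p where S: "\<And>k. k : {..<n::nat} ==> S k : {X. is_simple C X}" and d: "direct_sum_over C {..<n} S X i p"
  using C.obtain_decomposition[OF X] by metis
 note D = C.direct_sum_overD[OF d]
 obtain t where t: "t : Hom C X X" "\<And>k. k : {..<n} ==> t **[C] i k = Scale C (grade (S k)) (i k)"
  using C.direct_sum_cotuple[OF d X, of "\<lambda>k. Scale C (grade (S k)) (i k)"] C.Scale_hom[OF D(4)] by blast
 have pt: "p l **[C] t = Scale C (grade (S l)) (p l)" if l: "l : {..<n}" for l
 proof (rule C.direct_sum_eqI_from[OF d])
  fix k assume k: "k : {..<n}"
  show "p l **[C] t **[C] i k = Scale C (grade (S l)) (p l) **[C] i k"
   using t k l d D(3,6,7) by (cases "k = l") (auto simp: C.hom_iff C.comp_assoc)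
 qed (use t D l in "auto simp: C.hom_iff")
 have "?P t"
 proof (intro conjI allI impI)
  fix T f assume T: "is_simple C T" and f: "f : Hom C T X"
  show "t **[C] f = Scale C (grade T) f"
  proof (rule C.direct_sum_eqI_into[OF d])
   fix l assume l: "l : {..<n}"
   have pf: "p l **[C] f : Hom C T (S l)" using f D(5)[OF l] by (simp add: C.hom_iff)
   have "p l **[C] (t **[C] f) = Scale C (grade (S l)) (p l **[C] f)"
    by (subst C.comp_cong_left[OF pt[OF l]]) (use t f l d in "auto simp: C.hom_iff")
   also have "... = Scale C (grade T) (p l **[C] f)"
   proof (cases "p l **[C] f = Zero C T (S l)")
    case True
    then show ?thesis using C.hom_obj[OF pf] by simp
   next
    case False
    then have "is_iso C (p l **[C] f)" using C.simple_hom_iso[of T "S l"] T S[OF l] pf by blast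
    then show ?thesis using grade_iso[OF C.isomorphicI[OF pf]] by simp
   qed
   also have "... = p l **[C] Scale C (grade T) f" using f l d by (simp add: C.hom_iff)
   finally show "p l **[C] (t **[C] f) = p l **[C] Scale C (grade T) f" .
  qed (use t f in "auto simp: C.hom_iff")
 qed (rule t(1))
 moreover have "t' = t" if "?P t'" for t'
  by (rule C.simple_eqI) (use that \<open>?P t\<close> in auto)
 ultimately have "?P (parity X)" unfolding parity_def by (rule theI)
 then show "parity X : Hom C X X" "is_simple C S ==> f : Hom C S X ==> parity X **[C] f = Scale C (grade S) f" for S f by auto
qed

lemma parity_arrow [simp]: "X : Obj C ==> parity X : Arr C" "X : Obj C ==> Dom C (parity X) = X" "X : Obj C ==> Cod C (parity X) = X"
 using parity(1) by (auto simp: C.hom_iff)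

lemma parity_natural:
 assumes g: "g : Hom C X Y" shows "g **[C] parity X = parity Y **[C] g"
proof -
 note ob = C.hom_obj[OF g] and g' = g[unfolded C.hom_iff]
 show ?thesis
 proof (rule C.simple_eqI)
  fix S f assume S: "is_simple C S" and f: "f : Hom C S X"
  have "g **[C] f : Hom C S Y" using f g by (simp add: C.hom_iff)
  then show "g **[C] parity X **[C] f = parity Y **[C] g **[C] f"
   using parity(2)[OF ob(1) S f] parity(2)[OF ob(2) S] f g' ob by (simp add: C.hom_iff C.comp_assoc)
 qed (use g' ob in "auto simp: C.hom_iff")
qed

lemma parity_simple: "is_simple C S ==> parity S = Scale C (grade S) (Ident C S)"
 using parity(2)[of S S "Ident C S"] by (simp add: is_simple_def C.hom_iff)

text \<open>The image of a summand of \<open>X\<close> is a quotient of the trivial object \<open>F X\<close>.  If the summand is neither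
  \<open>1\<close> nor \<open>G\<close>, its image receives no arrow from \<open>1\<close>, so it vanishes.\<close>

lemma kernel_decomposition:
 assumes "X : Ker_objects C D F"
 obtains n S i p where "\<And>k. k : {..<n::nat} ==> S k : kernel_simples" "direct_sum_over C {..<n} S X i p"
proof -
 have X: "X : Obj C" and tr: "is_trivial D (FObj F X)" using assms by (auto simp: Ker_objects_def)
 obtain n S i p where S: "\<And>k. k : {..<n::nat} ==> S k : {X. is_simple C X}" and d: "direct_sum_over C {..<n} S X i p"
  using C.obtain_decomposition[OF X] by metis
 obtain m u q where dT: "direct_sum_over D {..<m::nat} (\<lambda>_. Unit D) (FObj F X) u q" using tr by (rule D.is_trivialE)
 have "S k : kernel_simples" if k: "k : {..<n}" for k
 proof (rule ccontr)
  note Dk = C.direct_sum_overD(3-6)[OF d k]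
  assume "S k \<notin> kernel_simples"
  then have n: "\<not> isomorphic C (S k) (Unit C)" "\<not> isomorphic C (S k) G" by (auto simp: kernel_simples_def)
  have "FArr F (p k) = Zero D (FObj F X) (FObj F (S k))"
  proof (rule D.direct_sum_eqI_from[OF dT])
   fix l assume l: "l : {..<m}"
   have "FArr F (p k) **[D] u l : Hom D (Unit D) (FObj F (S k))"
    using Dk(3) D.direct_sum_overD(4)[OF dT l] by (simp add: C.hom_iff D.hom_iff)
   from arrow_Unit_to_F_other[OF _ n this] show "FArr F (p k) **[D] u l = Zero D (FObj F X) (FObj F (S k)) **[D] u l"
    using S[OF k] D.direct_sum_overD(4)[OF dT l] Dk(1) by (simp add: D.hom_iff)
  qed (use Dk X in "auto simp: C.hom_iff D.hom_iff")
  then have "Ident D (FObj F (S k)) = Zero D (FObj F (S k)) (FObj F (S k))"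
   using Fa_Comp[OF Dk(2,3)] Dk X by (simp add: Fa_Ident C.hom_iff)
  then show False using simple_image_nonzero[OF C.fusion_category_axioms] S[OF k] by simp
 qed
 note * = this
 show thesis by (rule that[OF * d])
qed

text \<open>For different grades the hypothesis says \<open>2 h = 0\<close>.  For equal grades there is an isomorphism
  \<open>S \<rightarrow> T\<close>, and \<open>h\<close> is a multiple of its image because the images are isomorphic to \<open>1\<close>.\<close>

lemma lift_simple:
 assumes two: "(2::'k) \<noteq> 0" and S: "S : kernel_simples" and T: "T : kernel_simples"
  and h: "h : Hom D (FObj F S) (FObj F T)" "Scale D (grade S) h = Scale D (grade T) h"
 shows "\<exists>g\<in>Hom C S T. FArr F g = h"
proof (cases "grade S = grade T")
 case True
 have "(1::'k) \<noteq> - 1" using two by (simp add: eq_neg_iff_add_eq_0)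
 then have "isomorphic C S (Unit C) \<longleftrightarrow> isomorphic C T (Unit C)" using True by (auto simp: grade_def split: if_splits)
 then obtain P where "isomorphic C S P" "isomorphic C T P" using S T unfolding kernel_simples_def by blast
 then have "isomorphic C S T" using C.isomorphic_trans[OF _ C.isomorphic_sym] by blast
 then obtain a where a: "a : Hom C S T" "is_iso C a" by (auto simp: isomorphic_def)
 note Fa = Fa_iso[OF a(2)]
 have FS: "is_simple D (FObj F S)" using D.simple_isomorphic[OF D.Unit_simple F_kernel_simple] S by (simp add: kernel_simples_def)
 have "inverse_of D (FArr F a) **[D] h : Hom D (FObj F S) (FObj F S)" using a Fa(1) h by (simp add: C.hom_iff D.hom_iff)
 then obtain c where c: "inverse_of D (FArr F a) **[D] h = Scale D c (Ident D (FObj F S))"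
  using D.split[OF FS] by (auto simp: bij_betw_def)
 have "h = FArr F a **[D] (inverse_of D (FArr F a) **[D] h)" using a Fa(1) h by (simp add: C.hom_iff D.hom_iff)
 also have "... = FArr F (Scale C c a)" unfolding c using a kernel_simple(2)[OF S] Fa_Scale[OF a(1), of c] by (simp add: C.hom_iff)
 finally show ?thesis using C.Scale_hom[OF a(1)] by metis
next
 case False
 have "h = Zero D (FObj F S) (FObj F T)"
 proof -
  have "Scale D (grade S - grade T) h = Zero D (FObj F S) (FObj F T)"
   using D.Scale_add_left[of h "grade T" "- grade T"] D.Scale_add_left[of h "grade S" "- grade T"] h by (simp add: D.hom_iff)
  then show ?thesis using D.Scale_eq_Zero[of h "grade S - grade T"] False h(1) by (simp add: D.hom_iff)
 qed
 then show ?thesis using Fa_Zero C.Zero_hom kernel_simple(2)[OF S] kernel_simple(2)[OF T] by metis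
qed

lemma faithful_simple:
 assumes S: "S : kernel_simples" and T: "T : kernel_simples"
  and gh: "g : Hom C S T" "h : Hom C S T" "FArr F g = FArr F h"
 shows "g = h"
proof (rule ccontr)
 assume "g \<noteq> h"
 let ?s = "sub C g h"
 have s: "?s : Hom C S T" "?s \<noteq> Zero C S T" using C.sub_hom C.sub_eq_Zero_iff gh \<open>g \<noteq> h\<close> by auto
 have i: "is_iso C ?s" using C.simple_hom_iso[OF _ _ s] kernel_simple(1)[OF S] kernel_simple(1)[OF T] by simp
 have "FArr F ?s = Zero D (FObj F S) (FObj F T)" using Fa_sub[OF gh(1,2)] gh by (simp add: C.hom_iff)
 then have "inverse_of D (FArr F ?s) **[D] FArr F ?s = inverse_of D (FArr F ?s) **[D] Zero D (FObj F S) (FObj F T)" by simp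
 moreover have "inverse_of D (FArr F ?s) **[D] FArr F ?s = Ident D (FObj F S)"
  "inverse_of D (FArr F ?s) **[D] Zero D (FObj F S) (FObj F T) = Zero D (FObj F S) (FObj F S)"
  using Fa_iso(1)[OF i] s(1) kernel_simple(2)[OF S] by (simp_all add: C.hom_iff)
 ultimately show False using simple_image_nonzero[OF C.fusion_category_axioms kernel_simple(1)[OF S]] by simp
qed

text \<open>An arrow between images commutes with the parities if and only if its matrix entries between summands
  of different grade vanish, and the other entries lift uniquely.\<close>

lemma kernel_functor:
 assumes two: "(2::'k) \<noteq> 0"
 shows "functor_with_endomorphism C D F (Ker_objects C D F) (\<lambda>X. FArr F (parity X))"
proof (intro functor_with_endomorphism.intro functor_with_endomorphism_axioms.intro tensor_functor_axioms)
 let ?K = "Ker_objects C D F"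
 show sub: "?K \<subseteq> Obj C" by (auto simp: Ker_objects_def)
 have u: "Unit C : kernel_simples" by (simp add: kernel_simples_def)
 show "Unit C : ?K" using F_trivial[OF C.direct_sum_trivial[OF C.Unit_obj]] by (simp add: Ker_objects_def)
 show "FArr F (parity (Unit C)) **[D] FUnit F = FUnit F"
  using parity_simple[OF C.Unit_simple] by (simp add: grade_def Fa_Ident)
 fix X assume X: "X : ?K"
 then have Xo: "X : Obj C" using sub by auto
 show "FArr F (parity X) : Hom D (FObj F X) (FObj F X)" using Xo by (simp add: D.hom_iff)
 obtain n S i p where S: "\<And>k. k : {..<n::nat} ==> S k : kernel_simples" and d: "direct_sum_over C {..<n} S X i p"
  using kernel_decomposition[OF X] by metis
 note D = C.direct_sum_overD[OF d] and Fd = Fa_direct_sum[OF d]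
 fix Y assume Y: "Y : ?K"
 then have Yo: "Y : Obj C" using sub by auto
 obtain m T j q where T: "\<And>k. k : {..<m::nat} ==> T k : kernel_simples" and d': "direct_sum_over C {..<m} T Y j q"
  using kernel_decomposition[OF Y] by metis
 note D' = C.direct_sum_overD[OF d'] and Fd' = Fa_direct_sum[OF d']
 note dt = C.direct_sum_TensO[OF d d']
 show "X \<boxtimes>[C] Y : ?K"
  using F_trivial[OF dt] kernel_simples_TensO(1)[OF S T] Xo Yo by (force simp: Ker_objects_def kernel_simples_def)
 have "parity (X \<boxtimes>[C] Y) = parity X \<star>[C] parity Y"
 proof (rule C.direct_sum_eqI_from[OF dt])
  fix a assume "a : {..<n} \<times> {..<m}"
  then obtain k l where a: "a = (k, l)" and k: "k : {..<n}" and l: "l : {..<m}" by auto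
  note ks = kernel_simples_TensO[OF S[OF k] T[OF l]]
  have "i k \<star>[C] j l : Hom C (S k \<boxtimes>[C] T l) (X \<boxtimes>[C] Y)" using d d' k l by (simp add: C.hom_iff)
  from parity(2)[OF _ kernel_simple(1)[OF ks(1)] this]
  have "parity (X \<boxtimes>[C] Y) **[C] (i k \<star>[C] j l) = Scale C (grade (S k) * grade (T l)) (i k \<star>[C] j l)"
   using Xo Yo ks(2) by simp
  also have "... = Scale C (grade (S k)) (i k) \<star>[C] Scale C (grade (T l)) (j l)"
   using C.TensA_Scale_left[OF D(4)[OF k] C.Scale_hom[OF D'(4)[OF l]]] C.TensA_Scale_right[OF D(4)[OF k] D'(4)[OF l]] d d' k l
   by (simp add: C.Scale_Scale)
  also have "... = (parity X \<star>[C] parity Y) **[C] (i k \<star>[C] j l)"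
   using parity(2)[OF Xo kernel_simple(1)[OF S[OF k]] D(4)[OF k]] parity(2)[OF Yo kernel_simple(1)[OF T[OF l]] D'(4)[OF l]] d d' k l Xo Yo
   by (simp add: C.interchange)
  finally show "parity (X \<boxtimes>[C] Y) **[C] (case a of (k, l) => i k \<star>[C] j l) = (parity X \<star>[C] parity Y) **[C] (case a of (k, l) => i k \<star>[C] j l)"
   using a by simp
 qed (use Xo Yo in "auto simp: C.hom_iff")
 then show "FArr F (parity (X \<boxtimes>[C] Y)) **[D] FTens F X Y = FTens F X Y **[D] (FArr F (parity X) \<star>[D] FArr F (parity Y))"
  using FTens_natural[OF parity(1)[OF Xo] parity(1)[OF Yo]] by simp
 have comp: "q l **[C] (g **[C] i k) : Hom C (S k) (T l)" "FArr F (q l **[C] (g **[C] i k)) = FArr F (q l) **[D] (FArr F g **[D] FArr F (i k))"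
  if "g : Hom C X Y" "k : {..<n}" "l : {..<m}" for g k l
  using that d d' by (simp_all add: C.hom_iff Fa_Comp')
 show "bij_betw (FArr F) (Hom C X Y) {h : Hom D (FObj F X) (FObj F Y). h **[D] FArr F (parity X) = FArr F (parity Y) **[D] h}"
 proof (rule bij_betw_imageI)
  show "inj_on (FArr F) (Hom C X Y)"
  proof (rule inj_onI)
   fix g h assume gh: "g : Hom C X Y" "h : Hom C X Y" "FArr F g = FArr F h"
   show "g = h"
   proof (rule C.direct_sum_matrix_eqI[OF d d' gh(1,2)])
    fix k l assume kl: "k : {..<n}" "l : {..<m}"
    show "q l **[C] (g **[C] i k) = q l **[C] (h **[C] i k)"
     by (rule faithful_simple[OF S[OF kl(1)] T[OF kl(2)] comp(1)[OF gh(1) kl] comp(1)[OF gh(2) kl]])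
      (use comp(2)[OF gh(1) kl] comp(2)[OF gh(2) kl] gh(3) in simp)
   qed
  qed
  show "FArr F ` Hom C X Y = {h : Hom D (FObj F X) (FObj F Y). h **[D] FArr F (parity X) = FArr F (parity Y) **[D] h}"
  proof (intro equalityI subsetI)
   fix h assume "h : FArr F ` Hom C X Y"
   then obtain g where g: "g : Hom C X Y" "h = FArr F g" by blast
   have "FArr F g **[D] FArr F (parity X) = FArr F (parity Y) **[D] FArr F g"
    using Fa_Comp[OF parity(1)[OF Xo] g(1)] Fa_Comp[OF g(1) parity(1)[OF Yo]] parity_natural[OF g(1)] by simp
   then show "h : {h : Hom D (FObj F X) (FObj F Y). h **[D] FArr F (parity X) = FArr F (parity Y) **[D] h}"
    using g FArr_hom by auto
  next
   fix h assume "h : {h : Hom D (FObj F X) (FObj F Y). h **[D] FArr F (parity X) = FArr F (parity Y) **[D] h}"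
   then have h: "h : Hom D (FObj F X) (FObj F Y)" "h **[D] FArr F (parity X) = FArr F (parity Y) **[D] h" by auto
   have ex: "\<exists>g\<in>Hom C (S k) (T l). FArr F g = FArr F (q l) **[D] (h **[D] FArr F (i k))"
    if k: "k : {..<n}" and l: "l : {..<m}" for k l
   proof (rule lift_simple[OF two S[OF k] T[OF l]])
    note ar = h(1)[unfolded D.hom_iff] Fd Fd' k l Xo Yo
    show "FArr F (q l) **[D] (h **[D] FArr F (i k)) : Hom D (FObj F (S k)) (FObj F (T l))"
     using ar d d' by (simp add: D.hom_iff)
    have pi: "FArr F (parity X) **[D] FArr F (i k) = Scale D (grade (S k)) (FArr F (i k))"
     using Fa_Comp[OF D(4)[OF k] parity(1)[OF Xo]] parity(2)[OF Xo kernel_simple(1)[OF S[OF k]] D(4)[OF k]] Fa_Scale[OF D(4)[OF k]] by simp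
    have "q l **[C] parity Y = Scale C (grade (T l)) (q l)"
     using parity_natural[OF D'(5)[OF l]] parity_simple[OF kernel_simple(1)[OF T[OF l]]] kernel_simple(2)[OF T[OF l]] d' l by simp
    then have qp: "FArr F (q l) **[D] FArr F (parity Y) = Scale D (grade (T l)) (FArr F (q l))"
     using Fa_Comp[OF parity(1)[OF Yo] D'(5)[OF l]] Fa_Scale[OF D'(5)[OF l]] by simp
    have "Scale D (grade (S k)) (FArr F (q l) **[D] (h **[D] FArr F (i k))) = FArr F (q l) **[D] (h **[D] (FArr F (parity X) **[D] FArr F (i k)))"
     unfolding pi using ar d d' by simp
    also have "h **[D] (FArr F (parity X) **[D] FArr F (i k)) = FArr F (parity Y) **[D] (h **[D] FArr F (i k))"
     by (rule D.comp_cong2[OF h(2)]) (use ar d in auto)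
    also have "FArr F (q l) **[D] ... = Scale D (grade (T l)) (FArr F (q l)) **[D] (h **[D] FArr F (i k))"
     by (rule D.comp_cong_left[OF qp]) (use ar d d' in auto)
    also have "... = Scale D (grade (T l)) (FArr F (q l) **[D] (h **[D] FArr F (i k)))" using ar d d' by simp
    finally show "Scale D (grade (S k)) (FArr F (q l) **[D] (h **[D] FArr F (i k))) = Scale D (grade (T l)) (FArr F (q l) **[D] (h **[D] FArr F (i k)))" .
   qed
   obtain g' where g': "\<And>k l. k : {..<n} ==> l : {..<m} ==> g' k l : Hom C (S k) (T l) \<and> FArr F (g' k l) = FArr F (q l) **[D] (h **[D] FArr F (i k))"
    using ex by metis
   then obtain g where g: "g : Hom C X Y" "\<forall>k\<in>{..<n}. \<forall>l\<in>{..<m}. q l **[C] (g **[C] i k) = g' k l"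
    using C.direct_sum_matrix[OF d d', of g'] by blast
   have "FArr F g = h"
    by (rule D.direct_sum_matrix_eqI[OF Fd Fd' FArr_hom[OF g(1)] h(1)]) (use comp(2)[OF g(1)] g(2) g' in auto)
   then show "h : FArr F ` Hom C X Y" using g(1) by blast
  qed
 qed
qed

text \<open>Both \<open>F X\<close> and the trivial object on \<open>V\<close> are sums of copies of \<open>1\<close>, indexed by the same set, on
  which the two automorphisms act by the same signs.\<close>

lemma comparison_iso:
 fixes V :: "(int, 'k) rep"
 assumes two: "(2::'k) \<noteq> 0"
  and d: "direct_sum_over C I S X i p" and S: "\<And>k. k : I ==> S k : kernel_simples"
  and d': "direct_sum_over (rep_category Z2) I L V j q" and L: "\<And>k. k : I ==> L k = character (grade (S k))"
 shows "\<exists>\<theta>\<in>Hom D (FObj F X) (FObj D.trivial_functor V). is_iso D \<theta> \<and> \<theta> **[D] FArr F (parity X) = Z2_action D V **[D] \<theta>"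
proof -
 let ?R = "rep_category Z2 :: (int, 'k) rep_cat"
 interpret H: functor_with_endomorphism ?R D D.trivial_functor "Obj ?R" "Z2_action D" by (rule D.trivial_functor_Z2[OF two])
 let ?H = "D.trivial_functor :: ((int, 'k) rep, (int, 'k) rep_arrow, 'p, 'b) functor_data"
 note Dd = C.direct_sum_overD[OF d] and D' = H.C.direct_sum_overD[OF d']
 have "\<exists>a. a : Hom D (FObj F (S k)) (FObj ?H (L k)) \<and> is_iso D a" if "k : I" for k
 proof -
  have "isomorphic D (Unit D) (D.U 1)" by (rule D.isomorphicI[OF _ D.copower_unit(1)]) (simp add: D.hom_iff)
  moreover have "FObj ?H (L k) = D.U 1" using L[OF that] by (simp add: D.trivial_functor_def scalar_rep_def)
  ultimately have "isomorphic D (FObj F (S k)) (FObj ?H (L k))"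
   using D.isomorphic_trans[OF D.isomorphic_sym[OF F_kernel_simple]] S[OF that] by (simp add: kernel_simples_def)
  then show ?thesis by (auto simp: isomorphic_def)
 qed
 then obtain a where a: "\<And>k. k : I ==> a k : Hom D (FObj F (S k)) (FObj ?H (L k)) \<and> is_iso D (a k)" by metis
 note dF = Fa_direct_sum[OF d]
 note dH = D.direct_sum_of_isos[OF H.Fa_direct_sum[OF d'], of a, OF a[THEN conjunct1] a[THEN conjunct2]]
 obtain \<theta> where \<theta>: "\<theta> : Hom D (FObj F X) (FObj ?H V)" "is_iso D \<theta>" "\<And>k. k : I ==> \<theta> **[D] FArr F (i k) = FArr ?H (j k) **[D] a k"
  using D.direct_sum_unique[OF dF dH] by blast
 have Vo: "V : Obj ?R" using D'(1) .
 note ar = \<theta>(1)[unfolded D.hom_iff] H.\<tau>_arrow[OF Vo] Dd(1)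
 have "\<theta> **[D] FArr F (parity X) = Z2_action D V **[D] \<theta>"
 proof (rule D.direct_sum_eqI_from[OF dF])
  fix k assume k: "k : I"
  note Lk = D'(3)[OF k] and ak = a[OF k, unfolded D.hom_iff] H.Fa_hom[OF D'(4)[OF k], unfolded D.hom_iff]
  have act: "Z2_action D (L k) = Scale D (grade (S k)) (Ident D (FObj ?H (L k)))"
   using L[OF k] D.mat_arrow_smult[of "1\<^sub>m 1" 1 1 "grade (S k)"] D.mat_arrow_one[of 1]
   by (simp add: Z2_action_def scalar_rep_def Z2_carrier D.trivial_functor_def)
  have n: "FArr ?H (j k) **[D] Z2_action D (L k) = Z2_action D V **[D] FArr ?H (j k)"
   using H.lift[OF Lk Vo] D'(4)[OF k] by (auto simp: bij_betw_def)
  have "parity X **[C] i k = Scale C (grade (S k)) (i k)" by (rule parity(2)[OF Dd(1) kernel_simple(1)[OF S[OF k]] Dd(4)[OF k]])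
  then have pi: "FArr F (parity X) **[D] FArr F (i k) = Scale D (grade (S k)) (FArr F (i k))"
   using Fa_Comp[OF Dd(4)[OF k] parity(1)[OF Dd(1)]] Fa_Scale[OF Dd(4)[OF k]] by simp
  have "\<theta> **[D] FArr F (parity X) **[D] FArr F (i k) = Scale D (grade (S k)) (\<theta> **[D] FArr F (i k))"
   using ar d k pi by (simp add: D.comp_assoc)
  also have "... = FArr ?H (j k) **[D] (Z2_action D (L k) **[D] a k)" unfolding \<theta>(3)[OF k] act using ak d' k Lk by simp
  also have "... = Z2_action D V **[D] (FArr ?H (j k) **[D] a k)"
   by (rule D.comp_cong2[OF n]) (use ak d' k H.\<tau>_arrow[OF Lk] ar in auto)
  also have "... = Z2_action D V **[D] \<theta> **[D] FArr F (i k)" unfolding \<theta>(3)[OF k, symmetric] using ar d k by (simp add: D.comp_assoc)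
  finally show "\<theta> **[D] FArr F (parity X) **[D] FArr F (i k) = Z2_action D V **[D] \<theta> **[D] FArr F (i k)" .
 qed (use ar in "auto simp: D.hom_iff")
 then show ?thesis using \<theta>(1,2) by blast
qed

text \<open>In a decomposition into simple objects, \<open>1\<close> corresponds to the trivial and \<open>G\<close> to the sign
  character.\<close>

theorem kernel_is_rep_Z2:
 assumes two: "(2::'k) \<noteq> 0"
 shows "\<exists>f. tensor_functor (rep_category Z2) C f \<and> full_embedding (rep_category Z2) C f \<and>
  ess_image_objects (rep_category Z2) C f = Ker_objects C D F"
proof (rule comparison_functor[OF D.trivial_functor_Z2[OF two] rep_Z2_split_semisimple[OF two] kernel_functor[OF two]])
 let ?R = "rep_category Z2 :: (int, 'k) rep_cat"
 interpret R: split_semisimple_category ?R "{X : rep_objects Z2. fst X = 1}" by (rule rep_Z2_split_semisimple[OF two])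
 show "Y : Ker_objects C D F" if "X : Ker_objects C D F" "isomorphic C X Y" for X Y
  using that D.is_trivial_iso[OF _ Fo_isomorphic[OF that(2)]] C.isomorphic_obj[OF that(2)] by (simp add: Ker_objects_def)
 show "\<exists>X\<in>Ker_objects C D F. \<exists>\<theta>\<in>Hom D (FObj F X) (FObj D.trivial_functor V). is_iso D \<theta> \<and> \<theta> **[D] FArr F (parity X) = Z2_action D V **[D] \<theta>"
  if V: "V : Obj ?R" for V
 proof -
  have "V : rep_objects Z2" using V by simp
  from rep_Z2_decomposition[OF two this] obtain n L j q
   where L: "\<forall>k<n. L k : rep_objects Z2 \<and> fst (L k) = 1" and "is_direct_sum ?R n L V j q"
   by (elim exE conjE)
  then have d': "direct_sum_over ?R {..<n} L V j q" by (simp only: is_direct_sum_iff)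
  define S where "S k = (if L k = character 1 then Unit C else G)" for k
  have sS: "grade (Unit C) = 1" "grade G = - 1" using G_not_Unit C.isomorphic_sym by (auto simp: grade_def)
  have S: "S k : kernel_simples" for k by (simp add: S_def kernel_simples_def)
  have LS: "L k = character (grade (S k))" if "k : {..<n}" for k
   using L that one_dim_Z2[of "L k"] sS by (auto simp: S_def)
  obtain X i p where d: "direct_sum_over C {..<n} S X i p"
   using C.obtain_direct_sum[of "{..<n}" S] kernel_simple(2)[OF S] by blast
  have "X : Ker_objects C D F"
   using F_trivial[OF d] S C.direct_sum_overD(1)[OF d] by (simp add: Ker_objects_def kernel_simples_def)
  then show ?thesis using comparison_iso[OF two d S d' LS] by blast
 qed
 show "\<exists>V\<in>Obj ?R. \<exists>\<theta>\<in>Hom D (FObj F X) (FObj D.trivial_functor V). is_iso D \<theta> \<and> \<theta> **[D] FArr F (parity X) = Z2_action D V **[D] \<theta>"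
  if X: "X : Ker_objects C D F" for X
 proof -
  obtain n S i p where S: "\<And>k. k : {..<n::nat} ==> S k : kernel_simples" and d: "direct_sum_over C {..<n} S X i p"
   using kernel_decomposition[OF X] by metis
  have ch: "character (grade (S k)) : Obj ?R" for k using scalar_rep_obj[OF grade_square] by simp
  obtain V j q where d': "direct_sum_over ?R {..<n} (\<lambda>k. character (grade (S k))) V j q"
   using R.obtain_direct_sum[of "{..<n}" "\<lambda>k. character (grade (S k))"] ch by blast
  then show ?thesis using comparison_iso[OF two d S d' refl] R.direct_sum_overD(1)[OF d'] by blast
 qed
qed

end

theorem proposition3p13:
  fixes C :: "('o, 'a, 'k::field) monoidal_data"
    and D :: "('p, 'b, 'k) monoidal_data"
    and F :: "('o, 'a, 'p, 'b) functor_data"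
  assumes "fusion_category C"
    and "fusion_category D"
    and "tensor_functor C D F"
    and "dominant C D F"
    and "FP_index C D = 2"
  shows "normal_functor C D F \<and>
    ((2::'k) \<noteq> 0 \<longrightarrow>
      fusion_category (rep_category (integer_mod_group 2) :: ((int, 'k) rep, (int, 'k) rep_arrow, 'k) monoidal_data) \<and>
      (\<exists>f. exact_sequence (rep_category (integer_mod_group 2)) C D f F))"
proof -
 obtain G where "functor_with_kernel_of_order_two C D F G" using index_two_kernel[OF assms] by blast
 then interpret K: functor_with_kernel_of_order_two C D F G .
 have "\<exists>f. exact_sequence (rep_category Z2) C D f F" if "(2::'k) \<noteq> 0"
  using K.kernel_is_rep_Z2[OF that] assms(3,4) K.normal unfolding exact_sequence_def by blast
 then show ?thesis using K.normal rep_Z2_fusion by blast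
qed


end
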